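(* Let $V$ be an admissible, unimodular family of vectors in $\mathbb{Z}^d\setminus\{0\}$. Then the functions $B(V,U)$, $U\in\Lambda$, are orthogonal in $L^2([0,1]^d)$. Moreover, for every $1\le p<\infty$ there are constants $0<c\le C<\infty$ (depending only on $V$ and $p$) such that for every $f\in W_p^{\varrho_V+1}(\mathbb{R}^d)$ $$\int_{\mathbb{R}^d}\int_{[0,1]^d}\Big|\sum_{|\beta|=\varrho_V+1}\frac{1}{\beta!}D^\beta f(t)L_\beta(x)\Big|^p dx\,dt=\int_{\mathbb{R}^d}\int_{[0,1]^d}\Big|\sum_{U\in\Lambda}D_Uf(t)\,B(V,U)(x)\Big|^p dx\,dt ,$$ and, denoting this common value by $I_p(f)$ and putting $$J_p(f)=\sum_{U\in\Lambda}\int_{\mathbb{R}^d}|D_Uf(t)|^p\,dt\int_{[0,1]^d}|B(V,U)(x)|^p\,dx ,$$ one has $c\,J_p(f)\le I_p(f)\le C\,J_p(f)$. For $p=2$ one has the equality $I_2(f)=J_2(f)$.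
   Context: Notation. $V=\{v_1,\dots,v_n\}$ is a finite family of not necessarily distinct vectors in $\mathbb{Z}^d\setminus\{0\}$; subsets $U\subset V$ are taken with multiplicity (as subsets of the index set), and $\#U$ counts multiplicity. $V$ is admissible if $\operatorname{span}V=\mathbb{R}^d$, and unimodular if $|\det W|\le1$ for all $W\subset V$ with $\#W=d$. $W_p^k(\mathbb{R}^d)$ is the usual Sobolev space. $|\beta|=\beta_1+\dots+\beta_d$, $\beta!=\beta_1!\cdots\beta_d!$. The box spline $B_V$ is the compactly supported piecewise polynomial function determined by $\int_{\mathbb{R}^d} f(x)B_V(x)\,dx=\int_{[0,1]^n} f(u_1v_1+\dots+u_nv_n)\,du$ for every continuous $f$. $\varrho_V=\max\{r:\ \operatorname{span}(V\setminus W)=\mathbb{R}^d\text{ for all }W\subset V\text{ with }\#W=r\}$. $P$ is the orthogonal projection of $L^2(\mathbb{R}^d)$ onto the $L^2$-closure $S$ of $\operatorname{span}\{B_V(\cdot-\alpha):\alpha\in\mathbb{Z}^d\}$. For unimodular $V$ these translates form a Riesz basis of $S$ with dual basis $\phi(\cdot-\alpha)$, $\phi\in S$ exponentially decaying, so $Pf=\sum_{\alpha}\left(\int f\,\overline{\phi(\cdot-\alpha)}\right)B_V(\cdot-\alpha)$, and by this formula $P$ extends to functions of polynomial growth. $L_\beta(x)=P([\,]^\beta)(x)-x^\beta$, where $[\,]^\beta$ is the monomial $x\mapsto x^\beta$. $\Lambda=\{U\subset V:\ \#U=\varrho_V+1,\ \operatorname{span}(V\setminus U)\neq\mathbb{R}^d\}$.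 For $U\in\Lambda$ the Bernoulli spline is $$B(V,U)(x)=\sum_{\alpha\in\mathbb{Z}^d,\ \alpha\neq0,\ \alpha\perp(V\setminus U)}\ \Big(\prod_{v\in U}\frac1{2\pi i\,\alpha\cdot v}\Big)e^{2\pi i\alpha\cdot x},$$ where $\alpha\perp(V\setminus U)$ means $\alpha\cdot v=0$ for all $v\in V\setminus U$ (then $\alpha\cdot v\ne0$ for all $v\in U$). The index set is $\{k\alpha_U:k\in\mathbb{Z}\setminus\{0\}\}$ for some $\alpha_U\in\mathbb{Z}^d\setminus\{0\}$; when $\varrho_V=0$ the series is understood via symmetric partial sums $0<|k|\le N$. $D_U=\prod_{v\in U}D_v$, where $D_v=\sum_{j=1}^d v_j\,\partial/\partial x_j$ is the directional derivative. *)

theory Defs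
  imports "HOL-Analysis.Analysis"
begin

(* A family v_1, ..., v_n of vectors in Z^d is a list V; subfamilies ("subsets with multiplicity")
   are sets of indices U \<subseteq> {..<length V}.  The dimension is d = CARD('d). *)

definition real_vec :: "int^'d \<Rightarrow> real^'d" where
  "real_vec \<alpha> = (\<chi> j. real_of_int (\<alpha> $ j))"

definition span_of :: "(int^'d) list \<Rightarrow> nat set \<Rightarrow> (real^'d) set" where
  "span_of V U = span ((\<lambda>i. real_vec (V ! i)) ` U)"

definition admissible_family :: "(int^'d) list \<Rightarrow> bool" where
  "admissible_family V \<longleftrightarrow> span_of V {..<length V} = UNIV"

(* The d-element subfamilies are enumerated by the coordinate type; the choice of the
   enumeration only affects the sign of the determinant. *)
definition unimodular_family :: "(int^'d) list \<Rightarrow> bool" where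
  "unimodular_family V \<longleftrightarrow>
     (\<forall>\<sigma>::'d \<Rightarrow> nat. inj \<sigma> \<and> range \<sigma> \<subseteq> {..<length V} \<longrightarrow> \<bar>det (\<chi> j. V ! \<sigma> j)\<bar> \<le> 1)"

(* The bound r \<le> length V is implicit in the maximum: without it the condition would hold
   vacuously for every r > length V. *)
definition rho :: "(int^'d) list \<Rightarrow> nat" where
  "rho V = Max {r. r \<le> length V \<and>
     (\<forall>W \<subseteq> {..<length V}. card W = r \<longrightarrow> span_of V ({..<length V} - W) = UNIV)}"

definition Lambda :: "(int^'d) list \<Rightarrow> nat set set" where
  "Lambda V = {U. U \<subseteq> {..<length V} \<and> card U = rho V + 1 \<and>
     span_of V ({..<length V} - U) \<noteq> UNIV}"


section \<open>Box spline, its dual function, and the projection\<close>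

(* The integral identity determines B up to a null set, and so forces B to agree almost everywhere
   with a piecewise polynomial.  Everything below depends on B only up to null sets. *)
definition is_box_spline :: "(int^'d) list \<Rightarrow> (real^'d \<Rightarrow> real) \<Rightarrow> bool" where
  "is_box_spline V B \<longleftrightarrow>
     integrable lborel B \<and> bounded {x. B x \<noteq> 0} \<and>
     (\<forall>f :: real^'d \<Rightarrow> real. continuous_on UNIV f \<longrightarrow>
        (LINT x|lborel. f x * B x) =
        (LINT u:({..<length V} \<rightarrow>\<^sub>E {0..1})|PiM {..<length V} (\<lambda>_. lborel).
           f (\<Sum>i<length V. u i *\<^sub>R real_vec (V ! i))))"

definition box_spline :: "(int^'d) list \<Rightarrow> real^'d \<Rightarrow> real" where
  "box_spline V = (SOME B. is_box_spline V B)"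

definition square_integrable_on :: "(real^'d) set \<Rightarrow> (real^'d \<Rightarrow> complex) \<Rightarrow> bool" where
  "square_integrable_on A f \<longleftrightarrow>
     f \<in> borel_measurable lborel \<and> set_integrable lborel A (\<lambda>x. (norm (f x))\<^sup>2)"

(* The L^2-closure of the complex span of the integer translates of the box spline. *)
definition spline_space :: "(int^'d) list \<Rightarrow> (real^'d \<Rightarrow> complex) set" where
  "spline_space V = {f. square_integrable_on UNIV f \<and>
     (\<forall>\<epsilon>>0. \<exists>A c. finite A \<and>
        (\<integral>\<^sup>+x. ennreal ((norm (f x -
            (\<Sum>\<alpha>\<in>A. c \<alpha> * complex_of_real (box_spline V (x - real_vec \<alpha>)))))\<^sup>2) \<partial>lborel)
          < ennreal \<epsilon>)}"

definition is_dual_function :: "(int^'d) list \<Rightarrow> (real^'d \<Rightarrow> complex) \<Rightarrow> bool" where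
  "is_dual_function V \<phi> \<longleftrightarrow>
     \<phi> \<in> spline_space V \<and>
     (\<forall>\<alpha> \<beta>. (LINT x|lborel. complex_of_real (box_spline V (x - real_vec \<alpha>)) *
                cnj (\<phi> (x - real_vec \<beta>))) = (if \<alpha> = \<beta> then 1 else 0)) \<and>
     (\<exists>C>0. \<exists>a>0. AE x in lborel. norm (\<phi> x) \<le> C * exp (- a * norm x))"

definition dual_function :: "(int^'d) list \<Rightarrow> real^'d \<Rightarrow> complex" where
  "dual_function V = (SOME \<phi>. is_dual_function V \<phi>)"

(* The orthogonal projection onto the spline space, through the dual basis; this formula is also
   meaningful for functions of polynomial growth.  For every x only finitely many terms are
   nonzero. *)
definition spline_proj ::
    "(int^'d) list \<Rightarrow> (real^'d \<Rightarrow> complex) \<Rightarrow> real^'d \<Rightarrow> complex" where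
  "spline_proj V f x =
     (\<Sum>\<^sub>\<infinity>\<alpha>. (LINT y|lborel. f y * cnj (dual_function V (y - real_vec \<alpha>))) *
            complex_of_real (box_spline V (x - real_vec \<alpha>)))"


section \<open>Multi-indices and Bernoulli splines\<close>

definition mi_abs :: "nat^'d \<Rightarrow> nat" where
  "mi_abs \<beta> = (\<Sum>j\<in>UNIV. \<beta> $ j)"

definition mi_fact :: "nat^'d \<Rightarrow> nat" where
  "mi_fact \<beta> = (\<Prod>j\<in>UNIV. fact (\<beta> $ j))"

definition mono_fun :: "nat^'d \<Rightarrow> real^'d \<Rightarrow> complex" where
  "mono_fun \<beta> x = complex_of_real (\<Prod>j\<in>UNIV. (x $ j) ^ (\<beta> $ j))"

definition err_fun :: "(int^'d) list \<Rightarrow> nat^'d \<Rightarrow> real^'d \<Rightarrow> complex" where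
  "err_fun V \<beta> x = spline_proj V (mono_fun \<beta>) x - mono_fun \<beta> x"

definition bern_index :: "(int^'d) list \<Rightarrow> nat set \<Rightarrow> (int^'d) set" where
  "bern_index V U =
     {\<alpha>. \<alpha> \<noteq> 0 \<and> (\<forall>i\<in>{..<length V} - U. real_vec \<alpha> \<bullet> real_vec (V ! i) = 0)}"

definition bern_gen :: "(int^'d) list \<Rightarrow> nat set \<Rightarrow> int^'d" where
  "bern_gen V U = (SOME a. a \<noteq> 0 \<and> bern_index V U = {k *s a | k. k \<noteq> 0})"

definition bern_term :: "(int^'d) list \<Rightarrow> nat set \<Rightarrow> real^'d \<Rightarrow> int^'d \<Rightarrow> complex" where
  "bern_term V U x \<alpha> =
     (\<Prod>i\<in>U. 1 / (2 * of_real pi * \<i> * of_real (real_vec \<alpha> \<bullet> real_vec (V ! i)))) *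
     exp (2 * of_real pi * \<i> * of_real (real_vec \<alpha> \<bullet> x))"

(* For rho V = 0 the series converges only conditionally. *)
definition bernoulli_spline :: "(int^'d) list \<Rightarrow> nat set \<Rightarrow> real^'d \<Rightarrow> complex" where
  "bernoulli_spline V U x =
     (if rho V = 0
      then lim (\<lambda>N::nat. \<Sum>k\<in>{k::int. 0 < \<bar>k\<bar> \<and> \<bar>k\<bar> \<le> int N}. bern_term V U x (k *s bern_gen V U))
      else (\<Sum>\<^sub>\<infinity>\<alpha>\<in>bern_index V U. bern_term V U x \<alpha>))"


section \<open>Weak derivatives and Sobolev spaces\<close>

definition partial_deriv :: "'d::finite \<Rightarrow> (real^'d \<Rightarrow> real) \<Rightarrow> real^'d \<Rightarrow> real" where
  "partial_deriv j \<psi> x = frechet_derivative \<psi> (at x) (axis j 1)"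

(* Smoothness: all iterated partial derivatives exist and are differentiable everywhere. *)
definition test_fun :: "(real^'d \<Rightarrow> real) \<Rightarrow> bool" where
  "test_fun \<psi> \<longleftrightarrow>
     (\<forall>js x. foldr partial_deriv js \<psi> differentiable (at x)) \<and> bounded {x. \<psi> x \<noteq> 0}"

definition locally_integrable :: "(real^'d \<Rightarrow> complex) \<Rightarrow> bool" where
  "locally_integrable f \<longleftrightarrow>
     f \<in> borel_measurable lborel \<and> (\<forall>K. compact K \<longrightarrow> set_integrable lborel K f)"

(* g is the weak derivative of f of order \<beta>.  A classical derivative of order \<beta> of a test
   function is taken along any list of coordinates in which j occurs \<beta> $ j times. *)
definition weak_deriv ::
    "nat^'d \<Rightarrow> (real^'d \<Rightarrow> complex) \<Rightarrow> (real^'d \<Rightarrow> complex) \<Rightarrow> bool" where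
  "weak_deriv \<beta> f g \<longleftrightarrow>
     locally_integrable f \<and> locally_integrable g \<and>
     (\<forall>\<psi> js. test_fun \<psi> \<and> (\<forall>j. count_list js j = \<beta> $ j) \<longrightarrow>
        (LINT x|lborel. foldr partial_deriv js \<psi> x *\<^sub>R f x) =
        (- 1) ^ mi_abs \<beta> * (LINT x|lborel. \<psi> x *\<^sub>R g x))"

(* For \<beta> = 0 the condition says that f itself is p-integrable. *)
definition sobolev :: "nat \<Rightarrow> real \<Rightarrow> (real^'d \<Rightarrow> complex) set" where
  "sobolev k p = {f. \<forall>\<beta>. mi_abs \<beta> \<le> k \<longrightarrow>
     (\<exists>g. weak_deriv \<beta> f g \<and> integrable lborel (\<lambda>x. norm (g x) powr p))}"

definition wD :: "nat^'d \<Rightarrow> (real^'d \<Rightarrow> complex) \<Rightarrow> real^'d \<Rightarrow> complex" where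
  "wD \<beta> f = (SOME g. weak_deriv \<beta> f g)"

definition dir_D :: "int^'d \<Rightarrow> (real^'d \<Rightarrow> complex) \<Rightarrow> real^'d \<Rightarrow> complex" where
  "dir_D v f x = (\<Sum>j\<in>UNIV. of_int (v $ j) * wD (axis j 1) f x)"

(* The composition of the operators D_v, v in U, in increasing order of the indices; up to null
   sets the order is irrelevant on the Sobolev space of order card U. *)
definition D_sub ::
    "(int^'d) list \<Rightarrow> nat set \<Rightarrow> (real^'d \<Rightarrow> complex) \<Rightarrow> real^'d \<Rightarrow> complex" where
  "D_sub V U f = foldr (\<lambda>i. dir_D (V ! i)) (sorted_list_of_set U) f"


section \<open>The two functionals\<close>

definition I_fun :: "(int^'d) list \<Rightarrow> real \<Rightarrow> (real^'d \<Rightarrow> complex) \<Rightarrow> ennreal" where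
  "I_fun V p f =
     (\<integral>\<^sup>+t. (\<integral>\<^sup>+x\<in>cbox 0 1.
        ennreal (norm (\<Sum>U\<in>Lambda V. D_sub V U f t * bernoulli_spline V U x) powr p)
      \<partial>lborel) \<partial>lborel)"

definition J_fun :: "(int^'d) list \<Rightarrow> real \<Rightarrow> (real^'d \<Rightarrow> complex) \<Rightarrow> ennreal" where
  "J_fun V p f =
     (\<Sum>U\<in>Lambda V.
        (\<integral>\<^sup>+t. ennreal (norm (D_sub V U f t) powr p) \<partial>lborel) *
        (\<integral>\<^sup>+x\<in>cbox 0 1. ennreal (norm (bernoulli_spline V U x) powr p) \<partial>lborel))"

end

(* Put k = rho V + 1 and apply P to the polynomial (h . x)^k / k! for a fixed direction h.  The
   periodisation of e^{-z h . y} B_V(y) has the Fourier coefficients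
     prod_v (1 - e^{-z h.v}) / (z h.v + 2 pi i gamma.v),
   and after division by the coefficient at gamma = 0 the coefficient at gamma vanishes at z = 0 to
   the order #{v : gamma.v \<noteq> 0} >= k; for order exactly k, where U = {v : gamma.v \<noteq> 0} lies in
   Lambda, the coefficient of z^k is that of (prod_{v in U} h.v) B(V, U).  Reading off the
   coefficient of z^k gives explicit spline coefficients a with
     sum_alpha a(alpha) B_V(x - alpha) = (h . x)^k / k! + sum_U (prod_{v in U} h.v) B(V, U)(x).
   The Bernoulli part is orthogonal to the spline space, because the Fourier transform of B_V
   vanishes at the frequencies of B(V, U), so this spline is the projection.  Comparing the
   coefficients of h and replacing h by the gradient gives
     sum_beta D^beta f(t) L_beta(x) / beta! = sum_U D_U f(t) B(V, U)(x).
   The splines B(V, U) have disjoint Fourier supports.  This yields orthogonality and the case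
   p = 2; for general p, each |D_U f(t)| is bounded by an L^1 norm of the sum, since one Fourier
   coefficient isolates it. *)
theory Submission
  imports Defs "HOL-Real_Asymp.Real_Asymp" "HOL-Combinatorics.Multiset_Permutations"
begin

section \<open>Lebesgue integration on Euclidean space\<close>

text \<open>The definitions fix the box spline and its dual function only up to null sets, whereas
  periodisation needs sums that are finite at every point. The computations therefore use one
  representative \<open>b\<close> of the box spline that is everywhere bounded, nonnegative and
  supported in a ball; a.e. uniqueness transfers the results to \<open>box_spline\<close> and
  \<open>dual_function\<close>. Unimodularity acts twice: it makes the symbol of the Gram matrix
  positive, so that an exponentially decaying dual function exists, and it provides the generator of
  each index set of B(V, U). The expansion in z takes place in formal power series and so raises no
  convergence question. The identity for a direction h fails on a null set depending on h; to
  compare coefficients at one x, countably many h must separate the monomials, which Kronecker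
  substitution achieves. For \<open>rho V = 0\<close> the Bernoulli series converges only
  conditionally, and a uniform bound of the symmetric partial sums makes dominated convergence
  available. In the estimates for general p the point t is frozen: in x there remains a combination
  of finitely many fixed functions with coefficients D_U f(t), and bounds uniform in these
  coefficients are integrated over t.\<close>

lemma lborel_integral_shift:
  fixes f :: "'a::euclidean_space \<Rightarrow> 'b::{banach, second_countable_topology}"
  shows "(LINT x|lborel. f (x - t)) = (LINT x|lborel. f x)"
proof -
  have "(LINT x|lborel. f x) = (LINT x|distr lborel borel ((+) (- t)). f x)"
    by (simp add: lborel_distr_plus)
  also have "\<dots> = (LINT x|lborel. f (- t + x))"
  proof (cases "f \<in> borel_measurable borel")
    case True
    then show ?thesis by (subst integral_distr) auto
  next
    case False
    \<comment> \<open>Without measurability neither function is integrable, and both integrals take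
      the default value 0.\<close>
    have "\<not> integrable lborel f" "\<not> integrable lborel (\<lambda>x. f (- t + x))"
    proof -
      show "\<not> integrable lborel f" using False by auto
      have "f \<in> borel_measurable borel" if "(\<lambda>x. f (- t + x)) \<in> borel_measurable borel"
      proof -
        have "(\<lambda>x. f (- t + (t + x))) \<in> borel_measurable borel"
          by (rule measurable_compose[where f = "\<lambda>x. t + x", OF _ that]) simp
        then show ?thesis by (simp only: minus_add_cancel)
      qed
      then show "\<not> integrable lborel (\<lambda>x. f (- t + x))" using False by auto
    qed
    then show ?thesis by (simp add: lborel_distr_plus not_integrable_integral_eq)
  qed
  finally show ?thesis by simp
qed

lemma lborel_integrable_shift:
  fixes f :: "'a::euclidean_space \<Rightarrow> 'b::{banach, second_countable_topology}"
  assumes "integrable lborel f"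
  shows "integrable lborel (\<lambda>x. f (x - t))"
proof -
  have "integrable (distr lborel borel ((+) (- t))) f"
    using assms by (simp add: lborel_distr_plus)
  then have "integrable lborel (\<lambda>x. f (- t + x))"
    by (subst (asm) integrable_distr_eq) (use assms in auto)
  then show ?thesis by simp
qed

lemma lborel_nn_integral_shift:
  fixes f :: "'a::euclidean_space \<Rightarrow> ennreal"
  assumes [measurable]: "f \<in> borel_measurable borel"
  shows "(\<integral>\<^sup>+x. f (x - t) \<partial>lborel) = (\<integral>\<^sup>+x. f x \<partial>lborel)"
proof -
  have "(\<integral>\<^sup>+x. f x \<partial>lborel) = (\<integral>\<^sup>+x. f x \<partial>distr lborel borel ((+) (- t)))"
    by (simp add: lborel_distr_plus)
  also have "\<dots> = (\<integral>\<^sup>+x. f (- t + x) \<partial>lborel)" by (subst nn_integral_distr) auto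
  finally show ?thesis by simp
qed

lemma AE_lborel_shift:
  fixes t :: "'a::euclidean_space"
  assumes "AE x in lborel. P x"
  shows "AE x in lborel. P (x - t)"
proof -
  from assms obtain N where N: "N \<in> null_sets lborel" "{x. \<not> P x} \<subseteq> N"
    by (auto elim!: AE_E simp: null_sets_def)
  have "AE x in distr lborel borel ((+) (- t)). x \<notin> N"
    using AE_not_in[OF N(1)] by (subst lborel_distr_plus)
  then have "AE x in lborel. - t + x \<notin> N"
    using N by (subst (asm) AE_distr_iff) auto
  then show ?thesis
    by eventually_elim (use N in auto)
qed

text \<open>Open boxes form an intersection-stable generator of the Borel sets, and the sets over
  which the integral vanishes form a Dynkin system. Complements need a finite total integral, so the
  argument runs inside each bounded box \<open>?B n\<close>, and countably many null sets are
  collected.\<close>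

lemma AE_zero_if_box_integrals_zero:
  fixes g :: "'a::euclidean_space \<Rightarrow> 'b::{banach, second_countable_topology}"
  assumes [measurable]: "g \<in> borel_measurable borel"
    and int: "\<And>a b. set_integrable lborel (box a b) g"
    and zero: "\<And>a b. (LINT x:box a b|lborel. g x) = 0"
  shows "AE x in lborel. g x = 0"
proof -
  let ?B = "\<lambda>n::nat. box (- (real n *\<^sub>R One)) (real n *\<^sub>R One) :: 'a set"
  have *: "AE x in lborel. indicator (?B n) x *\<^sub>R g x = 0" for n
  proof (rule sigma_finite_measure.density_zero[OF lborel.sigma_finite_measure_axioms])
    let ?g = "\<lambda>x. indicator (?B n) x *\<^sub>R g x"
    show ig: "integrable lborel ?g" using int by (simp add: set_integrable_def)
    have total: "(LINT x|lborel. ?g x) = 0" using zero by (simp add: set_lebesgue_integral_def)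
    have si: "set_integrable lborel A ?g" if "A \<in> sets borel" for A
      unfolding set_integrable_def by (intro integrable_mult_indicator ig) (use that in auto)
    fix A :: "'a set" assume "A \<in> sets lborel"
    then have A: "A \<in> sigma_sets UNIV (range (\<lambda>(a, b). box a b))"
      by (simp add: borel_eq_box)
    have "Int_stable (range (\<lambda>(a, b). box a b :: 'a set))"
      by (auto simp: Int_stable_def box_Int_box)
    moreover have "range (\<lambda>(a, b). box a b :: 'a set) \<subseteq> Pow UNIV" by simp
    ultimately show "set_lebesgue_integral lborel A ?g = 0"
      using A
    proof (induction rule: sigma_sets_induct_disjoint)
      case (basic A)
      then obtain a b where A: "A = box a b" by auto
      obtain c d where cd: "A \<inter> ?B n = box c d" unfolding A box_Int_box by blast
      have "set_lebesgue_integral lborel A ?g = set_lebesgue_integral lborel (A \<inter> ?B n) g"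
        by (auto simp: set_lebesgue_integral_def indicator_def intro!: Bochner_Integration.integral_cong)
      then show ?case using zero cd by simp
    next
      case empty then show ?case by (simp add: set_lebesgue_integral_def)
    next
      case (compl A)
      have A: "A \<in> sets borel" using compl(1) by (simp add: borel_eq_box)
      have "set_lebesgue_integral lborel (UNIV - A) ?g + set_lebesgue_integral lborel A ?g
          = set_lebesgue_integral lborel ((UNIV - A) \<union> A) ?g"
        by (rule set_integral_Un[symmetric]) (use A in \<open>auto intro!: si\<close>)
      also have "\<dots> = 0" using total by (simp add: set_lebesgue_integral_def)
      finally show ?case using compl by simp
    next
      case (union A)
      have A: "A i \<in> sets borel" for i using union(2) by (auto simp: borel_eq_box)
      have "set_lebesgue_integral lborel (\<Union>i. A i) ?g = (\<Sum>i. set_lebesgue_integral lborel (A i) ?g)"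
        by (rule lebesgue_integral_countable_add) (use A union(1) in \<open>auto simp: disjoint_family_on_def intro!: si\<close>)
      with union(3) show ?case by simp
    qed
  qed
  have "AE x in lborel. \<forall>n. indicator (?B n) x *\<^sub>R g x = 0"
    by (subst AE_all_countable) (use * in blast)
  then show ?thesis
  proof eventually_elim
    fix x assume x: "\<forall>n. indicator (?B n) x *\<^sub>R g x = 0"
    have "x \<in> (\<Union>n. ?B n)" unfolding UN_box_eq_UNIV by simp
    then obtain n where "x \<in> ?B n" by auto
    with x show "g x = 0" by (auto dest!: spec[of _ n])
  qed
qed

text \<open>The indicator of an open box is the pointwise limit of the continuous functions min(1, n
  dist(x, complement)), which are bounded by 1; dominated convergence then reduces the claim to
  boxes.\<close>

lemma AE_zero_if_continuous_integrals_zero: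
  fixes g :: "'a::euclidean_space \<Rightarrow> 'b::{banach, second_countable_topology}"
  assumes int: "integrable lborel g"
    and zero: "\<And>f::'a \<Rightarrow> real. continuous_on UNIV f \<Longrightarrow> (LINT x|lborel. f x *\<^sub>R g x) = 0"
  shows "AE x in lborel. g x = 0"
proof (rule AE_zero_if_box_integrals_zero)
  show [measurable]: "g \<in> borel_measurable borel" using int by auto
  show "set_integrable lborel (box a b) g" for a b
    unfolding set_integrable_def by (intro integrable_mult_indicator int) auto
  fix a b :: 'a
  let ?K = "- box a b"
  \<comment> \<open>\<open>infdist\<close> to the empty set is 0 by default, so a nonempty
    complement is what makes the distance positive inside the box.\<close>
  have ne: "?K \<noteq> {}"
    using bounded_box[of a b] not_bounded_UNIV by (metis Compl_empty_eq double_compl)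
  define f where "f n x = min 1 (real n * infdist x ?K)" for n x
  have cont: "continuous_on UNIV (f n)" for n
    unfolding f_def by (intro continuous_intros)
  have lim: "(\<lambda>n. f n x) \<longlonglongrightarrow> indicator (box a b) x" for x
  proof (cases "x \<in> box a b")
    case True
    have "closed ?K" unfolding closed_def by (simp add: open_box)
    then have "infdist x ?K > 0"
      using True ne in_closed_iff_infdist_zero[of ?K x] infdist_nonneg[of x ?K] by auto
    then have "filterlim (\<lambda>n. real n * infdist x ?K) at_top sequentially"
      by (intro filterlim_at_top_mult_tendsto_pos[OF tendsto_const]
          filterlim_real_sequentially) (auto simp: mult.commute)
    then have "eventually (\<lambda>n. real n * infdist x ?K \<ge> 1) sequentially"
      by (auto simp: filterlim_at_top)
    then have "eventually (\<lambda>n. f n x = 1) sequentially"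
      by eventually_elim (auto simp: f_def)
    then show ?thesis using True by (simp add: tendsto_eventually)
  qed (auto simp: f_def)
  have [measurable]: "f n \<in> borel_measurable borel" for n
    by (rule borel_measurable_continuous_onI[OF cont])
  have "(\<lambda>n. LINT x|lborel. f n x *\<^sub>R g x) \<longlonglongrightarrow> (LINT x|lborel. indicator (box a b) x *\<^sub>R g x)"
  proof (rule integral_dominated_convergence[where w = "\<lambda>x. norm (g x)"])
    show "AE x in lborel. (\<lambda>n. f n x *\<^sub>R g x) \<longlonglongrightarrow> indicator (box a b) x *\<^sub>R g x"
      by (intro AE_I2 tendsto_scaleR lim tendsto_const)
    show "AE x in lborel. norm (f n x *\<^sub>R g x) \<le> norm (g x)" for n
      by (auto intro!: mult_left_le_one_le simp: f_def infdist_nonneg)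
  qed (use int in auto)
  then show "(LINT x:box a b|lborel. g x) = 0"
    using zero[OF cont] by (simp add: set_lebesgue_integral_def LIMSEQ_const_iff)
qed

text \<open>Fubini for functions with separated variables. \<open>lborel\<close> is by definition
  the image of a product measure indexed by \<open>Basis\<close>; \<open>?idx\<close> translates a
  basis vector back into its coordinate.\<close>

lemma cart_lborel_prod:
  fixes f :: "'d::finite \<Rightarrow> real \<Rightarrow> 'b::{real_normed_field, banach, second_countable_topology}"
  assumes int: "\<And>j. integrable lborel (f j)"
  shows "integrable lborel (\<lambda>x::real^'d. \<Prod>j\<in>UNIV. f j (x $ j))" (is ?A)
    and "(LINT x|lborel. (\<Prod>j\<in>UNIV. f j ((x::real^'d) $ j))) = (\<Prod>j\<in>UNIV. (LINT t|lborel. f j t))" (is ?B)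
proof -
  interpret product_sigma_finite "\<lambda>_::real^'d. lborel :: real measure" ..
  let ?idx = "\<lambda>b::real^'d. THE j. b = axis j 1"
  have idx: "?idx (axis j 1) = j" for j :: 'd
    by (auto simp: axis_eq_axis)
  have Bas: "(Basis :: (real^'d) set) = (\<lambda>j. axis j 1) ` UNIV"
    by (auto simp: Basis_vec_def)
  have inj: "inj (\<lambda>j::'d. axis j (1::real))" by (auto simp: inj_on_def axis_eq_axis)
  have m [measurable]: "f j \<in> borel_measurable borel" for j using int[of j] by auto
  have eq: "(\<Prod>j\<in>UNIV. f j ((\<Sum>b\<in>Basis. u b *\<^sub>R b) $ j)) = (\<Prod>b\<in>Basis. f (?idx b) (u b))"
    for u :: "real^'d \<Rightarrow> real"
  proof -
    have "(\<Sum>b\<in>Basis. u b *\<^sub>R b) $ j = u (axis j 1)" for j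
      unfolding Bas by (subst sum.reindex[OF inj]) (simp add: axis_def if_distrib sum.delta cong: if_cong)
    then show ?thesis
      unfolding Bas by (subst prod.reindex[OF inj]) (simp add: idx)
  qed
  have pr: "(\<Prod>b\<in>(Basis::(real^'d) set). F (?idx b)) = (\<Prod>j\<in>UNIV. F j)" for F :: "'d \<Rightarrow> 'b"
    unfolding Bas by (subst prod.reindex[OF inj]) (simp add: idx)
  have meas: "(\<lambda>u. \<Sum>b\<in>Basis. u b *\<^sub>R b) \<in> (\<Pi>\<^sub>M b\<in>Basis. lborel) \<rightarrow>\<^sub>M (borel :: (real^'d) measure)"
    by measurable
  have "integrable (\<Pi>\<^sub>M b\<in>Basis. lborel) (\<lambda>u. \<Prod>b\<in>(Basis::(real^'d) set). f (?idx b) (u b))"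
    by (intro product_integrable_prod int) auto
  then show ?A
    by (subst lborel_eq, subst integrable_distr_eq[OF meas]) (measurable, simp only: eq)
  have "(LINT u|(\<Pi>\<^sub>M b\<in>Basis. lborel). (\<Prod>b\<in>(Basis::(real^'d) set). f (?idx b) (u b)))
      = (\<Prod>b\<in>(Basis::(real^'d) set). (LINT t|lborel. f (?idx b) t))"
    by (intro product_integral_prod int) auto
  also have "\<dots> = (\<Prod>j\<in>UNIV. (LINT t|lborel. f j t))" by (rule pr)
  finally show ?B
    by (subst lborel_eq, subst integral_distr[OF meas]) (measurable, simp only: eq)
qed

section \<open>Integer vectors and the unit cube\<close>

lemma real_vec_simps [simp]:
  "real_vec (0::int^'d) = 0" "real_vec \<alpha> $ j = real_of_int (\<alpha> $ j)"
  by (auto simp: real_vec_def vec_eq_iff)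

lemma real_vec_add: "real_vec (\<alpha> + \<beta>) = real_vec \<alpha> + real_vec \<beta>"
  and real_vec_diff: "real_vec (\<alpha> - \<beta>) = real_vec \<alpha> - real_vec \<beta>"
  and real_vec_minus: "real_vec (- \<alpha>) = - real_vec \<alpha>"
  and real_vec_smult: "real_vec (k *s \<alpha>) = of_int k *\<^sub>R real_vec \<alpha>"
  by (auto simp: vec_eq_iff)

lemma real_vec_eq_0_iff [simp]: "real_vec \<alpha> = 0 \<longleftrightarrow> \<alpha> = 0"
  by (auto simp: vec_eq_iff)

text \<open>The inner product kept in \<open>int\<close>, so that integrality of \<gamma> \<bullet>
  v is built into the type.\<close>

definition idot :: "int^'d \<Rightarrow> int^'d \<Rightarrow> int" where
  "idot \<alpha> \<beta> = (\<Sum>j\<in>UNIV. \<alpha> $ j * \<beta> $ j)"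

lemma inner_real_vec: "real_vec \<alpha> \<bullet> real_vec \<beta> = of_int (idot \<alpha> \<beta>)"
  by (simp add: inner_vec_def idot_def)

text \<open>Half-open, so that its integer translates tile the space exactly; each point lies in one
  translate, given by floors.\<close>

definition half_cube :: "(real^'d) set" where
  "half_cube = {x. \<forall>j. 0 \<le> x $ j \<and> x $ j < 1}"

lemma half_cube_measurable [measurable]: "half_cube \<in> sets borel"
proof -
  have "half_cube = (\<Inter>j. {x::real^'d. 0 \<le> x $ j \<and> x $ j < 1})"
    by (auto simp: half_cube_def)
  also have "\<dots> \<in> sets borel"
    by (intro sets.countable_INT'') auto
  finally show ?thesis .
qed

lemma half_cube_subset: "half_cube \<subseteq> cbox 0 1"
  by (auto simp: half_cube_def mem_box_cart less_imp_le)

lemma half_cube_translate: "x + real_vec \<alpha> \<in> half_cube \<longleftrightarrow> \<alpha> = (\<chi> j. - \<lfloor>x $ j\<rfloor>)"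
proof -
  have "0 \<le> x $ j + real_of_int (\<alpha> $ j) \<and> x $ j + real_of_int (\<alpha> $ j) < 1
      \<longleftrightarrow> \<alpha> $ j = - \<lfloor>x $ j\<rfloor>" for j
    by linarith
  then show ?thesis by (auto simp: half_cube_def vec_eq_iff)
qed

lemma AE_component_neq: "AE x in lborel. (x::real^'d) $ j \<noteq> c"
  using AE_lborel_inner_neq[of "axis j 1 :: real^'d" c] by (simp add: inner_axis)

lemma AE_half_cube: "AE x in lborel. x \<in> (half_cube :: (real^'d) set) \<longleftrightarrow> x \<in> cbox 0 1"
proof -
  have "AE x in lborel. \<forall>j. (x::real^'d) $ j \<noteq> 1"
    using AE_component_neq by (subst AE_all_countable) auto
  then show ?thesis
    by eventually_elim (auto simp: half_cube_def mem_box_cart less_le)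
qed

text \<open>The space is cut into integer translates of the half-open cube and each piece is shifted
  back to the cube. Since one finite set \<open>A\<close> catches all nonzero terms, periodisation
  is a finite sum and commutes with the integral.\<close>

lemma integral_tiling:
  fixes F :: "real^'d \<Rightarrow> 'b::{banach, second_countable_topology}"
  assumes int: "integrable lborel F" and fin: "finite A"
    and A: "\<And>x \<alpha>. x \<in> cbox 0 1 \<Longrightarrow> F (x - real_vec \<alpha>) \<noteq> 0 \<Longrightarrow> \<alpha> \<in> A"
  shows "(LINT x|lborel. F x) = (LINT x:cbox 0 1|lborel. (\<Sum>\<alpha>\<in>A. F (x - real_vec \<alpha>)))"
proof -
  let ?f = "\<lambda>\<alpha> x. indicator half_cube (x + real_vec \<alpha>) *\<^sub>R F x"
  have [measurable]: "F \<in> borel_measurable borel" using int by auto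
  have F: "F x = (\<Sum>\<alpha>\<in>A. ?f \<alpha> x)" for x
  proof -
    define \<alpha>0 :: "int^'d" where "\<alpha>0 = (\<chi> j. - \<lfloor>x $ j\<rfloor>)"
    have "(\<Sum>\<alpha>\<in>A. ?f \<alpha> x) = (\<Sum>\<alpha>\<in>A. if \<alpha> = \<alpha>0 then F x else 0)"
      by (intro sum.cong) (auto simp: half_cube_translate \<alpha>0_def)
    also have "\<dots> = (if \<alpha>0 \<in> A then F x else 0)" using fin by simp
    also have "\<dots> = F x"
    proof -
      have "x + real_vec \<alpha>0 \<in> cbox 0 1"
        using half_cube_translate[of x \<alpha>0] half_cube_subset by (auto simp: \<alpha>0_def)
      then show ?thesis using A[of "x + real_vec \<alpha>0" \<alpha>0] by auto
    qed
    finally show ?thesis by simp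
  qed
  have i1: "integrable lborel (?f \<alpha>)" for \<alpha>
    by (rule Bochner_Integration.integrable_bound[OF int]) (auto simp: indicator_def)
  have i2: "integrable lborel (\<lambda>x. indicator half_cube x *\<^sub>R F (x - real_vec \<alpha>))" for \<alpha>
    using lborel_integrable_shift[OF i1[of \<alpha>], of "real_vec \<alpha>"] by simp
  have "(LINT x|lborel. F x) = (LINT x|lborel. (\<Sum>\<alpha>\<in>A. ?f \<alpha> x))" using F by simp
  also have "\<dots> = (\<Sum>\<alpha>\<in>A. (LINT x|lborel. ?f \<alpha> x))" by (intro Bochner_Integration.integral_sum i1)
  also have "\<dots> = (\<Sum>\<alpha>\<in>A. (LINT x|lborel. ?f \<alpha> (x - real_vec \<alpha>)))"
    by (simp only: lborel_integral_shift[of "?f _"])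
  also have "\<dots> = (LINT x|lborel. (\<Sum>\<alpha>\<in>A. indicator half_cube x *\<^sub>R F (x - real_vec \<alpha>)))"
    using i2 by (subst Bochner_Integration.integral_sum) auto
  also have "\<dots> = (LINT x|lborel. indicator (cbox 0 1) x *\<^sub>R (\<Sum>\<alpha>\<in>A. F (x - real_vec \<alpha>)))"
  proof (rule integral_cong_AE)
    show "AE x in lborel. (\<Sum>\<alpha>\<in>A. indicator half_cube x *\<^sub>R F (x - real_vec \<alpha>))
        = indicator (cbox 0 1) x *\<^sub>R (\<Sum>\<alpha>\<in>A. F (x - real_vec \<alpha>))"
      using AE_half_cube by eventually_elim (auto simp: indicator_def)
  qed auto
  finally show ?thesis by (simp add: set_lebesgue_integral_def)
qed

lemma finite_vec_components: "finite S \<Longrightarrow> finite {\<alpha>::'a^'d. \<forall>j. \<alpha> $ j \<in> S}"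
proof -
  assume "finite S"
  then have "finite (vec_lambda ` (PiE (UNIV::'d set) (\<lambda>_. S)))"
    by (intro finite_imageI finite_PiE) auto
  moreover have "{\<alpha>::'a^'d. \<forall>j. \<alpha> $ j \<in> S} \<subseteq> vec_lambda ` (PiE (UNIV::'d set) (\<lambda>_. S))"
  proof
    fix \<alpha> :: "'a^'d" assume "\<alpha> \<in> {\<alpha>. \<forall>j. \<alpha> $ j \<in> S}"
    then have "(\<lambda>j. \<alpha> $ j) \<in> PiE (UNIV::'d set) (\<lambda>_. S)" "\<alpha> = vec_lambda (\<lambda>j. \<alpha> $ j)" by auto
    then show "\<alpha> \<in> vec_lambda ` (PiE (UNIV::'d set) (\<lambda>_. S))" by blast
  qed
  ultimately show ?thesis by (rule finite_subset[rotated])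
qed

lemma finite_real_vec_ball: "finite {\<alpha>::int^'d. norm (real_vec \<alpha>) \<le> R}"
proof (rule finite_subset)
  show "finite {\<alpha>::int^'d. \<forall>j. \<alpha> $ j \<in> {-\<lceil>R\<rceil>..\<lceil>R\<rceil>}}" by (rule finite_vec_components) simp
  show "{\<alpha>::int^'d. norm (real_vec \<alpha>) \<le> R} \<subseteq> {\<alpha>. \<forall>j. \<alpha> $ j \<in> {-\<lceil>R\<rceil>..\<lceil>R\<rceil>}}"
  proof safe
    fix \<alpha> :: "int^'d" and j assume R: "norm (real_vec \<alpha>) \<le> R"
    have "\<bar>real_of_int (\<alpha> $ j)\<bar> \<le> R"
      using component_le_norm_cart[of "real_vec \<alpha>" j] R by simp
    then show "\<alpha> $ j \<in> {-\<lceil>R\<rceil>..\<lceil>R\<rceil>}" by simp linarith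
  qed
qed

lemma norm_cbox01: "x \<in> cbox 0 (1::real^'d) \<Longrightarrow> norm x \<le> real CARD('d)"
proof -
  assume x: "x \<in> cbox 0 1"
  have "norm x \<le> (\<Sum>j\<in>UNIV. \<bar>x $ j\<bar>)" by (rule norm_le_l1_cart)
  also have "\<dots> \<le> (\<Sum>j\<in>(UNIV::'d set). 1)" by (intro sum_mono) (use x in \<open>auto simp: mem_box_cart\<close>)
  finally show ?thesis by simp
qed

subsection \<open>Exponential decay\<close>

text \<open>The l1 norm is at most d times the Euclidean norm. Both the integrability of exponential
  decay on R^d and its summability over Z^d thereby reduce to dimension one.\<close>

lemma exp_norm_le_prod:
  fixes x :: "real^'d"
  assumes "a \<ge> 0"
  shows "exp (- a * norm x) \<le> (\<Prod>j\<in>UNIV. exp (- (a / CARD('d)) * \<bar>x $ j\<bar>))"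
proof -
  have "(\<Sum>j\<in>UNIV. \<bar>x $ j\<bar>) \<le> (\<Sum>j\<in>(UNIV::'d set). norm x)"
    by (intro sum_mono component_le_norm_cart)
  then have "(a / CARD('d)) * (\<Sum>j\<in>UNIV. \<bar>x $ j\<bar>) \<le> (a / CARD('d)) * (CARD('d) * norm x)"
    using assms by (intro mult_left_mono) auto
  then have "- a * norm x \<le> (\<Sum>j\<in>UNIV. - (a / CARD('d)) * \<bar>x $ j\<bar>)"
    by (simp add: sum_distrib_left sum_divide_distrib sum_negf)
  then show ?thesis by (simp add: exp_sum[symmetric])
qed

lemma exp_abs_integrable:
  assumes "a > 0" shows "integrable lborel (\<lambda>t::real. exp (- a * \<bar>t\<bar>))"
proof -
  have "(\<integral>\<^sup>+t. ennreal (exp (- a * t)) * indicator {0..} t \<partial>lborel) = ennreal (0 - (- exp (- a * 0) / a))"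
  proof (rule nn_integral_FTC_atLeast)
    show "((\<lambda>t. - exp (- a * t) / a) \<longlongrightarrow> 0) at_top" using assms by real_asymp
  qed (use assms in \<open>auto intro!: derivative_eq_intros\<close>)
  also have "(\<integral>\<^sup>+t. ennreal (exp (- a * t)) * indicator {0..} t \<partial>lborel)
      = (\<integral>\<^sup>+t. ennreal (norm (indicator {0..} t * exp (- a * t))) \<partial>lborel)"
    by (intro nn_integral_cong) (auto simp: indicator_def)
  finally have *: "integrable lborel (\<lambda>t. indicator {0..} t * exp (- a * t))"
    by (simp add: integrable_iff_bounded)
  have "integrable lborel (\<lambda>t. indicator {0..} (0 + (-1) * t) * exp (- a * (0 + (-1) * t)))"
    by (rule lborel_integrable_real_affine[OF *]) simp
  from Bochner_Integration.integrable_add[OF * this] show ?thesis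
    by (rule Bochner_Integration.integrable_bound) (auto simp: indicator_def)
qed

lemma exp_norm_integrable:
  assumes "a > 0" shows "integrable lborel (\<lambda>x::real^'d. exp (- a * norm x))"
proof (rule Bochner_Integration.integrable_bound)
  show "integrable lborel (\<lambda>x::real^'d. \<Prod>j\<in>UNIV. exp (- (a / CARD('d)) * \<bar>x $ j\<bar>))"
    by (intro cart_lborel_prod(1) exp_abs_integrable) (use assms in auto)
  show "AE x in lborel. norm (exp (- a * norm (x::real^'d))) \<le> norm (\<Prod>j\<in>UNIV. exp (- (a / CARD('d)) * \<bar>x $ j\<bar>))"
    using exp_norm_le_prod[of a] assms by (auto simp: prod_nonneg)
qed auto

lemma exp_int_summable:
  assumes "a > 0"
  obtains C where "C \<ge> 0" "\<And>N::nat. (\<Sum>k\<in>{- int N..int N}. exp (- a * \<bar>real_of_int k\<bar>)) \<le> C"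
proof
  \<comment> \<open>Two geometric series, over k \<ge> 0 and over k \<le> 0; the term at 0 is
    counted twice.\<close>
  let ?C = "2 * (1 / (1 - exp (- a)))"
  show "?C \<ge> 0" using assms by simp
  fix N :: nat
  have g: "(\<Sum>n\<le>N. exp (- a) ^ n) \<le> 1 / (1 - exp (- a))"
  proof -
    have "summable (\<lambda>n. exp (- a) ^ n)" using assms by (intro summable_geometric) auto
    then have "(\<Sum>n\<le>N. exp (- a) ^ n) \<le> suminf (\<lambda>n. exp (- a) ^ n)" by (intro sum_le_suminf) auto
    then show ?thesis using assms by (simp add: suminf_geometric)
  qed
  have "(\<Sum>k\<in>{- int N..int N}. exp (- a * \<bar>real_of_int k\<bar>))
      \<le> (\<Sum>k\<in>int ` {..N} \<union> (\<lambda>n. - int n) ` {..N}. exp (- a * \<bar>real_of_int k\<bar>))"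
  proof (rule sum_mono2)
    show "{- int N..int N} \<subseteq> int ` {..N} \<union> (\<lambda>n. - int n) ` {..N}"
    proof
      fix k assume k: "k \<in> {- int N..int N}"
      show "k \<in> int ` {..N} \<union> (\<lambda>n. - int n) ` {..N}"
      proof (cases "k \<ge> 0")
        case True then have "k = int (nat k)" "nat k \<le> N" using k by auto
        then show ?thesis by (metis UnI1 atMost_iff image_eqI)
      next
        case False then have "k = - int (nat (- k))" "nat (- k) \<le> N" using k by auto
        then show ?thesis by (metis UnI2 atMost_iff image_eqI)
      qed
    qed
  qed auto
  also have "\<dots> \<le> (\<Sum>k\<in>int ` {..N}. exp (- a * \<bar>real_of_int k\<bar>))
      + (\<Sum>k\<in>(\<lambda>n. - int n) ` {..N}. exp (- a * \<bar>real_of_int k\<bar>))"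
    by (subst sum.union_inter[symmetric]) (auto intro: sum_nonneg)
  also have "\<dots> = 2 * (\<Sum>n\<le>N. exp (- a) ^ n)"
    by (subst (1 2) sum.reindex) (auto simp: inj_on_def exp_of_nat_mult[symmetric] mult.commute)
  finally show "(\<Sum>k\<in>{- int N..int N}. exp (- a * \<bar>real_of_int k\<bar>)) \<le> ?C" using g by simp
qed

lemma exp_norm_summable:
  assumes "a > 0" shows "(\<lambda>\<alpha>::int^'d. exp (- a * norm (real_vec \<alpha>))) summable_on UNIV"
proof -
  obtain C where C: "C \<ge> 0" "\<And>N::nat. (\<Sum>k\<in>{- int N..int N}. exp (- (a / CARD('d)) * \<bar>real_of_int k\<bar>)) \<le> C"
    using exp_int_summable[of "a / CARD('d)"] assms by auto
  have "(\<Sum>\<alpha>\<in>F. exp (- a * norm (real_vec \<alpha>))) \<le> C ^ CARD('d)" if F: "finite F" for F :: "(int^'d) set"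
  proof -
    define N where "N = Max (insert 0 ((\<lambda>(\<alpha>, j). nat \<bar>\<alpha> $ j\<bar>) ` (F \<times> (UNIV::'d set))))"
    have N: "\<alpha> $ j \<in> {- int N..int N}" if "\<alpha> \<in> F" for \<alpha> j
    proof -
      have "nat \<bar>\<alpha> $ j\<bar> \<le> N"
        unfolding N_def using F that by (intro Max_ge) auto
      then show ?thesis by auto
    qed
    let ?P = "PiE (UNIV::'d set) (\<lambda>_. {- int N..int N})"
    have "(\<Sum>\<alpha>\<in>F. exp (- a * norm (real_vec \<alpha>)))
        \<le> (\<Sum>\<alpha>\<in>F. \<Prod>j\<in>UNIV. exp (- (a / CARD('d)) * \<bar>real_of_int (\<alpha> $ j)\<bar>))"
      using exp_norm_le_prod[of a "real_vec _"] assms by (intro sum_mono) auto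
    also have "\<dots> = (\<Sum>u\<in>vec_nth ` F. \<Prod>j\<in>UNIV. exp (- (a / CARD('d)) * \<bar>real_of_int (u j)\<bar>))"
      by (subst sum.reindex) (auto simp: inj_on_def vec_nth_inject)
    also have "\<dots> \<le> (\<Sum>u\<in>?P. \<Prod>j\<in>UNIV. exp (- (a / CARD('d)) * \<bar>real_of_int (u j)\<bar>))"
      using N F by (intro sum_mono2 finite_PiE prod_nonneg) auto
    also have "\<dots> = (\<Prod>j\<in>(UNIV::'d set). \<Sum>k\<in>{- int N..int N}. exp (- (a / CARD('d)) * \<bar>real_of_int k\<bar>))"
      by (subst prod_sum_PiE) auto
    also have "\<dots> \<le> (\<Prod>j\<in>(UNIV::'d set). C)"
      by (intro prod_mono) (use C in \<open>auto intro: sum_nonneg\<close>)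
    finally show ?thesis by simp
  qed
  then show ?thesis
    by (intro nonneg_bdd_above_summable_on) (auto simp: bdd_above_def)
qed

lemma power_mult_exp_bound:
  assumes "a > 0"
  obtains C where "C > 0" "\<And>t::real. t \<ge> 0 \<Longrightarrow> (1 + t) ^ k * exp (- a * t) \<le> C"
proof
  \<comment> \<open>From the k-th term of the exponential series: (a (1 + t))^k / k! \<le> e^a e^{a
    t}.\<close>
  let ?C = "fact k * (1 / a) ^ k * exp a"
  show "?C > 0" using assms by simp
  fix t :: real assume t: "t \<ge> 0"
  have "(a * (1 + t)) ^ k / fact k \<le> exp (a * (1 + t))"
  proof -
    have s: "summable (\<lambda>n. (a * (1 + t)) ^ n /\<^sub>R fact n)" by (rule summable_exp_generic)
    have "(\<Sum>n\<in>{k}. (a * (1 + t)) ^ n /\<^sub>R fact n) \<le> exp (a * (1 + t))"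
      unfolding exp_def by (rule sum_le_suminf[OF s]) (use assms t in auto)
    then show ?thesis by (simp add: divide_inverse mult.commute)
  qed
  then have "(a * (1 + t)) ^ k \<le> exp (a * (1 + t)) * fact k"
    by (subst (asm) pos_divide_le_eq) auto
  moreover have "exp (a * (1 + t)) = exp a * exp (a * t)" by (simp add: distrib_left exp_add)
  ultimately have "a ^ k * (1 + t) ^ k \<le> fact k * (exp a * exp (a * t))"
    by (simp add: power_mult_distrib mult_ac)
  then have "(1 + t) ^ k \<le> ?C * exp (a * t)"
    using assms by (simp add: field_simps power_divide)
  then have "(1 + t) ^ k * exp (- a * t) \<le> ?C * exp (a * t) * exp (- a * t)"
    by (intro mult_right_mono) auto
  then show "(1 + t) ^ k * exp (- a * t) \<le> ?C" by (simp add: exp_minus field_simps)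
qed

section \<open>Fourier analysis on the unit cube\<close>

definition char_fun :: "int^'d \<Rightarrow> real^'d \<Rightarrow> complex" where
  "char_fun \<gamma> x = exp (2 * of_real pi * \<i> * of_real (real_vec \<gamma> \<bullet> x))"

lemma char_fun_cis: "char_fun \<gamma> x = cis (2 * pi * (real_vec \<gamma> \<bullet> x))"
  by (simp add: char_fun_def cis_conv_exp mult_ac)

lemma norm_char_fun [simp]: "norm (char_fun \<gamma> x) = 1"
  by (simp add: char_fun_cis)

lemma char_fun_0 [simp]: "char_fun 0 x = 1" "char_fun \<gamma> 0 = 1"
  by (simp_all add: char_fun_cis)

lemma char_fun_add: "char_fun (\<alpha> + \<beta>) x = char_fun \<alpha> x * char_fun \<beta> x"
  by (simp add: char_fun_cis cis_mult real_vec_add inner_add_left distrib_left)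

lemma char_fun_add_arg: "char_fun \<alpha> (x + y) = char_fun \<alpha> x * char_fun \<alpha> y"
  by (simp add: char_fun_cis cis_mult inner_add_right distrib_left)

lemma char_fun_minus: "char_fun (- \<alpha>) x = cnj (char_fun \<alpha> x)"
  by (simp add: char_fun_cis cis_cnj real_vec_minus)

lemma char_fun_minus_arg: "char_fun \<alpha> (- x) = cnj (char_fun \<alpha> x)"
  by (simp add: char_fun_cis cis_cnj)

lemma char_fun_cnj_mult: "cnj (char_fun \<alpha> x) * char_fun \<alpha> x = 1"
  by (metis char_fun_0(1) char_fun_add char_fun_minus add.left_inverse)

lemma char_fun_diff: "char_fun (\<alpha> - \<beta>) x = char_fun \<alpha> x * cnj (char_fun \<beta> x)"
  using char_fun_add[of \<alpha> "- \<beta>" x] by (simp add: char_fun_minus)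

lemma char_fun_real_vec [simp]: "char_fun \<gamma> (real_vec \<alpha>) = 1"
  unfolding char_fun_cis inner_real_vec by (rule cis_multiple_2pi) simp

lemma char_fun_shift [simp]: "char_fun \<gamma> (x + real_vec \<alpha>) = char_fun \<gamma> x"
  "char_fun \<gamma> (x - real_vec \<alpha>) = char_fun \<gamma> x"
  using char_fun_add_arg[of \<gamma> x "real_vec \<alpha>"] char_fun_add_arg[of \<gamma> x "- real_vec \<alpha>"]
  by (auto simp: char_fun_minus_arg)

lemma continuous_on_char_fun [continuous_intros]:
  "continuous_on S f \<Longrightarrow> continuous_on S (\<lambda>x. char_fun \<gamma> (f x))"
  unfolding char_fun_def by (intro continuous_intros)

lemma char_fun_measurable [measurable]: "char_fun \<gamma> \<in> borel_measurable borel"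
  by (intro borel_measurable_continuous_onI continuous_on_char_fun continuous_on_id)

lemma set_integrable_bounded_cube:
  fixes g :: "real^'d \<Rightarrow> 'b::{banach, second_countable_topology}"
  assumes [measurable]: "g \<in> borel_measurable borel" and "AE x in lborel. norm (g x) \<le> M"
  shows "set_integrable lborel (cbox a b) g"
  unfolding set_integrable_def
proof (rule Bochner_Integration.integrable_bound)
  show "integrable lborel (\<lambda>x. indicator (cbox a b) x *\<^sub>R \<bar>M\<bar>)"
    by (intro integrable_real_indicator integrable_scaleR_left) (use emeasure_bounded_finite[OF bounded_cbox] in auto)
  show "AE x in lborel. norm (indicator (cbox a b) x *\<^sub>R g x) \<le> norm (indicat_real (cbox a b) x *\<^sub>R \<bar>M\<bar>)"
    using assms(2) by eventually_elim (auto simp: indicator_def)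
qed auto

text \<open>The character factors over the coordinates. In a coordinate with nonzero frequency the
  antiderivative takes the same value at both ends of the unit interval, so that factor is
  0.\<close>

lemma integral_char_fun_cube:
  "(LINT x:cbox 0 1|lborel. char_fun \<gamma> x) = (if \<gamma> = (0::int^'d) then 1 else 0)"
proof -
  let ?f = "\<lambda>(j::'d) (t::real). indicator {0..1} t *\<^sub>R cis (2 * pi * (of_int (\<gamma> $ j) * t))"
  have int: "integrable lborel (?f j)" for j
    by (rule borel_integrable_atLeastAtMost'[unfolded set_integrable_def]) (intro continuous_intros)
  have val: "(LINT t|lborel. ?f j t) = (if \<gamma> $ j = 0 then 1 else 0)" for j
  proof (cases "\<gamma> $ j = 0")
    case True then show ?thesis by simp
  next
    case False
    let ?c = "2 * pi * of_int (\<gamma> $ j) :: real"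
    let ?F = "\<lambda>t. - \<i> * cis (?c * t) / of_real ?c"
    have c: "?c \<noteq> 0" using False by simp
    have "((\<lambda>z. - \<i> * exp (\<i> * of_real ?c * z) / of_real ?c) has_field_derivative exp (\<i> * of_real ?c * z)) (at z)" for z
      by (rule derivative_eq_intros refl | use c in simp)+
    note D = has_vector_derivative_real_field[OF this]
    have "(?F has_vector_derivative cis (2 * pi * (of_int (\<gamma> $ j) * t))) (at t within {0..1})" for t
      using D[of t "{0..1}"] by (simp add: cis_conv_exp mult_ac)
    then have "(LINT t|lborel. ?f j t) = ?F 1 - ?F 0"
      by (intro integral_FTC_atLeastAtMost) (auto intro!: continuous_intros)
    moreover have "cis ?c = 1" by (rule cis_multiple_2pi) simp
    ultimately show ?thesis using False by simp
  qed
  have eq: "indicator (cbox 0 1) x *\<^sub>R char_fun \<gamma> x = (\<Prod>j\<in>UNIV. ?f j (x $ j))" for x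
  proof (cases "x \<in> cbox 0 1")
    case True
    then have "\<And>j. x $ j \<in> {0..1}" by (auto simp: mem_box_cart)
    then show ?thesis using True
      by (simp add: char_fun_cis inner_vec_def cis_conv_exp exp_sum[symmetric] sum_distrib_left of_real_sum)
  next
    case False
    then obtain j where "x $ j \<notin> {0..1}" by (auto simp: mem_box_cart)
    then have "?f j (x $ j) = 0" by simp
    then show ?thesis using False by (subst prod_zero) auto
  qed
  have "(LINT x:cbox 0 1|lborel. char_fun \<gamma> x) = (\<Prod>j\<in>UNIV. (LINT t|lborel. ?f j t))"
    unfolding set_lebesgue_integral_def eq by (rule cart_lborel_prod(2)[OF int])
  also have "\<dots> = (if \<gamma> = 0 then 1 else 0)"
    unfolding val by (auto simp: vec_eq_iff)
  finally show ?thesis .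
qed

text \<open>The radius \<open>r\<close> acts as a degree that adds up under products. Powers of the
  symbol thus have controlled degree, which turns the geometric series in
  \<open>inv_coeff_decay\<close> into exponential decay.\<close>

definition trig_poly :: "real \<Rightarrow> (real^'d \<Rightarrow> complex) \<Rightarrow> bool" where
  "trig_poly r f \<longleftrightarrow> (\<exists>A c. finite A \<and> (\<forall>\<alpha>\<in>A. norm (real_vec \<alpha>) \<le> r) \<and>
     (\<forall>x. f x = (\<Sum>\<alpha>\<in>A. c \<alpha> * char_fun \<alpha> x)))"

lemma trig_polyE:
  assumes "trig_poly r f"
  obtains A c where "finite A" "\<And>\<alpha>. \<alpha> \<in> A \<Longrightarrow> norm (real_vec \<alpha>) \<le> r"
    "\<And>x. f x = (\<Sum>\<alpha>\<in>A. c \<alpha> * char_fun \<alpha> x)"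
  using assms unfolding trig_poly_def by blast

lemma trig_poly_sum:
  assumes "finite S" "\<And>\<alpha>. \<alpha> \<in> S \<Longrightarrow> norm (real_vec \<alpha>) \<le> r"
  shows "trig_poly r (\<lambda>x. \<Sum>\<alpha>\<in>S. c \<alpha> * char_fun \<alpha> x)"
  unfolding trig_poly_def using assms by (intro exI[of _ S] exI[of _ c]) auto

lemma trig_poly_const: "r \<ge> 0 \<Longrightarrow> trig_poly r (\<lambda>x. c)"
  using trig_poly_sum[of "{0}" r "\<lambda>_. c"] by simp

lemma trig_poly_mono: "trig_poly r f \<Longrightarrow> r \<le> s \<Longrightarrow> trig_poly s f"
  unfolding trig_poly_def by (meson order_trans)

lemma trig_poly_add:
  assumes "trig_poly r f" "trig_poly r g"
  shows "trig_poly r (\<lambda>x. f x + g x)"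
proof -
  obtain A c where A: "finite A" "\<And>\<alpha>. \<alpha> \<in> A \<Longrightarrow> norm (real_vec \<alpha>) \<le> r"
    "\<And>x. f x = (\<Sum>\<alpha>\<in>A. c \<alpha> * char_fun \<alpha> x)" using assms(1) by (rule trig_polyE) blast
  obtain B d where B: "finite B" "\<And>\<alpha>. \<alpha> \<in> B \<Longrightarrow> norm (real_vec \<alpha>) \<le> r"
    "\<And>x. g x = (\<Sum>\<alpha>\<in>B. d \<alpha> * char_fun \<alpha> x)" using assms(2) by (rule trig_polyE) blast
  let ?e = "\<lambda>\<alpha>. (if \<alpha> \<in> A then c \<alpha> else 0) + (if \<alpha> \<in> B then d \<alpha> else 0)"
  have "f x + g x = (\<Sum>\<alpha>\<in>A \<union> B. ?e \<alpha> * char_fun \<alpha> x)" for x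
  proof -
    have "(\<Sum>\<alpha>\<in>A \<union> B. (if \<alpha> \<in> A then c \<alpha> * char_fun \<alpha> x else 0)) = (\<Sum>\<alpha>\<in>A. c \<alpha> * char_fun \<alpha> x)"
      "(\<Sum>\<alpha>\<in>A \<union> B. (if \<alpha> \<in> B then d \<alpha> * char_fun \<alpha> x else 0)) = (\<Sum>\<alpha>\<in>B. d \<alpha> * char_fun \<alpha> x)"
      using A(1) B(1) by (auto simp: sum.If_cases intro!: arg_cong2[where f = sum])
    then show ?thesis
      by (simp add: A(3) B(3) distrib_right sum.distrib if_distrib[of "\<lambda>t. t * _"] cong: if_cong)
  qed
  then have eq: "(\<lambda>x. f x + g x) = (\<lambda>x. \<Sum>\<alpha>\<in>A \<union> B. ?e \<alpha> * char_fun \<alpha> x)" by (rule ext)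
  show ?thesis unfolding eq by (rule trig_poly_sum) (use A B in auto)
qed

lemma trig_poly_mult:
  assumes "trig_poly r f" "trig_poly s g"
  shows "trig_poly (r + s) (\<lambda>x. f x * g x)"
proof -
  obtain A c where A: "finite A" "\<And>\<alpha>. \<alpha> \<in> A \<Longrightarrow> norm (real_vec \<alpha>) \<le> r"
    "\<And>x. f x = (\<Sum>\<alpha>\<in>A. c \<alpha> * char_fun \<alpha> x)" using assms(1) by (rule trig_polyE) blast
  obtain B d where B: "finite B" "\<And>\<alpha>. \<alpha> \<in> B \<Longrightarrow> norm (real_vec \<alpha>) \<le> s"
    "\<And>x. g x = (\<Sum>\<alpha>\<in>B. d \<alpha> * char_fun \<alpha> x)" using assms(2) by (rule trig_polyE) blast
  let ?S = "(\<lambda>(\<alpha>, \<beta>). \<alpha> + \<beta>) ` (A \<times> B)"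
  let ?e = "\<lambda>\<gamma>. \<Sum>p\<in>{p \<in> A \<times> B. fst p + snd p = \<gamma>}. c (fst p) * d (snd p)"
  have "f x * g x = (\<Sum>\<gamma>\<in>?S. ?e \<gamma> * char_fun \<gamma> x)" for x
  proof -
    have "f x * g x = (\<Sum>p\<in>A \<times> B. c (fst p) * d (snd p) * char_fun (fst p + snd p) x)"
      unfolding A(3) B(3) sum_product sum.cartesian_product by (auto intro!: sum.cong simp: char_fun_add)
    also have "\<dots> = (\<Sum>\<gamma>\<in>?S. \<Sum>p\<in>{p \<in> A \<times> B. fst p + snd p = \<gamma>}. c (fst p) * d (snd p) * char_fun (fst p + snd p) x)"
      by (rule sum.group[symmetric]) (use A(1) B(1) in auto)
    also have "\<dots> = (\<Sum>\<gamma>\<in>?S. ?e \<gamma> * char_fun \<gamma> x)"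
      unfolding sum_distrib_right by (intro sum.cong) auto
    finally show ?thesis .
  qed
  then have eq: "(\<lambda>x. f x * g x) = (\<lambda>x. \<Sum>\<gamma>\<in>?S. ?e \<gamma> * char_fun \<gamma> x)" by (rule ext)
  show ?thesis unfolding eq
  proof (rule trig_poly_sum)
    fix \<gamma> assume "\<gamma> \<in> ?S"
    then obtain \<alpha> \<beta> where "\<gamma> = \<alpha> + \<beta>" "\<alpha> \<in> A" "\<beta> \<in> B" by auto
    then show "norm (real_vec \<gamma>) \<le> r + s"
      using A(2)[of \<alpha>] B(2)[of \<beta>] norm_triangle_ineq[of "real_vec \<alpha>" "real_vec \<beta>"]
      by (simp add: real_vec_add)
  qed (use A B in auto)
qed

text \<open>Polynomials in the real and imaginary parts of e^{2 pi i x_j} are trigonometric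
  polynomials: the linear case uses the characters of frequency \<plusminus>e_j, and sums and
  products are handled by induction.\<close>

lemma trig_real_polynomial:
  fixes p :: "complex^'d \<Rightarrow> real"
  assumes "real_polynomial_function p"
  shows "\<exists>r. trig_poly r (\<lambda>x::real^'d. complex_of_real (p (\<chi> j. cis (2 * pi * x $ j))))"
  using assms
proof (induction p rule: real_polynomial_function.induct)
  case (linear f)
  have cx: "cis (2 * pi * x $ j) = char_fun (axis j 1) x" for x :: "real^'d" and j
  proof -
    have "real_vec (axis j 1) = (axis j 1 :: real^'d)" by (auto simp: vec_eq_iff axis_def)
    then show ?thesis by (simp add: char_fun_cis inner_axis')
  qed
  let ?a = "\<lambda>j. f (axis j 1)" and ?b = "\<lambda>j. f (axis j \<i>)"
  have f: "f w = (\<Sum>j\<in>UNIV. Re (w $ j) * ?a j + Im (w $ j) * ?b j)" for w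
  proof -
    interpret bounded_linear f by fact
    have "w = (\<Sum>j\<in>UNIV. Re (w $ j) *\<^sub>R axis j 1 + Im (w $ j) *\<^sub>R axis j \<i>)"
      by (auto simp: vec_eq_iff sum.distrib axis_def if_distrib complex_eq_iff sum.delta cong: if_cong)
    then have "f w = f (\<Sum>j\<in>UNIV. Re (w $ j) *\<^sub>R axis j 1 + Im (w $ j) *\<^sub>R axis j \<i>)" by simp
    then show ?thesis by (simp add: sum add scaleR)
  qed
  let ?P = "(\<lambda>j. axis j 1) ` UNIV :: (int^'d) set" and ?N = "(\<lambda>j. - axis j 1) ` UNIV :: (int^'d) set"
  \<comment> \<open>For z on the unit circle, a Re z + b Im z = (a - i b)/2 z + (a + i b)/2 cnj
    z.\<close>
  let ?c = "\<lambda>\<alpha>::int^'d. \<Sum>j\<in>UNIV. (if \<alpha> = axis j 1 then (of_real (?a j) - \<i> * of_real (?b j)) / 2 else 0)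
      + (if \<alpha> = - axis j 1 then (of_real (?a j) + \<i> * of_real (?b j)) / 2 else 0)"
  have "complex_of_real (f (\<chi> j. cis (2 * pi * x $ j))) = (\<Sum>\<alpha>\<in>?P \<union> ?N. ?c \<alpha> * char_fun \<alpha> x)" for x :: "real^'d"
  proof -
    have fin: "finite (?P \<union> ?N)" by simp
    have m: "axis j 1 \<in> ?P \<union> ?N" "- axis j 1 \<in> ?P \<union> ?N" for j by blast+
    have "(\<Sum>\<alpha>\<in>?P \<union> ?N. ?c \<alpha> * char_fun \<alpha> x)
       = (\<Sum>j\<in>UNIV. \<Sum>\<alpha>\<in>?P \<union> ?N. (if \<alpha> = axis j 1 then (of_real (?a j) - \<i> * of_real (?b j)) / 2 * char_fun \<alpha> x else 0)
      + (if \<alpha> = - axis j 1 then (of_real (?a j) + \<i> * of_real (?b j)) / 2 * char_fun \<alpha> x else 0))"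
      unfolding sum_distrib_right
      by (subst sum.swap, intro sum.cong refl) (simp only: distrib_right if_distrib[of "\<lambda>t. t * _"] mult_zero_left)
    also have "\<dots> = (\<Sum>j\<in>UNIV. (of_real (?a j) - \<i> * of_real (?b j)) / 2 * char_fun (axis j 1) x
        + (of_real (?a j) + \<i> * of_real (?b j)) / 2 * char_fun (- axis j 1) x)"
      by (intro sum.cong refl) (simp only: sum.distrib sum.delta fin m if_True)
    also have "\<dots> = (\<Sum>j\<in>UNIV. of_real (Re (cis (2 * pi * x $ j)) * ?a j + Im (cis (2 * pi * x $ j)) * ?b j))"
      unfolding char_fun_minus cx[symmetric]
      by (intro sum.cong refl) (simp add: complex_eq_iff field_simps)
    finally show ?thesis by (simp add: f[of "\<chi> j. cis (2 * pi * x $ j)"])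
  qed
  then have eq: "(\<lambda>x::real^'d. complex_of_real (f (\<chi> j. cis (2 * pi * x $ j)))) = (\<lambda>x. \<Sum>\<alpha>\<in>?P \<union> ?N. ?c \<alpha> * char_fun \<alpha> x)"
    by (rule ext)
  show ?case unfolding eq
  proof (intro exI[of _ "\<Sum>\<alpha>\<in>?P \<union> ?N. norm (real_vec \<alpha>)"] trig_poly_sum)
    show "norm (real_vec \<alpha>) \<le> (\<Sum>\<alpha>\<in>?P \<union> ?N. norm (real_vec \<alpha>))" if "\<alpha> \<in> ?P \<union> ?N" for \<alpha> :: "int^'d"
      by (rule member_le_sum) (use that in auto)
  qed simp
next
  case (const c)
  show ?case by (intro exI[of _ 0] trig_poly_const) simp
next
  case (add f g)
  then obtain r s where "trig_poly r (\<lambda>x::real^'d. complex_of_real (f (\<chi> j. cis (2 * pi * x $ j))))"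
    "trig_poly s (\<lambda>x::real^'d. complex_of_real (g (\<chi> j. cis (2 * pi * x $ j))))" by blast
  then have "trig_poly (max r s) (\<lambda>x::real^'d. complex_of_real (f (\<chi> j. cis (2 * pi * x $ j)))
      + complex_of_real (g (\<chi> j. cis (2 * pi * x $ j))))"
    by (intro trig_poly_add) (auto elim: trig_poly_mono)
  then show ?case by auto
next
  case (mult f g)
  then obtain r s where "trig_poly r (\<lambda>x::real^'d. complex_of_real (f (\<chi> j. cis (2 * pi * x $ j))))"
    "trig_poly s (\<lambda>x::real^'d. complex_of_real (g (\<chi> j. cis (2 * pi * x $ j))))" by blast
  from trig_poly_mult[OF this] show ?case by auto
qed

text \<open>The map to the torus identifies only opposite faces of the cube; a point of the open
  cube shares its image with no other point, since its coordinates differ from any others in [0, 1]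
  by less than 1.\<close>

lemma torus_inj:
  fixes x y :: "real^'d"
  assumes x: "x \<in> box 0 1" and y: "y \<in> cbox 0 1"
    and eq: "(\<chi> j. cis (2 * pi * x $ j)) = (\<chi> j. cis (2 * pi * y $ j))"
  shows "x = y"
proof -
  have "x $ j = y $ j" for j
  proof -
    have "cis (2 * pi * x $ j) = cis (2 * pi * y $ j)" using eq by (simp add: vec_eq_iff)
    then have "sin (2 * pi * x $ j) = sin (2 * pi * y $ j) \<and> cos (2 * pi * x $ j) = cos (2 * pi * y $ j)"
      by (metis cis.sel)
    then obtain n :: int where "2 * pi * x $ j = 2 * pi * y $ j + 2 * pi * n"
      using sin_cos_eq_iff by blast
    then have "2 * pi * x $ j = 2 * pi * (y $ j + n)" by (simp add: distrib_left)
    then have "x $ j = y $ j + n" by simp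
    moreover have "0 < x $ j" "x $ j < 1" "0 \<le> y $ j" "y $ j \<le> 1"
      using x y by (auto simp: mem_box_cart)
    ultimately show ?thesis by (cases "n = 0") linarith+
  qed
  then show ?thesis by (simp add: vec_eq_iff)
qed

text \<open>The torus is realised as the image of the cube in \<open>\<complex>\<^sup>d\<close>, where Stone-Weierstrass
  approximates continuous functions by polynomials in the coordinates, i.e. by trigonometric
  polynomials on the cube.\<close>

lemma fourier_unique:
  fixes F :: "real^'d \<Rightarrow> complex"
  assumes int: "set_integrable lborel (cbox 0 1) F"
    and zero: "\<And>\<gamma>. (LINT x:cbox 0 1|lborel. F x * char_fun \<gamma> x) = 0"
  shows "AE x in lborel. x \<in> cbox 0 1 \<longrightarrow> F x = 0"
proof -
  let ?e = "\<lambda>x::real^'d. (\<chi> j. cis (2 * pi * x $ j)) :: complex^'d"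
  let ?T = "?e ` cbox 0 1"
  define G where "G x = indicator (cbox 0 1) x *\<^sub>R F x" for x
  have iG: "integrable lborel G" using int by (simp add: G_def[abs_def] set_integrable_def)
  then have [measurable]: "G \<in> borel_measurable borel" by auto
  have ce: "continuous_on S ?e" for S
    unfolding cis_conv_exp by (intro continuous_on_vec_lambda continuous_intros)
  have cT: "compact ?T" by (intro compact_continuous_image ce compact_cbox)
  have poly0: "(LINT x|lborel. p (?e x) *\<^sub>R G x) = 0" if p: "real_polynomial_function p" for p
  proof -
    obtain A c where A: "finite (A :: (int^'d) set)"
      "\<And>x. complex_of_real (p (?e x)) = (\<Sum>\<alpha>\<in>A. c \<alpha> * char_fun \<alpha> x)"
      using trig_real_polynomial[OF p] unfolding trig_poly_def by blast
    have i: "integrable lborel (\<lambda>x. c \<alpha> * (G x * char_fun \<alpha> x))" for \<alpha>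
      by (intro integrable_mult_right Bochner_Integration.integrable_bound[OF iG]) (auto simp: norm_mult)
    have "(LINT x|lborel. p (?e x) *\<^sub>R G x) = (LINT x|lborel. (\<Sum>\<alpha>\<in>A. c \<alpha> * (G x * char_fun \<alpha> x)))"
      unfolding scaleR_conv_of_real A(2) by (simp add: sum_distrib_left sum_distrib_right mult_ac)
    also have "\<dots> = (\<Sum>\<alpha>\<in>A. c \<alpha> * (LINT x|lborel. G x * char_fun \<alpha> x))"
      using i by (subst Bochner_Integration.integral_sum) auto
    also have "\<dots> = 0"
      using zero by (simp add: G_def set_lebesgue_integral_def)
    finally show ?thesis .
  qed
  have cont0: "(LINT x|lborel. f (?e x) *\<^sub>R G x) = 0" if f: "continuous_on UNIV f" for f :: "complex^'d \<Rightarrow> real"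
  proof -
    have fe [measurable]: "(\<lambda>x. f (?e x)) \<in> borel_measurable borel"
      by (intro borel_measurable_continuous_onI continuous_on_compose2[OF f ce]) auto
    define K where "K = (LINT x|lborel. norm (G x))"
    have K: "K \<ge> 0" unfolding K_def by simp
    have "norm (LINT x|lborel. f (?e x) *\<^sub>R G x) \<le> \<epsilon> * K" if eps: "\<epsilon> > 0" for \<epsilon>
    proof -
      obtain p where p: "real_polynomial_function p" "\<And>w. w \<in> ?T \<Longrightarrow> \<bar>f w - p w\<bar> < \<epsilon>"
        using Stone_Weierstrass_real_polynomial_function[OF cT continuous_on_subset[OF f subset_UNIV] eps] by blast
      have [measurable]: "(\<lambda>x. p (?e x)) \<in> borel_measurable borel"
        by (intro borel_measurable_continuous_onI continuous_on_compose2[OF continuous_on_polymonial_function ce])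
          (use p in \<open>auto simp: real_polynomial_function_eq\<close>)
      have b: "norm ((f (?e x) - p (?e x)) *\<^sub>R G x) \<le> \<epsilon> * norm (G x)" for x
        using p(2)[of "?e x"] by (cases "x \<in> cbox 0 1") (auto simp: G_def mult_right_mono)
      have i1: "integrable lborel (\<lambda>x. \<epsilon> * norm (G x))" using iG by auto
      have i2: "integrable lborel (\<lambda>x. (f (?e x) - p (?e x)) *\<^sub>R G x)"
        by (rule Bochner_Integration.integrable_bound[OF i1]) (use b eps in \<open>auto\<close>)
      have i3: "integrable lborel (\<lambda>x. p (?e x) *\<^sub>R G x)"
      proof -
        have "compact (p ` ?T)"
          by (intro compact_continuous_image cT continuous_on_polymonial_function)
            (use p in \<open>auto simp: real_polynomial_function_eq\<close>)
        then have "bounded (p ` ?T)" by (rule compact_imp_bounded)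
        then obtain M where "\<forall>y\<in>p ` ?T. norm y \<le> M" unfolding bounded_iff by blast
        then have M: "\<bar>p (?e x)\<bar> \<le> M" if "x \<in> cbox 0 1" for x using that by auto
        have "integrable lborel (\<lambda>x. M * norm (G x))" using iG by auto
        then show ?thesis
        proof (rule Bochner_Integration.integrable_bound)
          have "\<bar>p (?e x)\<bar> * norm (G x) \<le> M * norm (G x)" for x
            using M[of x] by (cases "x \<in> cbox 0 1") (auto simp: G_def intro!: mult_right_mono)
          then show "AE x in lborel. norm (p (?e x) *\<^sub>R G x) \<le> norm (M * norm (G x))"
            by (auto intro!: AE_I2 order_trans[OF _ abs_ge_self])
        qed auto
      qed
      have "(LINT x|lborel. f (?e x) *\<^sub>R G x) = (LINT x|lborel. (f (?e x) - p (?e x)) *\<^sub>R G x + p (?e x) *\<^sub>R G x)"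
        by (simp add: scaleR_diff_left)
      also have "\<dots> = (LINT x|lborel. (f (?e x) - p (?e x)) *\<^sub>R G x)"
        using i2 i3 poly0[OF p(1)] by (subst Bochner_Integration.integral_add) auto
      also have "norm \<dots> \<le> (LINT x|lborel. norm ((f (?e x) - p (?e x)) *\<^sub>R G x))"
        by (rule integral_norm_bound)
      also have "\<dots> \<le> (LINT x|lborel. \<epsilon> * norm (G x))"
        by (intro integral_mono i1 integrable_norm i2 b)
      finally show ?thesis by (simp add: K_def)
    qed
    note bound = this
    have "norm (LINT x|lborel. f (?e x) *\<^sub>R G x) \<le> 0"
    proof (rule field_le_epsilon)
      fix \<epsilon> :: real assume "\<epsilon> > 0"
      \<comment> \<open>Dividing by K + 1 rather than K keeps the quotient meaningful for K =
        0.\<close>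
      then have "norm (LINT x|lborel. f (?e x) *\<^sub>R G x) \<le> \<epsilon> / (K + 1) * K" using bound[of "\<epsilon> / (K + 1)"] K by auto
      also have "\<dots> \<le> \<epsilon>" using K \<open>\<epsilon> > 0\<close> by (simp add: field_simps)
      finally show "norm (LINT x|lborel. f (?e x) *\<^sub>R G x) \<le> 0 + \<epsilon>" by simp
    qed
    then show ?thesis by simp
  qed
  \<comment> \<open>The faces, where points of the torus are glued together, are cut off; they are
    null.\<close>
  define H where "H x = indicator (box 0 1) x *\<^sub>R G x" for x
  have iH: "integrable lborel H" unfolding H_def by (intro integrable_mult_indicator iG) auto
  have "AE x in lborel. H x = 0"
  proof (rule AE_zero_if_box_integrals_zero)
    show "H \<in> borel_measurable borel" using iH by auto
    show "set_integrable lborel (box a b) H" for a b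
      unfolding set_integrable_def by (intro integrable_mult_indicator iH) auto
    fix a b :: "real^'d"
    obtain c d where cd: "box a b \<inter> box 0 1 = box c d" unfolding box_Int_box by blast
    let ?C = "?e ` (cbox 0 1 - box c d)"
    have "compact (cbox 0 1 - box c d)" by (intro compact_diff compact_cbox open_box)
    then have C: "compact ?C" by (intro compact_continuous_image ce)
    have sub: "box c d \<subseteq> box 0 1" using cd by auto
    have "0 \<in> cbox 0 (1::real^'d)" "0 \<notin> box 0 (1::real^'d)" by (auto simp: mem_box_cart)
    then have ne: "?C \<noteq> {}" using sub by blast
    \<comment> \<open>Continuous functions on the ambient space of the torus that vanish on the
      image of the rest of the cube. That image is compact and, by \<open>torus_inj\<close>, misses
      the image of the box, so inside the box the distance is positive and the limit is 1.\<close>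
    define f where "f n w = min 1 (real n * infdist w ?C)" for n w
    have cont: "continuous_on UNIV (f n)" for n
      unfolding f_def by (intro continuous_intros)
    have lim: "(\<lambda>n. f n (?e x)) \<longlonglongrightarrow> indicator (box c d) x" if x: "x \<in> cbox 0 1" for x
    proof (cases "x \<in> box c d")
      case True
      have "?e x \<notin> ?C"
      proof
        assume "?e x \<in> ?C"
        then obtain y where y: "?e x = ?e y" "y \<in> cbox 0 1" "y \<notin> box c d" by blast
        then have "x = y" using torus_inj[of x y] True sub by auto
        then show False using y True by simp
      qed
      then have "infdist (?e x) ?C > 0"
        using ne in_closed_iff_infdist_zero[OF compact_imp_closed[OF C], of "?e x"] infdist_nonneg[of "?e x" ?C]
        by linarith
      then have "filterlim (\<lambda>n. real n * infdist (?e x) ?C) at_top sequentially"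
        by (intro filterlim_at_top_mult_tendsto_pos[OF tendsto_const]
            filterlim_real_sequentially) (auto simp: mult.commute)
      then have "eventually (\<lambda>n. real n * infdist (?e x) ?C \<ge> 1) sequentially"
        by (auto simp: filterlim_at_top)
      then have "eventually (\<lambda>n. f n (?e x) = 1) sequentially"
        by eventually_elim (auto simp: f_def)
      then show ?thesis using True by (simp add: tendsto_eventually)
    next
      case False
      then have "?e x \<in> ?C" using x by blast
      then show ?thesis using False by (simp add: f_def)
    qed
    have "(\<lambda>n. LINT x|lborel. f n (?e x) *\<^sub>R G x) \<longlonglongrightarrow> (LINT x|lborel. indicator (box c d) x *\<^sub>R G x)"
    proof (rule integral_dominated_convergence[where w = "\<lambda>x. norm (G x)"])
      show "AE x in lborel. (\<lambda>n. f n (?e x) *\<^sub>R G x) \<longlonglongrightarrow> indicator (box c d) x *\<^sub>R G x"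
      proof (intro AE_I2)
        fix x
        show "(\<lambda>n. f n (?e x) *\<^sub>R G x) \<longlonglongrightarrow> indicator (box c d) x *\<^sub>R G x"
          by (cases "x \<in> cbox 0 1") (auto intro!: tendsto_scaleR lim tendsto_const simp: G_def)
      qed
      show "AE x in lborel. norm (f n (?e x) *\<^sub>R G x) \<le> norm (G x)" for n
        by (auto intro!: mult_left_le_one_le simp: f_def infdist_nonneg)
      show "(\<lambda>x. f n (?e x) *\<^sub>R G x) \<in> borel_measurable lborel" for n
        by (intro borel_measurable_scaleR)
          (auto intro!: borel_measurable_continuous_onI continuous_on_compose2[OF cont ce])
    qed (use iG in auto)
    then have "(LINT x|lborel. indicator (box c d) x *\<^sub>R G x) = 0"
      using cont0[OF cont] by (simp add: LIMSEQ_const_iff)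
    also have "(\<lambda>x. indicator (box c d) x *\<^sub>R G x) = (\<lambda>x. indicator (box a b) x *\<^sub>R H x)"
      unfolding cd[symmetric] H_def by (auto simp: indicator_def fun_eq_iff)
    finally show "(LINT x:box a b|lborel. H x) = 0" by (simp add: set_lebesgue_integral_def)
  qed
  moreover have "AE x in lborel. \<forall>j. (x::real^'d) $ j \<noteq> 1"
    using AE_component_neq by (subst AE_all_countable) auto
  moreover have "AE x in lborel. \<forall>j. (x::real^'d) $ j \<noteq> 0"
    using AE_component_neq by (subst AE_all_countable) auto
  ultimately show ?thesis
    by eventually_elim (auto simp: H_def G_def mem_box_cart less_le indicator_def split: if_splits)
qed

section \<open>Unimodular families\<close>

lemma det_real_vec: "det (\<chi> j. real_vec (A j) :: real^'d^'d) = of_int (det (\<chi> j. A j))"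
  by (simp add: det_def)

text \<open>A maximal independent set among the vectors of \<open>T\<close> is extended to a basis
  chosen from the whole family; \<open>J\<close> marks the rows that come from \<open>T\<close>.
  Indexing by the coordinate type makes the basis a square matrix, as unimodularity
  requires.\<close>

lemma basis_selection:
  fixes V :: "(int^'d) list"
  assumes adm: "admissible_family V" and T: "T \<subseteq> {..<length V}"
  obtains \<sigma> J where "inj \<sigma>" "range \<sigma> \<subseteq> {..<length V}" "det (\<chi> j::'d. V ! \<sigma> j) \<noteq> 0"
    "\<sigma> ` J \<subseteq> T" "span_of V (\<sigma> ` J) = span_of V T"
proof -
  let ?r = "\<lambda>i. real_vec (V ! i)"
  let ?Y = "?r ` {..<length V}"
  obtain B where B: "B \<subseteq> ?r ` T" "independent B" "?r ` T \<subseteq> span B"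
    using maximal_independent_subset[of "?r ` T"] by blast
  have "B \<subseteq> ?Y" using B(1) T by blast
  then obtain C where C: "B \<subseteq> C" "C \<subseteq> ?Y" "independent C" "?Y \<subseteq> span C"
    using maximal_independent_subset_extend[OF _ B(2), of ?Y] by blast
  have spanC: "span C = UNIV"
  proof -
    have "span ?Y \<subseteq> span C" using C(4) by (simp add: span_minimal)
    then show ?thesis using adm by (auto simp: admissible_family_def span_of_def)
  qed
  have "dim C = card C" using C(3) by (rule dim_eq_card_independent)
  moreover have "dim C = dim (UNIV :: (real^'d) set)" using spanC by (metis dim_span)
  ultimately have card: "card C = CARD('d)" by simp
  have finC: "finite C" using C(2) finite_subset by blast
  obtain h where h: "bij_betw h (UNIV::'d set) C"
    using finite_same_card_bij[of "UNIV::'d set" C] finC card by auto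
  \<comment> \<open>Vectors may repeat in \<open>V\<close>, so the same vector can have indices
    inside and outside \<open>T\<close>; for members of \<open>B\<close> an index inside
    \<open>T\<close> is preferred.\<close>
  define idx where "idx c = (if c \<in> B then SOME i. i \<in> T \<and> ?r i = c else SOME i. i < length V \<and> ?r i = c)" for c
  have idxB: "idx c \<in> T \<and> ?r (idx c) = c" if "c \<in> B" for c
  proof -
    have "\<exists>i. i \<in> T \<and> ?r i = c" using that B(1) by auto
    from someI_ex[OF this] show ?thesis using that by (simp add: idx_def)
  qed
  have idxC: "idx c < length V \<and> ?r (idx c) = c" if "c \<in> C" for c
  proof (cases "c \<in> B")
    case True then show ?thesis using idxB[of c] T by auto
  next
    case False
    have "\<exists>i. i < length V \<and> ?r i = c" using that C(2) by auto
    from someI_ex[OF this] show ?thesis using False by (simp add: idx_def)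
  qed
  have hC: "h j \<in> C" for j using h by (auto simp: bij_betw_def)
  let ?\<sigma> = "\<lambda>j. idx (h j)"
  have r\<sigma>: "?r (?\<sigma> j) = h j" for j using idxC hC by auto
  show ?thesis
  proof
    show "inj ?\<sigma>"
    proof (rule injI)
      fix i j assume "?\<sigma> i = ?\<sigma> j"
      then have "h i = h j" using r\<sigma> by metis
      then show "i = j" using h by (auto simp: bij_betw_def inj_def)
    qed
    show "range ?\<sigma> \<subseteq> {..<length V}" using idxC hC by auto
    show "?\<sigma> ` {j. h j \<in> B} \<subseteq> T" using idxB by auto
    have "?r ` ?\<sigma> ` {j. h j \<in> B} = B"
    proof -
      have "?r ` ?\<sigma> ` {j. h j \<in> B} = h ` {j. h j \<in> B}" using r\<sigma> by (auto simp: image_image)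
      also have "\<dots> = B" using h C(1) by (auto simp: bij_betw_def)
      finally show ?thesis .
    qed
    moreover have "span B = span (?r ` T)"
      using B by (metis span_eq span_superset subset_trans)
    ultimately show "span_of V (?\<sigma> ` {j. h j \<in> B}) = span_of V T" by (simp add: span_of_def)
    let ?A = "\<chi> j. real_vec (V ! ?\<sigma> j) :: real^'d^'d"
    have "rows ?A = C" using h by (auto simp: rows_def row_def r\<sigma> bij_betw_def vec_lambda_eta)
    then have "\<exists>B. B ** ?A = mat 1" using spanC by (simp add: matrix_left_invertible_span_rows)
    then have "det ?A \<noteq> 0" by (metis invertible_det_nz invertible_left_inverse)
    then show "det (\<chi> j::'d. V ! ?\<sigma> j) \<noteq> 0" by (simp add: det_real_vec)
  qed
qed

lemma integer_cramer:
  fixes A :: "int^'d^'d"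
  assumes "\<bar>det A\<bar> = 1"
  obtains \<gamma> :: "int^'d" where "\<And>j. idot (A $ j) \<gamma> = b j"
proof
  let ?R = "\<chi> j. real_vec (A $ j) :: real^'d^'d"
  let ?N = "\<lambda>k. (\<chi> i j. if j = k then b i else A $ i $ j) :: int^'d^'d"
  \<comment> \<open>Cramer's rule. Since det A is 1 or -1, dividing by it equals multiplying by it,
    and the solution is integral.\<close>
  define \<gamma> :: "int^'d" where "\<gamma> = (\<chi> k. det (?N k) * det A)"
  have dR: "det ?R = of_int (det A)" by (simp add: det_real_vec)
  then have nz: "det ?R \<noteq> 0" using assms by auto
  have N: "det (\<chi> i j. if j = k then (\<chi> i. real_of_int (b i)) $ i else ?R $ i $ j) = of_int (det (?N k))" for k
    by (simp add: det_def if_distrib[of real_of_int] cong: if_cong)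
  have "real_vec \<gamma> = (\<chi> k. det (\<chi> i j. if j = k then (\<chi> i. real_of_int (b i)) $ i else ?R $ i $ j) / det ?R)"
  proof -
    have "det A = 1 \<or> det A = - 1" using assms by linarith
    then show ?thesis unfolding N dR by (auto simp: vec_eq_iff \<gamma>_def)
  qed
  then have "?R *v real_vec \<gamma> = (\<chi> i. real_of_int (b i))"
    using cramer[OF nz] by blast
  then have "real_of_int (idot (A $ j) \<gamma>) = real_of_int (b j)" for j
    by (auto simp: vec_eq_iff matrix_vector_mult_def idot_def)
  then show "idot (A $ j) \<gamma> = b j" for j by simp
qed

text \<open>A nonzero integer determinant of absolute value at most 1 is \<plusminus>1, so the
  system has an integral solution for every integral right side.\<close>

lemma unimodular_solve:
  fixes V :: "(int^'d) list"
  assumes "unimodular_family V" "inj \<sigma>" "range \<sigma> \<subseteq> {..<length V}" "det (\<chi> j::'d. V ! \<sigma> j) \<noteq> 0"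
  obtains \<gamma> where "\<And>j. idot (V ! \<sigma> j) \<gamma> = b j"
proof -
  have "\<bar>det (\<chi> j::'d. V ! \<sigma> j)\<bar> = 1"
    using assms unfolding unimodular_family_def by (metis abs_le_zero_iff int_one_le_iff_zero_less leI nle_le zero_less_abs_iff)
  from integer_cramer[OF this, of b] show ?thesis using that by auto
qed

lemma idot_commute: "idot \<alpha> \<beta> = idot \<beta> \<alpha>"
  by (simp add: idot_def mult.commute)

lemma det_nz_span:
  fixes V :: "(int^'d) list"
  assumes "det (\<chi> j::'d. V ! \<sigma> j) \<noteq> 0"
  shows "span_of V (range \<sigma>) = UNIV"
proof -
  let ?A = "\<chi> j. real_vec (V ! \<sigma> j) :: real^'d^'d"
  have "det ?A \<noteq> 0" using assms by (simp add: det_real_vec)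
  then have "\<exists>B. B ** ?A = mat 1" by (metis invertible_det_nz invertible_left_inverse)
  then have "span (rows ?A) = UNIV" by (simp add: matrix_left_invertible_span_rows)
  moreover have "row j ?A = real_vec (V ! \<sigma> j)" for j
    by (simp add: row_def vec_eq_iff)
  then have "rows ?A = (\<lambda>i. real_vec (V ! i)) ` range \<sigma>"
    by (auto simp: rows_def)
  ultimately show ?thesis by (simp add: span_of_def)
qed

text \<open>If \<open>v \<bullet> \<xi>\<close> is an integer for each \<open>v\<close> in a subfamily, then the functional \<open>\<xi>\<close> on the span of
  the subfamily is represented by an integer vector.\<close>

lemma unimodular_integer_representation:
  fixes V :: "(int^'d) list"
  assumes adm: "admissible_family V" and uni: "unimodular_family V"
  obtains \<gamma> :: "int^'d" where
    "\<And>i. i < length V \<Longrightarrow> real_vec (V ! i) \<bullet> \<xi> \<in> \<int> \<Longrightarrow> real_vec (V ! i) \<bullet> real_vec \<gamma> = real_vec (V ! i) \<bullet> \<xi>"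
proof -
  let ?T = "{i. i < length V \<and> real_vec (V ! i) \<bullet> \<xi> \<in> \<int>}"
  obtain \<sigma> J where \<sigma>: "inj \<sigma>" "range \<sigma> \<subseteq> {..<length V}" "det (\<chi> j::'d. V ! \<sigma> j) \<noteq> 0"
    "\<sigma> ` J \<subseteq> ?T" "span_of V (\<sigma> ` J) = span_of V ?T"
    using basis_selection[OF adm, of ?T] by blast
  \<comment> \<open>For j in \<open>J\<close> the inner product is an integer and the floor is
    exact; for the other basis vectors the floor merely prescribes some integer.\<close>
  obtain \<gamma> where \<gamma>: "\<And>j. idot (V ! \<sigma> j) \<gamma> = \<lfloor>real_vec (V ! \<sigma> j) \<bullet> \<xi>\<rfloor>"
    using unimodular_solve[OF uni \<sigma>(1-3), of "\<lambda>j. \<lfloor>real_vec (V ! \<sigma> j) \<bullet> \<xi>\<rfloor>"] by blast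
  let ?S = "{w. w \<bullet> (real_vec \<gamma> - \<xi>) = 0}"
  have "real_vec (V ! i) \<in> ?S" if i: "i \<in> \<sigma> ` J" for i
  proof -
    obtain j where j: "i = \<sigma> j" "j \<in> J" using i by auto
    then have "real_vec (V ! i) \<bullet> \<xi> \<in> \<int>" using \<sigma>(4) by auto
    then have "real_of_int \<lfloor>real_vec (V ! i) \<bullet> \<xi>\<rfloor> = real_vec (V ! i) \<bullet> \<xi>" by simp
    then show ?thesis using \<gamma>[of j] j by (simp add: inner_diff_right inner_real_vec)
  qed
  moreover have "subspace ?S" by (auto simp: subspace_def inner_add_left)
  ultimately have "span_of V (\<sigma> ` J) \<subseteq> ?S"
    unfolding span_of_def by (intro span_minimal) auto
  then have "span_of V ?T \<subseteq> ?S" by (simp only: \<sigma>(5))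
  then have "real_vec (V ! i) \<in> ?S" if "i \<in> ?T" for i
    using that span_superset[of "(\<lambda>i. real_vec (V ! i)) ` ?T"] unfolding span_of_def by blast
  then show ?thesis using that by (auto simp: inner_diff_right)
qed

section \<open>The box spline\<close>

text \<open>Uniqueness of the Haar measure: translating by \<open>y\<close> under the double integral of
  \<open>f(L x) g(y)\<close> moves \<open>L\<close> from \<open>f\<close> to \<open>g\<close>.\<close>

lemma linear_image_nn_integral:
  fixes L L' :: "real^'d \<Rightarrow> real^'d"
  assumes L: "linear L" "linear L'" and inv: "\<And>x. L' (L x) = x" "\<And>x. L (L' x) = x"
  obtains c :: real where "c \<ge> 0"
    "\<And>f. f \<in> borel_measurable borel \<Longrightarrow> (\<integral>\<^sup>+x. f (L x) \<partial>lborel) = ennreal c * (\<integral>\<^sup>+x. f x \<partial>lborel)"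
proof -
  have [measurable]: "L \<in> borel_measurable borel" "L' \<in> borel_measurable borel"
    using L by (auto intro!: borel_measurable_continuous_onI linear_continuous_on linear_conv_bounded_linear[THEN iffD1])
  let ?Q = "half_cube :: (real^'d) set"
  let ?g = "indicator ?Q :: real^'d \<Rightarrow> ennreal"
  have g1: "(\<integral>\<^sup>+x. ?g x \<partial>lborel) = 1"
  proof -
    have "(\<integral>\<^sup>+x. ?g x \<partial>lborel) = (\<integral>\<^sup>+x. indicator (cbox 0 (1::real^'d)) x \<partial>lborel)"
    proof (rule nn_integral_cong_AE)
      show "AE x in lborel. ?g x = indicator (cbox 0 1) x"
        using AE_half_cube by eventually_elim (auto simp: indicator_def)
    qed
    also have "\<dots> = 1" 
    proof -
      have "(1::real^'d) \<bullet> b = 1" if "b \<in> Basis" for b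
        using that by (auto simp: Basis_vec_def inner_axis)
      then show ?thesis by (simp add: emeasure_lborel_cbox_eq)
    qed
    finally show ?thesis .
  qed
  \<comment> \<open>The Lebesgue measure of the preimage of -Q under L, with the cube Q normalised
    to measure 1. It is finite because the inverse map is bounded on Q.\<close>
  define c where "c = (\<integral>\<^sup>+x. ?g (- L x) \<partial>lborel)"
  have "c < \<infinity>"
  proof -
    have "bounded_linear (\<lambda>x. - L' x)"
      using L(2) by (intro bounded_linear_minus) (simp add: linear_conv_bounded_linear)
    then have "bounded ((\<lambda>x. - L' x) ` ?Q)"
      by (intro bounded_linear_image bounded_subset[OF bounded_cbox half_cube_subset])
    then have b: "bounded {x. - L x \<in> ?Q}"
    proof (rule bounded_subset)
      show "{x. - L x \<in> ?Q} \<subseteq> (\<lambda>x. - L' x) ` ?Q"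
      proof
        fix x assume x: "x \<in> {x. - L x \<in> ?Q}"
        have "x = - L' (- L x)" using inv linear_neg[OF L(2)] by simp
        then show "x \<in> (\<lambda>x. - L' x) ` ?Q" using x by blast
      qed
    qed
    have m: "{x. - L x \<in> ?Q} \<in> sets borel" by measurable
    have "c = (\<integral>\<^sup>+x. indicator {x. - L x \<in> ?Q} x \<partial>lborel)"
      unfolding c_def by (intro nn_integral_cong) (auto simp: indicator_def)
    also have "\<dots> = emeasure lborel {x. - L x \<in> ?Q}" using m by simp
    also have "\<dots> < \<infinity>" using emeasure_bounded_finite[OF b] by simp
    finally show ?thesis .
  qed
  then obtain c' where c': "c = ennreal c'" "c' \<ge> 0" by (cases c) auto
  show ?thesis
  proof
    show "c' \<ge> 0" by fact
    fix f :: "real^'d \<Rightarrow> ennreal" assume [measurable]: "f \<in> borel_measurable borel"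
    have "(\<integral>\<^sup>+x. f (L x) \<partial>lborel) = (\<integral>\<^sup>+x. f (L x) \<partial>lborel) * (\<integral>\<^sup>+y. ?g y \<partial>lborel)"
      using g1 by simp
    also have "\<dots> = (\<integral>\<^sup>+y. ?g y * (\<integral>\<^sup>+x. f (L x) \<partial>lborel) \<partial>lborel)"
      by (subst nn_integral_multc) (auto simp: mult.commute)
    also have "\<dots> = (\<integral>\<^sup>+y. (\<integral>\<^sup>+x. ?g y * f (L x + y) \<partial>lborel) \<partial>lborel)"
    proof (intro nn_integral_cong)
      fix y
      have "(\<integral>\<^sup>+x. f (L x) \<partial>lborel) = (\<integral>\<^sup>+x. f (L (x - (- L' y))) \<partial>lborel)"
        by (rule lborel_nn_integral_shift[symmetric]) measurable
      also have "(\<lambda>x. f (L (x - (- L' y)))) = (\<lambda>x. f (L x + y))"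
        using L(1) inv by (auto simp: linear_add linear_diff)
      finally show "?g y * (\<integral>\<^sup>+x. f (L x) \<partial>lborel) = (\<integral>\<^sup>+x. ?g y * f (L x + y) \<partial>lborel)"
        by (subst nn_integral_cmult) auto
    qed
    also have "\<dots> = (\<integral>\<^sup>+x. (\<integral>\<^sup>+y. ?g y * f (L x + y) \<partial>lborel) \<partial>lborel)"
      by (rule lborel_pair.Fubini') measurable
    also have "\<dots> = (\<integral>\<^sup>+x. (\<integral>\<^sup>+y. ?g (y - L x) * f y \<partial>lborel) \<partial>lborel)"
    proof (rule nn_integral_cong)
      fix x
      have "(\<integral>\<^sup>+y. ?g y * f (L x + y) \<partial>lborel) = (\<integral>\<^sup>+y. ?g (y - L x) * f (L x + (y - L x)) \<partial>lborel)"
        by (rule lborel_nn_integral_shift[symmetric]) measurable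
      then show "(\<integral>\<^sup>+y. ?g y * f (L x + y) \<partial>lborel) = (\<integral>\<^sup>+y. ?g (y - L x) * f y \<partial>lborel)" by simp
    qed
    also have "\<dots> = (\<integral>\<^sup>+y. (\<integral>\<^sup>+x. ?g (y - L x) * f y \<partial>lborel) \<partial>lborel)"
      by (rule lborel_pair.Fubini') measurable
    also have "\<dots> = (\<integral>\<^sup>+y. c * f y \<partial>lborel)"
    proof (intro nn_integral_cong)
      fix y
      have "(\<integral>\<^sup>+x. ?g (y - L x) * f y \<partial>lborel) = (\<integral>\<^sup>+x. ?g (y - L x) \<partial>lborel) * f y"
        by (rule nn_integral_multc) measurable
      also have "(\<integral>\<^sup>+x. ?g (y - L x) \<partial>lborel) = (\<integral>\<^sup>+x. ?g (y - L (x - (- L' y))) \<partial>lborel)"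
        by (rule lborel_nn_integral_shift[symmetric]) measurable
      also have "(\<lambda>x. ?g (y - L (x - (- L' y)))) = (\<lambda>x. ?g (- L x))"
        using L(1) inv by (auto simp: linear_add linear_diff)
      finally show "(\<integral>\<^sup>+x. ?g (y - L x) * f y \<partial>lborel) = c * f y" by (simp add: c_def)
    qed
    also have "\<dots> = c * (\<integral>\<^sup>+y. f y \<partial>lborel)" by (rule nn_integral_cmult) measurable
    finally show "(\<integral>\<^sup>+x. f (L x) \<partial>lborel) = ennreal c' * (\<integral>\<^sup>+x. f x \<partial>lborel)" by (simp add: c')
  qed
qed

text \<open>Links two models of d-dimensional Lebesgue measure, the product measure over the indices
  of a basis of V and \<open>lborel\<close> on vectors; they agree on rectangles, which determines
  the product measure.\<close>

lemma nn_integral_PiM_reindex: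
  fixes \<sigma> :: "'d::finite \<Rightarrow> nat"
  assumes inj: "inj \<sigma>" and f [measurable]: "f \<in> borel_measurable (PiM (range \<sigma>) (\<lambda>_. lborel :: real measure))"
  shows "(\<integral>\<^sup>+u. f u \<partial>PiM (range \<sigma>) (\<lambda>_. lborel)) = (\<integral>\<^sup>+x. f (\<lambda>i\<in>range \<sigma>. (x :: real^'d) $ inv \<sigma> i) \<partial>lborel)"
proof -
  interpret product_sigma_finite "\<lambda>_::nat. lborel :: real measure" ..
  let ?P = "PiM (range \<sigma>) (\<lambda>_. lborel :: real measure)"
  let ?h = "\<lambda>x::real^'d. \<lambda>i\<in>range \<sigma>. x $ inv \<sigma> i"
  have h [measurable]: "?h \<in> borel \<rightarrow>\<^sub>M ?P"
    by (rule measurable_restrict) auto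
  have Bas: "(Basis :: (real^'d) set) = (\<lambda>j. axis j 1) ` UNIV"
    by (auto simp: Basis_vec_def)
  have injb: "inj (\<lambda>j::'d. axis j (1::real))" by (auto simp: inj_on_def axis_eq_axis)
  have "distr lborel ?P ?h = ?P"
  proof (rule PiM_eqI)
    fix A :: "nat \<Rightarrow> real set" assume A: "\<And>i. i \<in> range \<sigma> \<Longrightarrow> A i \<in> sets lborel"
    let ?idx = "\<lambda>b::real^'d. THE j. b = axis j 1"
    have idx: "?idx (axis j 1) = j" for j :: 'd by (auto simp: axis_eq_axis)
    have m: "PiE (range \<sigma>) A \<in> sets ?P" using A by (intro sets_PiM_I_finite) auto
    have "emeasure (distr lborel ?P ?h) (PiE (range \<sigma>) A) = (\<integral>\<^sup>+x. indicator (PiE (range \<sigma>) A) (?h x) \<partial>lborel)"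
      using m by (subst nn_integral_indicator[symmetric], simp, subst nn_integral_distr) auto
    also have "\<dots> = (\<integral>\<^sup>+x. (\<Prod>b\<in>Basis. indicator (A (\<sigma> (?idx b))) (x \<bullet> b)) \<partial>lborel)"
    proof (intro nn_integral_cong)
      fix x :: "real^'d"
      have "(\<Prod>b\<in>Basis. indicator (A (\<sigma> (?idx b))) (x \<bullet> b)) = (\<Prod>j\<in>UNIV. indicator (A (\<sigma> j)) (x $ j) :: ennreal)"
        unfolding Bas by (subst prod.reindex[OF injb]) (simp add: idx inner_axis)
      also have "\<dots> = indicator (PiE (range \<sigma>) A) (?h x)"
      proof (cases "\<forall>j. x $ j \<in> A (\<sigma> j)")
        case True
        then have "?h x \<in> PiE (range \<sigma>) A" using inj by (auto simp: inv_f_f)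
        then show ?thesis using True by simp
      next
        case False
        then obtain j where j: "x $ j \<notin> A (\<sigma> j)" by blast
        have "?h x \<notin> PiE (range \<sigma>) A"
        proof
          assume "?h x \<in> PiE (range \<sigma>) A"
          then have "?h x (\<sigma> j) \<in> A (\<sigma> j)" by (rule PiE_mem) simp
          then show False using j inj by (simp add: inv_f_f)
        qed
        moreover have "(\<Prod>j\<in>UNIV. indicator (A (\<sigma> j)) (x $ j)) = (0 :: ennreal)"
            by (rule prod_zero) (use j in \<open>auto intro!: exI[of _ j]\<close>)
          ultimately show ?thesis by simp
      qed
      finally show "indicator (PiE (range \<sigma>) A) (?h x) = (\<Prod>b\<in>Basis. indicator (A (\<sigma> (?idx b))) (x \<bullet> b) :: ennreal)" ..
    qed
    also have "\<dots> = (\<Prod>b\<in>(Basis::(real^'d) set). \<integral>\<^sup>+t. indicator (A (\<sigma> (?idx b))) t \<partial>lborel)"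
      using A by (intro nn_integral_lborel_prod) auto
    also have "\<dots> = (\<Prod>j\<in>UNIV. emeasure lborel (A (\<sigma> j)))"
      unfolding Bas using A by (subst prod.reindex[OF injb]) (simp add: idx)
    also have "\<dots> = (\<Prod>i\<in>range \<sigma>. emeasure lborel (A i))"
      using inj by (subst prod.reindex) auto
    finally show "emeasure (distr lborel ?P ?h) (PiE (range \<sigma>) A) = (\<Prod>i\<in>range \<sigma>. emeasure lborel (A i))" .
  qed auto
  then have "(\<integral>\<^sup>+u. f u \<partial>?P) = (\<integral>\<^sup>+u. f u \<partial>distr lborel ?P ?h)" by simp
  also have "\<dots> = (\<integral>\<^sup>+x. f (?h x) \<partial>lborel)" by (subst nn_integral_distr) auto
  finally show ?thesis .
qed

section \<open>The push-forward of the unit cube and its density\<close>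

abbreviation unit_cube_on :: "nat set \<Rightarrow> (nat \<Rightarrow> real) set" where
  "unit_cube_on I \<equiv> PiE I (\<lambda>_. {0..1})"

abbreviation lborel_on :: "nat set \<Rightarrow> (nat \<Rightarrow> real) measure" where
  "lborel_on I \<equiv> PiM I (\<lambda>_. lborel)"

lemma unit_cube_on_measurable: "finite I \<Longrightarrow> unit_cube_on I \<in> sets (lborel_on I)"
  by (rule sets_PiM_I_finite) auto

lemma emeasure_unit_cube_on: "finite I \<Longrightarrow> emeasure (lborel_on I) (unit_cube_on I) = 1"
proof -
  interpret product_sigma_finite "\<lambda>_::nat. lborel :: real measure" ..
  assume "finite I" then show ?thesis by (subst emeasure_PiM) auto
qed

text \<open>Density of the image of the uniform distribution on the cube. Stated for all nonnegative
  Borel functions, so that Tonelli applies freely; the bound on \<open>B\<close> is carried along in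
  order to obtain a real-valued density in the end.\<close>

definition cube_density :: "nat set \<Rightarrow> (nat \<Rightarrow> real^'d) \<Rightarrow> (real^'d \<Rightarrow> ennreal) \<Rightarrow> bool" where
  "cube_density I r B \<longleftrightarrow> B \<in> borel_measurable borel \<and> (\<exists>M. \<forall>x. B x \<le> ennreal M) \<and>
     (\<forall>f\<in>borel_measurable borel. (\<integral>\<^sup>+x. f x * B x \<partial>lborel)
        = (\<integral>\<^sup>+u. indicator (unit_cube_on I) u * f (\<Sum>i\<in>I. u i *\<^sub>R r i) \<partial>lborel_on I))"

text \<open>For a basis the map from the cube is a linear isomorphism, so the density is a constant
  on the spanned parallelepiped; the constant is the one of the linear change of variables.\<close>

lemma cube_density_basis:
  fixes r :: "nat \<Rightarrow> real^'d" and \<sigma> :: "'d \<Rightarrow> nat"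
  assumes inj: "inj \<sigma>" and span: "span (r ` range \<sigma>) = UNIV"
  shows "\<exists>B. cube_density (range \<sigma>) r B"
proof -
  define L where "L x = (\<Sum>j\<in>UNIV. x $ j *\<^sub>R r (\<sigma> j))" for x :: "real^'d"
  have lin: "linear L"
    by (auto intro!: linearI simp: L_def scaleR_add_left sum.distrib scaleR_right.sum)
  have "surj L"
  proof -
    have "r (\<sigma> j) = L (axis j 1)" for j
      by (simp add: L_def axis_def if_distrib[of "\<lambda>t. t *\<^sub>R _"] sum.delta cong: if_cong)
    then have "r ` range \<sigma> \<subseteq> range L" by auto
    then have "span (r ` range \<sigma>) \<subseteq> range L"
      by (intro span_minimal linear_subspace_image[OF lin]) auto
    then show ?thesis using span by auto
  qed
  then obtain L' where L': "linear L'" "\<And>x. L' (L x) = x" "\<And>x. L (L' x) = x"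
    using linear_surjective_isomorphism[OF lin] by blast
  have [measurable]: "L \<in> borel_measurable borel" "L' \<in> borel_measurable borel"
    using lin L' by (auto intro!: borel_measurable_continuous_onI linear_continuous_on linear_conv_bounded_linear[THEN iffD1])
  obtain c where c: "c \<ge> 0"
    "\<And>f. f \<in> borel_measurable borel \<Longrightarrow> (\<integral>\<^sup>+x. f (L x) \<partial>lborel) = ennreal c * (\<integral>\<^sup>+x. f x \<partial>lborel)"
    using linear_image_nn_integral[OF lin L'] by blast
  let ?B = "\<lambda>x. ennreal c * indicator (cbox 0 1) (L' x)"
  have "cube_density (range \<sigma>) r ?B"
    unfolding cube_density_def
  proof (intro conjI ballI exI allI)
    show "?B \<in> borel_measurable borel" by measurable
    show "?B x \<le> ennreal c" for x by (auto simp: indicator_def)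
    fix f :: "real^'d \<Rightarrow> ennreal" assume [measurable]: "f \<in> borel_measurable borel"
    have "(\<integral>\<^sup>+x. f x * ?B x \<partial>lborel) = ennreal c * (\<integral>\<^sup>+x. f x * indicator (cbox 0 1) (L' x) \<partial>lborel)"
      by (subst nn_integral_cmult[symmetric]) (auto simp: mult_ac)
    also have "\<dots> = (\<integral>\<^sup>+x. f (L x) * indicator (cbox 0 1) (L' (L x)) \<partial>lborel)"
      by (rule c(2)[symmetric]) measurable
    also have "\<dots> = (\<integral>\<^sup>+x. indicator (unit_cube_on (range \<sigma>)) (\<lambda>i\<in>range \<sigma>. x $ inv \<sigma> i)
        * f (\<Sum>i\<in>range \<sigma>. (\<lambda>i\<in>range \<sigma>. x $ inv \<sigma> i) i *\<^sub>R r i) \<partial>lborel)"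
    proof (intro nn_integral_cong)
      fix x :: "real^'d"
      have "(\<Sum>i\<in>range \<sigma>. (\<lambda>i\<in>range \<sigma>. x $ inv \<sigma> i) i *\<^sub>R r i) = L x"
        using inj by (subst sum.reindex) (auto simp: L_def inv_f_f)
      moreover have "x \<in> cbox 0 1 \<longleftrightarrow> (\<lambda>i\<in>range \<sigma>. x $ inv \<sigma> i) \<in> unit_cube_on (range \<sigma>)"
        using inj by (auto simp: mem_box_cart PiE_iff inv_f_f)
      ultimately show "f (L x) * indicator (cbox 0 1) (L' (L x)) =
          indicator (unit_cube_on (range \<sigma>)) (\<lambda>i\<in>range \<sigma>. x $ inv \<sigma> i)
          * f (\<Sum>i\<in>range \<sigma>. (\<lambda>i\<in>range \<sigma>. x $ inv \<sigma> i) i *\<^sub>R r i)"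
        by (auto simp: L' indicator_def)
    qed
    also have "\<dots> = (\<integral>\<^sup>+u. indicator (unit_cube_on (range \<sigma>)) u * f (\<Sum>i\<in>range \<sigma>. u i *\<^sub>R r i) \<partial>lborel_on (range \<sigma>))"
    proof (rule nn_integral_PiM_reindex[OF inj, symmetric])
      have [measurable]: "unit_cube_on (range \<sigma>) \<in> sets (lborel_on (range \<sigma>))"
        by (rule unit_cube_on_measurable) simp
      show "(\<lambda>u. indicator (unit_cube_on (range \<sigma>)) u * f (\<Sum>i\<in>range \<sigma>. u i *\<^sub>R r i))
          \<in> borel_measurable (lborel_on (range \<sigma>))" by measurable
    qed
    finally show "(\<integral>\<^sup>+x. f x * ?B x \<partial>lborel)
        = (\<integral>\<^sup>+u. indicator (unit_cube_on (range \<sigma>)) u * f (\<Sum>i\<in>range \<sigma>. u i *\<^sub>R r i) \<partial>lborel_on (range \<sigma>))" .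
  qed
  then show ?thesis by (rule exI[where P = "cube_density (range \<sigma>) r"])
qed

text \<open>The classical recursion: a further vector r_i averages the density over the segment,
  B'(x) = \<integral> B(x - t r_i) dt with t in [0, 1]. Averaging preserves the bound.\<close>

lemma cube_density_insert:
  fixes r :: "nat \<Rightarrow> real^'d"
  assumes B: "cube_density I r B" and I: "finite I" "i \<notin> I"
  shows "\<exists>B. cube_density (insert i I) r B"
proof -
  interpret product_sigma_finite "\<lambda>_::nat. lborel :: real measure" ..
  from B obtain M where [measurable]: "B \<in> borel_measurable borel" and M: "\<And>x. B x \<le> ennreal M"
    and dens: "\<And>f. f \<in> borel_measurable borel \<Longrightarrow> (\<integral>\<^sup>+x. f x * B x \<partial>lborel)
        = (\<integral>\<^sup>+u. indicator (unit_cube_on I) u * f (\<Sum>i\<in>I. u i *\<^sub>R r i) \<partial>lborel_on I)"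
    unfolding cube_density_def by blast
  let ?B = "\<lambda>x. \<integral>\<^sup>+t. indicator {0..1} t * B (x - t *\<^sub>R r i) \<partial>lborel"
  have "cube_density (insert i I) r ?B"
    unfolding cube_density_def
  proof (intro conjI ballI exI allI)
    show "?B \<in> borel_measurable borel"
      by (rule lborel.borel_measurable_nn_integral) measurable
    show "?B x \<le> ennreal M" for x
    proof -
      have "?B x \<le> (\<integral>\<^sup>+t. ennreal M * indicator {0..1::real} t \<partial>lborel)"
        using M by (intro nn_integral_mono) (auto simp: indicator_def)
      also have "\<dots> = ennreal M" by (subst nn_integral_cmult_indicator) auto
      finally show ?thesis .
    qed
    fix f :: "real^'d \<Rightarrow> ennreal" assume [measurable]: "f \<in> borel_measurable borel"
    let ?F = "\<lambda>u. indicator (unit_cube_on (insert i I)) u * f (\<Sum>i\<in>insert i I. u i *\<^sub>R r i)"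
    have [measurable]: "unit_cube_on (insert i I) \<in> sets (lborel_on (insert i I))"
      "unit_cube_on I \<in> sets (lborel_on I)"
      using I by (auto intro!: unit_cube_on_measurable)
    have "(\<integral>\<^sup>+x. f x * ?B x \<partial>lborel) = (\<integral>\<^sup>+x. (\<integral>\<^sup>+t. f x * (indicator {0..1} t * B (x - t *\<^sub>R r i)) \<partial>lborel) \<partial>lborel)"
      by (intro nn_integral_cong nn_integral_cmult[symmetric]) measurable
    also have "\<dots> = (\<integral>\<^sup>+t. (\<integral>\<^sup>+x. f x * (indicator {0..1} t * B (x - t *\<^sub>R r i)) \<partial>lborel) \<partial>lborel)"
      by (rule lborel_pair.Fubini') measurable
    also have "\<dots> = (\<integral>\<^sup>+t. (\<integral>\<^sup>+u. ?F (u(i := t)) \<partial>lborel_on I) \<partial>lborel)"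
    proof (intro nn_integral_cong)
      fix t :: real
      have "(\<integral>\<^sup>+x. f x * (indicator {0..1} t * B (x - t *\<^sub>R r i)) \<partial>lborel)
          = (\<integral>\<^sup>+x. indicator {0..1} t * (f x * B (x - t *\<^sub>R r i)) \<partial>lborel)"
        by (simp add: mult_ac)
      also have "\<dots> = indicator {0..1} t * (\<integral>\<^sup>+x. f x * B (x - t *\<^sub>R r i) \<partial>lborel)"
        by (rule nn_integral_cmult) measurable
      also have "(\<integral>\<^sup>+x. f x * B (x - t *\<^sub>R r i) \<partial>lborel)
          = (\<integral>\<^sup>+x. f ((x - t *\<^sub>R r i) + t *\<^sub>R r i) * B (x - t *\<^sub>R r i) \<partial>lborel)" by simp
      also have "\<dots> = (\<integral>\<^sup>+x. f (x + t *\<^sub>R r i) * B x \<partial>lborel)"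
        by (rule lborel_nn_integral_shift[where f = "\<lambda>x. f (x + t *\<^sub>R r i) * B x"]) measurable
      also have "\<dots> = (\<integral>\<^sup>+u. indicator (unit_cube_on I) u * f ((\<Sum>i\<in>I. u i *\<^sub>R r i) + t *\<^sub>R r i) \<partial>lborel_on I)"
        by (rule dens) measurable
      also have "indicator {0..1} t * \<dots>
          = (\<integral>\<^sup>+u. indicator {0..1} t * (indicator (unit_cube_on I) u * f ((\<Sum>i\<in>I. u i *\<^sub>R r i) + t *\<^sub>R r i)) \<partial>lborel_on I)"
        by (rule nn_integral_cmult[symmetric]) measurable
      also have "\<dots> = (\<integral>\<^sup>+u. ?F (u(i := t)) \<partial>lborel_on I)"
      proof (intro nn_integral_cong)
        fix u assume u: "u \<in> space (lborel_on I)"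
        have "(\<Sum>k\<in>insert i I. (u(i := t)) k *\<^sub>R r k) = (\<Sum>k\<in>I. u k *\<^sub>R r k) + t *\<^sub>R r i"
          using I by (auto simp: add.commute intro!: sum.cong)
        moreover have "u(i := t) \<in> unit_cube_on (insert i I) \<longleftrightarrow> t \<in> {0..1} \<and> u \<in> unit_cube_on I"
          using I u by (auto simp: PiE_iff space_PiM extensional_def split: if_splits)
        ultimately show "indicator {0..1} t * (indicator (unit_cube_on I) u * f ((\<Sum>i\<in>I. u i *\<^sub>R r i) + t *\<^sub>R r i)) = ?F (u(i := t))"
          by (auto simp: indicator_def)
      qed
      finally show "(\<integral>\<^sup>+x. f x * (indicator {0..1} t * B (x - t *\<^sub>R r i)) \<partial>lborel) = (\<integral>\<^sup>+u. ?F (u(i := t)) \<partial>lborel_on I)" .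
    qed
    also have "\<dots> = (\<integral>\<^sup>+u. ?F u \<partial>lborel_on (insert i I))"
      by (rule product_nn_integral_insert_rev[OF I, symmetric]) measurable
    finally show "(\<integral>\<^sup>+x. f x * ?B x \<partial>lborel) = (\<integral>\<^sup>+u. ?F u \<partial>lborel_on (insert i I))" .
  qed
  then show ?thesis by (rule exI[where P = "cube_density (insert i I) r"])
qed

text \<open>A representative of the box spline whose bound and support hold at every point. The sums
  of integer translates are then finite pointwise.\<close>

locale box_fun =
  fixes V :: "(int^'d) list" and b :: "real^'d \<Rightarrow> real" and M R :: real
  assumes meas [measurable]: "b \<in> borel_measurable borel"
    and nonneg: "0 \<le> b x" and bound: "b x \<le> M" and supp: "b x \<noteq> 0 \<Longrightarrow> norm x \<le> R"
    and dens: "f \<in> borel_measurable borel \<Longrightarrow> (\<integral>\<^sup>+x. f x * ennreal (b x) \<partial>lborel)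
        = (\<integral>\<^sup>+u. indicator (unit_cube_on {..<length V}) u * f (\<Sum>i<length V. u i *\<^sub>R real_vec (V ! i)) \<partial>lborel_on {..<length V})"

text \<open>Starts with the parallelepiped of a basis selected from V and convolves with the
  remaining vectors one at a time.\<close>

lemma box_fun_exists:
  fixes V :: "(int^'d) list"
  assumes adm: "admissible_family V"
  obtains b M R where "box_fun V b M R"
proof -
  let ?r = "\<lambda>i. real_vec (V ! i)" and ?n = "length V"
  obtain \<sigma> J where \<sigma>: "inj \<sigma>" "range \<sigma> \<subseteq> {..<?n}" "det (\<chi> j::'d. V ! \<sigma> j) \<noteq> 0"
    by (rule basis_selection[OF adm, of "{}"]) auto
  have base: "\<exists>B. cube_density (range \<sigma>) ?r B"
    using cube_density_basis[OF \<sigma>(1), of ?r] det_nz_span[OF \<sigma>(3)] by (simp add: span_of_def)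
  have "finite K \<Longrightarrow> K \<inter> range \<sigma> = {} \<Longrightarrow> \<exists>B. cube_density (range \<sigma> \<union> K) ?r B" for K
  proof (induction rule: finite_induct)
    case empty then show ?case using base by simp
  next
    case (insert i K)
    then obtain B where "cube_density (range \<sigma> \<union> K) ?r B" by auto
    from cube_density_insert[OF this, of i] insert show ?case by auto
  qed
  from this[of "{..<?n} - range \<sigma>"] obtain B where "cube_density (range \<sigma> \<union> ({..<?n} - range \<sigma>)) ?r B"
    by auto
  then have "cube_density {..<?n} ?r B" using \<sigma>(2) by (simp add: Un_absorb1)
  then obtain M where B [measurable]: "B \<in> borel_measurable borel" and M: "\<And>x. B x \<le> ennreal M"
    and dens: "\<And>f. f \<in> borel_measurable borel \<Longrightarrow> (\<integral>\<^sup>+x. f x * B x \<partial>lborel)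
        = (\<integral>\<^sup>+u. indicator (unit_cube_on {..<?n}) u * f (\<Sum>i<?n. u i *\<^sub>R ?r i) \<partial>lborel_on {..<?n})"
    unfolding cube_density_def by blast
  define R where "R = (\<Sum>i<?n. norm (?r i))"
  define b where "b x = enn2real (B x) * indicator (cball 0 R) x" for x
  have fin: "B x < \<infinity>" for x using le_less_trans[OF M ennreal_less_top, of x] by simp
  \<comment> \<open>Points of the cube are mapped into the ball of radius R, the sum of the norms,
    so the density has no mass outside; cutting it off there changes it on a null set only.\<close>
  have "(\<integral>\<^sup>+x. indicator (- cball 0 R) x * B x \<partial>lborel)
      = (\<integral>\<^sup>+u. indicator (unit_cube_on {..<?n}) u * indicator (- cball 0 R) (\<Sum>i<?n. u i *\<^sub>R ?r i) \<partial>lborel_on {..<?n})"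
    by (rule dens) measurable
  also have "\<dots> = (\<integral>\<^sup>+u. 0 \<partial>lborel_on {..<?n})"
  proof (intro nn_integral_cong)
    fix u
    have "norm (\<Sum>i<?n. u i *\<^sub>R ?r i) \<le> R" if u: "u \<in> unit_cube_on {..<?n}"
      unfolding R_def
    proof (rule sum_norm_le)
      fix i assume "i \<in> {..<?n}"
      then have "0 \<le> u i" "u i \<le> 1" using u by (auto simp: PiE_iff)
      then show "norm (u i *\<^sub>R ?r i) \<le> norm (?r i)" by (auto intro: mult_left_le_one_le)
    qed
    then show "indicator (unit_cube_on {..<?n}) u * indicator (- cball 0 R) (\<Sum>i<?n. u i *\<^sub>R ?r i) = (0::ennreal)"
      by (auto simp: indicator_def)
  qed
  finally have "(\<integral>\<^sup>+x. indicator (- cball 0 R) x * B x \<partial>lborel) = 0" by simp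
  then have "AE x in lborel. indicator (- cball 0 R) x * B x = 0"
    by (subst (asm) nn_integral_0_iff_AE) auto
  then have eq: "AE x in lborel. B x = ennreal (b x)"
  proof eventually_elim
    case (elim x)
    then show ?case using fin[of x] by (cases "x \<in> cball 0 R") (auto simp: b_def)
  qed
  have "box_fun V b \<bar>M\<bar> R"
  proof
    show [measurable]: "b \<in> borel_measurable borel" 
      using borel_closed[OF closed_cball] unfolding b_def[abs_def]
      by (intro borel_measurable_times borel_measurable_indicator) auto
    show "0 \<le> b x" for x by (simp add: b_def)
    show "b x \<le> \<bar>M\<bar>" for x
    proof -
      have "enn2real (B x) \<le> \<bar>M\<bar>"
        using M[of x] by (intro enn2real_leI) (auto intro: order_trans ennreal_leI)
      then show ?thesis by (auto simp: b_def indicator_def)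
    qed
    show "norm x \<le> R" if "b x \<noteq> 0" for x using that by (auto simp: b_def indicator_def split: if_splits)
    fix f :: "real^'d \<Rightarrow> ennreal" assume f: "f \<in> borel_measurable borel"
    have "(\<integral>\<^sup>+x. f x * ennreal (b x) \<partial>lborel) = (\<integral>\<^sup>+x. f x * B x \<partial>lborel)"
      using eq by (intro nn_integral_cong_AE) (auto elim!: eventually_mono)
    then show "(\<integral>\<^sup>+x. f x * ennreal (b x) \<partial>lborel) = (\<integral>\<^sup>+u. indicator (unit_cube_on {..<?n}) u * f (\<Sum>i<?n. u i *\<^sub>R ?r i) \<partial>lborel_on {..<?n})"
      using dens[OF f] by simp
  qed
  then show ?thesis using that by blast
qed

context box_fun
begin

lemma integrable_b: "integrable lborel b"
proof (rule Bochner_Integration.integrable_bound)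
  show "integrable lborel (\<lambda>x::real^'d. indicator (cball 0 R) x *\<^sub>R M)"
    by (intro integrable_scaleR_left integrable_real_indicator) (use emeasure_bounded_finite[OF bounded_cball] in auto)
  have "norm (b x) \<le> norm (indicator (cball 0 R) x *\<^sub>R M)" for x
    using nonneg[of x] bound[of x] supp[of x] by (cases "b x = 0") (auto simp: indicator_def)
  then show "AE x in lborel. norm (b x) \<le> norm (indicator (cball 0 R) x *\<^sub>R M)" by simp
qed auto

lemma M_nonneg: "M \<ge> 0" using nonneg[of 0] bound[of 0] by simp

lemma norm_b: "\<bar>b x\<bar> \<le> M" using nonneg[of x] bound[of x] by simp

text \<open>The identity for nonnegative functions says that two measures coincide, the one with
  density \<open>b\<close> and the image of the cube measure; Bochner integrals then agree for every
  Borel function.\<close>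

lemma integral_b:
  fixes f :: "real^'d \<Rightarrow> 'b::{banach, second_countable_topology}"
  assumes f [measurable]: "f \<in> borel_measurable borel"
  shows "(LINT x|lborel. b x *\<^sub>R f x)
    = (LINT u:unit_cube_on {..<length V}|lborel_on {..<length V}. f (\<Sum>i<length V. u i *\<^sub>R real_vec (V ! i)))"
proof -
  let ?n = "length V"
  let ?S = "\<lambda>u. \<Sum>i<?n. u i *\<^sub>R real_vec (V ! i)"
  let ?C = "unit_cube_on {..<?n}" and ?P = "lborel_on {..<?n}"
  have [measurable]: "?C \<in> sets ?P" by (rule unit_cube_on_measurable) simp
  have eq: "density lborel (\<lambda>x. ennreal (b x)) = distr (density ?P (\<lambda>u. ennreal (indicator ?C u))) borel ?S"
  proof (rule measure_eqI)
    fix A assume "A \<in> sets (density lborel (\<lambda>x. ennreal (b x)))"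
    then have A [measurable]: "A \<in> sets borel" by simp
    have "emeasure (density lborel (\<lambda>x. ennreal (b x))) A = (\<integral>\<^sup>+x. indicator A x * ennreal (b x) \<partial>lborel)"
      by (subst emeasure_density) (auto simp: mult.commute)
    also have "\<dots> = (\<integral>\<^sup>+u. indicator ?C u * indicator A (?S u) \<partial>?P)"
      by (rule dens) measurable
    also have "\<dots> = emeasure (distr (density ?P (\<lambda>u. ennreal (indicator ?C u))) borel ?S) A"
      by (subst emeasure_distr) (auto simp: emeasure_density ennreal_indicator indicator_def space_PiM intro!: nn_integral_cong)
    finally show "emeasure (density lborel (\<lambda>x. ennreal (b x))) A
        = emeasure (distr (density ?P (\<lambda>u. ennreal (indicator ?C u))) borel ?S) A" .
  qed auto
  have "(LINT x|lborel. b x *\<^sub>R f x) = integral\<^sup>L (density lborel (\<lambda>x. ennreal (b x))) f"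
    by (rule integral_density[symmetric]) (auto simp: nonneg)
  also have "\<dots> = (LINT u|density ?P (\<lambda>u. ennreal (indicator ?C u)). f (?S u))"
    unfolding eq by (rule integral_distr) measurable
  also have "\<dots> = (LINT u|?P. indicator ?C u *\<^sub>R f (?S u))"
    by (rule integral_density) auto
  finally show ?thesis by (simp add: set_lebesgue_integral_def)
qed

lemma is_box_spline_b: "is_box_spline V b"
  unfolding is_box_spline_def
proof (intro conjI allI impI)
  show "integrable lborel b" by (rule integrable_b)
  show "bounded {x. b x \<noteq> 0}" using supp by (auto simp: bounded_iff)
  fix f :: "real^'d \<Rightarrow> real" assume "continuous_on UNIV f"
  then have "f \<in> borel_measurable borel" by (rule borel_measurable_continuous_onI)
  from integral_b[OF this] show "(LINT x|lborel. f x * b x)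
    = (LINT u:unit_cube_on {..<length V}|lborel_on {..<length V}. f (\<Sum>i<length V. u i *\<^sub>R real_vec (V ! i)))"
    by (simp add: mult.commute)
qed

lemma integrable_mult_supported:
  fixes f :: "'a::euclidean_space \<Rightarrow> real"
  assumes "continuous_on UNIV f" "integrable lborel B" "bounded {x. B x \<noteq> 0}"
  shows "integrable lborel (\<lambda>x. f x * B x :: real)"
proof -
  obtain r where r: "\<And>x. B x \<noteq> 0 \<Longrightarrow> x \<in> cball 0 r"
    using assms(3) by (auto simp: bounded_iff)
  have "compact (f ` cball 0 r)"
    by (intro compact_continuous_image continuous_on_subset[OF assms(1)]) auto
  then have "bounded (f ` cball 0 r)" by (rule compact_imp_bounded)
  then obtain C where C: "\<forall>y\<in>f ` cball 0 r. norm y \<le> C" unfolding bounded_iff by blast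
  have [measurable]: "f \<in> borel_measurable borel" "B \<in> borel_measurable borel"
    using assms by (auto intro: borel_measurable_continuous_onI)
  show ?thesis
  proof (rule Bochner_Integration.integrable_bound)
    show "integrable lborel (\<lambda>x. C * B x)" using assms(2) by auto
    show "AE x in lborel. norm (f x * B x) \<le> norm (C * B x)"
    proof (intro AE_I2)
      fix x
      show "norm (f x * B x) \<le> norm (C * B x)"
      proof (cases "B x = 0")
        case False
        then have "\<bar>f x\<bar> \<le> C" using r[of x] C by auto
        then show ?thesis by (auto simp: abs_mult intro!: mult_right_mono)
      qed auto
    qed
  qed auto
qed

text \<open>The difference of two candidates integrates to 0 against every continuous function.
  Hence the function selected in \<open>box_spline\<close> agrees a.e. with
  \<open>b\<close>.\<close>

lemma is_box_spline_unique:
  assumes "is_box_spline V B"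
  shows "AE x in lborel. B x = b x"
proof -
  have iB: "integrable lborel B" and sB: "bounded {x. B x \<noteq> 0}"
    and eB: "\<And>f. continuous_on UNIV f \<Longrightarrow> (LINT x|lborel. f x * B x) = (LINT x|lborel. f x * b x)"
    using assms is_box_spline_b by (auto simp: is_box_spline_def)
  have sb: "bounded {x. b x \<noteq> 0}" using supp by (auto simp: bounded_iff)
  have "AE x in lborel. B x - b x = 0"
  proof (rule AE_zero_if_continuous_integrals_zero)
    show "integrable lborel (\<lambda>x. B x - b x)" using iB integrable_b by auto
    fix f :: "real^'d \<Rightarrow> real" assume f: "continuous_on UNIV f"
    have "(LINT x|lborel. f x *\<^sub>R (B x - b x)) = (LINT x|lborel. f x * B x - f x * b x)"
      by (simp add: right_diff_distrib)
    also have "\<dots> = 0"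
      using integrable_mult_supported[OF f iB sB] integrable_mult_supported[OF f integrable_b sb] eB[OF f]
      by (subst Bochner_Integration.integral_diff) auto
    finally show "(LINT x|lborel. f x *\<^sub>R (B x - b x)) = 0" .
  qed
  then show ?thesis by eventually_elim simp
qed

lemma box_spline_eq: "AE x in lborel. box_spline V x = b x"
  by (rule is_box_spline_unique) (metis box_spline_def is_box_spline_b someI_ex)

end

lemma is_box_spline_box_spline:
  fixes V :: "(int^'d) list"
  assumes "admissible_family V" shows "is_box_spline V (box_spline V)"
proof -
  obtain b M R where "box_fun V b M R" using box_fun_exists[OF assms] .
  then have "is_box_spline V b" by (rule box_fun.is_box_spline_b)
  then show ?thesis unfolding box_spline_def by (rule someI[where P = "is_box_spline V"])
qed

section \<open>Moments of the box spline\<close>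

text \<open>The power series in z of \<integral> e^{-z u h} e^{-2 pi i u s} du over [0, 1]: the
  contribution of one vector v to the Fourier transform of e^{-z h . y} \<open>b\<close> at
  \<gamma>, with h and s standing for h . v and \<gamma> . v.\<close>

definition edge_fps :: "real \<Rightarrow> real \<Rightarrow> complex fps" where
  "edge_fps h s = Abs_fps (\<lambda>j. LINT u:{0..1}|lborel. of_real ((- u * h) ^ j / fact j) * cis (- 2 * pi * (u * s)))"

text \<open>The left side is the z^j coefficient of an integral over the cube whose integrand, an
  exponential of a sum, is a product over the coordinates. On coefficients Fubini becomes the Cauchy
  product, and one coordinate is split off at a time.\<close>

lemma cube_moment:
  fixes h s :: "nat \<Rightarrow> real"
  assumes "finite I"
  shows "(LINT u:unit_cube_on I|lborel_on I.
      of_real ((- (\<Sum>i\<in>I. u i * h i)) ^ j / fact j) * (\<Prod>i\<in>I. cis (- 2 * pi * (u i * s i))))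
    = fps_nth (\<Prod>i\<in>I. edge_fps (h i) (s i)) j"
  using assms
proof (induction I arbitrary: j rule: finite_induct)
  case empty
  \<comment> \<open>The empty product is the one-point measure, where the moment is 1 for j = 0 and
    0 otherwise.\<close>
  have "(PiM {} (\<lambda>_. lborel) :: (nat \<Rightarrow> real) measure) = count_space {\<lambda>_. undefined}" by (rule PiM_empty)
  then show ?case
    by (simp add: set_lebesgue_integral_def lebesgue_integral_count_space_finite power_0_left)
next
  case (insert i I)
  interpret product_sigma_finite "\<lambda>_::nat. lborel :: real measure" ..
  define A where "A I j u = indicator (unit_cube_on I) u *\<^sub>R (complex_of_real ((- (\<Sum>i\<in>I. u i * h i)) ^ j / fact j)
      * (\<Prod>i\<in>I. cis (- 2 * pi * (u i * s i))))" for I :: "nat set" and j u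
  define e where "e j t = indicator {0..1::real} t *\<^sub>R (complex_of_real ((- t * h i) ^ j / fact j) * cis (- 2 * pi * (t * s i)))" for j t
  have mA: "A I j \<in> borel_measurable (lborel_on I)" if "finite I" for I j
  proof -
    have [measurable]: "unit_cube_on I \<in> sets (lborel_on I)" by (rule unit_cube_on_measurable[OF that])
    show ?thesis unfolding A_def[abs_def] cis_conv_exp by measurable
  qed
  have iA: "integrable (lborel_on I) (A I j)" if "finite I" for I j
  proof (rule Bochner_Integration.integrable_bound)
    let ?C = "(\<Sum>i\<in>I. \<bar>h i\<bar>) ^ j / fact j"
    show "integrable (lborel_on I) (\<lambda>u. indicator (unit_cube_on I) u *\<^sub>R ?C)"
      by (intro integrable_scaleR_left integrable_real_indicator unit_cube_on_measurable)
        (use that in \<open>auto simp: emeasure_unit_cube_on\<close>)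
    show "AE u in lborel_on I. norm (A I j u) \<le> norm (indicator (unit_cube_on I) u *\<^sub>R ?C)"
    proof (rule AE_I2)
      fix u
      have "norm (complex_of_real ((- (\<Sum>i\<in>I. u i * h i)) ^ j / fact j) * (\<Prod>i\<in>I. cis (- 2 * pi * (u i * s i)))) \<le> ?C"
        if u: "u \<in> unit_cube_on I"
      proof -
        have "\<bar>\<Sum>i\<in>I. u i * h i\<bar> \<le> (\<Sum>i\<in>I. \<bar>h i\<bar>)"
        proof (rule order_trans[OF sum_abs sum_mono])
          fix i assume "i \<in> I"
          then have "0 \<le> u i" "u i \<le> 1" using u by (auto simp: PiE_iff)
          then show "\<bar>u i * h i\<bar> \<le> \<bar>h i\<bar>" by (auto simp: abs_mult intro: mult_left_le_one_le)
        qed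
        then have "\<bar>\<Sum>i\<in>I. u i * h i\<bar> ^ j \<le> (\<Sum>i\<in>I. \<bar>h i\<bar>) ^ j" by (intro power_mono) auto
        moreover have "norm (\<Prod>i\<in>I. cis (- 2 * pi * (u i * s i))) = 1"
          by (simp add: prod_norm[symmetric])
        ultimately show ?thesis
          by (simp add: norm_mult norm_divide norm_power power_abs divide_right_mono flip: of_real_sum of_real_mult of_real_minus of_real_power of_real_divide)
      qed
      moreover have "0 \<le> ?C" by (auto intro!: divide_nonneg_nonneg zero_le_power sum_nonneg)
      ultimately show "norm (A I j u) \<le> norm (indicator (unit_cube_on I) u *\<^sub>R ?C)"
        by (auto simp: A_def indicator_def)
    qed
  qed (rule mA[OF that])
  have ie: "integrable lborel (e j)" for j
    unfolding e_def[abs_def]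
    by (rule borel_integrable_atLeastAtMost'[unfolded set_integrable_def])
      (auto simp: cis_conv_exp intro!: continuous_intros)
  have Ie: "(LINT t|lborel. e j t) = fps_nth (edge_fps (h i) (s i)) j" for j
    by (simp only: edge_fps_def e_def set_lebesgue_integral_def fps_nth_Abs_fps)
  have split: "A (insert i I) j (u(i := t)) = (\<Sum>k\<le>j. A I k u * e (j - k) t)" if u: "u \<in> space (lborel_on I)" for u t
  proof -
    let ?S = "\<Sum>i\<in>I. u i * h i"
    have S: "(\<Sum>k\<in>insert i I. (u(i := t)) k * h k) = t * h i + ?S"
      using insert.hyps by (auto intro!: sum.cong)
    have P: "(\<Prod>k\<in>insert i I. cis (- 2 * pi * ((u(i := t)) k * s k)))
        = cis (- 2 * pi * (t * s i)) * (\<Prod>k\<in>I. cis (- 2 * pi * (u k * s k)))"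
      using insert.hyps by (auto intro!: prod.cong)
    have mem: "u(i := t) \<in> unit_cube_on (insert i I) \<longleftrightarrow> t \<in> {0..1} \<and> u \<in> unit_cube_on I"
      using insert.hyps u by (auto simp: PiE_iff space_PiM extensional_def split: if_splits)
    \<comment> \<open>The binomial theorem in divided powers, which is the coefficient form of e^{x
      + y} = e^x e^y.\<close>
    have "(- (t * h i + ?S)) ^ j / fact j = (\<Sum>k\<le>j. ((- ?S) ^ k / fact k) * ((- t * h i) ^ (j - k) / fact (j - k)))"
      using exp_series_add_commuting[of "- ?S" "- t * h i" j]
      by (simp add: divide_inverse_commute algebra_simps)
    then have E: "complex_of_real ((- (t * h i + ?S)) ^ j / fact j)
        = (\<Sum>k\<le>j. complex_of_real ((- ?S) ^ k / fact k) * complex_of_real ((- t * h i) ^ (j - k) / fact (j - k)))"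
      by (simp only: of_real_sum of_real_mult)
    have "A (insert i I) j (u(i := t)) = (\<Sum>k\<le>j. (indicator (unit_cube_on I) u * indicator {0..1} t) *\<^sub>R
        (complex_of_real ((- ?S) ^ k / fact k) * complex_of_real ((- t * h i) ^ (j - k) / fact (j - k))
        * (cis (- 2 * pi * (t * s i)) * (\<Prod>k\<in>I. cis (- 2 * pi * (u k * s k))))))"
      unfolding A_def S P E
      by (simp add: mem indicator_def sum_distrib_right)
    also have "\<dots> = (\<Sum>k\<le>j. A I k u * e (j - k) t)"
      unfolding A_def e_def by (intro sum.cong refl) (simp add: scaleR_conv_of_real mult_ac)
    finally show ?thesis .
  qed
  have "(LINT u:unit_cube_on (insert i I)|lborel_on (insert i I).
      of_real ((- (\<Sum>i\<in>insert i I. u i * h i)) ^ j / fact j) * (\<Prod>i\<in>insert i I. cis (- 2 * pi * (u i * s i))))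
    = (LINT u|lborel_on (insert i I). A (insert i I) j u)"
    by (simp only: A_def set_lebesgue_integral_def)
  also have "\<dots> = (LINT u|lborel_on I. (LINT t|lborel. A (insert i I) j (u(i := t))))"
    by (rule product_integral_insert) (use insert.hyps iA in auto)
  also have "\<dots> = (LINT u|lborel_on I. (\<Sum>k\<le>j. A I k u * fps_nth (edge_fps (h i) (s i)) (j - k)))"
  proof (rule Bochner_Integration.integral_cong[OF refl])
    fix u assume u: "u \<in> space (lborel_on I)"
    show "(LINT t|lborel. A (insert i I) j (u(i := t))) = (\<Sum>k\<le>j. A I k u * fps_nth (edge_fps (h i) (s i)) (j - k))"
      unfolding split[OF u] using ie by (subst Bochner_Integration.integral_sum) (auto simp: Ie)
  qed
  also have "\<dots> = (\<Sum>k\<le>j. (LINT u|lborel_on I. A I k u) * fps_nth (edge_fps (h i) (s i)) (j - k))"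
    using iA[OF insert.hyps(1)] by (subst Bochner_Integration.integral_sum) auto
  also have "\<dots> = (\<Sum>k\<le>j. fps_nth (\<Prod>i\<in>I. edge_fps (h i) (s i)) k * fps_nth (edge_fps (h i) (s i)) (j - k))"
    by (simp only: A_def insert.IH[unfolded set_lebesgue_integral_def])
  also have "\<dots> = fps_nth (\<Prod>i\<in>insert i I. edge_fps (h i) (s i)) j"
    using insert.hyps by (simp add: fps_mult_nth mult.commute[of "edge_fps _ _"] atLeast0AtMost)
  finally show ?case .
qed

context box_fun
begin

lemma box_moment:
  "(LINT y|lborel. b y *\<^sub>R (of_real ((- (h \<bullet> y)) ^ j / fact j) * cis (- 2 * pi * (\<eta> \<bullet> y))))
    = fps_nth (\<Prod>i<length V. edge_fps (h \<bullet> real_vec (V ! i)) (\<eta> \<bullet> real_vec (V ! i))) j"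
proof -
  have [measurable]: "(\<lambda>y::real^'d. complex_of_real ((- (h \<bullet> y)) ^ j / fact j) * cis (- 2 * pi * (\<eta> \<bullet> y))) \<in> borel_measurable borel"
    by (intro borel_measurable_continuous_onI) (auto simp: cis_conv_exp intro!: continuous_intros)
  have c: "cis (\<Sum>i\<in>I. f i) = (\<Prod>i\<in>I. cis (f i))" for I :: "nat set" and f
    by (induction I rule: infinite_finite_induct) (auto simp: cis_mult[symmetric])
  show ?thesis
    by (subst integral_b, measurable, subst cube_moment[symmetric])
      (auto simp: inner_sum_right sum_distrib_left sum_negf c[symmetric] mult_ac intro!: arg_cong2[where f = "set_lebesgue_integral _"])
qed

lemma box_fourier:
  "(LINT y|lborel. b y *\<^sub>R cis (- 2 * pi * (\<eta> \<bullet> y)))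
    = (\<Prod>i<length V. (LINT u:{0..1}|lborel. cis (- 2 * pi * (u * (\<eta> \<bullet> real_vec (V ! i))))))"
proof -
  have p: "fps_nth (\<Prod>i\<in>I. F i) 0 = (\<Prod>i\<in>I. fps_nth (F i) 0)" for F :: "nat \<Rightarrow> complex fps" and I
    by (induction I rule: infinite_finite_induct) auto
  show ?thesis using box_moment[of 0 0 \<eta>] by (simp add: p edge_fps_def)
qed

end

lemma integral_cis_unit:
  fixes s :: real
  shows "s \<noteq> 0 \<Longrightarrow> (LINT u:{0..1}|lborel. cis (- 2 * pi * (u * s))) = (1 - cis (- 2 * pi * s)) / (2 * pi * \<i> * s)"
proof -
  assume s: "s \<noteq> 0"
  let ?c = "- 2 * pi * s :: real"
  let ?F = "\<lambda>t. - \<i> * cis (?c * t) / of_real ?c"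
  have c: "?c \<noteq> 0" using s by simp
  have "((\<lambda>z. - \<i> * exp (\<i> * of_real ?c * z) / of_real ?c) has_field_derivative exp (\<i> * of_real ?c * z)) (at z)" for z
    by (rule derivative_eq_intros refl | use c in simp)+
  note D = has_vector_derivative_real_field[OF this]
  have "(?F has_vector_derivative cis (- 2 * pi * (t * s))) (at t within {0..1})" for t
    using D[of t "{0..1}"] by (simp add: cis_conv_exp mult_ac)
  then have "(LINT t:{0..1}|lborel. cis (- 2 * pi * (t * s))) = ?F 1 - ?F 0"
    unfolding set_lebesgue_integral_def
    by (intro integral_FTC_atLeastAtMost) (auto simp: cis_conv_exp intro!: continuous_intros)
  also have "\<dots> = (1 - cis (- 2 * pi * s)) / (2 * pi * \<i> * s)"
    using s by (simp add: field_simps)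
  finally show ?thesis .
qed

text \<open>The numerator 1 - e^{-2 pi i s} vanishes at integers only, and at s = 0 the integral is
  1. The zeros of a Fourier factor are thus exactly among the nonzero integers.\<close>

lemma integral_cis_unit_nz:
  fixes s :: real
  assumes "s = 0 \<or> s \<notin> \<int>"
  shows "(LINT u:{0..1}|lborel. cis (- 2 * pi * (u * s))) \<noteq> 0"
proof (cases "s = 0")
  case True then show ?thesis by (simp add: set_lebesgue_integral_def)
next
  case False
  have "cis (- 2 * pi * s) \<noteq> 1"
  proof
    assume "cis (- 2 * pi * s) = 1"
    then have "cos (- 2 * pi * s) = 1" by (simp add: complex_eq_iff)
    then obtain k :: int where "- 2 * pi * s = of_int k * 2 * pi"
      using cos_one_2pi_int by blast
    then have "pi * (s + of_int k) = 0" by (simp add: algebra_simps)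
    then have "s + of_int k = 0" by simp
    then have "s = - of_int k" by linarith
    then have "s \<in> \<int>" by simp
    then show False using assms False by simp
  qed
  then show ?thesis using False integral_cis_unit[OF False] by simp
qed

section \<open>The dual function\<close>

lemma measure_cbox01: "measure lborel (cbox 0 (1::real^'d)) = 1"
  using integral_char_fun_cube[of "0::int^'d"] by (simp add: set_lebesgue_integral_def scaleR_conv_of_real)

lemma set_integral_sum:
  fixes f :: "'i \<Rightarrow> 'a \<Rightarrow> 'b::{banach, second_countable_topology}"
  assumes "\<And>i. i \<in> I \<Longrightarrow> set_integrable N A (f i)"
  shows "(LINT x:A|N. (\<Sum>i\<in>I. f i x)) = (\<Sum>i\<in>I. (LINT x:A|N. f i x))"
    and "set_integrable N A (\<lambda>x. \<Sum>i\<in>I. f i x)"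
  using assms unfolding set_lebesgue_integral_def set_integrable_def scaleR_sum_right
  by (auto intro!: Bochner_Integration.integral_sum)

lemma trig_poly_coeff_zero:
  assumes "trig_poly r f" "norm (real_vec (\<alpha>::int^'d)) > r"
  shows "(LINT x:cbox 0 1|lborel. char_fun \<alpha> x * f x) = 0"
proof -
  obtain A c where A: "finite A" "\<And>\<beta>. \<beta> \<in> A \<Longrightarrow> norm (real_vec \<beta>) \<le> r"
    "\<And>x. f x = (\<Sum>\<beta>\<in>A. c \<beta> * char_fun \<beta> x)" using assms(1) by (rule trig_polyE) blast
  have i: "set_integrable lborel (cbox 0 1) (\<lambda>x. char_fun \<beta> x)" for \<beta> :: "int^'d"
    by (rule set_integrable_bounded_cube[where M = 1]) auto
  have "(LINT x:cbox 0 1|lborel. char_fun \<alpha> x * f x)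
      = (LINT x:cbox 0 1|lborel. (\<Sum>\<beta>\<in>A. c \<beta> * char_fun (\<alpha> + \<beta>) x))"
    by (simp add: A(3) sum_distrib_left char_fun_add mult_ac)
  also have "\<dots> = (\<Sum>\<beta>\<in>A. c \<beta> * (LINT x:cbox 0 1|lborel. char_fun (\<alpha> + \<beta>) x))"
    using A(1) i by (subst set_integral_sum(1)) auto
  also have "\<dots> = 0"
  proof (rule sum.neutral, rule ballI)
    fix \<beta> assume "\<beta> \<in> A"
    have "\<alpha> + \<beta> \<noteq> 0"
    proof
      assume "\<alpha> + \<beta> = 0"
      then have "\<alpha> = - \<beta>" by (simp add: eq_neg_iff_add_eq_0)
      then show False using A(2)[OF \<open>\<beta> \<in> A\<close>] assms(2) by (simp add: real_vec_minus)
    qed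
    then show "c \<beta> * (LINT x:cbox 0 1|lborel. char_fun (\<alpha> + \<beta>) x) = 0"
      by (simp add: integral_char_fun_cube)
  qed
  finally show ?thesis .
qed

section \<open>Locally finite sums of translates\<close>

locale spline_setting = box_fun V b M R for V :: "(int^'d) list" and b M R +
  assumes adm: "admissible_family V" and uni: "unimodular_family V"
begin

text \<open>Contains every lattice point whose translate of \<open>b\<close> meets the ball of
  radius r; it serves as the common finite index set for sums over translates.\<close>

definition near :: "real \<Rightarrow> (int^'d) set" where
  "near r = {\<alpha>. norm (real_vec \<alpha>) \<le> r + R}"

lemma finite_near [simp]: "finite (near r)"
  unfolding near_def by (rule finite_real_vec_ball)

lemma nearI: "norm x \<le> r \<Longrightarrow> b (x - real_vec \<alpha>) \<noteq> 0 \<Longrightarrow> \<alpha> \<in> near r"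
  using supp[of "x - real_vec \<alpha>"] norm_triangle_ineq4[of x "x - real_vec \<alpha>"]
  by (auto simp: near_def)

lemma nearI_cube: "x \<in> cbox 0 1 \<Longrightarrow> b (x - real_vec \<alpha>) \<noteq> 0 \<Longrightarrow> \<alpha> \<in> near (CARD('d))"
  by (rule nearI[OF norm_cbox01])

lemma near_diff: "b (x - real_vec \<alpha>) \<noteq> 0 \<Longrightarrow> b (x - real_vec \<beta>) \<noteq> 0 \<Longrightarrow> \<beta> - \<alpha> \<in> near R"
  using nearI[of "x - real_vec \<alpha>" R "\<beta> - \<alpha>"] supp[of "x - real_vec \<alpha>"] by (simp add: real_vec_diff)

text \<open>The sum is locally finite, since \<open>b\<close> has bounded support.\<close>

definition shift_sum :: "(int^'d \<Rightarrow> complex) \<Rightarrow> real^'d \<Rightarrow> complex" where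
  "shift_sum c x = (\<Sum>\<^sub>\<infinity>\<alpha>. c \<alpha> * of_real (b (x - real_vec \<alpha>)))"

lemma shift_sum_eq:
  assumes "finite A" "\<And>\<alpha>. b (x - real_vec \<alpha>) \<noteq> 0 \<Longrightarrow> \<alpha> \<in> A"
  shows "shift_sum c x = (\<Sum>\<alpha>\<in>A. c \<alpha> * of_real (b (x - real_vec \<alpha>)))"
proof -
  have "shift_sum c x = (\<Sum>\<^sub>\<infinity>\<alpha>\<in>A. c \<alpha> * of_real (b (x - real_vec \<alpha>)))"
    unfolding shift_sum_def by (rule infsum_cong_neutral) (use assms(2) in auto)
  then show ?thesis using assms(1) by simp
qed

lemma shift_sum_near: "norm x \<le> r \<Longrightarrow> shift_sum c x = (\<Sum>\<alpha>\<in>near r. c \<alpha> * of_real (b (x - real_vec \<alpha>)))"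
  by (rule shift_sum_eq) (auto intro: nearI)

lemma shift_sum_cube: "x \<in> cbox 0 1 \<Longrightarrow> shift_sum c x = (\<Sum>\<alpha>\<in>near (CARD('d)). c \<alpha> * of_real (b (x - real_vec \<alpha>)))"
  by (rule shift_sum_eq) (auto intro: nearI_cube)

lemma shift_sum_measurable [measurable]: "shift_sum c \<in> borel_measurable borel"
proof (rule borel_measurable_LIMSEQ_metric)
  show "(\<lambda>x. \<Sum>\<alpha>\<in>near (real n). c \<alpha> * of_real (b (x - real_vec \<alpha>))) \<in> borel_measurable borel" for n
    by measurable
  fix x :: "real^'d"
  have "eventually (\<lambda>n. real n \<ge> norm x) sequentially"
    using filterlim_real_sequentially by (auto simp: filterlim_at_top)
  then have "eventually (\<lambda>n. (\<Sum>\<alpha>\<in>near (real n). c \<alpha> * of_real (b (x - real_vec \<alpha>))) = shift_sum c x) sequentially"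
    by eventually_elim (simp add: shift_sum_near)
  then show "(\<lambda>n. \<Sum>\<alpha>\<in>near (real n). c \<alpha> * of_real (b (x - real_vec \<alpha>))) \<longlonglongrightarrow> shift_sum c x"
    by (rule tendsto_eventually)
qed

text \<open>If the translate by \<alpha> is nonzero at x, then |\<alpha>| \<ge> |x| - R. Half of the
  rate \<kappa> is spent on decay in x at the price e^{\<kappa> R / 2}, the other half makes the sum
  over \<alpha> converge. The constant is independent of the coefficients.\<close>

lemma shift_sum_decay:
  assumes \<kappa>: "\<kappa> > 0"
  obtains K where "K \<ge> 0" "\<And>c C x. C \<ge> 0 \<Longrightarrow> (\<And>\<alpha>. norm (c \<alpha>) \<le> C * exp (- \<kappa> * norm (real_vec \<alpha>)))
    \<Longrightarrow> norm (shift_sum c x) \<le> C * K * exp (- (\<kappa> / 2) * norm x)"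
proof
  let ?S = "\<Sum>\<^sub>\<infinity>\<alpha>::int^'d. exp (- (\<kappa> / 2) * norm (real_vec \<alpha>))"
  let ?K = "M * exp (\<kappa> / 2 * R) * ?S"
  have S: "(\<lambda>\<alpha>::int^'d. exp (- (\<kappa> / 2) * norm (real_vec \<alpha>))) summable_on UNIV"
    by (rule exp_norm_summable) (use \<kappa> in simp)
  show "?K \<ge> 0" using M_nonneg by (intro mult_nonneg_nonneg infsum_nonneg) auto
  fix c :: "int^'d \<Rightarrow> complex" and C :: real and x :: "real^'d"
  assume C: "C \<ge> 0" and c: "\<And>\<alpha>. norm (c \<alpha>) \<le> C * exp (- \<kappa> * norm (real_vec \<alpha>))"
  have "norm (shift_sum c x) \<le> (\<Sum>\<alpha>\<in>near (norm x). norm (c \<alpha> * of_real (b (x - real_vec \<alpha>))))"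
    unfolding shift_sum_near[OF order_refl] by (rule norm_sum)
  also have "\<dots> \<le> (\<Sum>\<alpha>\<in>near (norm x). C * M * exp (\<kappa> / 2 * R) * exp (- (\<kappa> / 2) * norm x) * exp (- (\<kappa> / 2) * norm (real_vec \<alpha>)))"
  proof (rule sum_mono)
    fix \<alpha>
    show "norm (c \<alpha> * of_real (b (x - real_vec \<alpha>)))
        \<le> C * M * exp (\<kappa> / 2 * R) * exp (- (\<kappa> / 2) * norm x) * exp (- (\<kappa> / 2) * norm (real_vec \<alpha>))"
    proof (cases "b (x - real_vec \<alpha>) = 0")
      case True then show ?thesis using C M_nonneg by simp
    next
      case False
      have "norm x \<le> norm (real_vec \<alpha>) + R"
        using supp[OF False] norm_triangle_sub[of x "real_vec \<alpha>"] by simp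
      then have "\<kappa> / 2 * norm x \<le> \<kappa> / 2 * (norm (real_vec \<alpha>) + R)"
        using \<kappa> by (intro mult_left_mono) auto
      then have le: "- \<kappa> * norm (real_vec \<alpha>) \<le> \<kappa> / 2 * R + (- (\<kappa> / 2) * norm x) + (- (\<kappa> / 2) * norm (real_vec \<alpha>))"
        by (simp add: algebra_simps)
      have "norm (c \<alpha> * of_real (b (x - real_vec \<alpha>))) \<le> C * exp (- \<kappa> * norm (real_vec \<alpha>)) * M"
        unfolding norm_mult using c[of \<alpha>] C norm_b by (intro mult_mono) auto
      also have "\<dots> \<le> C * exp (\<kappa> / 2 * R + (- (\<kappa> / 2) * norm x) + (- (\<kappa> / 2) * norm (real_vec \<alpha>))) * M"
        using C M_nonneg le by (intro mult_right_mono mult_left_mono) auto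
      finally show ?thesis by (simp only: exp_add mult_ac)
    qed
  qed
  also have "\<dots> = C * M * exp (\<kappa> / 2 * R) * exp (- (\<kappa> / 2) * norm x) * (\<Sum>\<alpha>\<in>near (norm x). exp (- (\<kappa> / 2) * norm (real_vec \<alpha>)))"
    by (simp only: sum_distrib_left)
  also have "\<dots> \<le> C * M * exp (\<kappa> / 2 * R) * exp (- (\<kappa> / 2) * norm x) * ?S"
    using C M_nonneg finite_sum_le_infsum[OF S, of "near (norm x)"] by (intro mult_left_mono) auto
  finally show "norm (shift_sum c x) \<le> C * ?K * exp (- (\<kappa> / 2) * norm x)" by (simp only: mult_ac)
qed

section \<open>The Gram sequence and its symbol\<close>

lemma integrable_shift: "integrable lborel (\<lambda>x. b (x - t))"
  by (rule lborel_integrable_shift[OF integrable_b])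

lemma integrable_bb: "integrable lborel (\<lambda>x. b (x - s) * b (x - t))"
proof (rule Bochner_Integration.integrable_bound)
  show "integrable lborel (\<lambda>x. b (x - s) * M)" using integrable_shift by auto
  have "\<bar>b (x - s)\<bar> * \<bar>b (x - t)\<bar> \<le> \<bar>b (x - s)\<bar> * \<bar>M\<bar>" for x
    using norm_b[of "x - t"] by (intro mult_left_mono) auto
  then show "AE x in lborel. norm (b (x - s) * b (x - t)) \<le> norm (b (x - s) * M)"
    by (simp add: abs_mult)
qed measurable

text \<open>The Gram matrix of the translates has the entry \<open>gram (\<beta> - \<alpha>)\<close>
  at (\<alpha>, \<beta>); it is a convolution operator on Z^d with finitely many nonzero
  coefficients, and \<open>symbol\<close> is its multiplier.\<close>

definition gram :: "int^'d \<Rightarrow> real" where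
  "gram \<alpha> = (LINT x|lborel. b x * b (x - real_vec \<alpha>))"

lemma gram_shift: "(LINT x|lborel. b (x - real_vec \<alpha>) * b (x - real_vec \<beta>)) = gram (\<beta> - \<alpha>)"
  using lborel_integral_shift[of "\<lambda>x. b x * b (x - real_vec (\<beta> - \<alpha>))" "real_vec \<alpha>"]
  by (simp add: gram_def real_vec_diff)

lemma gram_minus: "gram (- \<alpha>) = gram \<alpha>"
  using gram_shift[of \<alpha> 0] gram_shift[of 0 \<alpha>] by (simp add: mult.commute)

lemma near_minus: "- \<alpha> \<in> near r \<longleftrightarrow> \<alpha> \<in> near r"
  by (simp add: near_def real_vec_minus)

definition symbol :: "real^'d \<Rightarrow> complex" where
  "symbol \<xi> = (\<Sum>\<delta>\<in>near R. of_real (gram \<delta>) * char_fun \<delta> \<xi>)"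

text \<open>The Zak transform of \<open>b\<close>, up to sign conventions: a periodisation twisted
  by the character of \<xi>.\<close>

definition twisted :: "real^'d \<Rightarrow> real^'d \<Rightarrow> complex" where
  "twisted \<xi> = shift_sum (\<lambda>\<alpha>. char_fun \<alpha> \<xi>)"

lemma twisted_measurable [measurable]: "twisted \<xi> \<in> borel_measurable borel"
  by (simp add: twisted_def)

definition rsymbol :: "real^'d \<Rightarrow> real" where
  "rsymbol \<xi> = (LINT x:cbox 0 1|lborel. (norm (twisted \<xi> x))\<^sup>2)"

text \<open>Expanding |\<open>twisted\<close>|^2 gives a double sum over translates; the sum over
  one index reassembles the integral over R^d by tiling, the difference of the indices remains as
  \<delta>. The symbol is thus visibly real and nonnegative.\<close>

lemma symbol_eq: "symbol \<xi> = of_real (rsymbol \<xi>)"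
proof -
  let ?A = "near (CARD('d))"
  let ?F = "\<lambda>y. \<Sum>\<delta>\<in>near R. of_real (b y * b (y - real_vec \<delta>)) * cnj (char_fun \<delta> \<xi>)"
  have i: "integrable lborel (\<lambda>y. complex_of_real (b y * b (y - real_vec \<delta>)) * c)" for \<delta> c
    using integrable_of_real[OF integrable_bb[of 0 "real_vec \<delta>"]] by (intro integrable_mult_left) simp
  have "symbol \<xi> = (\<Sum>\<delta>\<in>near R. of_real (gram \<delta>) * cnj (char_fun \<delta> \<xi>))"
    unfolding symbol_def
    by (rule sum.reindex_bij_witness[of _ uminus uminus]) (auto simp: near_minus gram_minus char_fun_minus)
  also have "\<dots> = (LINT y|lborel. ?F y)"
    using i by (subst Bochner_Integration.integral_sum) (auto simp: gram_def simp flip: of_real_mult)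
  also have "\<dots> = (LINT x:cbox 0 1|lborel. (\<Sum>\<alpha>\<in>?A. ?F (x - real_vec \<alpha>)))"
  proof (rule integral_tiling)
    show "integrable lborel ?F" using i by (intro Bochner_Integration.integrable_sum) auto
    fix x \<alpha> assume x: "x \<in> cbox 0 1" and "?F (x - real_vec \<alpha>) \<noteq> 0"
    then have "b (x - real_vec \<alpha>) \<noteq> 0" by (auto intro: ccontr)
    then show "\<alpha> \<in> ?A" by (rule nearI_cube[OF x])
  qed simp
  also have "\<dots> = (LINT x:cbox 0 1|lborel. complex_of_real ((norm (twisted \<xi> x))\<^sup>2))"
  proof (rule set_lebesgue_integral_cong, simp, intro allI impI)
    fix x :: "real^'d" assume x: "x \<in> cbox 0 1"
    let ?f = "\<lambda>\<beta>. complex_of_real (b (x - real_vec \<beta>)) * cnj (char_fun \<beta> \<xi>)"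
    have "?F (x - real_vec \<alpha>) = of_real (b (x - real_vec \<alpha>)) * char_fun \<alpha> \<xi> * (\<Sum>\<beta>\<in>?A. ?f \<beta>)" for \<alpha>
    proof (cases "b (x - real_vec \<alpha>) = 0")
      case False
      \<comment> \<open>Substitution \<beta> = \<alpha> + \<delta>. The two index sets differ only
        in terms where \<open>b\<close> vanishes, because two translates nonzero at x have indices
        differing by an element of \<open>near R\<close>.\<close>
      have "(\<Sum>\<beta>\<in>?A. ?f \<beta>) = (\<Sum>\<beta>\<in>(\<lambda>\<delta>. \<alpha> + \<delta>) ` near R. ?f \<beta>)"
      proof (rule sum.mono_neutral_cong)
        show "?f \<beta> = 0" if "\<beta> \<in> (\<lambda>\<delta>. \<alpha> + \<delta>) ` near R - ?A" for \<beta>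
          using that nearI_cube[OF x, of \<beta>] by auto
        show "?f \<beta> = 0" if "\<beta> \<in> ?A - (\<lambda>\<delta>. \<alpha> + \<delta>) ` near R" for \<beta>
        proof -
          have "\<beta> - \<alpha> \<notin> near R" using that by (auto simp: image_iff)
          then show ?thesis using near_diff[OF False, of \<beta>] by auto
        qed
      qed auto
      also have "\<dots> = (\<Sum>\<delta>\<in>near R. ?f (\<alpha> + \<delta>))" by (subst sum.reindex) (auto simp: inj_on_def)
      finally have sum_eq: "(\<Sum>\<beta>\<in>?A. ?f \<beta>) = (\<Sum>\<delta>\<in>near R. ?f (\<alpha> + \<delta>))" .
      have term_eq: "of_real (b (x - real_vec \<alpha>) * b (x - real_vec \<alpha> - real_vec \<delta>)) * cnj (char_fun \<delta> \<xi>)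
          = of_real (b (x - real_vec \<alpha>)) * char_fun \<alpha> \<xi> * ?f (\<alpha> + \<delta>)" for \<delta>
      proof -
        have "of_real (b (x - real_vec \<alpha>)) * char_fun \<alpha> \<xi> * ?f (\<alpha> + \<delta>)
            = of_real (b (x - real_vec \<alpha>)) * of_real (b (x - real_vec \<alpha> - real_vec \<delta>)) * cnj (char_fun \<delta> \<xi>)
              * (cnj (char_fun \<alpha> \<xi>) * char_fun \<alpha> \<xi>)"
          by (simp add: char_fun_add real_vec_add diff_diff_eq)
        then show ?thesis by (simp only: char_fun_cnj_mult mult_1_right of_real_mult)
      qed
      show ?thesis unfolding sum_eq sum_distrib_left term_eq ..
    qed auto
    then have "(\<Sum>\<alpha>\<in>?A. ?F (x - real_vec \<alpha>)) = (\<Sum>\<alpha>\<in>?A. of_real (b (x - real_vec \<alpha>)) * char_fun \<alpha> \<xi>) * (\<Sum>\<beta>\<in>?A. ?f \<beta>)"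
      by (simp only: sum_distrib_right)
    also have "\<dots> = twisted \<xi> x * cnj (twisted \<xi> x)"
      unfolding twisted_def shift_sum_cube[OF x] by (simp add: mult.commute)
    finally show "(\<Sum>\<alpha>\<in>?A. ?F (x - real_vec \<alpha>)) = complex_of_real ((norm (twisted \<xi> x))\<^sup>2)"
      by (simp only: complex_norm_square)
  qed
  also have "\<dots> = of_real (rsymbol \<xi>)"
    unfolding rsymbol_def by (rule set_integral_complex_of_real)
  finally show ?thesis .
qed

lemma continuous_rsymbol: "continuous_on S rsymbol"
proof -
  have "rsymbol = (\<lambda>\<xi>. Re (symbol \<xi>))" by (simp add: symbol_eq)
  then show ?thesis unfolding symbol_def by (simp only:) (intro continuous_intros)
qed

text \<open>If the symbol vanished at \<xi>, the twisted periodisation would be 0 a.e., and with it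
  the Fourier transform of \<open>b\<close> at all of \<xi> + Z^d. That transform is a product of
  factors which vanish only where v . \<eta> is a nonzero integer; unimodularity supplies a point of
  \<xi> + Z^d where this happens for no v.\<close>

lemma rsymbol_pos: "rsymbol \<xi> > 0"
proof (rule ccontr)
  assume np: "\<not> rsymbol \<xi> > 0"
  let ?A = "near (CARD('d))"
  have "rsymbol \<xi> \<ge> 0" unfolding rsymbol_def set_lebesgue_integral_def by (rule Bochner_Integration.integral_nonneg) simp
  then have z: "rsymbol \<xi> = 0" using np by simp
  have tb: "norm (twisted \<xi> x) \<le> real (card ?A) * M" if "x \<in> cbox 0 1" for x
    unfolding twisted_def shift_sum_cube[OF that]
    by (rule sum_norm_bound) (auto simp: norm_mult norm_b)
  have "integrable lborel (\<lambda>x. indicator (cbox 0 1) x *\<^sub>R (norm (twisted \<xi> x))\<^sup>2)"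
  proof (rule Bochner_Integration.integrable_bound)
    show "integrable lborel (\<lambda>x::real^'d. indicator (cbox 0 1) x *\<^sub>R (real (card ?A) * M)\<^sup>2)"
      by (intro integrable_scaleR_left integrable_real_indicator) (use emeasure_bounded_finite[OF bounded_cbox] in auto)
    show "AE x in lborel. norm (indicator (cbox 0 1) x *\<^sub>R (norm (twisted \<xi> x))\<^sup>2)
        \<le> norm (indicat_real (cbox 0 1) x *\<^sub>R (real (card ?A) * M)\<^sup>2)"
      using tb by (auto simp: indicator_def intro!: power_mono)
  qed measurable
  then have "AE x in lborel. indicator (cbox 0 1) x *\<^sub>R (norm (twisted \<xi> x))\<^sup>2 = 0"
    using z unfolding rsymbol_def set_lebesgue_integral_def by (subst (asm) integral_nonneg_eq_0_iff_AE) auto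
  then have tw: "AE x in lborel. x \<in> cbox 0 1 \<longrightarrow> twisted \<xi> x = 0"
    by eventually_elim (auto simp: indicator_def)
  \<comment> \<open>After subtracting \<gamma>, the product with each v is either 0 or not an
    integer.\<close>
  obtain \<gamma> :: "int^'d" where \<gamma>:
    "\<And>i. i < length V \<Longrightarrow> real_vec (V ! i) \<bullet> \<xi> \<in> \<int> \<Longrightarrow> real_vec (V ! i) \<bullet> real_vec \<gamma> = real_vec (V ! i) \<bullet> \<xi>"
    using unimodular_integer_representation[OF adm uni] by blast
  let ?\<eta> = "\<xi> - real_vec \<gamma>"
  let ?F = "\<lambda>y. b y *\<^sub>R cis (- 2 * pi * (?\<eta> \<bullet> y))"
  have "(LINT y|lborel. ?F y) = (LINT x:cbox 0 1|lborel. (\<Sum>\<alpha>\<in>?A. ?F (x - real_vec \<alpha>)))"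
  proof (rule integral_tiling)
    have m: "(\<lambda>y::real^'d. cis (- 2 * pi * (?\<eta> \<bullet> y))) \<in> borel_measurable borel"
      by (intro borel_measurable_continuous_onI) (auto simp: cis_conv_exp intro!: continuous_intros)
    show "integrable lborel ?F"
      by (rule Bochner_Integration.integrable_bound[OF integrable_b])
        (use borel_measurable_scaleR[OF meas m] in \<open>simp_all\<close>)
    show "\<alpha> \<in> ?A" if "x \<in> cbox 0 1" "?F (x - real_vec \<alpha>) \<noteq> 0" for x \<alpha>
      by (rule nearI_cube[OF that(1)]) (use that(2) in auto)
  qed simp
  also have "\<dots> = (LINT x|(lborel :: (real^'d) measure). 0)"
    unfolding set_lebesgue_integral_def
  proof (rule integral_cong_AE)
    have [measurable]: "(\<lambda>y::real^'d. cis (- 2 * pi * (?\<eta> \<bullet> (y - t)))) \<in> borel_measurable borel" for t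
      by (intro borel_measurable_continuous_onI) (auto simp: cis_conv_exp intro!: continuous_intros)
    show "(\<lambda>x. indicator (cbox 0 1) x *\<^sub>R (\<Sum>\<alpha>\<in>?A. ?F (x - real_vec \<alpha>))) \<in> borel_measurable lborel"
      by measurable
    \<comment> \<open>The integer part \<gamma> of the frequency is invisible on lattice points, so
      the sum over translates is a multiple of \<open>twisted \<xi>\<close>.\<close>
    have c: "cis (- 2 * pi * (?\<eta> \<bullet> (x - real_vec \<alpha>))) = cis (- 2 * pi * (?\<eta> \<bullet> x)) * char_fun \<alpha> \<xi>" for x \<alpha>
    proof -
      have "- 2 * pi * (?\<eta> \<bullet> (x - real_vec \<alpha>)) = - 2 * pi * (?\<eta> \<bullet> x) + 2 * pi * (real_vec \<alpha> \<bullet> \<xi>) + 2 * pi * (- of_int (idot \<gamma> \<alpha>))"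
        by (simp add: inner_diff_left inner_diff_right inner_real_vec inner_commute algebra_simps flip: inner_real_vec)
      moreover have "cis (2 * pi * (- of_int (idot \<gamma> \<alpha>))) = 1" by (rule cis_multiple_2pi) simp
      ultimately show ?thesis by (simp only: cis_mult[symmetric] char_fun_cis mult_1_right)
    qed
    show "AE x in lborel. indicator (cbox 0 1) x *\<^sub>R (\<Sum>\<alpha>\<in>?A. ?F (x - real_vec \<alpha>)) = 0"
      using tw
    proof eventually_elim
      fix x assume x: "x \<in> cbox 0 1 \<longrightarrow> twisted \<xi> x = 0"
      show "indicator (cbox 0 1) x *\<^sub>R (\<Sum>\<alpha>\<in>?A. ?F (x - real_vec \<alpha>)) = 0"
      proof (cases "x \<in> cbox 0 1")
        case True
        have "(\<Sum>\<alpha>\<in>?A. ?F (x - real_vec \<alpha>)) = cis (- 2 * pi * (?\<eta> \<bullet> x)) * twisted \<xi> x"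
          unfolding twisted_def shift_sum_cube[OF True] c
          by (simp add: sum_distrib_left scaleR_conv_of_real mult_ac)
        then show ?thesis using x True by simp
      qed auto
    qed
  qed auto
  finally have "(\<Prod>i<length V. (LINT u:{0..1}|lborel. cis (- 2 * pi * (u * (?\<eta> \<bullet> real_vec (V ! i)))))) = 0"
    by (simp only: box_fourier integral_zero)
  then obtain i where i: "i < length V" "(LINT u:{0..1}|lborel. cis (- 2 * pi * (u * (?\<eta> \<bullet> real_vec (V ! i))))) = 0"
    by (auto simp: prod_zero_iff)
  have "?\<eta> \<bullet> real_vec (V ! i) = 0 \<or> ?\<eta> \<bullet> real_vec (V ! i) \<notin> \<int>"
  proof (cases "real_vec (V ! i) \<bullet> \<xi> \<in> \<int>")
    case True then show ?thesis using \<gamma>[OF i(1)] by (simp add: inner_diff_left inner_diff_right inner_commute)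
  next
    case False
    have "?\<eta> \<bullet> real_vec (V ! i) + of_int (idot \<gamma> (V ! i)) = real_vec (V ! i) \<bullet> \<xi>"
      by (simp add: inner_diff_left inner_diff_right inner_commute flip: inner_real_vec)
    then show ?thesis using False by (metis Ints_add Ints_of_int)
  qed
  then show False using integral_cis_unit_nz i(2) by blast
qed

section \<open>Fourier coefficients of the reciprocal symbol\<close>

lemma rsymbol_bounds:
  obtains m K where "0 < m" "m \<le> K" "\<And>\<xi>. \<xi> \<in> cbox 0 1 \<Longrightarrow> m \<le> rsymbol \<xi>" "\<And>\<xi>. \<xi> \<in> cbox 0 1 \<Longrightarrow> rsymbol \<xi> \<le> K"
proof -
  have ne: "cbox 0 (1::real^'d) \<noteq> {}"
  proof -
    have "0 \<in> cbox 0 (1::real^'d)" by (simp add: mem_box_cart)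
    then show ?thesis by blast
  qed
  obtain x where x: "x \<in> cbox 0 1" "\<forall>y\<in>cbox 0 1. rsymbol x \<le> rsymbol y"
    using continuous_attains_inf[OF compact_cbox ne continuous_rsymbol] by blast
  obtain z where z: "z \<in> cbox 0 1" "\<forall>y\<in>cbox 0 1. rsymbol y \<le> rsymbol z"
    using continuous_attains_sup[OF compact_cbox ne continuous_rsymbol] by blast
  show ?thesis using that[of "rsymbol x" "rsymbol z"] x z rsymbol_pos by auto
qed

text \<open>The convolution inverse of the Gram sequence, hence the coefficients of the dual
  function with respect to the translates of \<open>b\<close>.\<close>

definition inv_coeff :: "int^'d \<Rightarrow> complex" where
  "inv_coeff \<alpha> = (LINT \<xi>:cbox 0 1|lborel. char_fun \<alpha> \<xi> / of_real (rsymbol \<xi>))"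

lemma set_integrable_inv: "set_integrable lborel (cbox 0 1) (\<lambda>\<xi>. char_fun \<alpha> \<xi> / of_real (rsymbol \<xi>))"
  unfolding set_integrable_def
  by (rule borel_integrable_compact)
    (use rsymbol_pos in \<open>auto intro!: continuous_intros continuous_rsymbol simp: less_imp_neq[THEN not_sym]\<close>)

text \<open>Symbol times reciprocal symbol is 1, read on Fourier coefficients. The conjugate appears
  because the dual function enters inner products conjugated.\<close>

lemma inv_coeff_convolution:
  "(\<Sum>\<delta>\<in>near R. of_real (gram \<delta>) * cnj (inv_coeff (\<alpha> - \<delta>))) = (if \<alpha> = 0 then 1 else 0)"
proof -
  have c: "cnj (inv_coeff \<beta>) = (LINT \<xi>:cbox 0 1|lborel. char_fun (- \<beta>) \<xi> / of_real (rsymbol \<xi>))" for \<beta>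
    unfolding inv_coeff_def set_lebesgue_integral_def
    by (subst Bochner_Integration.integral_cnj[symmetric]) (simp add: char_fun_minus)
  have "(\<Sum>\<delta>\<in>near R. of_real (gram \<delta>) * cnj (inv_coeff (\<alpha> - \<delta>)))
      = (LINT \<xi>:cbox 0 1|lborel. (\<Sum>\<delta>\<in>near R. of_real (gram \<delta>) * (char_fun (- (\<alpha> - \<delta>)) \<xi> / of_real (rsymbol \<xi>))))"
    unfolding c set_integral_mult_right[symmetric]
    by (rule set_integral_sum(1)[symmetric]) (intro set_integrable_mult_right set_integrable_inv)
  also have "\<dots> = (LINT \<xi>:cbox 0 1|lborel. char_fun (- \<alpha>) \<xi>)"
  proof (rule set_lebesgue_integral_cong, simp, intro allI impI)
    fix \<xi> :: "real^'d"
    have "(\<Sum>\<delta>\<in>near R. of_real (gram \<delta>) * (char_fun (- (\<alpha> - \<delta>)) \<xi> / of_real (rsymbol \<xi>)))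
      = char_fun (- \<alpha>) \<xi> * symbol \<xi> / of_real (rsymbol \<xi>)"
    proof -
      have "char_fun (- (\<alpha> - \<delta>)) \<xi> = char_fun (- \<alpha>) \<xi> * char_fun \<delta> \<xi>" for \<delta>
        by (simp add: char_fun_add[symmetric])
      then show ?thesis by (simp add: symbol_def sum_distrib_left sum_divide_distrib mult_ac)
    qed
    then show "(\<Sum>\<delta>\<in>near R. of_real (gram \<delta>) * (char_fun (- (\<alpha> - \<delta>)) \<xi> / of_real (rsymbol \<xi>))) = char_fun (- \<alpha>) \<xi>"
      using rsymbol_pos[of \<xi>] by (simp add: symbol_eq)
  qed
  also have "\<dots> = (if \<alpha> = 0 then 1 else 0)" by (simp add: integral_char_fun_cube)
  finally show ?thesis .
qed

text \<open>Expanding \<open>1/g\<close> into a geometric series in \<open>1 - g/K\<close>, the first terms are trigonometric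
  polynomials of low degree and do not contribute to a high Fourier coefficient.\<close>

lemma inv_coeff_decay:
  obtains C \<kappa> where "C \<ge> 0" "\<kappa> > 0" "\<And>\<alpha>. norm (inv_coeff \<alpha>) \<le> C * exp (- \<kappa> * norm (real_vec \<alpha>))"
proof -
  obtain m K where mK: "0 < m" "m \<le> K" "\<And>\<xi>. \<xi> \<in> cbox 0 1 \<Longrightarrow> m \<le> rsymbol \<xi>" "\<And>\<xi>. \<xi> \<in> cbox 0 1 \<Longrightarrow> rsymbol \<xi> \<le> K"
    using rsymbol_bounds by blast
  define \<theta> where "\<theta> \<xi> = 1 - rsymbol \<xi> / K" for \<xi>
  \<comment> \<open>The maximum with 1/2 keeps q positive, so that ln q exists even when m =
    K.\<close>
  define q where "q = max (1 - m / K) (1 / 2)"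
  have q: "0 < q" "q < 1" using mK by (auto simp: q_def)
  have \<theta>: "0 \<le> \<theta> \<xi>" "\<theta> \<xi> \<le> q" if "\<xi> \<in> cbox 0 1" for \<xi>
    using mK(1,2) mK(3,4)[OF that] by (auto simp: \<theta>_def q_def divide_right_mono le_max_iff_disj)
  \<comment> \<open>Frequencies of the symbol have norm at most 2 R; the summand 1 makes r a
    positive divisor.\<close>
  define r where "r = 2 * \<bar>R\<bar> + 1"
  have r: "r > 0" by (simp add: r_def)
  have "trig_poly r (\<lambda>\<xi>. 1 + (\<Sum>\<delta>\<in>near R. (- of_real (gram \<delta> / K)) * char_fun \<delta> \<xi>))"
    by (intro trig_poly_add trig_poly_const trig_poly_sum) (auto simp: r_def near_def finite_real_vec_ball)
  moreover have "1 + (\<Sum>\<delta>\<in>near R. (- of_real (gram \<delta> / K)) * char_fun \<delta> \<xi>) = of_real (\<theta> \<xi>)" for \<xi>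
  proof -
    have "(\<Sum>\<delta>\<in>near R. (- of_real (gram \<delta> / K)) * char_fun \<delta> \<xi>) = - symbol \<xi> / of_real K"
      by (simp add: symbol_def sum_divide_distrib sum_negf)
    then show ?thesis by (simp add: \<theta>_def symbol_eq)
  qed
  ultimately have tp: "trig_poly r (\<lambda>\<xi>. complex_of_real (\<theta> \<xi>))" by simp
  have tpk: "trig_poly (real k * r) (\<lambda>\<xi>. complex_of_real (\<theta> \<xi> ^ k))" for k
  proof (induction k)
    case 0 then show ?case by (simp add: trig_poly_const)
  next
    case (Suc k)
    from trig_poly_mult[OF tp Suc.IH] show ?case by (simp add: algebra_simps)
  qed
  have c\<theta>: "continuous_on S \<theta>" for S unfolding \<theta>_def using mK by (intro continuous_intros continuous_rsymbol) auto
  have main: "norm (inv_coeff \<alpha>) \<le> q ^ n / m" if n: "real n * r \<le> norm (real_vec \<alpha>)" for n \<alpha>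
  proof -
    let ?e = "char_fun \<alpha>"
    have i1: "set_integrable lborel (cbox 0 1) (\<lambda>\<xi>. ?e \<xi> * of_real (\<theta> \<xi> ^ k))" for k
      unfolding set_integrable_def
      by (rule borel_integrable_compact) (auto intro!: continuous_intros c\<theta>)
    have i2: "set_integrable lborel (cbox 0 1) (\<lambda>\<xi>. ?e \<xi> * of_real (\<theta> \<xi> ^ n / rsymbol \<xi>))"
      unfolding set_integrable_def
      by (rule borel_integrable_compact)
        (use rsymbol_pos in \<open>auto intro!: continuous_intros c\<theta> continuous_rsymbol simp: less_imp_neq[THEN not_sym]\<close>)
    \<comment> \<open>The finite geometric sum: 1/g = (1/K) (1 + ... + \<theta>^{n-1}) + \<theta>^n
      / g with g = K (1 - \<theta>).\<close>
    have "?e \<xi> / of_real (rsymbol \<xi>) = (\<Sum>k<n. of_real (1 / K) * (?e \<xi> * of_real (\<theta> \<xi> ^ k))) + ?e \<xi> * of_real (\<theta> \<xi> ^ n / rsymbol \<xi>)" for \<xi>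
    proof -
      have pos: "rsymbol \<xi> > 0" by (rule rsymbol_pos)
      have "(\<Sum>k<n. \<theta> \<xi> ^ k) * (1 - \<theta> \<xi>) = 1 - \<theta> \<xi> ^ n"
        using one_diff_power_eq[of "\<theta> \<xi>" n] by (simp add: mult.commute)
      then have "(\<Sum>k<n. \<theta> \<xi> ^ k) * (rsymbol \<xi> / K) = 1 - \<theta> \<xi> ^ n" by (simp add: \<theta>_def)
      then have "1 / rsymbol \<xi> = 1 / K * (\<Sum>k<n. \<theta> \<xi> ^ k) + \<theta> \<xi> ^ n / rsymbol \<xi>"
        using pos mK by (simp add: field_simps)
      then have "complex_of_real (1 / rsymbol \<xi>) = of_real (1 / K) * (\<Sum>k<n. of_real (\<theta> \<xi> ^ k)) + of_real (\<theta> \<xi> ^ n / rsymbol \<xi>)"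
        by (simp only: of_real_add of_real_mult of_real_sum)
      then have "?e \<xi> * complex_of_real (1 / rsymbol \<xi>) = ?e \<xi> * (of_real (1 / K) * (\<Sum>k<n. of_real (\<theta> \<xi> ^ k)) + of_real (\<theta> \<xi> ^ n / rsymbol \<xi>))"
        by simp
      moreover have "?e \<xi> * complex_of_real (1 / rsymbol \<xi>) = ?e \<xi> / of_real (rsymbol \<xi>)" by simp
      ultimately show ?thesis
        by (simp only: distrib_left sum_distrib_left mult_ac)
    qed
    then have "inv_coeff \<alpha> = (LINT \<xi>:cbox 0 1|lborel. (\<Sum>k<n. of_real (1 / K) * (?e \<xi> * of_real (\<theta> \<xi> ^ k))) + ?e \<xi> * of_real (\<theta> \<xi> ^ n / rsymbol \<xi>))"
      by (simp only: inv_coeff_def)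
    also have "\<dots> = (LINT \<xi>:cbox 0 1|lborel. (\<Sum>k<n. of_real (1 / K) * (?e \<xi> * of_real (\<theta> \<xi> ^ k))))
        + (LINT \<xi>:cbox 0 1|lborel. ?e \<xi> * of_real (\<theta> \<xi> ^ n / rsymbol \<xi>))"
      by (rule set_integral_add) (intro set_integral_sum(2) set_integrable_mult_right i1 i2 | simp)+
    also have "(LINT \<xi>:cbox 0 1|lborel. (\<Sum>k<n. of_real (1 / K) * (?e \<xi> * of_real (\<theta> \<xi> ^ k))))
        = (\<Sum>k<n. of_real (1 / K) * (LINT \<xi>:cbox 0 1|lborel. ?e \<xi> * of_real (\<theta> \<xi> ^ k)))"
      by (subst set_integral_sum(1)) (auto intro!: set_integrable_mult_right i1[simplified] simp: set_integral_mult_right)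
    also have "\<dots> = 0"
    proof (rule sum.neutral, rule ballI)
      fix k assume "k \<in> {..<n}"
      then have "real k * r < real n * r" using r by simp
      then have "real k * r < norm (real_vec \<alpha>)" using n by linarith
      from trig_poly_coeff_zero[OF tpk this]
      show "of_real (1 / K) * (LINT \<xi>:cbox 0 1|lborel. ?e \<xi> * of_real (\<theta> \<xi> ^ k)) = 0" by simp
    qed
    finally have "norm (inv_coeff \<alpha>) = norm (LINT \<xi>:cbox 0 1|lborel. ?e \<xi> * of_real (\<theta> \<xi> ^ n / rsymbol \<xi>))" by simp
    also have "\<dots> \<le> (LINT \<xi>:cbox 0 1|lborel. norm (?e \<xi> * of_real (\<theta> \<xi> ^ n / rsymbol \<xi>)))"
      by (rule set_integral_norm_bound[OF i2])
    also have "\<dots> \<le> (LINT \<xi>:cbox 0 (1::real^'d)|lborel. q ^ n / m)"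
    proof (rule set_integral_mono)
      show "set_integrable lborel (cbox 0 1) (\<lambda>\<xi>. norm (?e \<xi> * of_real (\<theta> \<xi> ^ n / rsymbol \<xi>)))"
        using i2 by (rule set_integrable_norm)
      show "set_integrable lborel (cbox 0 (1::real^'d)) (\<lambda>\<xi>. q ^ n / m)"
        by (rule set_integrable_bounded_cube[where M = "q ^ n / m"]) (use q mK in auto)
      fix \<xi> :: "real^'d" assume \<xi>: "\<xi> \<in> cbox 0 1"
      have "\<theta> \<xi> ^ n / rsymbol \<xi> \<le> q ^ n / m"
        using \<theta>[OF \<xi>] mK(1) mK(3)[OF \<xi>] q by (intro frac_le power_mono) auto
      then show "norm (?e \<xi> * of_real (\<theta> \<xi> ^ n / rsymbol \<xi>)) \<le> q ^ n / m"
        using \<theta>[OF \<xi>] rsymbol_pos[of \<xi>] by (simp add: norm_mult norm_divide norm_power power_abs)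
    qed
    also have "\<dots> = q ^ n / m"
      by (simp add: set_lebesgue_integral_def measure_cbox01)
    finally show ?thesis .
  qed
  define \<kappa> where "\<kappa> = - ln q / r"
  have "\<kappa> > 0" using q r by (simp add: \<kappa>_def divide_neg_pos)
  show ?thesis
  proof (rule that[of "1 / (q * m)" \<kappa>])
    show "1 / (q * m) \<ge> 0" using q mK by simp
    show "\<kappa> > 0" by fact
    fix \<alpha> :: "int^'d"
    let ?t = "norm (real_vec \<alpha>) / r"
    \<comment> \<open>The largest n for which all omitted polynomials have degree below |\<alpha>|.
      Rounding down costs at most a factor 1/q, which goes into the constant.\<close>
    define n where "n = nat \<lfloor>?t\<rfloor>"
    have t0: "?t \<ge> 0" using r by simp
    have "real n \<le> ?t" using t0 by (simp add: n_def)
    then have "real n * r \<le> norm (real_vec \<alpha>)" using r by (simp add: pos_le_divide_eq)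
    then have "norm (inv_coeff \<alpha>) \<le> q ^ n / m" by (rule main)
    also have "q ^ n \<le> exp (- \<kappa> * norm (real_vec \<alpha>)) / q"
    proof -
      have "?t - 1 \<le> real n" using t0 unfolding n_def by linarith
      then have "real n * ln q \<le> (?t - 1) * ln q" using q by (intro mult_right_mono_neg) auto
      then have "exp (real n * ln q) \<le> exp ((?t - 1) * ln q)" by simp
      also have "(?t - 1) * ln q = - \<kappa> * norm (real_vec \<alpha>) - ln q" using r by (simp add: \<kappa>_def field_simps)
      also have "exp \<dots> = exp (- \<kappa> * norm (real_vec \<alpha>)) / q" using q by (simp add: exp_diff)
      finally show ?thesis using q by (simp add: exp_of_nat_mult)
    qed
    finally show "norm (inv_coeff \<alpha>) \<le> 1 / (q * m) * exp (- \<kappa> * norm (real_vec \<alpha>))"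
      using mK(1) q by (simp add: divide_right_mono mult.commute)
  qed
qed

end

section \<open>Biorthogonality, decay and uniqueness of the dual function\<close>

lemma borel_measurable_cnj [measurable (raw)]:
  "f \<in> borel_measurable N \<Longrightarrow> (\<lambda>x. cnj (f x)) \<in> borel_measurable N"
  by (rule measurable_compose[OF _ borel_measurable_continuous_onI[OF continuous_on_cnj[OF continuous_on_id]]])

lemma square_integrable_mult_integrable:
  fixes f g :: "'a \<Rightarrow> complex"
  assumes [measurable]: "f \<in> borel_measurable N" "g \<in> borel_measurable N"
    and "integrable N (\<lambda>x. (norm (f x))\<^sup>2)" "integrable N (\<lambda>x. (norm (g x))\<^sup>2)"
  shows "integrable N (\<lambda>x. f x * cnj (g x))"
proof (rule Bochner_Integration.integrable_bound)
  show "integrable N (\<lambda>x. (norm (f x))\<^sup>2 + (norm (g x))\<^sup>2)" using assms by auto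
  have "norm (f x * cnj (g x)) \<le> norm ((norm (f x))\<^sup>2 + (norm (g x))\<^sup>2)" for x
  proof -
    have "2 * (norm (f x) * norm (g x)) \<le> (norm (f x))\<^sup>2 + (norm (g x))\<^sup>2"
      using sum_squares_bound[of "norm (f x)" "norm (g x)"] by (simp add: mult.assoc)
    moreover have "0 \<le> norm (f x) * norm (g x)" by simp
    ultimately have "norm (f x) * norm (g x) \<le> (norm (f x))\<^sup>2 + (norm (g x))\<^sup>2" by linarith
    then show ?thesis by (simp add: norm_mult)
  qed
  then show "AE x in N. norm (f x * cnj (g x)) \<le> norm ((norm (f x))\<^sup>2 + (norm (g x))\<^sup>2)" by simp
qed measurable

lemma square_integrable_add:
  fixes f g :: "'a \<Rightarrow> complex"
  assumes [measurable]: "f \<in> borel_measurable N" "g \<in> borel_measurable N"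
    and "integrable N (\<lambda>x. (norm (f x))\<^sup>2)" "integrable N (\<lambda>x. (norm (g x))\<^sup>2)"
  shows "integrable N (\<lambda>x. (norm (f x + g x))\<^sup>2)" "integrable N (\<lambda>x. (norm (f x - g x))\<^sup>2)"
proof -
  have i: "integrable N (\<lambda>x. 2 * (norm (f x))\<^sup>2 + 2 * (norm (g x))\<^sup>2)" using assms by auto
  have p: "(norm (u + v))\<^sup>2 \<le> 2 * (norm u)\<^sup>2 + 2 * (norm v)\<^sup>2" for u v :: complex
  proof -
    have "(norm (u + v))\<^sup>2 \<le> (norm u + norm v)\<^sup>2" by (intro power_mono norm_triangle_ineq) auto
    also have "\<dots> \<le> 2 * (norm u)\<^sup>2 + 2 * (norm v)\<^sup>2"
      using sum_squares_bound[of "norm u" "norm v"] by (simp add: power2_sum)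
    finally show ?thesis .
  qed
  show "integrable N (\<lambda>x. (norm (f x + g x))\<^sup>2)"
    by (rule Bochner_Integration.integrable_bound[OF i]) (use p in \<open>auto intro!: AE_I2 order_trans[OF p] abs_ge_self\<close>)
  have p': "(norm (u - v))\<^sup>2 \<le> 2 * (norm u)\<^sup>2 + 2 * (norm v)\<^sup>2" for u v :: complex
    using p[of u "- v"] by simp
  show "integrable N (\<lambda>x. (norm (f x - g x))\<^sup>2)"
    by (rule Bochner_Integration.integrable_bound[OF i]) (use p' in \<open>auto intro!: AE_I2 order_trans[OF p'] abs_ge_self\<close>)
qed

context spline_setting
begin

definition dual :: "real^'d \<Rightarrow> complex" where
  "dual = shift_sum inv_coeff"

lemma dual_measurable [measurable]: "dual \<in> borel_measurable borel"
  by (simp add: dual_def)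

lemma dual_decay:
  obtains C \<kappa> where "C \<ge> 0" "\<kappa> > 0" "\<And>x. norm (dual x) \<le> C * exp (- \<kappa> * norm x)"
proof -
  obtain C \<kappa> where C: "C \<ge> 0" "\<kappa> > 0" "\<And>\<alpha>. norm (inv_coeff \<alpha>) \<le> C * exp (- \<kappa> * norm (real_vec \<alpha>))"
    using inv_coeff_decay by blast
  obtain K where K: "K \<ge> 0" "\<And>c C x. C \<ge> 0 \<Longrightarrow> (\<And>\<alpha>. norm (c \<alpha>) \<le> C * exp (- \<kappa> * norm (real_vec \<alpha>)))
    \<Longrightarrow> norm (shift_sum c x) \<le> C * K * exp (- (\<kappa> / 2) * norm x)"
    using shift_sum_decay[OF C(2)] by blast
  show ?thesis
    by (rule that[of "C * K" "\<kappa> / 2"]) (use C K(1) K(2)[OF C(1) C(3)] in \<open>auto simp: dual_def\<close>)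
qed

text \<open>On the support of one translate of \<open>b\<close> only finitely many terms of the dual
  function are nonzero; integrating them yields Gram entries, and the sum is the convolution
  identity for \<open>inv_coeff\<close>.\<close>

lemma dual_biorthogonal:
  "(LINT x|lborel. of_real (b (x - real_vec \<alpha>)) * cnj (dual (x - real_vec \<beta>))) = (if \<alpha> = \<beta> then 1 else 0)"
proof -
  let ?S = "(\<lambda>\<delta>. \<alpha> - \<beta> - \<delta>) ` near R"
  have pw: "of_real (b (x - real_vec \<alpha>)) * cnj (dual (x - real_vec \<beta>))
      = (\<Sum>\<gamma>\<in>?S. cnj (inv_coeff \<gamma>) * of_real (b (x - real_vec \<alpha>) * b (x - real_vec (\<beta> + \<gamma>))))" for x
  proof (cases "b (x - real_vec \<alpha>) = 0")
    case False
    have "dual (x - real_vec \<beta>) = (\<Sum>\<gamma>\<in>?S. inv_coeff \<gamma> * of_real (b (x - real_vec \<beta> - real_vec \<gamma>)))"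
      unfolding dual_def
    proof (rule shift_sum_eq)
      fix \<gamma> assume "b (x - real_vec \<beta> - real_vec \<gamma>) \<noteq> 0"
      then have "b (x - real_vec (\<beta> + \<gamma>)) \<noteq> 0" by (simp add: real_vec_add diff_diff_eq)
      from near_diff[OF this False] have "\<alpha> - \<beta> - \<gamma> \<in> near R" by (simp add: diff_diff_eq)
      moreover have "\<gamma> = \<alpha> - \<beta> - (\<alpha> - \<beta> - \<gamma>)" by simp
      ultimately show "\<gamma> \<in> ?S" by blast
    qed simp
    then show ?thesis by (simp add: sum_distrib_left real_vec_add diff_diff_eq mult_ac)
  qed auto
  have i: "integrable lborel (\<lambda>x. cnj (inv_coeff \<gamma>) * complex_of_real (b (x - real_vec \<alpha>) * b (x - real_vec (\<beta> + \<gamma>))))" for \<gamma>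
    using integrable_of_real[OF integrable_bb[of "real_vec \<alpha>" "real_vec (\<beta> + \<gamma>)"]] by (intro integrable_mult_right) simp
  have "(LINT x|lborel. of_real (b (x - real_vec \<alpha>)) * cnj (dual (x - real_vec \<beta>)))
      = (\<Sum>\<gamma>\<in>?S. cnj (inv_coeff \<gamma>) * of_real (gram (\<beta> + \<gamma> - \<alpha>)))"
    unfolding pw using i
    by (subst Bochner_Integration.integral_sum) (auto simp: gram_shift[symmetric] simp flip: of_real_mult)
  also have "\<dots> = (\<Sum>\<delta>\<in>near R. of_real (gram \<delta>) * cnj (inv_coeff (\<alpha> - \<beta> - \<delta>)))"
  proof (subst sum.reindex)
    show "inj_on (\<lambda>\<delta>. \<alpha> - \<beta> - \<delta>) (near R)" by (auto simp: inj_on_def)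
    have "gram (\<beta> + (\<alpha> - \<beta> - \<delta>) - \<alpha>) = gram \<delta>" for \<delta> using gram_minus[of \<delta>] by simp
    then show "(sum ((\<lambda>\<gamma>. cnj (inv_coeff \<gamma>) * complex_of_real (gram (\<beta> + \<gamma> - \<alpha>))) \<circ> (\<lambda>\<delta>. \<alpha> - \<beta> - \<delta>)) (near R))
        = (\<Sum>\<delta>\<in>near R. of_real (gram \<delta>) * cnj (inv_coeff (\<alpha> - \<beta> - \<delta>)))"
      by (simp add: mult.commute)
  qed
  also have "\<dots> = (if \<alpha> = \<beta> then 1 else 0)" unfolding inv_coeff_convolution by simp
  finally show ?thesis .
qed

lemma dual_square_integrable: "integrable lborel (\<lambda>x. (norm (dual x))\<^sup>2)"
proof -
  obtain C \<kappa> where C: "C \<ge> 0" "\<kappa> > 0" "\<And>x. norm (dual x) \<le> C * exp (- \<kappa> * norm x)" using dual_decay by blast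
  have "integrable lborel (\<lambda>x::real^'d. C\<^sup>2 * exp (- (2 * \<kappa>) * norm x))"
    using exp_norm_integrable[of "2 * \<kappa>"] C by auto
  then show ?thesis
  proof (rule Bochner_Integration.integrable_bound)
    have "(norm (dual x))\<^sup>2 \<le> C\<^sup>2 * exp (- (2 * \<kappa>) * norm x)" for x
    proof -
      have "(norm (dual x))\<^sup>2 \<le> (C * exp (- \<kappa> * norm x))\<^sup>2" by (intro power_mono C(3)) auto
      also have "\<dots> = C\<^sup>2 * exp (- (2 * \<kappa>) * norm x)"
        by (simp add: power_mult_distrib exp_double[symmetric] mult.assoc)
      finally show ?thesis .
    qed
    then show "AE x in lborel. norm ((norm (dual x))\<^sup>2) \<le> norm (C\<^sup>2 * exp (- (2 * \<kappa>) * norm x))"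
      by (auto intro!: AE_I2 order_trans[OF _ abs_ge_self])
  qed measurable
qed

text \<open>Places the dual function in the closed span. Outside \<open>near N\<close> the
  coefficients keep half of their decay rate, and the other half is the factor e^{-\<kappa> (N + R)
  / 2}; its square bounds the L^2 error.\<close>

lemma dual_approx:
  assumes \<epsilon>: "\<epsilon> > 0"
  obtains N where "(\<integral>\<^sup>+x. ennreal ((norm (dual x - (\<Sum>\<alpha>\<in>near N. inv_coeff \<alpha> * of_real (b (x - real_vec \<alpha>)))))\<^sup>2) \<partial>lborel) < ennreal \<epsilon>"
proof -
  obtain C \<kappa> where C: "C \<ge> 0" "\<kappa> > 0" "\<And>\<alpha>. norm (inv_coeff \<alpha>) \<le> C * exp (- \<kappa> * norm (real_vec \<alpha>))"
    using inv_coeff_decay by blast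
  have "\<kappa> / 2 > 0" using C by simp
  then obtain K where K: "K \<ge> 0" "\<And>c C x. C \<ge> 0 \<Longrightarrow> (\<And>\<alpha>. norm (c \<alpha>) \<le> C * exp (- (\<kappa> / 2) * norm (real_vec \<alpha>)))
    \<Longrightarrow> norm (shift_sum c x) \<le> C * K * exp (- (\<kappa> / 2 / 2) * norm x)"
    using shift_sum_decay[of "\<kappa> / 2"] by blast
  define J where "J = (LINT x|lborel. exp (- (\<kappa> / 2) * norm (x::real^'d)))"
  have iJ: "integrable lborel (\<lambda>x::real^'d. exp (- (\<kappa> / 2) * norm x))"
    by (rule exp_norm_integrable) (use C in simp)
  have J: "J \<ge> 0" unfolding J_def by simp
  have main: "(\<integral>\<^sup>+x. ennreal ((norm (dual x - (\<Sum>\<alpha>\<in>near N. inv_coeff \<alpha> * of_real (b (x - real_vec \<alpha>)))))\<^sup>2) \<partial>lborel)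
      \<le> ennreal ((C * K)\<^sup>2 * J * exp (- \<kappa> * (N + R)))" for N
  proof -
    let ?D = "C * exp (- (\<kappa> / 2) * (N + R))"
    define c where "c \<alpha> = (if \<alpha> \<in> near N then 0 else inv_coeff \<alpha>)" for \<alpha>
    have eq: "dual x - (\<Sum>\<alpha>\<in>near N. inv_coeff \<alpha> * of_real (b (x - real_vec \<alpha>))) = shift_sum c x" for x
    proof -
      let ?T = "near N \<union> near (norm x)"
      have "dual x = (\<Sum>\<alpha>\<in>?T. inv_coeff \<alpha> * of_real (b (x - real_vec \<alpha>)))"
        unfolding dual_def by (rule shift_sum_eq) (auto intro: nearI)
      moreover have "shift_sum c x = (\<Sum>\<alpha>\<in>?T. c \<alpha> * of_real (b (x - real_vec \<alpha>)))"
        by (rule shift_sum_eq) (auto intro: nearI)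
      moreover have "(\<Sum>\<alpha>\<in>near N. inv_coeff \<alpha> * of_real (b (x - real_vec \<alpha>)))
          = (\<Sum>\<alpha>\<in>?T. (if \<alpha> \<in> near N then inv_coeff \<alpha> * of_real (b (x - real_vec \<alpha>)) else 0))"
        by (rule sum.mono_neutral_cong_left) auto
      ultimately show ?thesis by (simp add: c_def sum_subtractf[symmetric]) (auto intro!: sum.cong)
    qed
    have cb: "norm (c \<alpha>) \<le> ?D * exp (- (\<kappa> / 2) * norm (real_vec \<alpha>))" for \<alpha>
    proof (cases "\<alpha> \<in> near N")
      case True then show ?thesis using C(1) by (simp add: c_def)
    next
      case False
      then have "N + R \<le> norm (real_vec \<alpha>)" by (simp add: near_def)
      then have "\<kappa> / 2 * (N + R) \<le> \<kappa> / 2 * norm (real_vec \<alpha>)" using C(2) by (intro mult_left_mono) auto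
      then have "- \<kappa> * norm (real_vec \<alpha>) \<le> (- (\<kappa> / 2) * (N + R)) + (- (\<kappa> / 2) * norm (real_vec \<alpha>))" by (simp add: field_simps)
      then have "exp (- \<kappa> * norm (real_vec \<alpha>)) \<le> exp (- (\<kappa> / 2) * (N + R)) * exp (- (\<kappa> / 2) * norm (real_vec \<alpha>))"
        by (simp only: exp_add[symmetric] exp_le_cancel_iff)
      then have "C * exp (- \<kappa> * norm (real_vec \<alpha>)) \<le> C * (exp (- (\<kappa> / 2) * (N + R)) * exp (- (\<kappa> / 2) * norm (real_vec \<alpha>)))"
        by (rule mult_left_mono[OF _ C(1)])
      then show ?thesis using C(3)[of \<alpha>] False by (simp add: c_def mult.assoc)
    qed
    have b1: "(norm (shift_sum c x))\<^sup>2 \<le> (C * K)\<^sup>2 * exp (- \<kappa> * (N + R)) * exp (- (\<kappa> / 2) * norm x)" for x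
    proof -
      have "norm (shift_sum c x) \<le> ?D * K * exp (- (\<kappa> / 2 / 2) * norm x)"
        by (rule K(2)) (use C(1) cb in auto)
      then have "(norm (shift_sum c x))\<^sup>2 \<le> (?D * K * exp (- (\<kappa> / 2 / 2) * norm x))\<^sup>2" by (intro power_mono) auto
      also have "\<dots> = (C * K)\<^sup>2 * (exp (- (\<kappa> / 2) * (N + R)))\<^sup>2 * (exp (- (\<kappa> / 2 / 2) * norm x))\<^sup>2"
        by (simp add: power_mult_distrib mult_ac)
      also have "(exp (- (\<kappa> / 2) * (N + R)))\<^sup>2 = exp (- \<kappa> * (N + R))"
        by (simp add: exp_double[symmetric] field_simps)
      also have "(exp (- (\<kappa> / 2 / 2) * norm x))\<^sup>2 = exp (- (\<kappa> / 2) * norm x)"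
        by (simp add: exp_double[symmetric])
      finally show ?thesis .
    qed
    have "(\<integral>\<^sup>+x. ennreal ((norm (shift_sum c x))\<^sup>2) \<partial>lborel)
        \<le> (\<integral>\<^sup>+x. ennreal ((C * K)\<^sup>2 * exp (- \<kappa> * (N + R)) * exp (- (\<kappa> / 2) * norm (x::real^'d))) \<partial>lborel)"
      by (intro nn_integral_mono ennreal_leI b1)
    also have "\<dots> = ennreal (LINT x|lborel. (C * K)\<^sup>2 * exp (- \<kappa> * (N + R)) * exp (- (\<kappa> / 2) * norm (x::real^'d)))"
      by (rule nn_integral_eq_integral) (use iJ in auto)
    also have "(LINT x|lborel. (C * K)\<^sup>2 * exp (- \<kappa> * (N + R)) * exp (- (\<kappa> / 2) * norm (x::real^'d))) = (C * K)\<^sup>2 * J * exp (- \<kappa> * (N + R))"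
      unfolding J_def integral_mult_right_zero by (simp only: mult_ac)
    finally show ?thesis by (simp only: eq)
  qed
  have "((\<lambda>N. (C * K)\<^sup>2 * J * exp (- \<kappa> * (N + R))) \<longlongrightarrow> 0) at_top"
    using C(2) by real_asymp
  then have "eventually (\<lambda>N. (C * K)\<^sup>2 * J * exp (- \<kappa> * (N + R)) < \<epsilon>) at_top"
    using \<epsilon> by (rule order_tendstoD)
  then obtain N where "(C * K)\<^sup>2 * J * exp (- \<kappa> * (N + R)) < \<epsilon>"
    by (auto simp: eventually_at_top_linorder)
  then have "ennreal ((C * K)\<^sup>2 * J * exp (- \<kappa> * (N + R))) < ennreal \<epsilon>"
    using J by (intro ennreal_lessI) (auto simp: \<epsilon>)
  with main[of N] show ?thesis by (intro that[of N]) (rule le_less_trans)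
qed

lemma box_spline_shift_eq: "AE x in lborel. \<forall>\<alpha>. box_spline V (x - real_vec \<alpha>) = b (x - real_vec \<alpha>)"
  by (subst AE_all_countable) (use AE_lborel_shift[OF box_spline_eq] in blast)

lemma box_spline_measurable: "box_spline V \<in> borel_measurable borel"
  using is_box_spline_box_spline[OF adm] unfolding is_box_spline_def by (auto dest: borel_measurable_integrable)

lemma finite_combination_cong:
  "(\<integral>\<^sup>+x. ennreal ((norm (f x - (\<Sum>\<alpha>\<in>A. c \<alpha> * of_real (box_spline V (x - real_vec \<alpha>)))))\<^sup>2) \<partial>lborel)
    = (\<integral>\<^sup>+x. ennreal ((norm (f x - (\<Sum>\<alpha>\<in>A. c \<alpha> * of_real (b (x - real_vec \<alpha>)))))\<^sup>2) \<partial>lborel)"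
proof (rule nn_integral_cong_AE)
  show "AE x in lborel. ennreal ((norm (f x - (\<Sum>\<alpha>\<in>A. c \<alpha> * of_real (box_spline V (x - real_vec \<alpha>)))))\<^sup>2)
      = ennreal ((norm (f x - (\<Sum>\<alpha>\<in>A. c \<alpha> * of_real (b (x - real_vec \<alpha>)))))\<^sup>2)"
    using box_spline_shift_eq by eventually_elim simp
qed

lemma box_integral_cong:
  assumes [measurable]: "g \<in> borel_measurable borel"
  shows "(LINT x|lborel. of_real (box_spline V (x - real_vec \<alpha>)) * g x) = (LINT x|lborel. of_real (b (x - real_vec \<alpha>)) * g x :: complex)"
proof (rule integral_cong_AE)
  note box_spline_measurable[measurable]
  show "(\<lambda>x. complex_of_real (box_spline V (x - real_vec \<alpha>)) * g x) \<in> borel_measurable lborel" by measurable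
  show "AE x in lborel. of_real (box_spline V (x - real_vec \<alpha>)) * g x = of_real (b (x - real_vec \<alpha>)) * g x"
    using box_spline_shift_eq by eventually_elim simp
qed measurable

lemma is_dual_dual: "is_dual_function V dual"
  unfolding is_dual_function_def
proof (intro conjI allI)
  show "dual \<in> spline_space V"
    unfolding spline_space_def square_integrable_on_def finite_combination_cong
  proof (intro CollectI conjI allI impI)
    show "dual \<in> borel_measurable lborel" by measurable
    show "set_integrable lborel UNIV (\<lambda>x. (norm (dual x))\<^sup>2)"
      using dual_square_integrable by (simp add: set_integrable_def)
    fix \<epsilon> :: real assume "\<epsilon> > 0"
    then obtain N where "(\<integral>\<^sup>+x. ennreal ((norm (dual x - (\<Sum>\<alpha>\<in>near N. inv_coeff \<alpha> * of_real (b (x - real_vec \<alpha>)))))\<^sup>2) \<partial>lborel) < ennreal \<epsilon>"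
      using dual_approx by blast
    then show "\<exists>A c. finite A \<and> (\<integral>\<^sup>+x. ennreal ((norm (dual x - (\<Sum>\<alpha>\<in>A. c \<alpha> * of_real (b (x - real_vec \<alpha>)))))\<^sup>2) \<partial>lborel) < ennreal \<epsilon>"
      by (intro exI[of _ "near N"] exI[of _ inv_coeff]) simp
  qed
  show "(LINT x|lborel. complex_of_real (box_spline V (x - real_vec \<alpha>)) * cnj (dual (x - real_vec \<beta>))) = (if \<alpha> = \<beta> then 1 else 0)" for \<alpha> \<beta>
  proof -
    have "(\<lambda>x. cnj (dual (x - real_vec \<beta>))) \<in> borel_measurable borel" by measurable
    from box_integral_cong[OF this, of \<alpha>] show ?thesis by (simp add: dual_biorthogonal)
  qed
  obtain C \<kappa> where C: "C \<ge> 0" "\<kappa> > 0" "\<And>x. norm (dual x) \<le> C * exp (- \<kappa> * norm x)" using dual_decay by blast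
  \<comment> \<open>The definition asks for a strictly positive constant, while C may be 0.\<close>
  have "norm (dual x) \<le> (C + 1) * exp (- \<kappa> * norm x)" for x
    using C(3)[of x] by (simp add: distrib_right add_increasing2)
  then show "\<exists>C>0. \<exists>a>0. AE x in lborel. norm (dual x) \<le> C * exp (- a * norm x)"
    using C by (intro exI[of _ "C + 1"] conjI exI[of _ \<kappa>]) auto
qed

text \<open>The difference \<delta> of two dual functions lies in the closed span and is orthogonal
  to every translate. A finite combination D close to \<delta> is orthogonal to \<delta>, so the
  norm of \<delta> is at most that of \<delta> - D, which is arbitrarily small.\<close>

lemma is_dual_unique:
  assumes \<phi>: "is_dual_function V \<phi>"
  shows "AE x in lborel. \<phi> x = dual x"
proof -
  have [measurable]: "\<phi> \<in> borel_measurable borel" and s\<phi>: "integrable lborel (\<lambda>x. (norm (\<phi> x))\<^sup>2)"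
    using \<phi> by (auto simp: is_dual_function_def spline_space_def square_integrable_on_def set_integrable_def)
  have bi: "(LINT x|lborel. complex_of_real (b (x - real_vec \<alpha>)) * cnj (\<phi> x)) = (if \<alpha> = 0 then 1 else 0)" for \<alpha>
  proof -
    have "(LINT x|lborel. complex_of_real (box_spline V (x - real_vec \<alpha>)) * cnj (\<phi> (x - real_vec 0))) = (if \<alpha> = 0 then 1 else 0)"
      using \<phi> unfolding is_dual_function_def by blast
    moreover have "(\<lambda>x. cnj (\<phi> x)) \<in> borel_measurable borel" by measurable
    ultimately show ?thesis using box_integral_cong[of "\<lambda>x. cnj (\<phi> x)" \<alpha>] by simp
  qed
  define \<delta> where "\<delta> x = \<phi> x - dual x" for x
  have [measurable]: "\<delta> \<in> borel_measurable borel" unfolding \<delta>_def by measurable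
  have s\<delta>: "integrable lborel (\<lambda>x. (norm (\<delta> x))\<^sup>2)"
    unfolding \<delta>_def by (rule square_integrable_add) (use s\<phi> dual_square_integrable in auto)
  have sb: "integrable lborel (\<lambda>x. (norm (complex_of_real (b (x - t))))\<^sup>2)" for t
    using integrable_bb[of t t] by (simp add: power2_eq_square)
  have ib: "integrable lborel (\<lambda>x. complex_of_real (b (x - t)) * cnj (f x))"
    if "f \<in> borel_measurable borel" "integrable lborel (\<lambda>x. (norm (f x))\<^sup>2)" for f t
    by (rule square_integrable_mult_integrable) (use that sb in auto)
  have orth: "(LINT x|lborel. complex_of_real (b (x - real_vec \<alpha>)) * cnj (\<delta> x)) = 0" for \<alpha>
  proof -
    have "(LINT x|lborel. complex_of_real (b (x - real_vec \<alpha>)) * cnj (\<delta> x))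
      = (LINT x|lborel. complex_of_real (b (x - real_vec \<alpha>)) * cnj (\<phi> x) - complex_of_real (b (x - real_vec \<alpha>)) * cnj (dual x))"
      by (simp add: \<delta>_def right_diff_distrib)
    also have "\<dots> = (LINT x|lborel. complex_of_real (b (x - real_vec \<alpha>)) * cnj (\<phi> x)) - (LINT x|lborel. complex_of_real (b (x - real_vec \<alpha>)) * cnj (dual x))"
      by (intro Bochner_Integration.integral_diff ib s\<phi> dual_square_integrable) auto
    also have "\<dots> = 0" using bi dual_biorthogonal[of \<alpha> 0] by simp
    finally show ?thesis .
  qed
  have small: "(LINT x|lborel. (norm (\<delta> x))\<^sup>2) \<le> 4 * \<epsilon>" if \<epsilon>: "\<epsilon> > 0" for \<epsilon>
  proof -
    have "\<forall>\<epsilon>>0. \<exists>A c. finite A \<and> (\<integral>\<^sup>+x. ennreal ((norm (\<phi> x - (\<Sum>\<alpha>\<in>A. c \<alpha> * of_real (b (x - real_vec \<alpha>)))))\<^sup>2) \<partial>lborel) < ennreal \<epsilon>"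
      using \<phi> by (auto simp: is_dual_function_def spline_space_def finite_combination_cong)
    then obtain A c where A: "finite A" "(\<integral>\<^sup>+x. ennreal ((norm (\<phi> x - (\<Sum>\<alpha>\<in>A. c \<alpha> * of_real (b (x - real_vec \<alpha>)))))\<^sup>2) \<partial>lborel) < ennreal \<epsilon>"
      using \<epsilon> by blast
    obtain N where N: "(\<integral>\<^sup>+x. ennreal ((norm (dual x - (\<Sum>\<alpha>\<in>near N. inv_coeff \<alpha> * of_real (b (x - real_vec \<alpha>)))))\<^sup>2) \<partial>lborel) < ennreal \<epsilon>"
      using dual_approx[OF \<epsilon>] by blast
    define T1 where "T1 x = (\<Sum>\<alpha>\<in>A. c \<alpha> * of_real (b (x - real_vec \<alpha>)))" for x
    define T2 where "T2 x = (\<Sum>\<alpha>\<in>near N. inv_coeff \<alpha> * of_real (b (x - real_vec \<alpha>)))" for x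
    define D where "D x = T1 x - T2 x" for x
    have [measurable]: "T1 \<in> borel_measurable borel" "T2 \<in> borel_measurable borel" "D \<in> borel_measurable borel"
      unfolding T1_def T2_def D_def by measurable
    have sq_sum: "integrable lborel (\<lambda>x. (norm (\<Sum>\<alpha>\<in>B. d \<alpha> * complex_of_real (b (x - real_vec \<alpha>))))\<^sup>2)" if "finite B" for B d
      using that
    proof (induction B rule: finite_induct)
      case (insert \<alpha> B)
      have "integrable lborel (\<lambda>x. (norm (d \<alpha> * complex_of_real (b (x - real_vec \<alpha>))))\<^sup>2)"
        using sb[of "real_vec \<alpha>"] by (simp add: norm_mult power_mult_distrib)
      then have "integrable lborel (\<lambda>x. (norm (d \<alpha> * complex_of_real (b (x - real_vec \<alpha>)) + (\<Sum>\<alpha>\<in>B. d \<alpha> * complex_of_real (b (x - real_vec \<alpha>)))))\<^sup>2)"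
        by (intro square_integrable_add(1) insert.IH) measurable
      then show ?case using insert.hyps by simp
    qed simp
    have sT: "integrable lborel (\<lambda>x. (norm (T1 x))\<^sup>2)" "integrable lborel (\<lambda>x. (norm (T2 x))\<^sup>2)"
      unfolding T1_def T2_def by (auto intro!: sq_sum A)
    have sD: "integrable lborel (\<lambda>x. (norm (D x))\<^sup>2)"
      unfolding D_def by (rule square_integrable_add) (use sT in auto)
    have s1: "integrable lborel (\<lambda>x. (norm (\<phi> x - T1 x))\<^sup>2)" by (rule square_integrable_add) (use sT s\<phi> in auto)
    have s2: "integrable lborel (\<lambda>x. (norm (dual x - T2 x))\<^sup>2)" by (rule square_integrable_add) (use sT dual_square_integrable in auto)
    have l1: "(LINT x|lborel. (norm (\<phi> x - T1 x))\<^sup>2) \<le> \<epsilon>"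
      using A(2) \<epsilon> unfolding T1_def[symmetric] nn_integral_eq_integral[OF s1, simplified] by (simp add: ennreal_less_iff)
    have l2: "(LINT x|lborel. (norm (dual x - T2 x))\<^sup>2) \<le> \<epsilon>"
      using N \<epsilon> unfolding T2_def[symmetric] nn_integral_eq_integral[OF s2, simplified] by (simp add: ennreal_less_iff)
    have iD\<delta>: "integrable lborel (\<lambda>x. D x * cnj (\<delta> x))"
      by (rule square_integrable_mult_integrable) (use sD s\<delta> in auto)
    have comb: "(LINT x|lborel. (\<Sum>\<alpha>\<in>B. d \<alpha> * complex_of_real (b (x - real_vec \<alpha>))) * cnj (\<delta> x)) = 0" for B d
    proof -
      have "(LINT x|lborel. (\<Sum>\<alpha>\<in>B. d \<alpha> * complex_of_real (b (x - real_vec \<alpha>))) * cnj (\<delta> x))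
        = (LINT x|lborel. (\<Sum>\<alpha>\<in>B. d \<alpha> * (complex_of_real (b (x - real_vec \<alpha>)) * cnj (\<delta> x))))"
        by (simp add: sum_distrib_right mult.assoc)
      also have "\<dots> = (\<Sum>\<alpha>\<in>B. d \<alpha> * (LINT x|lborel. complex_of_real (b (x - real_vec \<alpha>)) * cnj (\<delta> x)))"
        using ib[of \<delta>] s\<delta> by (subst Bochner_Integration.integral_sum) auto
      finally show ?thesis by (simp add: orth)
    qed
    have D0: "(LINT x|lborel. D x * cnj (\<delta> x)) = 0"
    proof -
      have "(LINT x|lborel. D x * cnj (\<delta> x)) = (LINT x|lborel. T1 x * cnj (\<delta> x)) - (LINT x|lborel. T2 x * cnj (\<delta> x))"
        unfolding D_def left_diff_distrib
        by (intro Bochner_Integration.integral_diff square_integrable_mult_integrable) (use sT s\<delta> in auto)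
      then show ?thesis unfolding T1_def T2_def comb by simp
    qed
    define E where "E x = Re (D x * cnj (\<delta> x))" for x
    have iE: "integrable lborel E" unfolding E_def by (rule integrable_Re[OF iD\<delta>])
    have E0: "(LINT x|lborel. E x) = 0" unfolding E_def using D0 iD\<delta> by (simp only: integral_Re) simp
    define E where "E x = Re (D x * cnj (\<delta> x))" for x
    have iE: "integrable lborel E" unfolding E_def by (rule integrable_Re[OF iD\<delta>])
    have E0: "(LINT x|lborel. E x) = 0" unfolding E_def using D0 iD\<delta> by (simp only: integral_Re) simp
    \<comment> \<open>Expand |\<delta> - D|^2 and drop |D|^2; the mixed term E has integral
      0.\<close>
    have p1: "(norm (\<delta> x))\<^sup>2 \<le> (norm (\<delta> x - D x))\<^sup>2 + 2 * E x" for x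
    proof -
      have "(norm (\<delta> x - D x))\<^sup>2 = (norm (\<delta> x))\<^sup>2 + (norm (D x))\<^sup>2 - 2 * Re (D x * cnj (\<delta> x))"
        unfolding cmod_power2 by (simp add: power2_eq_square algebra_simps)
      then show ?thesis by (simp add: E_def)
    qed
    have p2: "(norm (\<delta> x - D x))\<^sup>2 \<le> 2 * (norm (\<phi> x - T1 x))\<^sup>2 + 2 * (norm (dual x - T2 x))\<^sup>2" for x
    proof -
      have "\<delta> x - D x = (\<phi> x - T1 x) - (dual x - T2 x)" by (simp add: \<delta>_def D_def)
      then have "(norm (\<delta> x - D x))\<^sup>2 \<le> (norm (\<phi> x - T1 x) + norm (dual x - T2 x))\<^sup>2"
        by (simp only:) (intro power_mono norm_triangle_ineq4 norm_ge_zero)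
      also have "\<dots> \<le> 2 * (norm (\<phi> x - T1 x))\<^sup>2 + 2 * (norm (dual x - T2 x))\<^sup>2"
        using sum_squares_bound[of "norm (\<phi> x - T1 x)" "norm (dual x - T2 x)"] by (simp add: power2_sum)
      finally show ?thesis .
    qed
    have "(LINT x|lborel. (norm (\<delta> x))\<^sup>2)
        \<le> (LINT x|lborel. 2 * (norm (\<phi> x - T1 x))\<^sup>2 + 2 * (norm (dual x - T2 x))\<^sup>2 + 2 * E x)"
    proof (rule integral_mono)
      show "(norm (\<delta> x))\<^sup>2 \<le> 2 * (norm (\<phi> x - T1 x))\<^sup>2 + 2 * (norm (dual x - T2 x))\<^sup>2 + 2 * E x" for x
        using p1[of x] p2[of x] by linarith
    qed (use s\<delta> s1 s2 iE in auto)
    also have "\<dots> = 2 * (LINT x|lborel. (norm (\<phi> x - T1 x))\<^sup>2) + 2 * (LINT x|lborel. (norm (dual x - T2 x))\<^sup>2) + 2 * (LINT x|lborel. E x)"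
      using s1 s2 iE by (simp add: Bochner_Integration.integral_add)
    also have "\<dots> \<le> 4 * \<epsilon>" using l1 l2 E0 by simp
    finally show ?thesis .
  qed
  have "(LINT x|lborel. (norm (\<delta> x))\<^sup>2) \<le> 0"
  proof (rule field_le_epsilon)
    fix e :: real assume "e > 0"
    then show "(LINT x|lborel. (norm (\<delta> x))\<^sup>2) \<le> 0 + e" using small[of "e / 4"] by simp
  qed
  moreover have "(LINT x|lborel. (norm (\<delta> x))\<^sup>2) \<ge> 0" by simp
  ultimately have "(LINT x|lborel. (norm (\<delta> x))\<^sup>2) = 0" by simp
  then have "AE x in lborel. (norm (\<delta> x))\<^sup>2 = 0"
    using s\<delta> by (subst (asm) integral_nonneg_eq_0_iff_AE) auto
  then show ?thesis by eventually_elim (simp add: \<delta>_def)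
qed

lemma dual_function_eq: "AE x in lborel. dual_function V x = dual x"
  by (rule is_dual_unique) (metis dual_function_def is_dual_dual someI_ex)

end

section \<open>The families in \<open>\<Lambda>\<close>\<close>

text \<open>For \<gamma> \<noteq> 0 the normalised Fourier coefficient at \<gamma> vanishes to at
  least the order \<open>card (active V \<gamma>)\<close> in z.\<close>

definition active :: "(int^'d) list \<Rightarrow> int^'d \<Rightarrow> nat set" where
  "active V \<gamma> = {i. i < length V \<and> idot \<gamma> (V ! i) \<noteq> 0}"

lemma bern_index_iff: "\<gamma> \<in> bern_index V U \<longleftrightarrow> \<gamma> \<noteq> 0 \<and> active V \<gamma> \<subseteq> U"
  by (auto simp: bern_index_def active_def inner_real_vec)

text \<open>All vectors outside the active set lie in the hyperplane orthogonal to \<gamma>.\<close>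

lemma span_of_complement_active:
  assumes "\<gamma> \<noteq> 0" "W \<supseteq> active V \<gamma>"
  shows "span_of V ({..<length V} - W) \<noteq> UNIV"
proof
  assume sp: "span_of V ({..<length V} - W) = UNIV"
  let ?S = "{w. w \<bullet> real_vec \<gamma> = 0}"
  have "subspace ?S" by (auto simp: subspace_def inner_add_left)
  moreover have "real_vec (V ! i) \<in> ?S" if "i \<in> {..<length V} - W" for i
    using that assms(2) by (auto simp: active_def inner_real_vec idot_commute)
  ultimately have "span_of V ({..<length V} - W) \<subseteq> ?S"
    unfolding span_of_def by (intro span_minimal) auto
  then have "real_vec \<gamma> \<in> ?S" using sp by blast
  then show False using assms(1) by simp
qed

text \<open>The maximum defining \<open>rho\<close> is attained because admissibility puts 0 into
  the set. A smaller \<open>W\<close> is enlarged to exactly \<open>rho V\<close> indices, and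
  deleting fewer vectors leaves a larger span.\<close>

lemma rho_spanning:
  assumes adm: "admissible_family V" and W: "W \<subseteq> {..<length V}" "card W \<le> rho V"
  shows "span_of V ({..<length V} - W) = UNIV"
proof -
  let ?P = "{r. r \<le> length V \<and> (\<forall>W \<subseteq> {..<length V}. card W = r \<longrightarrow> span_of V ({..<length V} - W) = UNIV)}"
  have "finite ?P" by simp
  moreover have "0 \<in> ?P"
  proof -
    have "span_of V ({..<length V} - W) = UNIV" if "W \<subseteq> {..<length V}" "card W = 0" for W
    proof -
      have "W = {}" using that by (metis card_0_eq finite_lessThan finite_subset)
      then show ?thesis using adm by (simp add: admissible_family_def)
    qed
    then show ?thesis using le0 by blast
  qed
  ultimately have "rho V \<in> ?P" unfolding rho_def by (intro Max_in) auto
  then have r: "rho V \<le> card {..<length V}" and sp: "\<And>W. W \<subseteq> {..<length V} \<Longrightarrow> card W = rho V \<Longrightarrow> span_of V ({..<length V} - W) = UNIV"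
    by auto
  obtain W' where W': "W \<subseteq> W'" "W' \<subseteq> {..<length V}" "card W' = rho V"
    using obtain_subset_with_card_n exists_subset_between[OF W(2) r W(1)] by blast
  have "span_of V ({..<length V} - W') \<subseteq> span_of V ({..<length V} - W)"
    unfolding span_of_def by (intro span_mono image_mono) (use W'(1) in auto)
  then show ?thesis using sp[OF W'(2,3)] by auto
qed

lemma card_active:
  assumes "admissible_family V" "\<gamma> \<noteq> 0" shows "rho V + 1 \<le> card (active V \<gamma>)"
  using rho_spanning[OF assms(1), of "active V \<gamma>"] span_of_complement_active[OF assms(2), of V "active V \<gamma>"]
  by (force simp: active_def)

lemma active_Lambda:
  assumes "\<gamma> \<noteq> 0" "card (active V \<gamma>) = rho V + 1" shows "active V \<gamma> \<in> Lambda V"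
  using span_of_complement_active[OF assms(1), of V "active V \<gamma>"] assms(2)
  by (auto simp: Lambda_def) (auto simp: active_def)

lemma LambdaD:
  assumes "U \<in> Lambda V" shows "finite U" "card U = rho V + 1" "U \<subseteq> {..<length V}"
  using assms by (auto simp: Lambda_def intro: finite_subset)

lemma finite_Lambda [simp]: "finite (Lambda V)"
  by (rule finite_subset[of _ "Pow {..<length V}"]) (auto simp: Lambda_def)

text \<open>The active set lies in \<open>U\<close> and has at least as many elements. Consequently
  a frequency determines its \<open>U\<close>, and the index sets of distinct Bernoulli splines are
  disjoint.\<close>

lemma bern_index_active:
  assumes "admissible_family V" "U \<in> Lambda V" "\<gamma> \<in> bern_index V U" shows "active V \<gamma> = U"
  using card_active[OF assms(1), of \<gamma>] assms(3) LambdaD[OF assms(2)]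
  by (intro card_seteq) (auto simp: bern_index_iff)

lemma bern_index_iff_active:
  assumes "admissible_family V" "U \<in> Lambda V"
  shows "\<gamma> \<in> bern_index V U \<longleftrightarrow> \<gamma> \<noteq> 0 \<and> active V \<gamma> = U"
  using bern_index_active[OF assms] by (auto simp: bern_index_iff)

lemma idot_linear:
  "idot (\<alpha> - \<beta>) v = idot \<alpha> v - idot \<beta> v" "idot (k *s \<alpha>) v = k * idot \<alpha> v"
  by (simp_all add: idot_def left_diff_distrib sum_subtractf sum_distrib_left mult.assoc)

text \<open>In a basis of V adapted to the complement of \<open>U\<close>, some member v lies
  outside the span of that complement; the generator is the dual basis vector that pairs to 1 with v
  and to 0 with the others.\<close>

lemma bern_gen_spec:
  fixes V :: "(int^'d) list"
  assumes adm: "admissible_family V" and uni: "unimodular_family V" and U: "U \<in> Lambda V"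
  shows "bern_gen V U \<noteq> 0" "bern_index V U = {k *s bern_gen V U | k. k \<noteq> 0}"
proof -
  let ?T = "{..<length V} - U"
  obtain \<sigma> J where \<sigma>: "inj \<sigma>" "range \<sigma> \<subseteq> {..<length V}" "det (\<chi> j::'d. V ! \<sigma> j) \<noteq> 0"
    "\<sigma> ` J \<subseteq> ?T" "span_of V (\<sigma> ` J) = span_of V ?T"
    using basis_selection[OF adm, of ?T] by blast
  have "J \<noteq> UNIV" using \<sigma>(5) det_nz_span[OF \<sigma>(3)] U by (auto simp: Lambda_def)
  then obtain j0 where j0: "j0 \<notin> J" by auto
  obtain a where a: "\<And>j. idot (V ! \<sigma> j) a = (if j = j0 then 1 else 0)"
    using unimodular_solve[OF uni \<sigma>(1-3), of "\<lambda>j. if j = j0 then 1 else 0"] by blast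
  have a0: "a \<noteq> 0" using a[of j0] by (auto simp: idot_def)
  have aB: "a \<in> bern_index V U"
  proof -
    let ?S = "{w. w \<bullet> real_vec a = 0}"
    have "subspace ?S" by (auto simp: subspace_def inner_add_left)
    moreover have "real_vec (V ! i) \<in> ?S" if i: "i \<in> \<sigma> ` J" for i
    proof -
      obtain j where "i = \<sigma> j" "j \<in> J" using i by auto
      then show ?thesis using a[of j] j0 by (auto simp: inner_real_vec)
    qed
    ultimately have "span_of V (\<sigma> ` J) \<subseteq> ?S"
      unfolding span_of_def by (intro span_minimal) auto
    then have "span_of V ?T \<subseteq> ?S" by (simp only: \<sigma>(5))
    then have "real_vec (V ! i) \<in> ?S" if "i \<in> ?T" for i
      using that span_superset[of "(\<lambda>i. real_vec (V ! i)) ` ?T"] unfolding span_of_def by blast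
    then show ?thesis using a0 by (auto simp: bern_index_def inner_commute)
  qed
  have "bern_index V U = {k *s a | k. k \<noteq> 0}"
  proof safe
    fix \<alpha> assume \<alpha>: "\<alpha> \<in> bern_index V U"
    let ?k = "idot (V ! \<sigma> j0) \<alpha>"
    have "\<sigma> j0 \<in> active V a" using a[of j0] \<sigma>(2) by (auto simp: active_def idot_commute)
    then have s0: "\<sigma> j0 \<in> U" using bern_index_active[OF adm U aB] by simp
    \<comment> \<open>The difference is orthogonal also to the vector at \<sigma> j0, which belongs
      to \<open>U\<close>. A nonzero element of the index set would have all of \<open>U\<close> as
      its active set.\<close>
    have "\<alpha> - ?k *s a = 0"
    proof (rule ccontr)
      assume nz: "\<alpha> - ?k *s a \<noteq> 0"
      have "active V (\<alpha> - ?k *s a) \<subseteq> U"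
      proof
        fix i assume "i \<in> active V (\<alpha> - ?k *s a)"
        then have "i \<in> active V \<alpha> \<or> i \<in> active V a" by (auto simp: active_def idot_linear)
        then show "i \<in> U" using \<alpha> aB unfolding bern_index_iff by blast
      qed
      then have "\<alpha> - ?k *s a \<in> bern_index V U" using nz by (simp add: bern_index_iff)
      from bern_index_active[OF adm U this] s0
      have "idot (\<alpha> - ?k *s a) (V ! \<sigma> j0) \<noteq> 0" by (auto simp: active_def)
      then show False
        using a[of j0] by (simp add: idot_linear idot_commute[of \<alpha> "V ! \<sigma> j0"] idot_commute[of a "V ! \<sigma> j0"])
    qed
    then have "\<alpha> = ?k *s a" by simp
    moreover have "?k \<noteq> 0"
    proof
      assume "?k = 0"
      with calculation have "\<alpha> = 0" by simp
      then show False using \<alpha> by (simp add: bern_index_def)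
    qed
    ultimately show "\<exists>k. \<alpha> = k *s a \<and> k \<noteq> 0" by blast
  next
    fix k :: int assume "k \<noteq> 0"
    then show "k *s a \<in> bern_index V U"
      using aB a0 unfolding bern_index_iff by (auto simp: active_def idot_linear)
  qed
  then have "\<exists>a. a \<noteq> 0 \<and> bern_index V U = {k *s a | k. k \<noteq> 0}" using a0 by blast
  from someI_ex[OF this] show "bern_gen V U \<noteq> 0" "bern_index V U = {k *s bern_gen V U | k. k \<noteq> 0}"
    unfolding bern_gen_def by auto
qed

section \<open>Generating functions of the moments\<close>

text \<open>The formal counterpart of \<integral> e^{-u (z h + 2 pi i s)} du = (1 - e^{-z h}) / (z h
  + 2 pi i s) for integral s. The denominator is multiplied out, which covers s = 0 and h = 0 as
  well.\<close>

lemma edge_fps_relation: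
  assumes "s \<in> \<int>"
  shows "edge_fps h s * (fps_const (2 * pi * \<i> * s) + fps_const (of_real h) * fps_X) = 1 - fps_exp (- of_real h)"
proof (rule fps_ext)
  fix n
  let ?e = "\<lambda>n. fps_nth (edge_fps h s) n"
  have cis1: "cis (- 2 * pi * s) = 1"
  proof -
    have "- s \<in> \<int>" using assms by simp
    from cis_multiple_2pi[OF this] show ?thesis by (simp add: mult_ac)
  qed
  have cont: "set_integrable lborel {0..1::real} (\<lambda>u. complex_of_real ((- u * h) ^ j / fact j) * cis (- 2 * pi * (u * s)))" for j
    by (rule borel_integrable_atLeastAtMost') (auto simp: cis_conv_exp intro!: continuous_intros)
  have dc: "((\<lambda>u. cis (- 2 * pi * (u * s))) has_vector_derivative (- 2 * pi * \<i> * s) * cis (- 2 * pi * (u * s))) (at u within A)" for u A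
  proof -
    have "((\<lambda>z. exp ((- 2 * pi * \<i> * s) * z)) has_field_derivative (- 2 * pi * \<i> * s) * exp ((- 2 * pi * \<i> * s) * z)) (at z)" for z
      by (auto intro!: derivative_eq_intros)
    from has_vector_derivative_real_field[OF this, of u A]
    show ?thesis by (simp add: cis_conv_exp mult_ac)
  qed
  show "fps_nth (edge_fps h s * (fps_const (2 * pi * \<i> * s) + fps_const (of_real h) * fps_X)) n = fps_nth (1 - fps_exp (- of_real h)) n"
  proof (cases n)
    case 0
    have "?e 0 * (2 * pi * \<i> * s) = 0"
    proof (cases "s = 0")
      case False
      then show ?thesis using integral_cis_unit[OF False] cis1 by (simp add: edge_fps_def)
    qed simp
    then show ?thesis using 0 by (simp add: distrib_left)
  next
    case (Suc m)
    \<comment> \<open>The z^{m+1} coefficient of -e^{-u (z h + 2 pi i s)}; its derivative combines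
      the integrands of orders m + 1 and m.\<close>
    let ?F = "\<lambda>u. - (complex_of_real ((- u * h) ^ Suc m / fact (Suc m)) * cis (- 2 * pi * (u * s)))"
    let ?g = "\<lambda>j u. complex_of_real ((- u * h) ^ j / fact j) * cis (- 2 * pi * (u * s))"
    have "(?F has_vector_derivative (2 * pi * \<i> * s) * ?g (Suc m) u + of_real h * ?g m u) (at u within {0..1})" for u
    proof -
      have "((\<lambda>u. (- u * h) ^ Suc m / fact (Suc m)) has_real_derivative (- h * ((- u * h) ^ m / fact m))) (at u within {0..1})"
      proof -
        have "((\<lambda>u. (- u * h) ^ Suc m) has_real_derivative (real (Suc m) * ((- u * h) ^ m * (- h)))) (at u within {0..1})"
          by (auto intro!: derivative_eq_intros simp del: power_Suc)
        from DERIV_cdivide[OF this, of "fact (Suc m)"]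
        have "((\<lambda>u. (- u * h) ^ Suc m / fact (Suc m)) has_real_derivative (real (Suc m) * ((- u * h) ^ m * (- h)) / (real (Suc m) * fact m))) (at u within {0..1})"
          by (simp only: fact_Suc)
        moreover have "real (Suc m) * ((- u * h) ^ m * (- h)) / (real (Suc m) * fact m) = - h * ((- u * h) ^ m / fact m)"
          by (simp del: of_nat_Suc)
        ultimately show ?thesis by (simp only: fact_Suc)
      qed
      then have "((\<lambda>u. complex_of_real ((- u * h) ^ Suc m / fact (Suc m))) has_vector_derivative of_real (- h * ((- u * h) ^ m / fact m))) (at u within {0..1})"
        by (intro has_vector_derivative_of_real) (simp add: has_real_derivative_iff_has_vector_derivative)
      from has_vector_derivative_minus[OF has_vector_derivative_mult[OF this dc[of u "{0..1}"]]]
      show ?thesis by (simp only: of_real_mult of_real_minus) (simp add: algebra_simps)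
    qed
    then have "(LINT u:{0..1}|lborel. (2 * pi * \<i> * s) * ?g (Suc m) u + of_real h * ?g m u) = ?F 1 - ?F 0"
      unfolding set_lebesgue_integral_def
    proof (intro integral_FTC_atLeastAtMost)
      have "continuous_on {0..1} (?g j)" for j
        by (auto simp: cis_conv_exp intro!: continuous_intros)
      then show "continuous_on {0..1} (\<lambda>u. (2 * pi * \<i> * s) * ?g (Suc m) u + of_real h * ?g m u)"
        by (intro continuous_on_add continuous_on_mult_left)
    qed auto
    also have "?F 1 - ?F 0 = - (of_real ((- h) ^ Suc m / fact (Suc m)))"
      using cis1 by simp
    also have "(LINT u:{0..1}|lborel. (2 * pi * \<i> * s) * ?g (Suc m) u + of_real h * ?g m u)
        = (2 * pi * \<i> * s) * ?e (Suc m) + of_real h * ?e m"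
      unfolding edge_fps_def fps_nth_Abs_fps
      by (subst set_integral_add(2)) (use cont in \<open>auto intro!: set_integrable_mult_right simp only: set_integral_mult_right\<close>)
    finally have "(2 * pi * \<i> * s) * ?e (Suc m) + of_real h * ?e m = - (of_real ((- h) ^ Suc m / fact (Suc m)))" .
    then have "fps_nth (fps_const (2 * pi * \<i> * s) * edge_fps h s + fps_const (of_real h) * (fps_X * edge_fps h s)) (Suc m)
        = fps_nth (1 - fps_exp (- of_real h)) (Suc m)" by (simp add: distrib_right)
    moreover have "edge_fps h s * (fps_const (2 * pi * \<i> * s) + fps_const (of_real h) * fps_X)
        = fps_const (2 * pi * \<i> * s) * edge_fps h s + fps_const (of_real h) * (fps_X * edge_fps h s)"
      by (simp only: distrib_left mult_ac)
    ultimately show ?thesis using Suc by (simp only:)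
  qed
qed

lemma edge_fps_nth_0: "fps_nth (edge_fps h 0) 0 = 1"
  by (simp add: edge_fps_def set_lebesgue_integral_def)

text \<open>The numerator 1 - e^{-z h} is the same for every integer s and cancels, leaving z h / (z
  h + 2 pi i s): one factor z for each active vector.\<close>

lemma edge_fps_quotient:
  assumes "s \<in> \<int>" "s \<noteq> 0"
  shows "edge_fps h s * inverse (edge_fps h 0)
    = fps_X * (fps_const (of_real h) * inverse (fps_const (2 * pi * \<i> * s) + fps_const (of_real h) * fps_X))"
proof -
  let ?D = "fps_const (2 * pi * \<i> * s) + fps_const (of_real h) * fps_X :: complex fps"
  have D: "?D * inverse ?D = 1" using assms by (intro inverse_mult_eq_1') auto
  have E: "edge_fps h 0 * inverse (edge_fps h 0) = 1" by (intro inverse_mult_eq_1') (simp add: edge_fps_nth_0)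
  have "edge_fps h s * ?D = edge_fps h 0 * (fps_const (of_real h) * fps_X)"
    using edge_fps_relation[OF assms(1), of h] edge_fps_relation[of 0 h] by simp
  then have "edge_fps h s * ?D * (inverse ?D * inverse (edge_fps h 0)) = edge_fps h 0 * (fps_const (of_real h) * fps_X) * (inverse ?D * inverse (edge_fps h 0))"
    by simp
  then have "edge_fps h s * inverse (edge_fps h 0) * (?D * inverse ?D)
      = fps_X * (fps_const (of_real h) * inverse ?D) * (edge_fps h 0 * inverse (edge_fps h 0))"
    by (simp only: mult_ac)
  then show ?thesis by (simp only: D E mult_1_right)
qed

text \<open>The product of z (h . v) / (1 - e^{-z h . v}), as in the Todd class, with factor 1 where
  h . v = 0. It is the reciprocal of the Fourier coefficient at \<gamma> = 0.\<close>

definition todd_fps :: "(int^'d) list \<Rightarrow> real^'d \<Rightarrow> complex fps" where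
  "todd_fps V h = inverse (\<Prod>i<length V. edge_fps (h \<bullet> real_vec (V ! i)) 0)"

text \<open>Inactive vectors contribute 1, and each active one contributes z times a series with
  constant term (h . v) / (2 pi i \<gamma> . v). The product of these terms is the coefficient found
  in a Bernoulli spline.\<close>

lemma todd_fps_coeff:
  fixes V :: "(int^'d) list"
  assumes m: "m \<le> card (active V \<gamma>)"
  shows "fps_nth (todd_fps V h * (\<Prod>i<length V. edge_fps (h \<bullet> real_vec (V ! i)) (real_vec \<gamma> \<bullet> real_vec (V ! i)))) m
    = (if m = card (active V \<gamma>) then \<Prod>i\<in>active V \<gamma>. of_real (h \<bullet> real_vec (V ! i)) / (2 * pi * \<i> * of_real (real_vec \<gamma> \<bullet> real_vec (V ! i))) else 0)"
proof -
  let ?h = "\<lambda>i. h \<bullet> real_vec (V ! i)" and ?s = "\<lambda>i. real_vec \<gamma> \<bullet> real_vec (V ! i)"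
  let ?W = "\<lambda>i. fps_const (of_real (?h i)) * inverse (fps_const (2 * pi * \<i> * ?s i) + fps_const (of_real (?h i)) * fps_X) :: complex fps"
  have inv: "inverse (\<Prod>i\<in>I. edge_fps (?h i) 0) = (\<Prod>i\<in>I. inverse (edge_fps (?h i) 0))" for I
    by (induction I rule: infinite_finite_induct) (auto simp: fps_inverse_mult)
  have "todd_fps V h * (\<Prod>i<length V. edge_fps (?h i) (?s i)) = (\<Prod>i<length V. edge_fps (?h i) (?s i) * inverse (edge_fps (?h i) 0))"
    by (simp add: todd_fps_def inv prod.distrib mult.commute)
  also have "\<dots> = (\<Prod>i\<in>active V \<gamma>. fps_X * ?W i)"
  proof (rule prod.mono_neutral_cong_right)
    show "\<forall>i\<in>{..<length V} - active V \<gamma>. edge_fps (?h i) (?s i) * inverse (edge_fps (?h i) 0) = 1"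
    proof
      fix i assume "i \<in> {..<length V} - active V \<gamma>"
      then have "?s i = 0" by (auto simp: active_def inner_real_vec)
      then show "edge_fps (?h i) (?s i) * inverse (edge_fps (?h i) 0) = 1"
        by (simp only:) (intro inverse_mult_eq_1', simp add: edge_fps_nth_0)
    qed
    show "edge_fps (?h i) (?s i) * inverse (edge_fps (?h i) 0) = fps_X * ?W i" if "i \<in> active V \<gamma>" for i
      by (rule edge_fps_quotient) (use that in \<open>auto simp: active_def inner_real_vec\<close>)
  qed (auto simp: active_def)
  also have "\<dots> = fps_X ^ card (active V \<gamma>) * (\<Prod>i\<in>active V \<gamma>. ?W i)" by (simp add: prod.distrib)
  finally have eq: "todd_fps V h * (\<Prod>i<length V. edge_fps (?h i) (?s i)) = fps_X ^ card (active V \<gamma>) * (\<Prod>i\<in>active V \<gamma>. ?W i)" .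
  have n0: "fps_nth (\<Prod>i\<in>I. F i) 0 = (\<Prod>i\<in>I. fps_nth (F i) 0)" for F :: "nat \<Rightarrow> complex fps" and I
    by (induction I rule: infinite_finite_induct) auto
  have w: "fps_nth (?W i) 0 = of_real (?h i) / (2 * pi * \<i> * of_real (?s i))" for i
    by (simp only: fps_mult_nth_0 fps_inverse_nth_0 fps_add_nth fps_nth_fps_const fps_X_nth if_True refl if_False zero_neq_one mult_zero_right add_0_right divide_inverse)
  show ?thesis
  proof (cases "m = card (active V \<gamma>)")
    case True
    then show ?thesis unfolding eq fps_X_power_mult_nth by (simp only: less_irrefl if_False diff_self_eq_0 n0 w if_True refl)
  next
    case False
    then show ?thesis unfolding eq fps_X_power_mult_nth using m by simp
  qed
qed

lemma AE_periodic:
  fixes P :: "real^'d \<Rightarrow> bool"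
  assumes ae: "AE x in lborel. x \<in> cbox 0 1 \<longrightarrow> P x" and per: "\<And>x \<alpha>. P (x - real_vec \<alpha>) \<Longrightarrow> P x"
  shows "AE x in lborel. P x"
proof -
  have "AE x in lborel. \<forall>\<alpha>. x - real_vec \<alpha> \<in> cbox 0 1 \<longrightarrow> P (x - real_vec \<alpha>)"
    by (subst AE_all_countable) (use AE_lborel_shift[OF ae] in blast)
  then show ?thesis
  proof eventually_elim
    fix x :: "real^'d" assume x: "\<forall>\<alpha>. x - real_vec \<alpha> \<in> cbox 0 1 \<longrightarrow> P (x - real_vec \<alpha>)"
    let ?\<alpha> = "(\<chi> j. \<lfloor>x $ j\<rfloor>) :: int^'d"
    have "x + real_vec (- ?\<alpha>) \<in> half_cube" unfolding half_cube_translate by (simp add: vec_eq_iff)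
    then have "x - real_vec ?\<alpha> \<in> cbox 0 1" using half_cube_subset by (auto simp: real_vec_minus)
    then show "P x" using x per by blast
  qed
qed

section \<open>Bernoulli splines\<close>

text \<open>Abel summation: multiplying by 1 - z shifts the differences to the coefficients 1/k. The
  bound adds 1/(n+1), 1/(N+1) and the telescoping sum 1/(n+1) - 1/(N+1).\<close>

lemma summation_by_parts_tail:
  fixes z :: complex
  assumes "norm z = 1" "n \<le> N"
  shows "norm ((1 - z) * (\<Sum>k\<in>{n<..N}. z ^ k / of_nat k)) \<le> 2 / real (n + 1)"
proof -
  have "(1 - z) * (\<Sum>k\<in>{n<..N}. z ^ k / of_nat k)
      = z ^ (n + 1) / of_nat (n + 1) - z ^ (N + 1) / of_nat (N + 1)
        - (\<Sum>k\<in>{n<..N}. z ^ (k + 1) * of_real (1 / real k - 1 / real (k + 1)))"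
    using assms(2)
  proof (induction N rule: dec_induct)
    case (step N)
    have s: "{n<..Suc N} = insert (Suc N) {n<..N}" using step by auto
    have "(1 - z) * (z ^ Suc N / of_nat (Suc N)) = z ^ (N + 1) / of_nat (N + 1) - z ^ (N + 2) / of_nat (N + 2)
        - z ^ (Suc N + 1) * of_real (1 / real (Suc N) - 1 / real (Suc N + 1))"
      by (simp add: left_diff_distrib right_diff_distrib diff_divide_distrib add.commute)
    then show ?case unfolding s using step.IH by (simp add: distrib_left)
  qed simp
  also have "norm \<dots> \<le> 1 / real (n + 1) + 1 / real (N + 1) + (\<Sum>k\<in>{n<..N}. 1 / real k - 1 / real (k + 1))"
  proof (intro norm_triangle_le_diff add_mono norm_triangle_le_diff)
    show "norm (\<Sum>k\<in>{n<..N}. z ^ (k + 1) * of_real (1 / real k - 1 / real (k + 1))) \<le> (\<Sum>k\<in>{n<..N}. 1 / real k - 1 / real (k + 1))"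
    proof (rule sum_norm_le)
      fix k assume "k \<in> {n<..N}"
      then have "0 < k" by auto
      then have "0 \<le> 1 / real k - 1 / real (k + 1)" by (simp add: field_simps)
      moreover have "norm (z ^ (k + 1) * of_real (1 / real k - 1 / real (k + 1))) = \<bar>1 / real k - 1 / real (k + 1)\<bar>"
        unfolding norm_mult norm_power assms(1) norm_of_real by simp
      ultimately show "norm (z ^ (k + 1) * of_real (1 / real k - 1 / real (k + 1))) \<le> 1 / real k - 1 / real (k + 1)" by linarith
    qed
  qed (simp_all add: norm_divide norm_power norm_mult assms(1) del: of_nat_add of_nat_Suc)
  also have "(\<Sum>k\<in>{n<..N}. 1 / real k - 1 / real (k + 1)) = 1 / real (n + 1) - 1 / real (N + 1)"
    using assms(2)
  proof (induction N rule: dec_induct)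
    case (step N)
    have s: "{n<..Suc N} = insert (Suc N) {n<..N}" using step by auto
    show ?case unfolding s using step.IH by simp
  qed simp
  finally show ?thesis by simp
qed

text \<open>For z = e^{i \<theta>} this is 2 i times the sum of sin(k \<theta>) / k, the partial sum
  of the sawtooth series met when \<open>rho V = 0\<close>.\<close>

definition sine_sum :: "nat \<Rightarrow> complex \<Rightarrow> complex" where
  "sine_sum N z = (\<Sum>k\<in>{0<..N}. (z ^ k - cnj z ^ k) / of_nat k)"

lemma sine_sum_eq: "sine_sum N z = (\<Sum>k\<in>{0<..N}. z ^ k / of_nat k) - cnj (\<Sum>k\<in>{0<..N}. z ^ k / of_nat k)"
  by (simp add: sine_sum_def diff_divide_distrib sum_subtractf)

text \<open>At z = 1 all terms vanish. Elsewhere the tail estimate, divided by |1 - z|, gives the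
  Cauchy property.\<close>

lemma sine_sum_convergent:
  assumes "norm z = 1" shows "convergent (\<lambda>N. sine_sum N z)"
proof (cases "z = 1")
  case True then show ?thesis by (simp add: sine_sum_def convergent_const)
next
  case False
  let ?s = "\<lambda>N. \<Sum>k\<in>{0<..N}. z ^ k / of_nat k"
  let ?d = "norm (1 - z)"
  have d: "?d > 0" using False by simp
  have tail: "norm (?s N - ?s n) \<le> 2 / (real (n + 1) * ?d)" if "n \<le> N" for n N
  proof -
    have "{0<..N} = {0<..n} \<union> {n<..N}" using that by auto
    then have "?s N = ?s n + (\<Sum>k\<in>{n<..N}. z ^ k / of_nat k)" by (simp add: sum.union_disjoint)
    then have "norm (?s N - ?s n) * ?d = norm ((1 - z) * (\<Sum>k\<in>{n<..N}. z ^ k / of_nat k))"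
      by (simp add: norm_mult mult.commute)
    also have "\<dots> \<le> 2 / real (n + 1)" by (rule summation_by_parts_tail[OF assms that])
    finally have "norm (?s N - ?s n) \<le> 2 / real (n + 1) / ?d" using d by (simp only: pos_le_divide_eq)
    then show ?thesis by (simp only: divide_divide_eq_left)
  qed
  have "Cauchy ?s"
  proof (rule CauchyI)
    fix e :: real assume e: "e > 0"
    have "((\<lambda>n. 4 / (real (n + 1) * ?d)) \<longlongrightarrow> 0) sequentially" using d by real_asymp
    then have "eventually (\<lambda>n. 4 / (real (n + 1) * ?d) < e) sequentially" using e by (rule order_tendstoD)
    then obtain M where M: "4 / (real (M + 1) * ?d) < e" by (auto simp: eventually_sequentially)
    have "norm (?s m - ?s n) < e" if "m \<ge> M" "n \<ge> M" for m n
    proof -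
      have "norm (?s m - ?s n) \<le> norm (?s m - ?s M) + norm (?s n - ?s M)"
        using norm_triangle_ineq4[of "?s m - ?s M" "?s n - ?s M"] by simp
      also have "\<dots> \<le> 2 / (real (M + 1) * ?d) + 2 / (real (M + 1) * ?d)"
        by (intro add_mono tail that)
      also have "\<dots> < e" using M by simp
      finally show ?thesis .
    qed
    then show "\<exists>M. \<forall>m\<ge>M. \<forall>n\<ge>M. norm (?s m - ?s n) < e" by blast
  qed
  then have "convergent ?s" by (simp add: Cauchy_convergent_iff)
  then obtain l where l: "?s \<longlonglongrightarrow> l" by (auto simp: convergent_def)
  have "(\<lambda>N. ?s N - cnj (?s N)) \<longlonglongrightarrow> l - cnj l" by (intro tendsto_diff l tendsto_cnj)
  then show ?thesis unfolding sine_sum_eq by (auto simp: convergent_def)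
qed

text \<open>The tail bound degenerates as z tends to 1, so the sum is split near 1/|1 - z|. Below,
  each term is at most 2 |1 - z|, in total 2; above, summation by parts bounds the tail by 2, and
  its conjugate adds another 2.\<close>

lemma sine_sum_bounded:
  assumes z: "norm z = 1" shows "norm (sine_sum N z) \<le> 6"
proof (cases "z = 1")
  case True then show ?thesis by (simp add: sine_sum_def)
next
  case False
  let ?d = "norm (1 - z)"
  have d: "?d > 0" using False by simp
  have low: "norm (sine_sum n z) \<le> 2 * (real n * ?d)" for n
  proof -
    have "norm (sine_sum n z) \<le> (\<Sum>k\<in>{0<..n}. 2 * ?d)"
      unfolding sine_sum_def
    proof (rule sum_norm_le)
      fix k assume k: "k \<in> {0<..n}"
      have "norm (z ^ k - cnj z ^ k) = norm ((z ^ k - 1) - cnj (z ^ k - 1))" by simp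
      also have "\<dots> \<le> norm (z ^ k - 1) + norm (cnj (z ^ k - 1))" by (rule norm_triangle_ineq4)
      also have "\<dots> = 2 * norm (z ^ k - 1 ^ k)" unfolding complex_mod_cnj by simp
      also have "\<dots> \<le> 2 * (real k * norm (z - 1))"
        using norm_power_diff[of z 1 k] z by simp
      also have "norm (z - 1) = ?d" by (rule norm_minus_commute)
      finally show "norm ((z ^ k - cnj z ^ k) / of_nat k) \<le> 2 * ?d"
        using k by (simp add: norm_divide field_simps)
    qed
    then show ?thesis by simp
  qed
  define n where "n = nat \<lfloor>1 / ?d\<rfloor>"
  have n1: "real n * ?d \<le> 1"
  proof -
    have "real n \<le> 1 / ?d" using d by (simp add: n_def)
    then show ?thesis using d by (simp add: field_simps)
  qed
  have n2: "1 \<le> real (n + 1) * ?d"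
  proof -
    have "1 / ?d \<le> real (n + 1)" using d unfolding n_def by simp linarith
    then show ?thesis using d by (simp add: field_simps)
  qed
  show ?thesis
  proof (cases "N \<le> n")
    case True
    have "real N * ?d \<le> real n * ?d" using True by (intro mult_right_mono) auto
    then show ?thesis using low[of N] n1 by linarith
  next
    case False
    let ?t = "\<Sum>k\<in>{n<..N}. z ^ k / of_nat k"
    have "{0<..N} = {0<..n} \<union> {n<..N}" using False by auto
    then have eq: "sine_sum N z = sine_sum n z + (?t - cnj ?t)"
      by (simp add: sine_sum_eq sum.union_disjoint)
    have "norm (sine_sum N z) \<le> norm (sine_sum n z) + norm (?t - cnj ?t)"
      unfolding eq by (rule norm_triangle_ineq)
    also have "\<dots> \<le> norm (sine_sum n z) + (norm ?t + norm (cnj ?t))"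
      by (intro add_left_mono norm_triangle_ineq4)
    finally have "norm (sine_sum N z) \<le> norm (sine_sum n z) + (norm ?t + norm (cnj ?t))" .
    moreover have "norm ?t \<le> 2"
    proof -
      have "?d * norm ?t \<le> 2 / real (n + 1)"
        using summation_by_parts_tail[OF z, of n N] False by (simp add: norm_mult)
      then have "(real (n + 1) * ?d) * norm ?t \<le> 2" by (simp add: field_simps)
      moreover have "1 * norm ?t \<le> (real (n + 1) * ?d) * norm ?t" using n2 by (intro mult_right_mono) auto
      ultimately show ?thesis by linarith
    qed
    ultimately show ?thesis using low[of n] n1 by (simp only: complex_mod_cnj)
  qed
qed

section \<open>Symmetric partial sums of a Bernoulli spline\<close>

definition sym_interval :: "nat \<Rightarrow> int set" where
  "sym_interval N = {k. 0 < \<bar>k\<bar> \<and> \<bar>k\<bar> \<le> int N}"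

lemma finite_sym_interval [simp]: "finite (sym_interval N)"
  by (rule finite_subset[of _ "{- int N..int N}"]) (auto simp: sym_interval_def)

lemma sum_sym_interval: "(\<Sum>k\<in>sym_interval N. f k) = (\<Sum>k\<in>{0<..N}. f (int k) + f (- int k))"
proof -
  have "sym_interval N = int ` {0<..N} \<union> (\<lambda>k. - int k) ` {0<..N}"
  proof safe
    fix k assume "k \<in> sym_interval N" "k \<notin> (\<lambda>k. - int k) ` {0<..N}"
    then have "k = int (nat k) \<and> nat k \<in> {0<..N}"
      by (cases "k > 0") (auto simp: sym_interval_def image_iff dest!: bspec[of _ _ "nat (- k)"])
    then show "k \<in> int ` {0<..N}" by blast
  qed (auto simp: sym_interval_def)
  then have "(\<Sum>k\<in>sym_interval N. f k) = (\<Sum>k\<in>int ` {0<..N}. f k) + (\<Sum>k\<in>(\<lambda>k. - int k) ` {0<..N}. f k)"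
    by (simp only:) (rule sum.union_disjoint, auto)
  also have "\<dots> = (\<Sum>k\<in>{0<..N}. f (int k)) + (\<Sum>k\<in>{0<..N}. f (- int k))"
    by (subst (1 2) sum.reindex) (auto simp: inj_on_def)
  finally show ?thesis by (simp add: sum.distrib)
qed

lemma char_fun_multiple:
  "char_fun (int k *s a) x = char_fun a x ^ k" "char_fun ((- int k) *s a) x = cnj (char_fun a x) ^ k"
proof -
  show 1: "char_fun (int k *s a) x = char_fun a x ^ k"
  proof (induction k)
    case 0
    have "int 0 *s a = 0" by (simp add: vec_eq_iff)
    then show ?case by simp
  next
    case (Suc k)
    have "int (Suc k) *s a = a + int k *s a" by (simp add: vec_eq_iff distrib_right)
    then show ?case using Suc.IH by (simp only: char_fun_add power_Suc)
  qed
  have "(- int k) *s a = - (int k *s a)" by (simp add: vec_eq_iff)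
  then show "char_fun ((- int k) *s a) x = cnj (char_fun a x) ^ k" by (simp only: char_fun_minus 1 complex_cnj_power)
qed

definition bern_coeff :: "(int^'d) list \<Rightarrow> nat set \<Rightarrow> int^'d \<Rightarrow> complex" where
  "bern_coeff V U \<alpha> = (\<Prod>i\<in>U. 1 / (2 * of_real pi * \<i> * of_real (real_vec \<alpha> \<bullet> real_vec (V ! i))))"

lemma bern_term_eq: "bern_term V U x \<alpha> = bern_coeff V U \<alpha> * char_fun \<alpha> x"
  by (simp add: bern_term_def bern_coeff_def char_fun_def)

lemma bern_coeff_multiple: "bern_coeff V U (k *s a) = bern_coeff V U a / of_int k ^ card U"
proof -
  have "bern_coeff V U (k *s a) = (\<Prod>i\<in>U. 1 / (2 * of_real pi * \<i> * of_real (real_vec a \<bullet> real_vec (V ! i))) * (1 / of_int k))"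
    unfolding bern_coeff_def by (intro prod.cong refl) (simp add: real_vec_smult)
  then show ?thesis by (simp only: prod.distrib prod_constant bern_coeff_def) (simp add: power_divide)
qed

lemma inverse_square_sym_bound:
  obtains C where "C \<ge> 0" "\<And>N. (\<Sum>k\<in>sym_interval N. 1 / (of_int k)\<^sup>2) \<le> (C::real)"
proof
  let ?C = "2 * (\<Sum>n. inverse (real n ^ 2))"
  have s: "summable (\<lambda>n. inverse (real n ^ 2))" by (rule inverse_power_summable) simp
  show "?C \<ge> 0" using suminf_nonneg[OF s] by simp
  show "(\<Sum>k\<in>sym_interval N. 1 / (of_int k)\<^sup>2) \<le> ?C" for N
  proof -
    have "(\<Sum>k\<in>sym_interval N. 1 / (real_of_int k)\<^sup>2) = 2 * (\<Sum>k\<in>{0<..N}. inverse (real k ^ 2))"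
      unfolding sum_sym_interval sum_distrib_left by (intro sum.cong) (auto simp: divide_inverse)
    also have "(\<Sum>k\<in>{0<..N}. inverse (real k ^ 2)) \<le> (\<Sum>n. inverse (real n ^ 2))"
      by (rule sum_le_suminf[OF s]) auto
    finally show ?thesis by simp
  qed
qed

locale bern_setting =
  fixes V :: "(int^'d) list" and U
  assumes adm: "admissible_family V" and uni: "unimodular_family V" and U: "U \<in> Lambda V"
begin

definition partial :: "nat \<Rightarrow> real^'d \<Rightarrow> complex" where
  "partial N x = (\<Sum>k\<in>sym_interval N. bern_term V U x (k *s bern_gen V U))"

lemmas gen = bern_gen_spec[OF adm uni U]

text \<open>Treats both branches of \<open>bernoulli_spline\<close> alike: symmetric partial sums
  along the generator converge pointwise and are uniformly bounded. For \<open>rho V = 0\<close>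
  they are sine sums; otherwise the terms are at most of size 1/k^2 and the series converges
  absolutely.\<close>

lemma partial_limit_bound:
  obtains C where "C \<ge> 0" "\<And>N x. norm (partial N x) \<le> C" "\<And>x. (\<lambda>N. partial N x) \<longlonglongrightarrow> bernoulli_spline V U x"
proof (cases "rho V = 0")
  case True
  let ?a = "bern_gen V U"
  let ?c = "bern_coeff V U ?a"
  have cU: "card U = 1" using LambdaD(2)[OF U] True by simp
  \<comment> \<open>With a single vector in \<open>U\<close> the coefficient is odd in k, so the
    terms k and -k combine to a difference of conjugates.\<close>
  have eq: "partial N x = ?c * sine_sum N (char_fun ?a x)" for N x
    unfolding partial_def sum_sym_interval sine_sum_def sum_distrib_left
    by (intro sum.cong refl)
      (simp add: bern_term_eq bern_coeff_multiple cU char_fun_multiple[simplified] char_fun_multiple diff_divide_distrib right_diff_distrib)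
  have lim: "(\<lambda>N. partial N x) \<longlonglongrightarrow> bernoulli_spline V U x" for x
  proof -
    have "convergent (\<lambda>N. partial N x)"
      unfolding eq by (intro convergent_mult convergent_const sine_sum_convergent) simp
    then have "(\<lambda>N. partial N x) \<longlonglongrightarrow> lim (\<lambda>N. partial N x)" by (simp add: convergent_LIMSEQ_iff)
    then show ?thesis using True by (simp add: bernoulli_spline_def partial_def sym_interval_def)
  qed
  have "norm (partial N x) \<le> norm ?c * 6" for N x
    unfolding eq norm_mult by (intro mult_left_mono sine_sum_bounded) auto
  then show ?thesis using lim by (intro that[of "norm ?c * 6"]) auto
next
  case False
  let ?a = "bern_gen V U"
  let ?c = "bern_coeff V U ?a"
  have cU: "card U \<ge> 2" using LambdaD(2)[OF U] False by simp
  obtain C where C: "C \<ge> 0" "\<And>N. (\<Sum>k\<in>sym_interval N. 1 / (of_int k)\<^sup>2) \<le> (C::real)"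
    using inverse_square_sym_bound by blast
  have nb: "norm (bern_term V U x (k *s ?a)) \<le> norm ?c * (1 / (of_int k)\<^sup>2)" if "k \<noteq> 0" for k x
  proof -
    have "(real_of_int \<bar>k\<bar>) ^ 2 \<le> (real_of_int \<bar>k\<bar>) ^ card U"
      using that cU by (intro power_increasing) auto
    then have "1 / \<bar>real_of_int k\<bar> ^ card U \<le> 1 / (of_int k)\<^sup>2"
      using that by (intro divide_left_mono) auto
    then have "norm ?c * (1 / \<bar>real_of_int k\<bar> ^ card U) \<le> norm ?c * (1 / (of_int k)\<^sup>2)" by (intro mult_left_mono) auto
    then show ?thesis by (simp add: bern_term_eq bern_coeff_multiple norm_mult norm_divide norm_power)
  qed
  have sumb: "(\<Sum>k\<in>sym_interval N. norm (bern_term V U x (k *s ?a))) \<le> norm ?c * C" for N x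
  proof -
    have "(\<Sum>k\<in>sym_interval N. norm (bern_term V U x (k *s ?a))) \<le> (\<Sum>k\<in>sym_interval N. norm ?c * (1 / (of_int k)\<^sup>2))"
      by (intro sum_mono nb) (auto simp: sym_interval_def)
    also have "\<dots> \<le> norm ?c * C" unfolding sum_distrib_left[symmetric] by (intro mult_left_mono C) auto
    finally show ?thesis .
  qed
  have "norm (partial N x) \<le> norm ?c * C" for N x
    unfolding partial_def by (rule order_trans[OF norm_sum sumb])
  moreover have "(\<lambda>N. partial N x) \<longlonglongrightarrow> bernoulli_spline V U x" for x
  proof -
    let ?f = "\<lambda>k. bern_term V U x (k *s ?a)"
    have "(\<lambda>k. norm (?f k)) summable_on {k. k \<noteq> 0}"
    proof (rule nonneg_bdd_above_summable_on)
      have "sum (\<lambda>k. norm (?f k)) F \<le> norm ?c * C" if F: "F \<subseteq> {k. k \<noteq> 0}" "finite F" for F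
      proof -
        define N where "N = Max (insert 0 ((\<lambda>k. nat \<bar>k\<bar>) ` F))"
        have "F \<subseteq> sym_interval N"
        proof
          fix k assume "k \<in> F"
          then have "nat \<bar>k\<bar> \<le> N" unfolding N_def using F by (intro Max_ge) auto
          then show "k \<in> sym_interval N" using \<open>k \<in> F\<close> F by (auto simp: sym_interval_def)
        qed
        then have "sum (\<lambda>k. norm (?f k)) F \<le> (\<Sum>k\<in>sym_interval N. norm (?f k))" by (intro sum_mono2) auto
        then show ?thesis using sumb[where N = N and x = x] by linarith
      qed
      then show "bdd_above (sum (\<lambda>k. norm (?f k)) ` {F. F \<subseteq> {k. k \<noteq> 0} \<and> finite F})"
        by (auto simp: bdd_above_def)
    qed auto
    then have "?f summable_on {k. k \<noteq> 0}" by (rule abs_summable_summable)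
    then have "(?f has_sum infsum ?f {k. k \<noteq> 0}) {k. k \<noteq> 0}" by (rule has_sum_infsum)
    then have L: "(sum ?f \<longlongrightarrow> infsum ?f {k. k \<noteq> 0}) (finite_subsets_at_top {k. k \<noteq> 0})" by (simp add: has_sum_def)
    \<comment> \<open>The symmetric intervals exhaust the nonzero integers, so the unordered sum is
      the limit of the partial sums.\<close>
    have "filterlim sym_interval (finite_subsets_at_top {k. k \<noteq> 0}) sequentially"
      unfolding filterlim_finite_subsets_at_top
    proof (intro allI impI)
      fix X :: "int set" assume X: "finite X \<and> X \<subseteq> {k. k \<noteq> 0}"
      have "X \<subseteq> sym_interval N" if "N \<ge> Max (insert 0 ((\<lambda>k. nat \<bar>k\<bar>) ` X))" for N
      proof
        fix k assume "k \<in> X"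
        then have "nat \<bar>k\<bar> \<le> Max (insert 0 ((\<lambda>k. nat \<bar>k\<bar>) ` X))" using X by (intro Max_ge) auto
        then show "k \<in> sym_interval N" using \<open>k \<in> X\<close> X that by (auto simp: sym_interval_def)
      qed
      moreover have "sym_interval N \<subseteq> {k. k \<noteq> 0}" for N by (auto simp: sym_interval_def)
      ultimately show "eventually (\<lambda>N. finite (sym_interval N) \<and> X \<subseteq> sym_interval N \<and> sym_interval N \<subseteq> {k. k \<noteq> 0}) sequentially"
        unfolding eventually_sequentially by (intro exI[of _ "Max (insert 0 ((\<lambda>k. nat \<bar>k\<bar>) ` X))"]) auto
    qed
    from filterlim_compose[OF L this] have "(\<lambda>N. partial N x) \<longlonglongrightarrow> infsum ?f {k. k \<noteq> 0}"
      by (simp add: partial_def)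
    moreover have "infsum ?f {k. k \<noteq> 0} = bernoulli_spline V U x"
    proof -
      have "bern_index V U = (\<lambda>k. k *s ?a) ` {k. k \<noteq> 0}" using gen(2) by auto
      moreover have "inj_on (\<lambda>k. k *s ?a) {k. k \<noteq> 0}"
        using gen(1) by (auto simp: inj_on_def vec_eq_iff)
      ultimately show ?thesis using False by (simp add: bernoulli_spline_def infsum_reindex o_def)
    qed
    ultimately show ?thesis by simp
  qed
  ultimately show ?thesis using C(1) by (intro that[of "norm ?c * C"]) auto
qed

lemma partial_measurable [measurable]: "partial N \<in> borel_measurable borel"
  unfolding partial_def[abs_def] bern_term_eq by measurable

lemma bernoulli_spline_measurable: "bernoulli_spline V U \<in> borel_measurable borel"
  using partial_limit_bound by (metis borel_measurable_LIMSEQ_metric partial_measurable)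

lemma bernoulli_spline_bounded:
  obtains C where "C \<ge> 0" "\<And>x. norm (bernoulli_spline V U x) \<le> C"
proof -
  obtain C where C: "C \<ge> 0" "\<And>N x. norm (partial N x) \<le> C" "\<And>x. (\<lambda>N. partial N x) \<longlonglongrightarrow> bernoulli_spline V U x"
    using partial_limit_bound by blast
  have "norm (bernoulli_spline V U x) \<le> C" for x
    by (rule Lim_norm_ubound[OF _ C(3)[of x]]) (use C(2) in auto)
  then show ?thesis using C(1) that by blast
qed

lemma bernoulli_integral_limit:
  assumes g [measurable]: "g \<in> borel_measurable borel" and K: "\<And>x. norm (g x) \<le> K"
  shows "(\<lambda>N. LINT x:cbox 0 1|lborel. partial N x * g x) \<longlonglongrightarrow> (LINT x:cbox 0 1|lborel. bernoulli_spline V U x * g x)"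
proof -
  obtain C where C: "C \<ge> 0" "\<And>N x. norm (partial N x) \<le> C" "\<And>x. (\<lambda>N. partial N x) \<longlonglongrightarrow> bernoulli_spline V U x"
    using partial_limit_bound by blast
  note bernoulli_spline_measurable[measurable]
  show ?thesis
    unfolding set_lebesgue_integral_def
  proof (rule integral_dominated_convergence[where w = "\<lambda>x. indicator (cbox 0 1) x *\<^sub>R (C * K)"])
    show "integrable lborel (\<lambda>x::real^'d. indicator (cbox 0 1) x *\<^sub>R (C * K))"
      by (intro integrable_scaleR_left integrable_real_indicator) (use emeasure_bounded_finite[OF bounded_cbox] in auto)
    show "AE x in lborel. (\<lambda>N. indicator (cbox 0 1) x *\<^sub>R (partial N x * g x)) \<longlonglongrightarrow> indicator (cbox 0 1) x *\<^sub>R (bernoulli_spline V U x * g x)"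
      by (intro AE_I2 tendsto_intros C(3))
    show "AE x in lborel. norm (indicator (cbox 0 1) x *\<^sub>R (partial N x * g x)) \<le> indicat_real (cbox 0 1) x *\<^sub>R (C * K)" for N
      using C K by (auto simp: indicator_def norm_mult intro!: mult_mono)
  qed measurable
qed

text \<open>The coefficient at \<gamma> is constant once the partial sum has passed the index of
  \<gamma>, and dominated convergence carries it to the limit.\<close>

lemma bernoulli_fourier:
  "(LINT x:cbox 0 1|lborel. bernoulli_spline V U x * cnj (char_fun \<gamma> x)) = (if \<gamma> \<in> bern_index V U then bern_coeff V U \<gamma> else 0)"
proof -
  let ?a = "bern_gen V U"
  have i: "set_integrable lborel (cbox 0 1) (\<lambda>x. char_fun \<beta> x)" for \<beta> :: "int^'d"
    by (rule set_integrable_bounded_cube[where M = 1]) auto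
  have "(LINT x:cbox 0 1|lborel. partial N x * cnj (char_fun \<gamma> x))
      = (\<Sum>k\<in>sym_interval N. if k *s ?a = \<gamma> then bern_coeff V U \<gamma> else 0)" for N
  proof -
    have "(LINT x:cbox 0 1|lborel. partial N x * cnj (char_fun \<gamma> x))
        = (LINT x:cbox 0 1|lborel. (\<Sum>k\<in>sym_interval N. bern_coeff V U (k *s ?a) * char_fun (k *s ?a - \<gamma>) x))"
      by (simp add: partial_def bern_term_eq sum_distrib_right char_fun_diff mult.assoc)
    also have "\<dots> = (\<Sum>k\<in>sym_interval N. bern_coeff V U (k *s ?a) * (LINT x:cbox 0 1|lborel. char_fun (k *s ?a - \<gamma>) x))"
      using i by (subst set_integral_sum(1)) auto
    also have "\<dots> = (\<Sum>k\<in>sym_interval N. if k *s ?a = \<gamma> then bern_coeff V U \<gamma> else 0)"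
      by (intro sum.cong refl) (auto simp: integral_char_fun_cube)
    finally show ?thesis .
  qed
  moreover have "(\<lambda>N. \<Sum>k\<in>sym_interval N. if k *s ?a = \<gamma> then bern_coeff V U \<gamma> else 0)
      \<longlonglongrightarrow> (if \<gamma> \<in> bern_index V U then bern_coeff V U \<gamma> else 0)"
  proof (cases "\<gamma> \<in> bern_index V U")
    case True
    then obtain k0 where k0: "\<gamma> = k0 *s ?a" "k0 \<noteq> 0" using gen(2) by auto
    have inj: "k *s ?a = k0 *s ?a \<longleftrightarrow> k = k0" for k using gen(1) by (auto simp: vec_eq_iff)
    have "eventually (\<lambda>N. (\<Sum>k\<in>sym_interval N. if k *s ?a = \<gamma> then bern_coeff V U \<gamma> else 0) = bern_coeff V U \<gamma>) sequentially"
      unfolding eventually_sequentially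
    proof (intro exI[of _ "nat \<bar>k0\<bar>"] allI impI)
      fix N assume "N \<ge> nat \<bar>k0\<bar>"
      then have "k0 \<in> sym_interval N" using k0 by (auto simp: sym_interval_def)
      then show "(\<Sum>k\<in>sym_interval N. if k *s ?a = \<gamma> then bern_coeff V U \<gamma> else 0) = bern_coeff V U \<gamma>"
        unfolding k0(1) inj by (simp add: sum.delta)
    qed
    then show ?thesis using True by (simp add: tendsto_eventually)
  next
    case False
    have "k *s ?a \<noteq> \<gamma>" if "k \<in> sym_interval N" for k N
      using that False gen(2) by (auto simp: sym_interval_def)
    then have "(\<Sum>k\<in>sym_interval N. if k *s ?a = \<gamma> then bern_coeff V U \<gamma> else 0) = 0" for N
      by (intro sum.neutral) auto
    then show ?thesis using False by simp
  qed
  moreover have "(\<lambda>N. LINT x:cbox 0 1|lborel. partial N x * cnj (char_fun \<gamma> x))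
      \<longlonglongrightarrow> (LINT x:cbox 0 1|lborel. bernoulli_spline V U x * cnj (char_fun \<gamma> x))"
    by (rule bernoulli_integral_limit[where K = 1]) auto
  ultimately show ?thesis by (simp add: LIMSEQ_unique)
qed

lemma bernoulli_spline_periodic: "bernoulli_spline V U (x - real_vec \<alpha>) = bernoulli_spline V U x"
  by (simp add: bernoulli_spline_def bern_term_eq cong: if_cong)

lemma bernoulli_set_integrable: "set_integrable lborel (cbox 0 1) (bernoulli_spline V U)"
  using bernoulli_spline_bounded by (metis AE_I2 bernoulli_spline_measurable set_integrable_bounded_cube)

end

text \<open>Only one factor is replaced by partial sums. These are finite combinations of
  frequencies belonging to \<open>U'\<close>, at which the spline of \<open>U\<close> has
  coefficient 0; the uniform bound permits the limit.\<close>

lemma bernoulli_orthogonal: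
  fixes V :: "(int^'d) list"
  assumes adm: "admissible_family V" and uni: "unimodular_family V" and U: "U \<in> Lambda V" "U' \<in> Lambda V" "U \<noteq> U'"
  shows "(LINT x:cbox 0 1|lborel. bernoulli_spline V U x * cnj (bernoulli_spline V U' x)) = 0"
proof -
  interpret A: bern_setting V U by unfold_locales (use assms in auto)
  interpret B: bern_setting V U' by unfold_locales (use assms in auto)
  obtain C where C: "\<And>x. norm (bernoulli_spline V U x) \<le> C" using A.bernoulli_spline_bounded by blast
  note [measurable] = A.bernoulli_spline_measurable
  have z: "(LINT x:cbox 0 1|lborel. B.partial N x * cnj (bernoulli_spline V U x)) = 0" for N
  proof -
    have disj: "k *s bern_gen V U' \<notin> bern_index V U" if "k \<in> sym_interval N" for k
    proof
      assume "k *s bern_gen V U' \<in> bern_index V U"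
      moreover have "k *s bern_gen V U' \<in> bern_index V U'" using that B.gen(2) by (auto simp: sym_interval_def)
      ultimately show False using bern_index_active[OF adm] U by metis
    qed
    have i: "set_integrable lborel (cbox 0 1) (\<lambda>x. char_fun \<beta> x * cnj (bernoulli_spline V U x))" for \<beta>
      by (rule set_integrable_bounded_cube[where M = C]) (use C in \<open>auto simp: norm_mult\<close>)
    have zk: "(LINT x:cbox 0 1|lborel. char_fun (k *s bern_gen V U') x * cnj (bernoulli_spline V U x)) = 0" if "k \<in> sym_interval N" for k
    proof -
      have "(LINT x:cbox 0 1|lborel. char_fun (k *s bern_gen V U') x * cnj (bernoulli_spline V U x))
          = cnj (LINT x:cbox 0 1|lborel. bernoulli_spline V U x * cnj (char_fun (k *s bern_gen V U') x))"
        unfolding set_lebesgue_integral_def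
        by (subst Bochner_Integration.integral_cnj[symmetric]) (simp add: mult.commute)
      then show ?thesis using disj[OF that] by (simp add: A.bernoulli_fourier)
    qed
    have "(LINT x:cbox 0 1|lborel. B.partial N x * cnj (bernoulli_spline V U x))
      = (LINT x:cbox 0 1|lborel. (\<Sum>k\<in>sym_interval N. bern_coeff V U' (k *s bern_gen V U') * (char_fun (k *s bern_gen V U') x * cnj (bernoulli_spline V U x))))"
      by (simp add: B.partial_def bern_term_eq sum_distrib_right mult.assoc)
    also have "\<dots> = (\<Sum>k\<in>sym_interval N. bern_coeff V U' (k *s bern_gen V U') * (LINT x:cbox 0 1|lborel. char_fun (k *s bern_gen V U') x * cnj (bernoulli_spline V U x)))"
      using i by (subst set_integral_sum(1)) auto
    finally show ?thesis using zk by simp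
  qed
  have "(\<lambda>N. LINT x:cbox 0 1|lborel. B.partial N x * cnj (bernoulli_spline V U x))
      \<longlonglongrightarrow> (LINT x:cbox 0 1|lborel. bernoulli_spline V U' x * cnj (bernoulli_spline V U x))"
    by (rule B.bernoulli_integral_limit[where K = C]) (use C in auto)
  then have "(LINT x:cbox 0 1|lborel. bernoulli_spline V U' x * cnj (bernoulli_spline V U x)) = 0"
    using z by (simp add: LIMSEQ_const_iff)
  moreover have "(LINT x:cbox 0 1|lborel. bernoulli_spline V U x * cnj (bernoulli_spline V U' x))
      = cnj (LINT x:cbox 0 1|lborel. bernoulli_spline V U' x * cnj (bernoulli_spline V U x))"
    unfolding set_lebesgue_integral_def
    by (subst Bochner_Integration.integral_cnj[symmetric]) (simp add: mult.commute)
  ultimately show ?thesis by simp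
qed

section \<open>Multi-indices\<close>

definition mi_pow :: "real^'d \<Rightarrow> nat^'d \<Rightarrow> real" where
  "mi_pow x \<beta> = (\<Prod>j\<in>UNIV. (x $ j) ^ (\<beta> $ j))"

lemma mono_fun_eq: "mono_fun \<beta> x = of_real (mi_pow x \<beta>)"
  by (simp add: mono_fun_def mi_pow_def)

text \<open>A word of coordinates is an ordered multi-index. Products of n linear forms and iterated
  derivatives expand over words, and the fibres of this map are counted by multinomial
  coefficients.\<close>

definition mi_list :: "'d list \<Rightarrow> nat^'d" where
  "mi_list \<sigma> = (\<chi> j. count_list \<sigma> j)"

definition lists_of :: "nat \<Rightarrow> 'd::finite list set" where
  "lists_of n = {\<sigma>. length \<sigma> = n}"

lemma finite_lists_of [simp]: "finite (lists_of n :: 'd::finite list set)"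
  using finite_lists_length_eq[of "UNIV :: 'd set" n] by (simp add: lists_of_def)

lemma mi_list_simps [simp]: "mi_list [] = 0" "mi_list (j # \<sigma>) = mi_list \<sigma> + axis j 1"
  by (auto simp: mi_list_def vec_eq_iff axis_def)

lemma sum_lists_of_Suc:
  fixes f :: "'d::finite list \<Rightarrow> 'b::comm_monoid_add"
  shows "(\<Sum>\<sigma>\<in>lists_of (Suc n). f \<sigma>) = (\<Sum>j\<in>UNIV. \<Sum>\<sigma>\<in>lists_of n. f (j # \<sigma>))"
proof -
  have "lists_of (Suc n) = (\<lambda>(j, \<sigma>). j # \<sigma>) ` (UNIV \<times> (lists_of n :: 'd list set))"
    by (auto simp: lists_of_def length_Suc_conv image_iff)
  then have "(\<Sum>\<sigma>\<in>lists_of (Suc n). f \<sigma>) = (\<Sum>p\<in>UNIV \<times> lists_of n. f (fst p # snd p))"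
    by (simp only:) (subst sum.reindex, auto simp: inj_on_def case_prod_unfold)
  then show ?thesis by (simp add: sum.cartesian_product case_prod_unfold)
qed

lemma lists_of_0 [simp]: "lists_of 0 = {[]}"
  by (auto simp: lists_of_def)

lemma mi_abs_mi_list: "\<sigma> \<in> lists_of n \<Longrightarrow> mi_abs (mi_list \<sigma>) = n"
proof (induction \<sigma> arbitrary: n)
  case (Cons j \<sigma>)
  then have "mi_abs (mi_list \<sigma>) = n - 1" "n > 0" by (auto simp: lists_of_def)
  moreover have "mi_abs (mi_list \<sigma> + axis j 1) = mi_abs (mi_list \<sigma>) + 1"
    by (simp add: mi_abs_def sum.distrib axis_def)
  ultimately show ?case by simp
qed (simp add: lists_of_def mi_abs_def)

lemma mi_pow_list: "mi_pow x (mi_list \<sigma>) = (\<Prod>j\<leftarrow>\<sigma>. x $ j)"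
proof (induction \<sigma>)
  case (Cons j \<sigma>)
  have "mi_pow x (mi_list \<sigma> + axis j 1) = mi_pow x (mi_list \<sigma>) * (\<Prod>i\<in>UNIV. if i = j then x $ i else 1)"
    unfolding mi_pow_def prod.distrib[symmetric] by (intro prod.cong refl) (simp add: axis_def)
  then show ?case using Cons by (simp add: mult.commute)
qed (simp add: mi_pow_def)

lemma finite_mi_abs [simp]: "finite {\<beta>::nat^'d. mi_abs \<beta> = n}"
proof (rule finite_subset)
  show "finite {\<beta>::nat^'d. \<forall>j. \<beta> $ j \<in> {..n}}" by (rule finite_vec_components) simp
  show "{\<beta>::nat^'d. mi_abs \<beta> = n} \<subseteq> {\<beta>. \<forall>j. \<beta> $ j \<in> {..n}}"
  proof safe
    fix \<beta> :: "nat^'d" and j assume "n = mi_abs \<beta>"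
    then show "\<beta> $ j \<le> mi_abs \<beta>" unfolding mi_abs_def by (intro member_le_sum) auto
  qed
qed

text \<open>The words with multi-index \<beta> are the permutations of the multiset in which j
  occurs \<beta>_j times.\<close>

lemma card_mi_list_fibre:
  fixes \<beta> :: "nat^'d"
  assumes "mi_abs \<beta> = n"
  shows "real (card {\<sigma> \<in> lists_of n. mi_list \<sigma> = \<beta>}) = fact n / real (mi_fact \<beta>)"
proof -
  define A where "A = (\<Sum>j\<in>(UNIV::'d set). replicate_mset (\<beta> $ j) j)"
  have cA: "count A j = \<beta> $ j" for j
    by (simp add: A_def count_sum)
  have sA: "size A = n" using assms by (simp add: A_def size_multiset_sum mi_abs_def)
  have "{\<sigma> \<in> lists_of n. mi_list \<sigma> = \<beta>} = permutations_of_multiset A"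
  proof safe
    fix \<sigma> :: "'d list"
    show "\<sigma> \<in> permutations_of_multiset A" if "\<beta> = mi_list \<sigma>"
      using that by (auto simp: permutations_of_multiset_def multiset_eq_iff cA mi_list_def count_mset count_list_eq_length_filter)
    assume "\<sigma> \<in> permutations_of_multiset A"
    then have m: "mset \<sigma> = A" by (simp add: permutations_of_multiset_def)
    then show "\<sigma> \<in> lists_of n" using sA by (metis lists_of_def mem_Collect_eq size_mset)
    show "mi_list \<sigma> = \<beta>" using m cA by (auto simp: mi_list_def vec_eq_iff count_mset count_list_eq_length_filter)
  qed
  moreover have "real (card (permutations_of_multiset A)) = fact n / real (\<Prod>x\<in>set_mset A. fact (count A x))"
    unfolding card_permutations_of_multiset(1) sA
    using card_permutations_of_multiset(2)[of A] by (simp add: real_of_nat_div sA)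
  moreover have "(\<Prod>x\<in>set_mset A. fact (count A x)) = mi_fact \<beta>"
  proof -
    have "(\<Prod>x\<in>set_mset A. fact (count A x)) = (\<Prod>x\<in>UNIV. fact (count A x) :: nat)"
      by (rule prod.mono_neutral_left) (auto simp: not_in_iff)
    then show ?thesis by (simp add: mi_fact_def cA)
  qed
  ultimately show ?thesis by simp
qed

lemma multinomial:
  fixes h x :: "real^'d"
  shows "(h \<bullet> x) ^ n / fact n = (\<Sum>\<beta> | mi_abs \<beta> = n. mi_pow h \<beta> / real (mi_fact \<beta>) * mi_pow x \<beta>)"
proof -
  have pw: "(\<Sum>j\<in>UNIV. a j) ^ n = (\<Sum>\<sigma>\<in>lists_of n. \<Prod>j\<leftarrow>\<sigma>. a j)" for a :: "'d \<Rightarrow> real"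
  proof (induction n)
    case (Suc n)
    then show ?case
      by (simp add: sum_lists_of_Suc sum_distrib_left sum_distrib_right) (rule sum.swap)
  qed simp
  have pl: "(\<Prod>j\<leftarrow>\<sigma>. h $ j * x $ j) = (\<Prod>j\<leftarrow>\<sigma>. h $ j) * (\<Prod>j\<leftarrow>\<sigma>. x $ j)" for \<sigma>
    by (induction \<sigma>) auto
  have "(h \<bullet> x) ^ n = (\<Sum>\<sigma>\<in>lists_of n. mi_pow h (mi_list \<sigma>) * mi_pow x (mi_list \<sigma>))"
    unfolding inner_vec_def pw mi_pow_list by (simp add: pl)
  also have "\<dots> = (\<Sum>\<beta> | mi_abs \<beta> = n. \<Sum>\<sigma>\<in>{\<sigma> \<in> lists_of n. mi_list \<sigma> = \<beta>}. mi_pow h (mi_list \<sigma>) * mi_pow x (mi_list \<sigma>))"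
    by (rule sum.group[symmetric]) (auto simp: mi_abs_mi_list)
  also have "\<dots> = (\<Sum>\<beta> | mi_abs \<beta> = n. real (card {\<sigma> \<in> lists_of n. mi_list \<sigma> = \<beta>}) * (mi_pow h \<beta> * mi_pow x \<beta>))"
    by (intro sum.cong refl) simp
  also have "\<dots> = (\<Sum>\<beta> | mi_abs \<beta> = n. fact n / real (mi_fact \<beta>) * (mi_pow h \<beta> * mi_pow x \<beta>))"
    by (intro sum.cong refl) (simp add: card_mi_list_fibre)
  finally show ?thesis by (simp add: sum_divide_distrib)
qed

lemma abs_mi_pow_le: "\<bar>mi_pow x \<beta>\<bar> \<le> (1 + norm x) ^ mi_abs \<beta>"
proof -
  have "\<bar>mi_pow x \<beta>\<bar> = (\<Prod>j\<in>UNIV. \<bar>x $ j\<bar> ^ (\<beta> $ j))"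
    by (simp add: mi_pow_def abs_prod power_abs)
  also have "\<dots> \<le> (\<Prod>j\<in>UNIV. (1 + norm x) ^ (\<beta> $ j))"
    using component_le_norm_cart[of x] by (intro prod_mono conjI power_mono) (auto intro: add_increasing)
  also have "\<dots> = (1 + norm x) ^ mi_abs \<beta>" by (simp add: mi_abs_def power_sum)
  finally show ?thesis .
qed

lemma mi_pow_measurable [measurable]: "(\<lambda>x. mi_pow x \<beta>) \<in> borel_measurable borel"
  unfolding mi_pow_def by (intro borel_measurable_continuous_onI continuous_intros)

text \<open>The exponents are the place values of base n + 1. A monomial of degree n in these
  coordinates becomes a power of t whose exponent has the digits \<beta>_j \<le> n.\<close>

definition kronecker_point :: "nat \<Rightarrow> nat \<Rightarrow> real^'d" where
  "kronecker_point n t = (\<chi> j. real t ^ ((n + 1) ^ to_nat j))"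

definition kronecker_weight :: "nat \<Rightarrow> nat^'d \<Rightarrow> nat" where
  "kronecker_weight n \<beta> = (\<Sum>j\<in>UNIV. (n + 1) ^ to_nat j * \<beta> $ j)"

lemma mi_pow_kronecker: "mi_pow (kronecker_point n t) \<beta> = real t ^ kronecker_weight n \<beta>"
  by (simp add: mi_pow_def kronecker_point_def kronecker_weight_def power_sum power_mult)

text \<open>Uniqueness of digits in base n + 1: at the lowest position where two multi-indices
  differ, the difference would be divisible by n + 1 and yet smaller in absolute value.\<close>

lemma inj_kronecker_weight: "inj_on (kronecker_weight n) {\<beta>::nat^'d. mi_abs \<beta> = n}"
proof (rule inj_onI, rule ccontr)
  fix \<beta> \<beta>' :: "nat^'d"
  assume b: "\<beta> \<in> {\<beta>. mi_abs \<beta> = n}" "\<beta>' \<in> {\<beta>. mi_abs \<beta> = n}"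
    and w: "kronecker_weight n \<beta> = kronecker_weight n \<beta>'" and ne: "\<beta> \<noteq> \<beta>'"
  define B where "B = int (n + 1)"
  define D where "D j = int (\<beta> $ j) - int (\<beta>' $ j)" for j
  have le: "\<beta> $ j \<le> n" "\<beta>' $ j \<le> n" for j
    using b member_le_sum[of j UNIV "\<lambda>j. \<beta> $ j"] member_le_sum[of j UNIV "\<lambda>j. \<beta>' $ j"] by (auto simp: mi_abs_def)
  obtain j1 where "D j1 \<noteq> 0" using ne by (auto simp: vec_eq_iff D_def)
  then obtain j0 where j0: "D j0 \<noteq> 0" "\<And>j. D j \<noteq> 0 \<Longrightarrow> to_nat j0 \<le> to_nat j"
    using ex_has_least_nat[of "\<lambda>j. D j \<noteq> 0" j1 to_nat] by blast
  have "(\<Sum>j\<in>UNIV. B ^ to_nat j * D j) = int (kronecker_weight n \<beta>) - int (kronecker_weight n \<beta>')"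
    by (simp add: kronecker_weight_def D_def B_def right_diff_distrib sum_subtractf)
  then have "0 = (\<Sum>j\<in>UNIV. B ^ to_nat j * D j)" using w by simp
  also have "\<dots> = B ^ to_nat j0 * D j0 + (\<Sum>j\<in>UNIV - {j0}. B ^ to_nat j * D j)"
    by (rule sum.remove) auto
  finally have eq: "B ^ to_nat j0 * D j0 = - (\<Sum>j\<in>UNIV - {j0}. B ^ to_nat j * D j)" by linarith
  have "B ^ (to_nat j0 + 1) dvd (\<Sum>j\<in>UNIV - {j0}. B ^ to_nat j * D j)"
  proof (rule dvd_sum)
    fix j assume j: "j \<in> UNIV - {j0}"
    show "B ^ (to_nat j0 + 1) dvd B ^ to_nat j * D j"
    proof (cases "D j = 0")
      case False
      then have "to_nat j0 \<le> to_nat j" by (rule j0(2))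
      moreover have "to_nat j \<noteq> to_nat j0" using j by simp
      ultimately have "to_nat j0 + 1 \<le> to_nat j" by linarith
      then show ?thesis by (intro dvd_mult2 le_imp_power_dvd)
    qed simp
  qed
  then have "B ^ (to_nat j0 + 1) dvd B ^ to_nat j0 * D j0" unfolding eq by simp
  moreover have "B \<noteq> 0" by (simp add: B_def)
  ultimately have "B dvd D j0" by simp
  moreover have "\<bar>D j0\<bar> < B" using le[of j0] by (simp add: D_def B_def)
  ultimately have "D j0 = 0" using zdvd_imp_le[of B "\<bar>D j0\<bar>"] by force
  then show False using j0(1) by simp
qed

text \<open>Kronecker substitution turns distinct monomials of degree \<open>n\<close> into distinct powers of
  one variable.\<close>

lemma homogeneous_coeffs_zero:
  fixes c :: "nat^'d \<Rightarrow> complex"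
  assumes zero: "\<And>t. (\<Sum>\<beta> | mi_abs \<beta> = n. of_real (mi_pow (kronecker_point n t) \<beta>) * c \<beta>) = 0"
    and \<beta>: "mi_abs \<beta> = n"
  shows "c \<beta> = 0"
proof -
  let ?w = "kronecker_weight n :: nat^'d \<Rightarrow> nat"
  define p where "p = (\<Sum>\<beta> | mi_abs \<beta> = n. monom (c \<beta>) (?w \<beta>))"
  have "poly p (of_nat t) = 0" for t
    using zero[of t] by (simp add: p_def poly_sum poly_monom mi_pow_kronecker mult.commute)
  then have "range of_nat \<subseteq> {z. poly p z = 0}" by auto
  moreover have "infinite (range (of_nat :: nat \<Rightarrow> complex))" by (rule range_inj_infinite) (rule inj_of_nat)
  ultimately have "p = 0" using poly_roots_finite finite_subset by metis
  then have "0 = poly.coeff p (?w \<beta>)" by simp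
  also have "\<dots> = (\<Sum>\<beta>' | mi_abs \<beta>' = n. if \<beta>' = \<beta> then c \<beta>' else 0)"
    unfolding p_def coeff_sum coeff_monom
    by (intro sum.cong refl) (use inj_kronecker_weight[of n] \<beta> in \<open>auto dest: inj_onD\<close>)
  also have "\<dots> = c \<beta>" using \<beta> by simp
  finally show ?thesis by simp
qed

section \<open>The projection of a monomial\<close>

lemma fourier_eq:
  fixes F G :: "real^'d \<Rightarrow> complex"
  assumes F: "set_integrable lborel (cbox 0 1) F" and G: "set_integrable lborel (cbox 0 1) G"
    and eq: "\<And>\<gamma>. (LINT x:cbox 0 1|lborel. F x * cnj (char_fun \<gamma> x)) = (LINT x:cbox 0 1|lborel. G x * cnj (char_fun \<gamma> x))"
    and per: "\<And>x \<alpha>. F (x - real_vec \<alpha>) = F x" "\<And>x \<alpha>. G (x - real_vec \<alpha>) = G x"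
  shows "AE x in lborel. F x = G x"
proof (rule AE_periodic)
  have i: "set_integrable lborel (cbox 0 1) (\<lambda>x. H x * cnj (char_fun \<gamma> x))"
    if "set_integrable lborel (cbox 0 1) H" for H :: "real^'d \<Rightarrow> complex" and \<gamma>
    using that unfolding set_integrable_def
  proof (rule Bochner_Integration.integrable_bound)
    have "(\<lambda>x. (indicator (cbox 0 1) x *\<^sub>R H x) * cnj (char_fun \<gamma> x)) \<in> borel_measurable lborel"
      using that unfolding set_integrable_def by (intro borel_measurable_times borel_measurable_cnj) auto
    then show "(\<lambda>x. indicator (cbox 0 1) x *\<^sub>R (H x * cnj (char_fun \<gamma> x))) \<in> borel_measurable lborel"
      by simp
  qed (simp add: norm_mult)
  have "AE x in lborel. x \<in> cbox 0 1 \<longrightarrow> F x - G x = 0"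
  proof (rule fourier_unique)
    show "set_integrable lborel (cbox 0 1) (\<lambda>x. F x - G x)" using F G by (rule set_integral_diff)
    show "(LINT x:cbox 0 1|lborel. (F x - G x) * char_fun \<gamma> x) = 0" for \<gamma>
    proof -
      have "(LINT x:cbox 0 1|lborel. (F x - G x) * cnj (char_fun (- \<gamma>) x))
        = (LINT x:cbox 0 1|lborel. F x * cnj (char_fun (- \<gamma>) x)) - (LINT x:cbox 0 1|lborel. G x * cnj (char_fun (- \<gamma>) x))"
        unfolding left_diff_distrib by (intro set_integral_diff(2) i F G)
      then show ?thesis using eq[of "- \<gamma>"] by (simp add: char_fun_minus)
    qed
  qed
  then show "AE x in lborel. x \<in> cbox 0 1 \<longrightarrow> F x = G x" by eventually_elim simp
qed (simp add: per)

section \<open>The periodised exponential and its normalised coefficients\<close>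

context spline_setting
begin

text \<open>Periodised box spline with the factor \<open>e^{-z h \<bullet> y}\<close>, as a power series in \<open>z\<close>. Its Fourier
  coefficients are products of \<open>edge_fps\<close>, so multiplying by \<open>todd_fps\<close> makes all of them with
  \<open>\<gamma> \<noteq> 0\<close> divisible by \<open>z ^ (rho V + 1)\<close>.\<close>

definition per_fps :: "real^'d \<Rightarrow> real^'d \<Rightarrow> complex fps" where
  "per_fps h x = (\<Sum>\<alpha>\<in>near (norm x). fps_const (of_real (b (x - real_vec \<alpha>))) * fps_exp (of_real (- (h \<bullet> (x - real_vec \<alpha>)))))"

lemma per_fps_eq:
  assumes "finite A" "\<And>\<alpha>. b (x - real_vec \<alpha>) \<noteq> 0 \<Longrightarrow> \<alpha> \<in> A"
  shows "per_fps h x = (\<Sum>\<alpha>\<in>A. fps_const (of_real (b (x - real_vec \<alpha>))) * fps_exp (of_real (- (h \<bullet> (x - real_vec \<alpha>)))))"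
  unfolding per_fps_def
proof (rule sum.mono_neutral_cong)
  fix \<alpha>
  show "fps_const (of_real (b (x - real_vec \<alpha>))) * fps_exp (of_real (- (h \<bullet> (x - real_vec \<alpha>)))) = (0 :: complex fps)"
    if "\<alpha> \<in> A - near (norm x)"
  proof -
    have "b (x - real_vec \<alpha>) = 0" using that nearI[OF order_refl, of x \<alpha>] by auto
    then show ?thesis by simp
  qed
  show "fps_const (of_real (b (x - real_vec \<alpha>))) * fps_exp (of_real (- (h \<bullet> (x - real_vec \<alpha>)))) = (0 :: complex fps)"
    if "\<alpha> \<in> near (norm x) - A"
  proof -
    have "b (x - real_vec \<alpha>) = 0" using that assms(2)[of \<alpha>] by auto
    then show ?thesis by simp
  qed
qed (use assms in auto)

definition box_mom :: "real^'d \<Rightarrow> nat \<Rightarrow> real^'d \<Rightarrow> complex" where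
  "box_mom h j y = b y *\<^sub>R of_real ((- (h \<bullet> y)) ^ j / fact j)"

lemma per_fps_nth:
  assumes "finite A" "\<And>\<alpha>. b (x - real_vec \<alpha>) \<noteq> 0 \<Longrightarrow> \<alpha> \<in> A"
  shows "fps_nth (per_fps h x) j = (\<Sum>\<alpha>\<in>A. box_mom h j (x - real_vec \<alpha>))"
proof -
  have eq: "per_fps h x = (\<Sum>\<alpha>\<in>A. fps_const (of_real (b (x - real_vec \<alpha>))) * fps_exp (of_real (- (h \<bullet> (x - real_vec \<alpha>)))))"
    by (rule per_fps_eq) (use assms in auto)
  show ?thesis unfolding eq by (simp add: fps_sum_nth box_mom_def scaleR_conv_of_real)
qed

lemma per_fps_periodic: "per_fps h (x - real_vec \<beta>) = per_fps h x"
proof -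
  let ?A = "near (norm (x - real_vec \<beta>))"
  have "per_fps h x = (\<Sum>\<alpha>\<in>(\<lambda>\<alpha>. \<beta> + \<alpha>) ` ?A. fps_const (of_real (b (x - real_vec \<alpha>))) * fps_exp (of_real (- (h \<bullet> (x - real_vec \<alpha>)))))"
  proof (rule per_fps_eq)
    fix \<alpha> assume nz: "b (x - real_vec \<alpha>) \<noteq> 0"
    have "\<alpha> - \<beta> \<in> ?A" using nz nearI[OF order_refl, of "x - real_vec \<beta>" "\<alpha> - \<beta>"] by (simp add: real_vec_diff)
    then show "\<alpha> \<in> (\<lambda>\<alpha>. \<beta> + \<alpha>) ` ?A" by (auto simp: image_iff intro!: bexI[of _ "\<alpha> - \<beta>"])
  qed simp
  also have "\<dots> = per_fps h (x - real_vec \<beta>)"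
    unfolding per_fps_def by (subst sum.reindex) (auto simp: inj_on_def real_vec_add diff_diff_eq)
  finally show ?thesis ..
qed

lemma box_mom_measurable [measurable]: "box_mom h j \<in> borel_measurable borel"
proof -
  have "(\<lambda>y. complex_of_real ((- (h \<bullet> y)) ^ j / fact j)) \<in> borel_measurable borel"
    by (intro borel_measurable_continuous_onI) (auto intro!: continuous_intros)
  then show ?thesis unfolding box_mom_def[abs_def] by (intro borel_measurable_scaleR meas)
qed

lemma box_mom_integrable: "integrable lborel (box_mom h j)"
proof (rule Bochner_Integration.integrable_bound)
  let ?C = "(norm h * \<bar>R\<bar>) ^ j / fact j"
  show "integrable lborel (\<lambda>y. b y * ?C)" using integrable_b by auto
  have "norm (box_mom h j y) \<le> norm (b y * ?C)" for y
  proof (cases "b y = 0")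
    case False
    have "\<bar>h \<bullet> y\<bar> \<le> norm h * norm y" by (rule Cauchy_Schwarz_ineq2)
    also have "\<dots> \<le> norm h * \<bar>R\<bar>" using supp[OF False] by (intro mult_left_mono) auto
    finally have "\<bar>h \<bullet> y\<bar> ^ j \<le> (norm h * \<bar>R\<bar>) ^ j" by (intro power_mono) auto
    then have "\<bar>h \<bullet> y\<bar> ^ j / fact j \<le> ?C" by (intro divide_right_mono) auto
    then have "\<bar>b y\<bar> * (\<bar>h \<bullet> y\<bar> ^ j / fact j) \<le> \<bar>b y\<bar> * ?C" by (intro mult_left_mono) auto
    moreover have "norm (box_mom h j y) = \<bar>b y\<bar> * (\<bar>h \<bullet> y\<bar> ^ j / fact j)"
      by (simp only: box_mom_def norm_scaleR norm_of_real) (simp add: power_abs)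
    moreover have "norm (b y * ?C) = \<bar>b y\<bar> * ?C" by (simp add: abs_mult power_abs)
    ultimately show ?thesis by linarith
  qed (simp add: box_mom_def)
  then show "AE y in lborel. norm (box_mom h j y) \<le> norm (b y * ?C)" by simp
qed measurable

text \<open>Characters are invariant under integer shifts, so tiling turns the coefficient over the
  cube into a moment of \<open>b\<close> over R^d.\<close>

lemma per_fps_fourier:
  shows "(LINT x:cbox 0 1|lborel. fps_nth (per_fps h x) j * cnj (char_fun \<gamma> x))
    = fps_nth (\<Prod>i<length V. edge_fps (h \<bullet> real_vec (V ! i)) (real_vec \<gamma> \<bullet> real_vec (V ! i))) j" (is ?I)
  and "set_integrable lborel (cbox 0 1) (\<lambda>x. fps_nth (per_fps h x) j * cnj (char_fun \<gamma> x))" (is ?J)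
proof -
  let ?G = "\<lambda>y. box_mom h j y * cnj (char_fun \<gamma> y)"
  let ?A = "near (CARD('d))"
  have iG: "integrable lborel ?G"
    by (rule Bochner_Integration.integrable_bound[OF box_mom_integrable[of h j]]) (auto simp: norm_mult)
  have eq: "fps_nth (per_fps h x) j * cnj (char_fun \<gamma> x) = (\<Sum>\<alpha>\<in>?A. ?G (x - real_vec \<alpha>))" if "x \<in> cbox 0 1" for x
    by (subst per_fps_nth[of ?A]) (auto intro: nearI_cube[OF that] simp: sum_distrib_right)
  have "(LINT x:cbox 0 1|lborel. fps_nth (per_fps h x) j * cnj (char_fun \<gamma> x)) = (LINT x:cbox 0 1|lborel. (\<Sum>\<alpha>\<in>?A. ?G (x - real_vec \<alpha>)))"
    by (rule set_lebesgue_integral_cong) (use eq in auto)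
  also have "\<dots> = (LINT y|lborel. ?G y)"
  proof (rule integral_tiling[symmetric, OF iG])
    show "\<alpha> \<in> ?A" if "x \<in> cbox 0 1" "?G (x - real_vec \<alpha>) \<noteq> 0" for x \<alpha>
      by (rule nearI_cube[OF that(1)]) (use that(2) in \<open>auto simp: box_mom_def\<close>)
  qed simp
  also have "\<dots> = (LINT y|lborel. b y *\<^sub>R (of_real ((- (h \<bullet> y)) ^ j / fact j) * cis (- 2 * pi * (real_vec \<gamma> \<bullet> y))))"
    by (simp add: box_mom_def char_fun_cis cis_cnj)
  finally show ?I by (simp only: box_moment)
  have "set_integrable lborel (cbox 0 1) (\<lambda>x. \<Sum>\<alpha>\<in>?A. ?G (x - real_vec \<alpha>))"
    unfolding set_integrable_def
    by (intro integrable_mult_indicator Bochner_Integration.integrable_sum lborel_integrable_shift iG) auto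
  then show ?J by (subst set_integrable_cong[OF refl refl eq]) auto
qed

text \<open>The z^m coefficient of the periodised box spline after division by its mean
  value.\<close>

definition resid :: "real^'d \<Rightarrow> nat \<Rightarrow> real^'d \<Rightarrow> complex" where
  "resid h m x = fps_nth (todd_fps V h * per_fps h x) m"

lemma resid_fourier:
  "(LINT x:cbox 0 1|lborel. resid h m x * cnj (char_fun \<gamma> x))
    = fps_nth (todd_fps V h * (\<Prod>i<length V. edge_fps (h \<bullet> real_vec (V ! i)) (real_vec \<gamma> \<bullet> real_vec (V ! i)))) m" (is ?A)
  and resid_set_integrable: "set_integrable lborel (cbox 0 1) (resid h m)" (is ?B)
proof -
  have eq: "resid h m x * c = (\<Sum>i=0..m. fps_nth (todd_fps V h) i * (fps_nth (per_fps h x) (m - i) * c))" for x c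
    by (simp add: resid_def fps_mult_nth sum_distrib_right mult.assoc)
  show ?A unfolding eq
    by (subst set_integral_sum(1)) (auto intro!: set_integrable_mult_right per_fps_fourier(2) simp: per_fps_fourier(1) fps_mult_nth)
  have "set_integrable lborel (cbox 0 1) (\<lambda>x. resid h m x * cnj (char_fun 0 x))"
    unfolding eq by (intro set_integral_sum(2) set_integrable_mult_right per_fps_fourier(2))
  then show ?B by simp
qed

lemma resid_periodic: "resid h m (x - real_vec \<alpha>) = resid h m x"
  by (simp add: resid_def per_fps_periodic)

lemma todd_fps_zero: "todd_fps V h * (\<Prod>i<length V. edge_fps (h \<bullet> real_vec (V ! i)) 0) = 1"
proof -
  have n0: "fps_nth (\<Prod>i\<in>I. F i) 0 = (\<Prod>i\<in>I. fps_nth (F i) 0)" for F :: "nat \<Rightarrow> complex fps" and I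
    by (induction I rule: infinite_finite_induct) auto
  show ?thesis unfolding todd_fps_def by (rule inverse_mult_eq_1) (simp add: n0 edge_fps_nth_0)
qed

text \<open>For \<gamma> \<noteq> 0 at least \<open>rho V + 1\<close> vectors are active, so all
  coefficients up to order \<open>rho V\<close> vanish, and the mean is the series 1. In effect
  these are the Strang-Fix conditions.\<close>

lemma resid_low:
  assumes m: "m \<le> rho V" shows "AE x in lborel. resid h m x = (if m = 0 then 1 else 0)"
proof (rule fourier_eq[OF resid_set_integrable])
  show "set_integrable lborel (cbox 0 1) (\<lambda>x::real^'d. if m = 0 then 1 else 0 :: complex)"
    by (rule set_integrable_bounded_cube[where M = 1]) auto
  show "(LINT x:cbox 0 1|lborel. resid h m x * cnj (char_fun \<gamma> x)) = (LINT x:cbox 0 1|lborel. (if m = 0 then 1 else 0) * cnj (char_fun \<gamma> x))" for \<gamma>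
  proof -
    have "(LINT x:cbox 0 1|lborel. (if m = 0 then 1 else 0) * cnj (char_fun \<gamma> x)) = (if m = 0 \<and> \<gamma> = 0 then 1 else 0)"
      using integral_char_fun_cube[of "- \<gamma>"] by (simp add: char_fun_minus set_lebesgue_integral_def)
    moreover have "fps_nth (todd_fps V h * (\<Prod>i<length V. edge_fps (h \<bullet> real_vec (V ! i)) (real_vec \<gamma> \<bullet> real_vec (V ! i)))) m = (if m = 0 \<and> \<gamma> = 0 then 1 else 0)"
    proof (cases "\<gamma> = 0")
      case True then show ?thesis by (simp add: todd_fps_zero)
    next
      case False
      then have "m < card (active V \<gamma>)" using card_active[OF adm False] m by simp
      then show ?thesis using False by (subst todd_fps_coeff) auto
    qed
    ultimately show ?thesis by (simp only: resid_fourier)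
  qed
qed (simp_all add: resid_periodic)

definition bern_sum :: "real^'d \<Rightarrow> real^'d \<Rightarrow> complex" where
  "bern_sum h x = (\<Sum>U\<in>Lambda V. (\<Prod>i\<in>U. of_real (h \<bullet> real_vec (V ! i))) * bernoulli_spline V U x)"

lemma bern_setting: "U \<in> Lambda V \<Longrightarrow> bern_setting V U"
  by (intro bern_setting.intro adm uni)

lemma bernoulli_char_set_integrable:
  assumes "U \<in> Lambda V"
  shows "set_integrable lborel (cbox 0 1) (\<lambda>x. bernoulli_spline V U x * cnj (char_fun \<gamma> x))"
proof -
  interpret bern_setting V U by (rule bern_setting[OF assms])
  obtain C where C: "\<And>x. norm (bernoulli_spline V U x) \<le> C" using bernoulli_spline_bounded by blast
  note bernoulli_spline_measurable[measurable]
  show ?thesis by (rule set_integrable_bounded_cube[where M = C]) (use C in \<open>auto simp: norm_mult\<close>)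
qed

text \<open>At order \<open>rho V + 1\<close> a frequency survives only if exactly that many vectors
  are active, that is, if its active set belongs to \<open>Lambda V\<close>; there both sides have
  the same Fourier coefficient.\<close>

lemma resid_top: "AE x in lborel. resid h (rho V + 1) x = bern_sum h x"
proof (rule fourier_eq[OF resid_set_integrable])
  show "set_integrable lborel (cbox 0 1) (bern_sum h)"
    unfolding bern_sum_def[abs_def]
    by (intro set_integral_sum(2) set_integrable_mult_right bern_setting.bernoulli_set_integrable bern_setting)
  show "(LINT x:cbox 0 1|lborel. resid h (rho V + 1) x * cnj (char_fun \<gamma> x)) = (LINT x:cbox 0 1|lborel. bern_sum h x * cnj (char_fun \<gamma> x))" for \<gamma>
  proof -
    have "(LINT x:cbox 0 1|lborel. bern_sum h x * cnj (char_fun \<gamma> x))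
      = (\<Sum>U\<in>Lambda V. (\<Prod>i\<in>U. of_real (h \<bullet> real_vec (V ! i))) * (LINT x:cbox 0 1|lborel. bernoulli_spline V U x * cnj (char_fun \<gamma> x)))"
      unfolding bern_sum_def sum_distrib_right mult.assoc
      by (subst set_integral_sum(1)) (auto intro!: set_integrable_mult_right bernoulli_char_set_integrable)
    also have "\<dots> = (\<Sum>U\<in>Lambda V. if \<gamma> \<noteq> 0 \<and> active V \<gamma> = U then (\<Prod>i\<in>U. of_real (h \<bullet> real_vec (V ! i))) * bern_coeff V U \<gamma> else 0)"
      by (intro sum.cong refl)
        (simp add: bern_setting.bernoulli_fourier[OF bern_setting] bern_index_iff_active[OF adm])
    also have "\<dots> = (if \<gamma> \<noteq> 0 \<and> active V \<gamma> \<in> Lambda V then (\<Prod>i\<in>active V \<gamma>. of_real (h \<bullet> real_vec (V ! i))) * bern_coeff V (active V \<gamma>) \<gamma> else 0)"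
      by (cases "\<gamma> = 0") (auto simp: sum.delta')
    also have "\<dots> = fps_nth (todd_fps V h * (\<Prod>i<length V. edge_fps (h \<bullet> real_vec (V ! i)) (real_vec \<gamma> \<bullet> real_vec (V ! i)))) (rho V + 1)"
    proof (cases "\<gamma> = 0")
      case True then show ?thesis by (simp add: todd_fps_zero)
    next
      case False
      have "active V \<gamma> \<in> Lambda V \<longleftrightarrow> rho V + 1 = card (active V \<gamma>)"
        using active_Lambda[OF False] LambdaD(2)[of "active V \<gamma>" V] by auto
      moreover have "(\<Prod>i\<in>active V \<gamma>. of_real (h \<bullet> real_vec (V ! i))) * bern_coeff V (active V \<gamma>) \<gamma>
          = (\<Prod>i\<in>active V \<gamma>. of_real (h \<bullet> real_vec (V ! i)) / (2 * pi * \<i> * of_real (real_vec \<gamma> \<bullet> real_vec (V ! i))))"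
        unfolding bern_coeff_def prod.distrib[symmetric] by (intro prod.cong refl) simp
      ultimately show ?thesis
        using False by (subst todd_fps_coeff[OF card_active[OF adm False]]) simp
    qed
    finally show ?thesis by (simp only: resid_fourier)
  qed
  show "bern_sum h (x - real_vec \<alpha>) = bern_sum h x" for x \<alpha>
    unfolding bern_sum_def by (intro sum.cong refl) (simp add: bern_setting.bernoulli_spline_periodic[OF bern_setting])
qed (simp add: resid_periodic)

text \<open>\<open>shift_sum (mono_coeff h)\<close> will turn out to be the projection of \<open>x \<mapsto> (h \<bullet> x) ^ k / k!\<close>,
  where \<open>k = rho V + 1\<close>.\<close>

definition mono_coeff :: "real^'d \<Rightarrow> int^'d \<Rightarrow> complex" where
  "mono_coeff h \<alpha> = fps_nth (todd_fps V h * fps_exp (of_real (h \<bullet> real_vec \<alpha>))) (rho V + 1)"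

text \<open>Writing h . \<alpha> = h . x - h . (x - \<alpha>) splits the exponential into a factor
  depending on x alone and the periodised one; the sum is their Cauchy product.\<close>

lemma shift_sum_mono_coeff:
  "shift_sum (mono_coeff h) x = (\<Sum>i=0..rho V + 1. of_real ((h \<bullet> x) ^ i / fact i) * resid h (rho V + 1 - i) x)"
proof -
  let ?A = "near (norm x)"
  have e: "fps_exp (complex_of_real (h \<bullet> real_vec \<alpha>)) = fps_exp (of_real (h \<bullet> x)) * fps_exp (of_real (- (h \<bullet> (x - real_vec \<alpha>))))" for \<alpha>
    by (simp add: fps_exp_add_mult[symmetric] inner_diff_right)
  have "shift_sum (mono_coeff h) x = (\<Sum>\<alpha>\<in>?A. fps_nth (fps_const (of_real (b (x - real_vec \<alpha>))) * (todd_fps V h * fps_exp (of_real (h \<bullet> real_vec \<alpha>)))) (rho V + 1))"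
    unfolding shift_sum_near[OF order_refl] mono_coeff_def by (simp add: mult.commute)
  also have "\<dots> = fps_nth (\<Sum>\<alpha>\<in>?A. fps_const (of_real (b (x - real_vec \<alpha>))) * (todd_fps V h * fps_exp (of_real (h \<bullet> real_vec \<alpha>)))) (rho V + 1)"
    by (simp only: fps_sum_nth)
  also have "(\<Sum>\<alpha>\<in>?A. fps_const (of_real (b (x - real_vec \<alpha>))) * (todd_fps V h * fps_exp (of_real (h \<bullet> real_vec \<alpha>))))
      = fps_exp (of_real (h \<bullet> x)) * (todd_fps V h * per_fps h x)"
    unfolding e per_fps_def sum_distrib_left by (intro sum.cong refl) (simp only: mult_ac)
  finally show ?thesis by (simp add: fps_mult_nth resid_def)
qed

text \<open>In the Cauchy product only the extreme terms remain: i = \<open>rho V + 1\<close> meets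
  the coefficient of order 0, which is 1, and i = 0 meets the Bernoulli part. All others vanish
  a.e.\<close>

lemma shift_sum_mono_coeff_AE:
  "AE x in lborel. shift_sum (mono_coeff h) x = of_real ((h \<bullet> x) ^ (rho V + 1) / fact (rho V + 1)) + bern_sum h x"
proof -
  let ?k = "rho V + 1"
  have "AE x in lborel. \<forall>m\<in>{..rho V}. resid h m x = (if m = 0 then 1 else 0)"
  proof (rule AE_finite_allI)
    show "AE x in lborel. resid h m x = (if m = 0 then 1 else 0)" if "m \<in> {..rho V}" for m
      by (rule resid_low) (use that in auto)
  qed simp
  then show ?thesis using resid_top[of h]
  proof eventually_elim
    fix x assume low: "\<forall>m\<in>{..rho V}. resid h m x = (if m = 0 then 1 else 0)" and top: "resid h ?k x = bern_sum h x"
    have "shift_sum (mono_coeff h) x = of_real ((h \<bullet> x) ^ 0 / fact 0) * resid h (?k - 0) x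
        + (\<Sum>i=Suc 0..?k. of_real ((h \<bullet> x) ^ i / fact i) * resid h (?k - i) x)"
      unfolding shift_sum_mono_coeff by (subst sum.atLeast_Suc_atMost) auto
    also have "(\<Sum>i=Suc 0..?k. of_real ((h \<bullet> x) ^ i / fact i) * resid h (?k - i) x)
        = (\<Sum>i=Suc 0..?k. if i = ?k then of_real ((h \<bullet> x) ^ ?k / fact ?k) else 0)"
    proof (intro sum.cong refl)
      fix i assume i: "i \<in> {Suc 0..?k}"
      then have "?k - i \<in> {..rho V}" by auto
      then have "resid h (?k - i) x = (if ?k - i = 0 then 1 else 0)" using low by blast
      then show "of_real ((h \<bullet> x) ^ i / fact i) * resid h (?k - i) x = (if i = ?k then complex_of_real ((h \<bullet> x) ^ ?k / fact ?k) else 0)"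
        using i by auto
    qed
    also have "\<dots> = of_real ((h \<bullet> x) ^ ?k / fact ?k)" by (subst sum.delta) auto
    finally show "shift_sum (mono_coeff h) x = of_real ((h \<bullet> x) ^ ?k / fact ?k) + bern_sum h x"
      using top by simp
  qed
qed

section \<open>Pairings with the dual function\<close>

lemma partition_of_unity: "AE x in lborel. (\<Sum>\<alpha>\<in>near (norm x). b (x - real_vec \<alpha>)) = 1"
proof -
  have t0: "fps_nth (todd_fps V 0) 0 = 1"
    using arg_cong[OF todd_fps_zero[of 0], of "\<lambda>f. fps_nth f 0"]
  proof -
    have n0: "fps_nth (\<Prod>i\<in>I. F i) 0 = (\<Prod>i\<in>I. fps_nth (F i) 0)" for F :: "nat \<Rightarrow> complex fps" and I
      by (induction I rule: infinite_finite_induct) auto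
    have "fps_nth (\<Prod>i<length V. edge_fps ((0::real^'d) \<bullet> real_vec (V ! i)) 0) 0 = 1" unfolding n0 edge_fps_nth_0 by simp
    then show ?thesis unfolding todd_fps_def fps_inverse_nth_0 by simp
  qed
  \<comment> \<open>The case h = 0 and m = 0: the plain periodisation of \<open>b\<close> has mean 1
    and no other frequency.\<close>
  have "AE x in lborel. resid 0 0 x = (if 0 = (0::nat) then 1 else 0)" by (rule resid_low) simp
  then show ?thesis
  proof eventually_elim
    fix x assume x: "resid 0 0 x = (if 0 = (0::nat) then 1 else 0)"
    have "fps_nth (per_fps 0 x) 0 = (\<Sum>\<alpha>\<in>near (norm x). box_mom 0 0 (x - real_vec \<alpha>))"
      by (rule per_fps_nth) (auto intro: nearI)
    then have "complex_of_real (\<Sum>\<alpha>\<in>near (norm x). b (x - real_vec \<alpha>)) = 1"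
      using x t0 by (simp add: resid_def box_mom_def scaleR_conv_of_real)
    then show "(\<Sum>\<alpha>\<in>near (norm x). b (x - real_vec \<alpha>)) = 1" by (simp only: of_real_eq_1_iff)
  qed
qed

text \<open>Interchanges the infinite sum with the integral along truncations to growing balls,
  dominated by \<open>W\<close>. The limit along balls is what both applications evaluate: one sum
  has a single nonzero term, in the other all terms vanish.\<close>

lemma integral_shift_sum:
  assumes w [measurable]: "w \<in> borel_measurable borel" and W: "integrable lborel W"
    and bd: "AE x in lborel. (\<Sum>\<alpha>\<in>near (norm x). norm (c \<alpha>) * b (x - real_vec \<alpha>)) * norm (w x) \<le> W x"
    and i: "\<And>\<alpha>. integrable lborel (\<lambda>x. of_real (b (x - real_vec \<alpha>)) * w x)"
  shows "integrable lborel (\<lambda>x. shift_sum c x * w x)"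
    and "(\<lambda>N. \<Sum>\<alpha>\<in>near (real N). c \<alpha> * (LINT x|lborel. of_real (b (x - real_vec \<alpha>)) * w x)) \<longlonglongrightarrow> (LINT x|lborel. shift_sum c x * w x)"
proof -
  let ?f = "\<lambda>N x. (\<Sum>\<alpha>\<in>near (real N). c \<alpha> * of_real (b (x - real_vec \<alpha>))) * w x"
  have lim: "(\<lambda>N. ?f N x) \<longlonglongrightarrow> shift_sum c x * w x" for x
  proof -
    have "eventually (\<lambda>n. real n \<ge> norm x) sequentially"
      using filterlim_real_sequentially by (auto simp: filterlim_at_top)
    then have "eventually (\<lambda>N. ?f N x = shift_sum c x * w x) sequentially"
      by eventually_elim (simp add: shift_sum_near)
    then show ?thesis by (rule tendsto_eventually)
  qed
  have le: "norm (?f N x) \<le> (\<Sum>\<alpha>\<in>near (norm x). norm (c \<alpha>) * b (x - real_vec \<alpha>)) * norm (w x)" for N x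
  proof -
    have "norm (\<Sum>\<alpha>\<in>near (real N). c \<alpha> * of_real (b (x - real_vec \<alpha>))) \<le> (\<Sum>\<alpha>\<in>near (real N). norm (c \<alpha>) * b (x - real_vec \<alpha>))"
      by (rule order_trans[OF norm_sum]) (simp add: norm_mult nonneg)
    also have "\<dots> \<le> (\<Sum>\<alpha>\<in>near (norm x). norm (c \<alpha>) * b (x - real_vec \<alpha>))"
    proof -
      have "(\<Sum>\<alpha>\<in>near (real N). norm (c \<alpha>) * b (x - real_vec \<alpha>)) = (\<Sum>\<alpha>\<in>near (real N) \<inter> near (norm x). norm (c \<alpha>) * b (x - real_vec \<alpha>))"
        by (rule sum.mono_neutral_right) (auto dest: nearI[OF order_refl, of x])
      also have "\<dots> \<le> (\<Sum>\<alpha>\<in>near (norm x). norm (c \<alpha>) * b (x - real_vec \<alpha>))"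
        by (rule sum_mono2) (auto simp: nonneg)
      finally show ?thesis .
    qed
    finally show ?thesis unfolding norm_mult by (intro mult_right_mono) auto
  qed
  have AEb: "AE x in lborel. norm (?f N x) \<le> W x" for N
    using bd by eventually_elim (rule order_trans[OF le])
  show "integrable lborel (\<lambda>x. shift_sum c x * w x)"
  proof (rule integrable_dominated_convergence[where s = ?f and w = W])
    show "AE x in lborel. norm (?f N x) \<le> W x" for N by (rule AEb)
  qed (use lim W in auto)
  have "(\<lambda>N. LINT x|lborel. ?f N x) \<longlonglongrightarrow> (LINT x|lborel. shift_sum c x * w x)"
  proof (rule integral_dominated_convergence[where s = ?f and w = W])
    show "AE x in lborel. norm (?f N x) \<le> W x" for N by (rule AEb)
  qed (use lim W in auto)
  moreover have "(LINT x|lborel. ?f N x) = (\<Sum>\<alpha>\<in>near (real N). c \<alpha> * (LINT x|lborel. of_real (b (x - real_vec \<alpha>)) * w x))" for N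
    unfolding sum_distrib_right mult.assoc using i by (subst Bochner_Integration.integral_sum) auto
  ultimately show "(\<lambda>N. \<Sum>\<alpha>\<in>near (real N). c \<alpha> * (LINT x|lborel. of_real (b (x - real_vec \<alpha>)) * w x)) \<longlonglongrightarrow> (LINT x|lborel. shift_sum c x * w x)"
    by simp
qed

text \<open>Half of the decay rate absorbs the polynomial factor; the shift by t costs the constant
  e^{\<kappa> |t|}.\<close>

lemma poly_dual_bound:
  obtains D \<kappa> where "D \<ge> 0" "\<kappa> > 0" "\<And>y. (1 + norm y) ^ k * norm (dual (y - t)) \<le> D * exp (- \<kappa> * norm y)"
proof -
  obtain C \<kappa> where C: "C \<ge> 0" "\<kappa> > 0" "\<And>x. norm (dual x) \<le> C * exp (- \<kappa> * norm x)" using dual_decay by blast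
  obtain C2 where C2: "C2 > 0" "\<And>s::real. s \<ge> 0 \<Longrightarrow> (1 + s) ^ k * exp (- (\<kappa> / 2) * s) \<le> C2"
    using power_mult_exp_bound[of "\<kappa> / 2" k] C(2) by auto
  have "(1 + norm y) ^ k * norm (dual (y - t)) \<le> (C * exp (\<kappa> * norm t) * C2) * exp (- (\<kappa> / 2) * norm y)" for y
  proof -
    have "norm y \<le> norm (y - t) + norm t" by (metis diff_add_cancel norm_triangle_ineq)
    then have "\<kappa> * norm y \<le> \<kappa> * (norm (y - t) + norm t)" using C(2) by (intro mult_left_mono) auto
    then have "- \<kappa> * norm (y - t) \<le> \<kappa> * norm t + - (\<kappa> / 2) * norm y + - (\<kappa> / 2) * norm y"
      by (simp add: algebra_simps)
    then have "exp (- \<kappa> * norm (y - t)) \<le> exp (\<kappa> * norm t) * exp (- (\<kappa> / 2) * norm y) * exp (- (\<kappa> / 2) * norm y)"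
      by (simp only: exp_add[symmetric] exp_le_cancel_iff)
    then have "norm (dual (y - t)) \<le> C * (exp (\<kappa> * norm t) * exp (- (\<kappa> / 2) * norm y) * exp (- (\<kappa> / 2) * norm y))"
      using C(3)[of "y - t"] mult_left_mono[OF _ C(1)] order_trans by blast
    then have "(1 + norm y) ^ k * norm (dual (y - t)) \<le> (1 + norm y) ^ k * (C * (exp (\<kappa> * norm t) * exp (- (\<kappa> / 2) * norm y) * exp (- (\<kappa> / 2) * norm y)))"
      by (intro mult_left_mono) auto
    also have "\<dots> = C * exp (\<kappa> * norm t) * ((1 + norm y) ^ k * exp (- (\<kappa> / 2) * norm y)) * exp (- (\<kappa> / 2) * norm y)"
      by (simp only: mult_ac)
    also have "\<dots> \<le> C * exp (\<kappa> * norm t) * C2 * exp (- (\<kappa> / 2) * norm y)"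
      using C(1) C2(2)[of "norm y"] by (intro mult_right_mono mult_left_mono) auto
    finally show ?thesis .
  qed
  then show ?thesis using C C2(1) by (intro that[of "C * exp (\<kappa> * norm t) * C2" "\<kappa> / 2"]) auto
qed

lemma poly_dual_integrable:
  assumes [measurable]: "f \<in> borel_measurable borel" and f: "\<And>y. norm (f y) \<le> K * (1 + norm y) ^ k"
  shows "integrable lborel (\<lambda>y. f y * cnj (dual (y - t)))"
proof -
  obtain D \<kappa> where D: "D \<ge> 0" "\<kappa> > 0" "\<And>y. (1 + norm y) ^ k * norm (dual (y - t)) \<le> D * exp (- \<kappa> * norm y)"
    using poly_dual_bound by blast
  have "norm (f 0) \<le> K" using f[of 0] by simp
  then have K: "K \<ge> 0" by (rule order_trans[OF norm_ge_zero])
  have "integrable lborel (\<lambda>y::real^'d. K * (D * exp (- \<kappa> * norm y)))" using exp_norm_integrable[OF D(2)] by auto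
  then show ?thesis
  proof (rule Bochner_Integration.integrable_bound)
    have "norm (f y * cnj (dual (y - t))) \<le> norm (K * (D * exp (- \<kappa> * norm y)))" for y
    proof -
      have "norm (f y * cnj (dual (y - t))) \<le> K * (1 + norm y) ^ k * norm (dual (y - t))"
        unfolding norm_mult complex_mod_cnj by (intro mult_right_mono f) auto
      also have "\<dots> \<le> K * (D * exp (- \<kappa> * norm y))" unfolding mult.assoc using K by (intro mult_left_mono D) auto
      finally show ?thesis by simp
    qed
    then show "AE y in lborel. norm (f y * cnj (dual (y - t))) \<le> norm (K * (D * exp (- \<kappa> * norm y)))" by simp
  qed measurable
qed

text \<open>As a coefficient of a product with e^{z h . \<alpha>}, this is a polynomial in h .
  \<alpha> of degree at most \<open>rho V + 1\<close>.\<close>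

lemma mono_coeff_bound:
  obtains K where "K \<ge> 0" "\<And>\<alpha>. norm (mono_coeff h \<alpha>) \<le> K * (1 + norm (real_vec \<alpha>)) ^ (rho V + 1)"
proof -
  let ?k = "rho V + 1"
  let ?K = "\<Sum>i=0..?k. norm (fps_nth (todd_fps V h) i) * (1 + norm h) ^ ?k"
  have "norm (mono_coeff h \<alpha>) \<le> ?K * (1 + norm (real_vec \<alpha>)) ^ ?k" for \<alpha>
  proof -
    let ?s = "\<bar>h \<bullet> real_vec \<alpha>\<bar>" and ?n = "norm (real_vec \<alpha>)"
    have s: "?s \<le> (1 + norm h) * (1 + ?n)"
      using Cauchy_Schwarz_ineq2[of h "real_vec \<alpha>"] by (simp add: algebra_simps add_increasing)
    have "norm (fps_nth (todd_fps V h) i * fps_nth (fps_exp (complex_of_real (h \<bullet> real_vec \<alpha>))) (?k - i))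
        \<le> norm (fps_nth (todd_fps V h) i) * ((1 + norm h) ^ ?k * (1 + ?n) ^ ?k)" for i
    proof -
      have "norm (fps_nth (fps_exp (complex_of_real (h \<bullet> real_vec \<alpha>))) (?k - i)) = ?s ^ (?k - i) / fact (?k - i)"
        by (simp add: norm_divide norm_power)
      also have "\<dots> \<le> ?s ^ (?k - i)" 
      proof -
        have "?s ^ (?k - i) * 1 \<le> ?s ^ (?k - i) * fact (?k - i)" by (intro mult_left_mono fact_ge_1) auto
        then show ?thesis by (simp add: divide_le_eq)
      qed
      also have "\<dots> \<le> ((1 + norm h) * (1 + ?n)) ^ (?k - i)" by (intro power_mono s) auto
      also have "\<dots> \<le> ((1 + norm h) * (1 + ?n)) ^ ?k"
      proof (rule power_increasing)
        have "1 * 1 \<le> (1 + norm h) * (1 + ?n)" by (intro mult_mono) auto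
        then show "1 \<le> (1 + norm h) * (1 + ?n)" by simp
      qed simp
      finally show ?thesis unfolding norm_mult power_mult_distrib by (intro mult_left_mono) auto
    qed
    then have "norm (mono_coeff h \<alpha>) \<le> (\<Sum>i=0..?k. norm (fps_nth (todd_fps V h) i) * ((1 + norm h) ^ ?k * (1 + ?n) ^ ?k))"
      unfolding mono_coeff_def fps_mult_nth by (intro order_trans[OF norm_sum] sum_mono)
    also have "\<dots> = ?K * (1 + ?n) ^ ?k" by (simp only: sum_distrib_right mult.assoc)
    finally show ?thesis .
  qed
  moreover have "?K \<ge> 0" by (intro sum_nonneg) auto
  ultimately show ?thesis using that by blast
qed

text \<open>Biorthogonality reads off the coefficient. Polynomial growth of the coefficients against
  exponential decay of the dual function justifies the interchange.\<close>

lemma integral_mono_coeff_dual: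
  "integrable lborel (\<lambda>y. shift_sum (mono_coeff h) y * cnj (dual (y - real_vec \<beta>)))" (is ?A)
  "(LINT y|lborel. shift_sum (mono_coeff h) y * cnj (dual (y - real_vec \<beta>))) = mono_coeff h \<beta>" (is ?B)
proof -
  let ?k = "rho V + 1"
  let ?w = "\<lambda>y. cnj (dual (y - real_vec \<beta>))"
  obtain K where K: "K \<ge> 0" "\<And>\<alpha>. norm (mono_coeff h \<alpha>) \<le> K * (1 + norm (real_vec \<alpha>)) ^ ?k"
    using mono_coeff_bound by blast
  obtain D \<kappa> where D: "D \<ge> 0" "\<kappa> > 0" "\<And>y. (1 + norm y) ^ ?k * norm (dual (y - real_vec \<beta>)) \<le> D * exp (- \<kappa> * norm y)"
    using poly_dual_bound by blast
  have wm: "?w \<in> borel_measurable borel" by measurable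
  have Wi: "integrable lborel (\<lambda>y::real^'d. K * (1 + \<bar>R\<bar>) ^ ?k * (D * exp (- \<kappa> * norm y)))"
    using exp_norm_integrable[OF D(2)] by auto
  have bd: "AE y in lborel. (\<Sum>\<alpha>\<in>near (norm y). norm (mono_coeff h \<alpha>) * b (y - real_vec \<alpha>)) * norm (?w y) \<le> K * (1 + \<bar>R\<bar>) ^ ?k * (D * exp (- \<kappa> * norm y))"
    using partition_of_unity
  proof eventually_elim
    fix y assume y: "(\<Sum>\<alpha>\<in>near (norm y). b (y - real_vec \<alpha>)) = 1"
    \<comment> \<open>Contributing translates have |\<alpha>| \<le> |y| + R, so all coefficients
      have one common bound, and the weights \<open>b\<close> sum to 1.\<close>
    have "(\<Sum>\<alpha>\<in>near (norm y). norm (mono_coeff h \<alpha>) * b (y - real_vec \<alpha>))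
        \<le> (\<Sum>\<alpha>\<in>near (norm y). K * ((1 + \<bar>R\<bar>) * (1 + norm y)) ^ ?k * b (y - real_vec \<alpha>))"
    proof (rule sum_mono)
      fix \<alpha>
      show "norm (mono_coeff h \<alpha>) * b (y - real_vec \<alpha>) \<le> K * ((1 + \<bar>R\<bar>) * (1 + norm y)) ^ ?k * b (y - real_vec \<alpha>)"
      proof (cases "b (y - real_vec \<alpha>) = 0")
        case False
        then have "norm (real_vec \<alpha>) \<le> norm y + R" using nearI[OF order_refl] by (auto simp: near_def)
        moreover have "(1 + \<bar>R\<bar>) * (1 + norm y) = 1 + norm y + \<bar>R\<bar> + \<bar>R\<bar> * norm y" by (simp add: algebra_simps)
        moreover have "0 \<le> \<bar>R\<bar> * norm y" by simp
        ultimately have "1 + norm (real_vec \<alpha>) \<le> (1 + \<bar>R\<bar>) * (1 + norm y)" by linarith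
        then have "(1 + norm (real_vec \<alpha>)) ^ ?k \<le> ((1 + \<bar>R\<bar>) * (1 + norm y)) ^ ?k" by (intro power_mono) auto
        then have "norm (mono_coeff h \<alpha>) \<le> K * ((1 + \<bar>R\<bar>) * (1 + norm y)) ^ ?k"
          using K mult_left_mono order_trans by blast
        then show ?thesis using nonneg by (intro mult_right_mono) auto
      qed simp
    qed
    also have "\<dots> = K * (1 + \<bar>R\<bar>) ^ ?k * (1 + norm y) ^ ?k"
      unfolding sum_distrib_left[symmetric] y by (simp only: power_mult_distrib mult.assoc mult_1_right)
    finally have "(\<Sum>\<alpha>\<in>near (norm y). norm (mono_coeff h \<alpha>) * b (y - real_vec \<alpha>)) * norm (?w y)
        \<le> K * (1 + \<bar>R\<bar>) ^ ?k * (1 + norm y) ^ ?k * norm (?w y)" by (rule mult_right_mono) auto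
    also have "\<dots> \<le> K * (1 + \<bar>R\<bar>) ^ ?k * (D * exp (- \<kappa> * norm y))"
      unfolding mult.assoc complex_mod_cnj using K(1) D(3)[of y] by (intro mult_left_mono) auto
    finally show "(\<Sum>\<alpha>\<in>near (norm y). norm (mono_coeff h \<alpha>) * b (y - real_vec \<alpha>)) * norm (?w y) \<le> K * (1 + \<bar>R\<bar>) ^ ?k * (D * exp (- \<kappa> * norm y))" .
  qed
  have bi: "integrable lborel (\<lambda>y. complex_of_real (b (y - real_vec \<alpha>)) * ?w y)" for \<alpha>
    by (rule poly_dual_integrable[where K = M and k = 0]) (auto simp: norm_b)
  show ?A by (rule integral_shift_sum(1)[OF wm Wi bd bi])
  have "(\<lambda>N. \<Sum>\<alpha>\<in>near (real N). mono_coeff h \<alpha> * (LINT y|lborel. of_real (b (y - real_vec \<alpha>)) * ?w y)) \<longlonglongrightarrow> (LINT y|lborel. shift_sum (mono_coeff h) y * ?w y)"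
    by (rule integral_shift_sum(2)[OF wm Wi bd bi])
  moreover have "eventually (\<lambda>N. (\<Sum>\<alpha>\<in>near (real N). mono_coeff h \<alpha> * (LINT y|lborel. of_real (b (y - real_vec \<alpha>)) * ?w y)) = mono_coeff h \<beta>) sequentially"
  proof -
    have "eventually (\<lambda>n. real n \<ge> norm (real_vec \<beta>) + \<bar>R\<bar>) sequentially"
      using filterlim_real_sequentially by (auto simp: filterlim_at_top)
    then show ?thesis
    proof eventually_elim
      fix N assume "real N \<ge> norm (real_vec \<beta>) + \<bar>R\<bar>"
      then have "\<beta> \<in> near (real N)" by (auto simp: near_def)
      have "(\<Sum>\<alpha>\<in>near (real N). mono_coeff h \<alpha> * (LINT y|lborel. of_real (b (y - real_vec \<alpha>)) * ?w y))
          = (\<Sum>\<alpha>\<in>near (real N). if \<alpha> = \<beta> then mono_coeff h \<beta> else 0)"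
        unfolding dual_biorthogonal by (intro sum.cong) auto
      then show "(\<Sum>\<alpha>\<in>near (real N). mono_coeff h \<alpha> * (LINT y|lborel. of_real (b (y - real_vec \<alpha>)) * ?w y)) = mono_coeff h \<beta>"
        using \<open>\<beta> \<in> near (real N)\<close> by simp
    qed
  qed
  then have "(\<lambda>N. \<Sum>\<alpha>\<in>near (real N). mono_coeff h \<alpha> * (LINT y|lborel. of_real (b (y - real_vec \<alpha>)) * ?w y)) \<longlonglongrightarrow> mono_coeff h \<beta>"
    by (rule tendsto_eventually)
  ultimately show ?B by (rule LIMSEQ_unique)
qed

text \<open>Integrating a periodic function against a translate of \<open>b\<close> gives its mean
  over the cube, by the partition of unity. The mean of a Bernoulli spline is 0, since its index set
  omits 0; summing over translates gives the dual function.\<close>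

lemma integral_bernoulli_dual:
  assumes U: "U \<in> Lambda V"
  shows "integrable lborel (\<lambda>y. bernoulli_spline V U y * cnj (dual (y - t)))" (is ?I)
    and "(LINT y|lborel. bernoulli_spline V U y * cnj (dual (y - real_vec \<beta>))) = 0" (is ?J)
proof -
  interpret bern_setting V U by (rule bern_setting[OF U])
  let ?B = "bernoulli_spline V U"
  note bernoulli_spline_measurable[measurable]
  obtain C where C: "C \<ge> 0" "\<And>x. norm (?B x) \<le> C" using bernoulli_spline_bounded by blast
  show ?I by (rule poly_dual_integrable[where K = C and k = 0]) (use C in auto)
  let ?w = "\<lambda>y. cnj (?B y)"
  obtain C1 \<kappa> where C1: "C1 \<ge> 0" "\<kappa> > 0" "\<And>\<alpha>. norm (inv_coeff \<alpha>) \<le> C1 * exp (- \<kappa> * norm (real_vec \<alpha>))"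
    using inv_coeff_decay by blast
  obtain K where K: "K \<ge> 0" "\<And>c C x. C \<ge> 0 \<Longrightarrow> (\<And>\<alpha>. norm (c \<alpha>) \<le> C * exp (- \<kappa> * norm (real_vec \<alpha>)))
    \<Longrightarrow> norm (shift_sum c x) \<le> C * K * exp (- (\<kappa> / 2) * norm x)"
    using shift_sum_decay[OF C1(2)] by blast
  have Wi: "integrable lborel (\<lambda>y::real^'d. C1 * K * exp (- (\<kappa> / 2) * norm y) * C)"
    using exp_norm_integrable[of "\<kappa> / 2"] C1(2) by auto
  have bd: "(\<Sum>\<alpha>\<in>near (norm y). norm (inv_coeff \<alpha>) * b (y - real_vec \<alpha>)) * norm (?w y) \<le> C1 * K * exp (- (\<kappa> / 2) * norm y) * C" for y
  proof -
    have "(\<Sum>\<alpha>\<in>near (norm y). norm (inv_coeff \<alpha>) * b (y - real_vec \<alpha>)) = norm (shift_sum (\<lambda>\<alpha>. of_real (norm (inv_coeff \<alpha>))) y)"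
      unfolding shift_sum_near[OF order_refl] of_real_mult[symmetric] of_real_sum[symmetric] norm_of_real
      by (rule abs_of_nonneg[symmetric]) (auto intro!: sum_nonneg simp: nonneg)
    also have "\<dots> \<le> C1 * K * exp (- (\<kappa> / 2) * norm y)"
      by (rule K(2)) (use C1 in auto)
    finally show ?thesis using C by (intro mult_mono) (auto simp: C1(1) K(1))
  qed
  have bi: "integrable lborel (\<lambda>y. complex_of_real (b (y - real_vec \<alpha>)) * ?w y)" for \<alpha>
  proof (rule Bochner_Integration.integrable_bound)
    show "integrable lborel (\<lambda>y. b (y - real_vec \<alpha>) * C)" using integrable_shift by auto
    show "AE y in lborel. norm (complex_of_real (b (y - real_vec \<alpha>)) * ?w y) \<le> norm (b (y - real_vec \<alpha>) * C)"
      using C by (auto simp: norm_mult abs_mult intro!: mult_left_mono order_trans[OF C(2)])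
  qed measurable
  have z: "(LINT y|lborel. complex_of_real (b (y - real_vec \<alpha>)) * ?w y) = 0" for \<alpha>
  proof -
    let ?A = "near (CARD('d))"
    have "(LINT y|lborel. complex_of_real (b (y - real_vec \<alpha>)) * ?w y) = (LINT y|lborel. complex_of_real (b (y - real_vec \<alpha>)) * ?w (y - real_vec \<alpha>))"
      by (simp add: bernoulli_spline_periodic)
    also have "\<dots> = (LINT y|lborel. complex_of_real (b y) * ?w y)"
      by (rule lborel_integral_shift[where f = "\<lambda>y. complex_of_real (b y) * ?w y"])
    also have "\<dots> = (LINT x:cbox 0 1|lborel. (\<Sum>\<alpha>\<in>?A. complex_of_real (b (x - real_vec \<alpha>)) * ?w (x - real_vec \<alpha>)))"
    proof (rule integral_tiling)
      show "integrable lborel (\<lambda>y. complex_of_real (b y) * ?w y)" using bi[of 0] by simp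
      show "\<alpha> \<in> ?A" if "x \<in> cbox 0 1" "complex_of_real (b (x - real_vec \<alpha>)) * ?w (x - real_vec \<alpha>) \<noteq> 0" for x \<alpha>
        by (rule nearI_cube[OF that(1)]) (use that(2) in auto)
    qed simp
    also have "\<dots> = (LINT x:cbox 0 1|lborel. cnj (?B x))"
      unfolding set_lebesgue_integral_def
    proof (rule integral_cong_AE)
      show "AE x in lborel. indicator (cbox 0 1) x *\<^sub>R (\<Sum>\<alpha>\<in>?A. complex_of_real (b (x - real_vec \<alpha>)) * ?w (x - real_vec \<alpha>)) = indicator (cbox 0 1) x *\<^sub>R cnj (?B x)"
        using partition_of_unity
      proof eventually_elim
        fix x assume x: "(\<Sum>\<alpha>\<in>near (norm x). b (x - real_vec \<alpha>)) = 1"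
        show "indicator (cbox 0 1) x *\<^sub>R (\<Sum>\<alpha>\<in>?A. complex_of_real (b (x - real_vec \<alpha>)) * ?w (x - real_vec \<alpha>)) = indicator (cbox 0 1) x *\<^sub>R cnj (?B x)"
        proof (cases "x \<in> cbox 0 1")
          case True
          have "(\<Sum>\<alpha>\<in>?A. complex_of_real (b (x - real_vec \<alpha>)) * ?w (x - real_vec \<alpha>)) = (\<Sum>\<alpha>\<in>?A. 1 * complex_of_real (b (x - real_vec \<alpha>))) * cnj (?B x)"
            by (simp add: bernoulli_spline_periodic sum_distrib_right)
          also have "(\<Sum>\<alpha>\<in>?A. 1 * complex_of_real (b (x - real_vec \<alpha>))) = (\<Sum>\<alpha>\<in>near (norm x). 1 * complex_of_real (b (x - real_vec \<alpha>)))"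
            unfolding shift_sum_cube[OF True, of "\<lambda>_. 1", symmetric] shift_sum_near[OF order_refl, of "\<lambda>_. 1", symmetric] ..
          also have "\<dots> = of_real (\<Sum>\<alpha>\<in>near (norm x). b (x - real_vec \<alpha>))" by simp
          finally show ?thesis using x by simp
        qed simp
      qed
    qed measurable
    also have "\<dots> = cnj (LINT x:cbox 0 1|lborel. ?B x * cnj (char_fun 0 x))"
      unfolding set_lebesgue_integral_def by (subst Bochner_Integration.integral_cnj[symmetric]) simp
    also have "\<dots> = 0" unfolding bernoulli_fourier by (simp add: bern_index_def)
    finally show ?thesis .
  qed
  have wm: "?w \<in> borel_measurable borel" by measurable
  have "(\<lambda>N. \<Sum>\<alpha>\<in>near (real N). inv_coeff \<alpha> * (LINT y|lborel. of_real (b (y - real_vec \<alpha>)) * ?w y)) \<longlonglongrightarrow> (LINT y|lborel. shift_sum inv_coeff y * ?w y)"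
    by (rule integral_shift_sum(2)[OF wm Wi AE_I2[OF bd] bi])
  then have "(LINT y|lborel. dual y * ?w y) = 0" by (simp add: z dual_def LIMSEQ_const_iff)
  then have "cnj (LINT y|lborel. dual y * ?w y) = 0" by simp
  then have "(LINT y|lborel. ?B y * cnj (dual y)) = 0"
    by (subst (asm) Bochner_Integration.integral_cnj[symmetric]) (simp add: mult.commute)
  moreover have "(LINT y|lborel. ?B y * cnj (dual (y - real_vec \<beta>))) = (LINT y|lborel. ?B (y - real_vec \<beta>) * cnj (dual (y - real_vec \<beta>)))"
    by (simp add: bernoulli_spline_periodic)
  ultimately show ?J using lborel_integral_shift[of "\<lambda>y. ?B y * cnj (dual y)" "real_vec \<beta>"] by simp
qed

text \<open>The power of h . y is the spline with coefficients \<open>mono_coeff\<close> minus the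
  Bernoulli part, which pairs to 0 with the dual function. Hence these are the coefficients of the
  projection.\<close>

lemma monomial_coeff:
  "(LINT y|lborel. of_real ((h \<bullet> y) ^ (rho V + 1) / fact (rho V + 1)) * cnj (dual (y - real_vec \<beta>))) = mono_coeff h \<beta>"
proof -
  let ?d = "\<lambda>y. cnj (dual (y - real_vec \<beta>))"
  let ?q = "\<lambda>y. complex_of_real ((h \<bullet> y) ^ (rho V + 1) / fact (rho V + 1))"
  have [measurable]: "?q \<in> borel_measurable borel"
    by (intro borel_measurable_continuous_onI continuous_on_of_real continuous_on_divide continuous_on_power
        continuous_on_inner continuous_on_const continuous_on_id) simp
  have bm [measurable]: "bern_sum h \<in> borel_measurable borel"
    unfolding bern_sum_def[abs_def]
    by (intro borel_measurable_sum borel_measurable_times bern_setting.bernoulli_spline_measurable bern_setting) auto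
  have ib: "integrable lborel (\<lambda>y. bern_sum h y * ?d y)"
    unfolding bern_sum_def sum_distrib_right mult.assoc
    by (intro Bochner_Integration.integrable_sum integrable_mult_right integral_bernoulli_dual(1))
  have zb: "(LINT y|lborel. bern_sum h y * ?d y) = 0"
    unfolding bern_sum_def sum_distrib_right mult.assoc
    by (subst Bochner_Integration.integral_sum) (auto intro!: integrable_mult_right integral_bernoulli_dual(1) simp: integral_bernoulli_dual(2))
  have "(LINT y|lborel. ?q y * ?d y) = (LINT y|lborel. shift_sum (mono_coeff h) y * ?d y - bern_sum h y * ?d y)"
  proof (rule integral_cong_AE)
    show "AE y in lborel. ?q y * ?d y = shift_sum (mono_coeff h) y * ?d y - bern_sum h y * ?d y"
      using shift_sum_mono_coeff_AE[of h] by eventually_elim (simp only: left_diff_distrib[symmetric] add_diff_cancel_right')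
  qed measurable
  also have "\<dots> = mono_coeff h \<beta>"
    using integral_mono_coeff_dual[of h \<beta>] ib zb by (subst Bochner_Integration.integral_diff) auto
  finally show ?thesis .
qed

lemma dual_function_integral:
  assumes [measurable]: "f \<in> borel_measurable borel"
  shows "(LINT y|lborel. f y * cnj (dual_function V (y - t))) = (LINT y|lborel. f y * cnj (dual (y - t)))"
proof (rule integral_cong_AE)
  have "is_dual_function V (dual_function V)"
    unfolding dual_function_def by (rule someI[where P = "is_dual_function V"]) (rule is_dual_dual)
  then have [measurable]: "dual_function V \<in> borel_measurable borel"
    by (auto simp: is_dual_function_def spline_space_def square_integrable_on_def)
  show "(\<lambda>y. f y * cnj (dual_function V (y - t))) \<in> borel_measurable lborel" by measurable
  show "AE y in lborel. f y * cnj (dual_function V (y - t)) = f y * cnj (dual (y - t))"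
    using AE_lborel_shift[OF dual_function_eq, of t] by eventually_elim simp
qed measurable

text \<open>The multinomial formula assembles the projections of the monomials into that of (h .
  x)^k / k!, whose spline coefficients are \<open>mono_coeff\<close>. The exceptional null set still
  depends on h.\<close>

theorem err_identity:
  "AE x in lborel. (\<Sum>\<beta> | mi_abs \<beta> = rho V + 1. of_real (mi_pow h \<beta> / real (mi_fact \<beta>)) * err_fun V \<beta> x) = bern_sum h x"
  using box_spline_shift_eq shift_sum_mono_coeff_AE[of h]
proof eventually_elim
  let ?k = "rho V + 1"
  fix x assume bx: "\<forall>\<alpha>. box_spline V (x - real_vec \<alpha>) = b (x - real_vec \<alpha>)"
    and sx: "shift_sum (mono_coeff h) x = of_real ((h \<bullet> x) ^ ?k / fact ?k) + bern_sum h x"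
  let ?c = "\<lambda>\<beta>. complex_of_real (mi_pow h \<beta> / real (mi_fact \<beta>))"
  let ?p = "\<lambda>\<beta> \<alpha>. LINT y|lborel. of_real (mi_pow y \<beta>) * cnj (dual (y - real_vec \<alpha>))"
  have e: "err_fun V \<beta> x = shift_sum (?p \<beta>) x - of_real (mi_pow x \<beta>)" for \<beta>
  proof -
    have "(\<lambda>y. complex_of_real (mi_pow y \<beta>)) \<in> borel_measurable borel" by measurable
    from dual_function_integral[OF this] show ?thesis
      unfolding err_fun_def spline_proj_def mono_fun_eq shift_sum_def using bx by simp
  qed
  have m: "complex_of_real ((h \<bullet> y) ^ ?k / fact ?k) = (\<Sum>\<beta> | mi_abs \<beta> = ?k. ?c \<beta> * of_real (mi_pow y \<beta>))" for y
    unfolding multinomial by (simp only: of_real_sum of_real_mult)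
  have ip: "integrable lborel (\<lambda>y. complex_of_real (mi_pow y \<beta>) * cnj (dual (y - real_vec \<alpha>)))" for \<beta> \<alpha>
    by (rule poly_dual_integrable[where K = 1 and k = "mi_abs \<beta>"]) (use abs_mi_pow_le in auto)
  have pc: "(\<Sum>\<beta> | mi_abs \<beta> = ?k. ?c \<beta> * ?p \<beta> \<alpha>) = mono_coeff h \<alpha>" for \<alpha>
  proof -
    have "mono_coeff h \<alpha> = (LINT y|lborel. (\<Sum>\<beta> | mi_abs \<beta> = ?k. ?c \<beta> * (of_real (mi_pow y \<beta>) * cnj (dual (y - real_vec \<alpha>)))))"
      unfolding monomial_coeff[symmetric] m sum_distrib_right mult.assoc ..
    also have "\<dots> = (\<Sum>\<beta> | mi_abs \<beta> = ?k. ?c \<beta> * ?p \<beta> \<alpha>)"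
      using ip by (subst Bochner_Integration.integral_sum) auto
    finally show ?thesis ..
  qed
  have "(\<Sum>\<beta> | mi_abs \<beta> = ?k. ?c \<beta> * shift_sum (?p \<beta>) x) = (\<Sum>\<alpha>\<in>near (norm x). (\<Sum>\<beta> | mi_abs \<beta> = ?k. ?c \<beta> * ?p \<beta> \<alpha>) * of_real (b (x - real_vec \<alpha>)))"
    unfolding shift_sum_near[OF order_refl] sum_distrib_left sum_distrib_right mult.assoc by (rule sum.swap)
  also have "\<dots> = shift_sum (mono_coeff h) x" unfolding pc shift_sum_near[OF order_refl] ..
  finally have "(\<Sum>\<beta> | mi_abs \<beta> = ?k. ?c \<beta> * shift_sum (?p \<beta>) x) = of_real ((h \<bullet> x) ^ ?k / fact ?k) + bern_sum h x"
    using sx by simp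
  then show "(\<Sum>\<beta> | mi_abs \<beta> = ?k. ?c \<beta> * err_fun V \<beta> x) = bern_sum h x"
    unfolding e m right_diff_distrib sum_subtractf by simp
qed

end

section \<open>Test functions\<close>

text \<open>The polynomial p_n for which the n-th derivative of e^{-c/x} is p_n(1/x) e^{-c/x}. With
  y = 1/x the derivative of y is -y^2, which gives p_{n+1} = y^2 (c p_n - p_n').\<close>

definition flat_poly :: "real \<Rightarrow> nat \<Rightarrow> real poly" where
  "flat_poly c n = ((\<lambda>p. [:0, 0, 1:] * (smult c p - pderiv p)) ^^ n) 1"

definition flat_fun :: "real \<Rightarrow> nat \<Rightarrow> real \<Rightarrow> real" where
  "flat_fun c n x = (if x > 0 then poly (flat_poly c n) (1 / x) * exp (- c / x) else 0)"

text \<open>The extra power y^k makes the induction over the coefficients work, since each step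
  multiplies by y.\<close>

lemma poly_exp_decay:
  fixes q :: "real poly"
  assumes c: "c > 0" shows "((\<lambda>y. y ^ k * poly q y * exp (- c * y)) \<longlongrightarrow> 0) at_top"
proof (induction q arbitrary: k)
  case 0 then show ?case by simp
next
  case (pCons a q)
  have lim: "((\<lambda>y. (c * y) ^ k / exp (c * y)) \<longlongrightarrow> 0) at_top"
    by (rule filterlim_compose[OF tendsto_power_div_exp_0])
      (use c in \<open>auto intro!: filterlim_tendsto_pos_mult_at_top[OF tendsto_const] filterlim_ident\<close>)
  have "((\<lambda>y. a / c ^ k * ((c * y) ^ k / exp (c * y)) + y ^ Suc k * poly q y * exp (- c * y)) \<longlongrightarrow> a / c ^ k * 0 + 0) at_top"
    by (intro tendsto_add tendsto_mult_left lim pCons.IH)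
  moreover have "a / c ^ k * ((c * y) ^ k / exp (c * y)) + y ^ Suc k * poly q y * exp (- c * y) = y ^ k * poly (pCons a q) y * exp (- c * y)" for y
    using c by (simp add: power_mult_distrib exp_minus field_simps)
  ultimately show ?case by simp
qed

text \<open>Calculus away from 0. At 0 the substitution y = 1/x turns the right difference quotient
  into a polynomial times e^{-c y} at infinity.\<close>

lemma flat_fun_deriv:
  assumes c: "c > 0" shows "(flat_fun c n has_real_derivative flat_fun c (Suc n) x) (at x)"
proof -
  let ?p = "flat_poly c n"
  have Suc: "flat_poly c (Suc n) = [:0, 0, 1:] * (smult c ?p - pderiv ?p)" by (simp add: flat_poly_def)
  consider "x > 0" | "x < 0" | "x = 0" by linarith
  then show ?thesis
  proof cases
    case 1
    have "((\<lambda>x. poly ?p (1 / x) * exp (- c / x)) has_real_derivative flat_fun c (Suc n) x) (at x)"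
      unfolding flat_fun_def Suc using 1
      by (auto intro!: derivative_eq_intros DERIV_chain2[OF poly_DERIV] simp: field_simps power2_eq_square)
    then show ?thesis
    proof (rule has_field_derivative_transform_within_open[where S = "{0<..}"])
      show "poly ?p (1 / y) * exp (- c / y) = flat_fun c n y" if "y \<in> {0<..}" for y
        using that by (simp add: flat_fun_def)
    qed (use 1 in auto)
  next
    case 2
    have "((\<lambda>x. 0) has_real_derivative flat_fun c (Suc n) x) (at x)" using 2 by (simp add: flat_fun_def)
    then show ?thesis
    proof (rule has_field_derivative_transform_within_open[where S = "{..<0}"])
      show "0 = flat_fun c n y" if "y \<in> {..<0}" for y using that by (simp add: flat_fun_def)
    qed (use 2 in auto)
  next
    case 3
    have "((\<lambda>h. flat_fun c n h / h) \<longlongrightarrow> 0) (at 0)"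
    proof (rule filterlim_split_at)
      have "eventually (\<lambda>h. 0 = flat_fun c n h / h) (at_left 0)"
        by (auto simp: eventually_at_filter flat_fun_def)
      then show "((\<lambda>h. flat_fun c n h / h) \<longlongrightarrow> 0) (at_left 0)"
        by (rule Lim_transform_eventually[OF tendsto_const])
      have "((\<lambda>y. y ^ 1 * poly ?p y * exp (- c * y)) \<longlongrightarrow> 0) at_top" by (rule poly_exp_decay[OF c])
      moreover have "eventually (\<lambda>y. y ^ 1 * poly ?p y * exp (- c * y) = flat_fun c n (inverse y) / inverse y) at_top"
        using eventually_gt_at_top[of 0] by eventually_elim (simp add: flat_fun_def field_simps)
      ultimately have "((\<lambda>y. flat_fun c n (inverse y) / inverse y) \<longlongrightarrow> 0) at_top"
        by (rule Lim_transform_eventually)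
      then show "((\<lambda>h. flat_fun c n h / h) \<longlongrightarrow> 0) (at_right 0)"
        by (simp add: filterlim_at_right_to_top)
    qed
    then show ?thesis unfolding has_field_derivative_def 3
      by (simp add: DERIV_def flat_fun_def flip: has_field_derivative_def)
  qed
qed

text \<open>A class of functions closed under partial derivatives, so that every iterated derivative
  is differentiable. The rule \<open>affine\<close> asks for a whole sequence of successive
  derivatives \<open>D\<close>, so differentiating only moves along the sequence.\<close>

inductive smooth_expr :: "(real^'d \<Rightarrow> real) \<Rightarrow> bool" where
  const: "smooth_expr (\<lambda>x. c)"
| affine: "(\<And>n t. (D n has_real_derivative D (Suc n) t) (at t)) \<Longrightarrow> smooth_expr (\<lambda>x. D n (s * x $ j + t0))"
| add: "smooth_expr f \<Longrightarrow> smooth_expr g \<Longrightarrow> smooth_expr (\<lambda>x. f x + g x)"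
| mult: "smooth_expr f \<Longrightarrow> smooth_expr g \<Longrightarrow> smooth_expr (\<lambda>x. f x * g x)"

lemma partial_derivI: "(\<And>x. (f has_derivative f' x) (at x)) \<Longrightarrow> partial_deriv i f = (\<lambda>x. f' x (axis i 1))"
  unfolding partial_deriv_def by (metis frechet_derivative_at)

lemma smooth_expr_deriv:
  assumes "smooth_expr f" shows "(\<forall>x. f differentiable (at x)) \<and> (\<forall>i. smooth_expr (partial_deriv i f))"
  using assms
proof (induction rule: smooth_expr.induct)
  case (const c)
  have "partial_deriv i (\<lambda>x::real^'a. c) = (\<lambda>x. 0)" for i
    by (rule partial_derivI[where f' = "\<lambda>x h. 0"]) simp
  then show ?case by (auto intro: smooth_expr.const)
next
  case (affine D n s j t0)
  have d: "((\<lambda>x::real^'a. D n (s * x $ j + t0)) has_derivative (\<lambda>h. D (Suc n) (s * x $ j + t0) * (s * h $ j))) (at x)" for x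
  proof -
    have "((\<lambda>x::real^'a. s * x $ j + t0) has_derivative (\<lambda>h. s * h $ j)) (at x)"
      by (auto intro!: derivative_eq_intros bounded_linear.has_derivative[OF bounded_linear_vec_nth])
    moreover have "(D n has_derivative (*) (D (Suc n) (s * x $ j + t0))) (at (s * x $ j + t0))"
      using affine by (simp add: has_field_derivative_def)
    ultimately show ?thesis using diff_chain_at[of "\<lambda>x. s * x $ j + t0" "\<lambda>h. s * h $ j" x "D n"] by (simp add: o_def)
  qed
  have "partial_deriv i (\<lambda>x::real^'a. D n (s * x $ j + t0)) = (\<lambda>x. D (Suc n) (s * x $ j + t0) * (s * axis i 1 $ j))" for i
    by (rule partial_derivI[OF d])
  moreover have "smooth_expr (\<lambda>x. D (Suc n) (s * x $ j + t0) * (s * axis i 1 $ j))" for i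
    by (intro smooth_expr.mult smooth_expr.affine smooth_expr.const affine)
  ultimately show ?case using d by (auto simp: differentiable_def)
next
  case (add f g)
  have "((\<lambda>x. f x + g x) has_derivative (\<lambda>h. frechet_derivative f (at x) h + frechet_derivative g (at x) h)) (at x)" for x
    using add by (intro has_derivative_add) (auto simp: frechet_derivative_works)
  note d = this
  have "partial_deriv i (\<lambda>x. f x + g x) = (\<lambda>x. partial_deriv i f x + partial_deriv i g x)" for i
    unfolding partial_derivI[OF d] by (simp add: partial_deriv_def)
  then show ?case using d add by (auto simp: differentiable_def intro: smooth_expr.add)
next
  case (mult f g)
  have "((\<lambda>x. f x * g x) has_derivative (\<lambda>h. f x * frechet_derivative g (at x) h + frechet_derivative f (at x) h * g x)) (at x)" for x
    using mult by (intro has_derivative_mult) (auto simp: frechet_derivative_works)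
  note d = this
  have "partial_deriv i (\<lambda>x. f x * g x) = (\<lambda>x. f x * partial_deriv i g x + partial_deriv i f x * g x)" for i
    unfolding partial_derivI[OF d] by (simp add: partial_deriv_def)
  moreover have "smooth_expr (\<lambda>x. f x * partial_deriv i g x + partial_deriv i f x * g x)" for i
    by (intro smooth_expr.add smooth_expr.mult) (use mult in auto)
  ultimately show ?case using d by (auto simp: differentiable_def)
qed

lemma smooth_expr_test_fun:
  assumes "smooth_expr f" "bounded {x. f x \<noteq> 0}" shows "test_fun f"
proof -
  have "smooth_expr (foldr partial_deriv js f)" for js
    by (induction js) (use assms(1) smooth_expr_deriv in auto)
  then show ?thesis using assms(2) smooth_expr_deriv by (auto simp: test_fun_def)
qed

lemma smooth_expr_prod: "(\<And>j. j \<in> S \<Longrightarrow> smooth_expr (f j)) \<Longrightarrow> smooth_expr (\<lambda>x. \<Prod>j\<in>S. f j x)"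
  by (induction S rule: infinite_finite_induct) (auto intro: smooth_expr.const smooth_expr.mult)

lemma box_test_functions:
  fixes a b :: "real^'d"
  obtains \<psi> :: "nat \<Rightarrow> real^'d \<Rightarrow> real" where "\<And>n. test_fun (\<psi> n)" "\<And>n x. 0 \<le> \<psi> n x \<and> \<psi> n x \<le> 1"
    "\<And>x. (\<lambda>n. \<psi> n x) \<longlonglongrightarrow> indicator (box a b) x" "\<And>n x. x \<notin> box a b \<Longrightarrow> \<psi> n x = 0"
proof
  \<comment> \<open>The factors are e^{-c/t} with t the distance to a face of the box; as c tends to
    0 they tend to 1 inside, while they vanish outside.\<close>
  let ?c = "\<lambda>n. 1 / real (Suc n)"
  let ?\<psi> = "\<lambda>n (x::real^'d). \<Prod>j\<in>UNIV. flat_fun (?c n) 0 (1 * x $ j + - a $ j) * flat_fun (?c n) 0 (- 1 * x $ j + b $ j)"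
  have f0: "flat_fun c 0 t = (if t > 0 then exp (- c / t) else 0)" for c t
    by (simp add: flat_fun_def flat_poly_def)
  have fb: "0 \<le> flat_fun c 0 t \<and> flat_fun c 0 t \<le> 1" if "c > 0" for c t using that by (simp add: f0)
  show z: "?\<psi> n x = 0" if x: "x \<notin> box a b" for n x
  proof -
    obtain j where "x $ j \<le> a $ j \<or> x $ j \<ge> b $ j" using x by (auto simp: mem_box_cart not_less)
    then show ?thesis by (intro prod_zero bexI[of _ j]) (auto simp: f0)
  qed
  show "test_fun (?\<psi> n)" for n
  proof (rule smooth_expr_test_fun)
    show "smooth_expr (?\<psi> n)"
      by (intro smooth_expr_prod smooth_expr.mult smooth_expr.affine flat_fun_deriv) auto
    have "{x. ?\<psi> n x \<noteq> 0} \<subseteq> box a b" using z by blast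
    then show "bounded {x. ?\<psi> n x \<noteq> 0}" by (rule bounded_subset[OF bounded_box])
  qed
  show "0 \<le> ?\<psi> n x \<and> ?\<psi> n x \<le> 1" for n x
    using fb[of "?c n"] by (intro conjI prod_nonneg prod_le_1) (auto intro: mult_le_one)
  show "(\<lambda>n. ?\<psi> n x) \<longlonglongrightarrow> indicator (box a b) x" for x
  proof (cases "x \<in> box a b")
    case True
    then have p: "1 * x $ j + - a $ j > 0" "- 1 * x $ j + b $ j > 0" for j by (auto simp: mem_box_cart)
    have l: "(\<lambda>n. flat_fun (?c n) 0 t) \<longlonglongrightarrow> 1" if "t > 0" for t
    proof -
      have "(\<lambda>n. exp (- (1 / real (Suc n)) / t)) \<longlonglongrightarrow> 1" using that by real_asymp
      then show ?thesis using that by (simp add: f0)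
    qed
    have "(\<lambda>n. ?\<psi> n x) \<longlonglongrightarrow> (\<Prod>j\<in>(UNIV::'d set). 1 * 1)"
      by (intro tendsto_prod tendsto_mult l p)
    then show ?thesis using True by simp
  next
    case False
    have "(\<lambda>n. ?\<psi> n x) = (\<lambda>n. 0)" by (rule ext) (rule z[OF False])
    then show ?thesis unfolding indicator_simps(2)[OF False] by (simp only: tendsto_const)
  qed
qed

section \<open>Weak derivatives\<close>

lemma test_fun_continuous: "test_fun \<psi> \<Longrightarrow> continuous_on UNIV \<psi>"
proof -
  assume "test_fun \<psi>"
  then have "foldr partial_deriv [] \<psi> differentiable (at x)" for x unfolding test_fun_def by blast
  then show ?thesis by (auto simp: continuous_on_eq_continuous_at differentiable_imp_continuous_within)
qed

lemma partial_deriv_zero: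
  assumes "open S" "x \<in> S" "\<And>y. y \<in> S \<Longrightarrow> f y = 0" shows "partial_deriv i f x = 0"
proof -
  have "(f has_derivative (\<lambda>h. 0)) (at x)"
    by (rule has_derivative_transform_within_open[OF has_derivative_const assms(1,2)]) (use assms(3) in auto)
  then show ?thesis unfolding partial_deriv_def by (metis frechet_derivative_at)
qed

lemma test_fun_partial_deriv:
  assumes "test_fun \<psi>" shows "test_fun (partial_deriv i \<psi>)"
  unfolding test_fun_def
proof (intro conjI allI)
  have "foldr partial_deriv (js @ [i]) \<psi> differentiable (at x)" for js x
    using assms unfolding test_fun_def by blast
  then show "foldr partial_deriv js (partial_deriv i \<psi>) differentiable (at x)" for js x by simp
  let ?S = "closure {x. \<psi> x \<noteq> 0}"
  have "partial_deriv i \<psi> x = 0" if "x \<notin> ?S" for x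
  proof (rule partial_deriv_zero[of "- ?S"])
    show "\<psi> y = 0" if "y \<in> - ?S" for y using that closure_subset[of "{x. \<psi> x \<noteq> 0}"] by auto
  qed (use that in auto)
  then have "{x. partial_deriv i \<psi> x \<noteq> 0} \<subseteq> ?S" by blast
  moreover have "bounded ?S" using assms unfolding test_fun_def by (blast intro: bounded_closure)
  ultimately show "bounded {x. partial_deriv i \<psi> x \<noteq> 0}" by (rule bounded_subset[rotated])
qed

lemma test_fun_foldr: "test_fun \<psi> \<Longrightarrow> test_fun (foldr partial_deriv js \<psi>)"
  by (induction js) (auto intro: test_fun_partial_deriv)

lemma test_fun_integrable:
  assumes \<psi>: "test_fun \<psi>" and g: "locally_integrable g"
  shows "integrable lborel (\<lambda>x. \<psi> x *\<^sub>R g x)"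
proof -
  obtain r where r: "\<And>x. \<psi> x \<noteq> 0 \<Longrightarrow> x \<in> cball 0 r"
    using \<psi> by (auto simp: test_fun_def bounded_iff)
  have "compact (\<psi> ` cball 0 r)"
    by (intro compact_continuous_image continuous_on_subset[OF test_fun_continuous[OF \<psi>]]) auto
  then have "bounded (\<psi> ` cball 0 r)" by (rule compact_imp_bounded)
  then obtain C where C: "\<forall>y\<in>\<psi> ` cball 0 r. norm y \<le> C" unfolding bounded_iff by blast
  have [measurable]: "\<psi> \<in> borel_measurable borel" "g \<in> borel_measurable borel"
    using g by (auto simp: locally_integrable_def intro: borel_measurable_continuous_onI test_fun_continuous[OF \<psi>])
  have "set_integrable lborel (cball 0 r) g" using g by (auto simp: locally_integrable_def)
  then have "integrable lborel (\<lambda>x. C *\<^sub>R (indicator (cball 0 r) x *\<^sub>R g x))"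
    unfolding set_integrable_def by (rule integrable_scaleR_right)
  then show ?thesis
  proof (rule Bochner_Integration.integrable_bound)
    have "norm (\<psi> x *\<^sub>R g x) \<le> norm (C *\<^sub>R (indicator (cball 0 r) x *\<^sub>R g x))" for x
    proof (cases "\<psi> x = 0")
      case False
      then have "x \<in> cball 0 r" "\<bar>\<psi> x\<bar> \<le> C" using r[of x] C by auto
      then show ?thesis by (auto intro!: mult_right_mono)
    qed simp
    then show "AE x in lborel. norm (\<psi> x *\<^sub>R g x) \<le> norm (C *\<^sub>R (indicator (cball 0 r) x *\<^sub>R g x))" by simp
  qed measurable
qed

lemma locally_integrable_diff:
  "locally_integrable f \<Longrightarrow> locally_integrable g \<Longrightarrow> locally_integrable (\<lambda>x. f x - g x)"
  unfolding locally_integrable_def by (auto intro: set_integral_diff)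

lemma locally_integrable_sum:
  "(\<And>i. i \<in> I \<Longrightarrow> locally_integrable (f i)) \<Longrightarrow> locally_integrable (\<lambda>x. \<Sum>i\<in>I. c i * f i x)"
  unfolding locally_integrable_def
  by (auto intro!: set_integral_sum(2) set_integrable_mult_right borel_measurable_sum borel_measurable_times)

lemma locally_integrable_cong_AE:
  fixes f f' :: "real^'d \<Rightarrow> complex"
  assumes f: "locally_integrable f" and eq: "AE x in lborel. f x = f' x" and m: "f' \<in> borel_measurable borel"
  shows "locally_integrable f'"
  unfolding locally_integrable_def
proof (intro conjI allI impI)
  show "f' \<in> borel_measurable lborel" using m by simp
  fix K :: "(real^'d) set" assume K: "compact K"
  then have "set_integrable lborel K f" using f by (simp add: locally_integrable_def)
  then show "set_integrable lborel K f'"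
    unfolding set_integrable_def
  proof (rule integrable_cong_AE_imp)
    show "AE x in lborel. indicator K x *\<^sub>R f x = indicator K x *\<^sub>R f' x" using eq by eventually_elim simp
    show "(\<lambda>x. indicator K x *\<^sub>R f' x) \<in> borel_measurable lborel"
      using m K by (intro borel_measurable_scaleR borel_measurable_indicator) (auto simp: compact_imp_closed)
  qed
qed

text \<open>The fundamental lemma of the calculus of variations: indicators of boxes are bounded
  limits of test functions supported in the box.\<close>

lemma test_functions_determine:
  fixes g :: "real^'d \<Rightarrow> complex"
  assumes g: "locally_integrable g" and zero: "\<And>\<psi>. test_fun \<psi> \<Longrightarrow> (LINT x|lborel. \<psi> x *\<^sub>R g x) = 0"
  shows "AE x in lborel. g x = 0"
proof (rule AE_zero_if_box_integrals_zero)
  show [measurable]: "g \<in> borel_measurable borel" using g by (simp add: locally_integrable_def)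
  have sc: "set_integrable lborel (cbox a b) g" for a b using g by (simp add: locally_integrable_def)
  show sb: "set_integrable lborel (box a b) g" for a b
    by (rule set_integrable_subset[OF sc[of a b]]) (auto simp: box_subset_cbox)
  fix a b :: "real^'d"
  obtain \<psi> where \<psi>: "\<And>n. test_fun (\<psi> n)" "\<And>n x. 0 \<le> \<psi> n x \<and> \<psi> n x \<le> 1"
    "\<And>x. (\<lambda>n. \<psi> n x) \<longlonglongrightarrow> indicator (box a b) x" "\<And>n x. x \<notin> box a b \<Longrightarrow> \<psi> n x = 0"
    by (rule box_test_functions[of a b]) blast
  have [measurable]: "\<psi> n \<in> borel_measurable borel" for n
    by (intro borel_measurable_continuous_onI test_fun_continuous \<psi>)
  have "(\<lambda>n. LINT x|lborel. \<psi> n x *\<^sub>R g x) \<longlonglongrightarrow> (LINT x|lborel. indicator (box a b) x *\<^sub>R g x)"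
  proof (rule integral_dominated_convergence[where w = "\<lambda>x. norm (indicator (box a b) x *\<^sub>R g x)"])
    show "integrable lborel (\<lambda>x. norm (indicator (box a b) x *\<^sub>R g x))"
      using sb[of a b] unfolding set_integrable_def by (rule integrable_norm)
    show "AE x in lborel. (\<lambda>n. \<psi> n x *\<^sub>R g x) \<longlonglongrightarrow> indicator (box a b) x *\<^sub>R g x"
      by (intro AE_I2 tendsto_scaleR \<psi> tendsto_const)
    have "norm (\<psi> n x *\<^sub>R g x) \<le> norm (indicator (box a b) x *\<^sub>R g x)" for n x
      using \<psi>(2)[of n x] \<psi>(4)[of x n] by (cases "x \<in> box a b") (auto intro: mult_left_le_one_le)
    then show "AE x in lborel. norm (\<psi> n x *\<^sub>R g x) \<le> norm (indicator (box a b) x *\<^sub>R g x)" for n by simp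
  qed measurable
  then show "(LINT x:box a b|lborel. g x) = 0"
    using zero[OF \<psi>(1)] by (simp add: set_lebesgue_integral_def LIMSEQ_const_iff)
qed

section \<open>Rules for weak derivatives\<close>

lemma mi_list_exists: "\<exists>\<sigma>. mi_list \<sigma> = \<beta>"
proof -
  have "real (card {\<sigma> \<in> lists_of (mi_abs \<beta>). mi_list \<sigma> = \<beta>}) \<noteq> 0"
    unfolding card_mi_list_fibre[OF refl] by (simp add: mi_fact_def)
  then have "{\<sigma> \<in> lists_of (mi_abs \<beta>). mi_list \<sigma> = \<beta>} \<noteq> {}" by (metis card.empty of_nat_0)
  then show ?thesis by blast
qed

lemma weak_derivD:
  assumes "weak_deriv (mi_list \<sigma>) f g" "test_fun \<psi>"
  shows "(LINT x|lborel. foldr partial_deriv \<sigma> \<psi> x *\<^sub>R f x) = (- 1) ^ mi_abs (mi_list \<sigma>) * (LINT x|lborel. \<psi> x *\<^sub>R g x)"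
  using assms by (auto simp: weak_deriv_def mi_list_def)

text \<open>Determines the function selected in \<open>wD\<close> up to a null set.\<close>

lemma weak_deriv_unique:
  assumes "weak_deriv \<beta> f g" "weak_deriv \<beta> f g'"
  shows "AE x in lborel. g x = g' x"
proof -
  obtain \<sigma> where \<sigma>: "mi_list \<sigma> = \<beta>" using mi_list_exists by blast
  have l: "locally_integrable g" "locally_integrable g'" using assms by (auto simp: weak_deriv_def)
  have "AE x in lborel. g x - g' x = 0"
  proof (rule test_functions_determine[OF locally_integrable_diff[OF l]])
    fix \<psi> :: "real^'a \<Rightarrow> real" assume \<psi>: "test_fun \<psi>"
    have "(- 1) ^ mi_abs (mi_list \<sigma>) * (LINT x|lborel. \<psi> x *\<^sub>R g x) = (- 1) ^ mi_abs (mi_list \<sigma>) * (LINT x|lborel. \<psi> x *\<^sub>R g' x)"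
      using weak_derivD[OF assms(1)[folded \<sigma>] \<psi>] weak_derivD[OF assms(2)[folded \<sigma>] \<psi>] by simp
    then have "(LINT x|lborel. \<psi> x *\<^sub>R g x) = (LINT x|lborel. \<psi> x *\<^sub>R g' x)" by simp
    then show "(LINT x|lborel. \<psi> x *\<^sub>R (g x - g' x)) = 0"
      unfolding scaleR_diff_right
      using test_fun_integrable[OF \<psi> l(1)] test_fun_integrable[OF \<psi> l(2)] by (subst Bochner_Integration.integral_diff) auto
  qed
  then show ?thesis by eventually_elim simp
qed

text \<open>Iterated directional derivatives are known only up to null sets, so the function to be
  differentiated must be exchangeable. Measurability of the new function is a separate assumption
  because a.e. equality does not preserve Borel measurability.\<close>

lemma weak_deriv_cong_AE:
  fixes f f' g :: "real^'d \<Rightarrow> complex"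
  assumes w: "weak_deriv \<beta> f g" and eq: "AE x in lborel. f x = f' x" and m: "f' \<in> borel_measurable borel"
  shows "weak_deriv \<beta> f' g"
  unfolding weak_deriv_def
proof (intro conjI allI impI)
  show "locally_integrable f'" using w by (intro locally_integrable_cong_AE[OF _ eq m]) (simp add: weak_deriv_def)
  show "locally_integrable g" using w by (simp add: weak_deriv_def)
  fix \<psi> :: "real^'d \<Rightarrow> real" and js assume a: "test_fun \<psi> \<and> (\<forall>j. count_list js j = \<beta> $ j)"
  have [measurable]: "foldr partial_deriv js \<psi> \<in> borel_measurable borel"
    using a by (intro borel_measurable_continuous_onI test_fun_continuous test_fun_foldr) auto
  have [measurable]: "f \<in> borel_measurable borel" using w by (simp add: weak_deriv_def locally_integrable_def)
  note m[measurable]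
  have "(LINT x|lborel. foldr partial_deriv js \<psi> x *\<^sub>R f' x) = (LINT x|lborel. foldr partial_deriv js \<psi> x *\<^sub>R f x)"
    by (rule integral_cong_AE) (measurable, use eq in \<open>auto elim: eventually_mono\<close>)
  then show "(LINT x|lborel. foldr partial_deriv js \<psi> x *\<^sub>R f' x) = (- 1) ^ mi_abs \<beta> * (LINT x|lborel. \<psi> x *\<^sub>R g x)"
    using w a by (simp add: weak_deriv_def)
qed

lemma weak_deriv_sum:
  fixes f g :: "'i \<Rightarrow> real^'d \<Rightarrow> complex"
  assumes w: "\<And>i. i \<in> I \<Longrightarrow> weak_deriv \<beta> (f i) (g i)"
  shows "weak_deriv \<beta> (\<lambda>x. \<Sum>i\<in>I. c i * f i x) (\<lambda>x. \<Sum>i\<in>I. c i * g i x)"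
  unfolding weak_deriv_def
proof (intro conjI allI impI)
  have l: "locally_integrable (f i)" "locally_integrable (g i)" if "i \<in> I" for i
    using w[OF that] by (auto simp: weak_deriv_def)
  then show "locally_integrable (\<lambda>x. \<Sum>i\<in>I. c i * f i x)" "locally_integrable (\<lambda>x. \<Sum>i\<in>I. c i * g i x)"
    by (auto intro: locally_integrable_sum)
  fix \<psi> :: "real^'d \<Rightarrow> real" and js assume a: "test_fun \<psi> \<and> (\<forall>j. count_list js j = \<beta> $ j)"
  have s: "(LINT x|lborel. \<eta> x *\<^sub>R (\<Sum>i\<in>I. c i * F i x)) = (\<Sum>i\<in>I. c i * (LINT x|lborel. \<eta> x *\<^sub>R F i x))"
    if "test_fun \<eta>" "\<And>i. i \<in> I \<Longrightarrow> locally_integrable (F i)" for \<eta> F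
  proof -
    have "(LINT x|lborel. \<eta> x *\<^sub>R (\<Sum>i\<in>I. c i * F i x)) = (LINT x|lborel. (\<Sum>i\<in>I. c i * (\<eta> x *\<^sub>R F i x)))"
      by (simp add: scaleR_sum_right)
    also have "\<dots> = (\<Sum>i\<in>I. (LINT x|lborel. c i * (\<eta> x *\<^sub>R F i x)))"
      by (rule Bochner_Integration.integral_sum) (intro integrable_mult_right test_fun_integrable that)
    finally show ?thesis by (simp only: integral_mult_right_zero)
  qed
  have "(LINT x|lborel. foldr partial_deriv js \<psi> x *\<^sub>R (\<Sum>i\<in>I. c i * f i x)) = (\<Sum>i\<in>I. c i * (LINT x|lborel. foldr partial_deriv js \<psi> x *\<^sub>R f i x))"
    using a l by (intro s test_fun_foldr) auto
  also have "\<dots> = (\<Sum>i\<in>I. c i * ((- 1) ^ mi_abs \<beta> * (LINT x|lborel. \<psi> x *\<^sub>R g i x)))"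
    using w a by (intro sum.cong refl) (simp add: weak_deriv_def)
  also have "\<dots> = (- 1) ^ mi_abs \<beta> * (\<Sum>i\<in>I. c i * (LINT x|lborel. \<psi> x *\<^sub>R g i x))"
    unfolding sum_distrib_left by (intro sum.cong refl) (simp only: mult_ac)
  also have "(\<Sum>i\<in>I. c i * (LINT x|lborel. \<psi> x *\<^sub>R g i x)) = (LINT x|lborel. \<psi> x *\<^sub>R (\<Sum>i\<in>I. c i * g i x))"
    using a l by (intro s[symmetric]) auto
  finally show "(LINT x|lborel. foldr partial_deriv js \<psi> x *\<^sub>R (\<Sum>i\<in>I. c i * f i x)) = (- 1) ^ mi_abs \<beta> * (LINT x|lborel. \<psi> x *\<^sub>R (\<Sum>i\<in>I. c i * g i x))" .
qed

lemma mi_abs_axis: "mi_abs (axis j 1) = 1"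
  by (simp add: mi_abs_def axis_def)

lemma mi_abs_add: "mi_abs (\<alpha> + \<beta>) = mi_abs \<alpha> + mi_abs \<beta>"
  by (simp add: mi_abs_def sum.distrib)

text \<open>The definition of the derivative of order \<beta> is tested with the derivative of
  \<psi> in direction j, and compared with the derivative of order \<beta> + e_j tested with
  \<psi>.\<close>

lemma weak_deriv_step:
  fixes f g g' :: "real^'d \<Rightarrow> complex"
  assumes w: "weak_deriv \<beta> f g" and w': "weak_deriv (\<beta> + axis j 1) f g'"
  shows "weak_deriv (axis j 1) g g'"
  unfolding weak_deriv_def
proof (intro conjI allI impI)
  show "locally_integrable g" "locally_integrable g'" using w w' by (auto simp: weak_deriv_def)
  fix \<psi> :: "real^'d \<Rightarrow> real" and js assume a: "test_fun \<psi> \<and> (\<forall>i. count_list js i = axis j 1 $ i)"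
  \<comment> \<open>The multi-index e_j belongs to a single word.\<close>
  have js: "js = [j]"
  proof -
    have "mi_list js = mi_list [j]" using a by (simp add: mi_list_def vec_eq_iff axis_def)
    then have "length js = 1" using mi_abs_mi_list[of js "length js"] mi_abs_axis[of j] by (simp add: lists_of_def)
    then obtain i where i: "js = [i]" by (metis One_nat_def length_0_conv length_Suc_conv)
    have "count_list js i = 1" using i by simp
    then have "axis j (1::nat) $ i = 1" using a by metis
    then show ?thesis using i by (auto simp: axis_def split: if_splits)
  qed
  obtain \<sigma> where \<sigma>: "mi_list \<sigma> = \<beta>" using mi_list_exists by blast
  \<comment> \<open>Appending j at the end makes it the derivative that \<open>foldr\<close> applies
    first.\<close>
  have \<sigma>j: "mi_list (\<sigma> @ [j]) = \<beta> + axis j 1" using \<sigma> by (auto simp: mi_list_def vec_eq_iff axis_def)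
  have "(LINT x|lborel. foldr partial_deriv \<sigma> (partial_deriv j \<psi>) x *\<^sub>R f x) = (- 1) ^ mi_abs \<beta> * (LINT x|lborel. partial_deriv j \<psi> x *\<^sub>R g x)"
    using weak_derivD[OF w[folded \<sigma>], of "partial_deriv j \<psi>"] a \<sigma> by (simp add: test_fun_partial_deriv)
  moreover have "(LINT x|lborel. foldr partial_deriv (\<sigma> @ [j]) \<psi> x *\<^sub>R f x) = (- 1) ^ (mi_abs \<beta> + 1) * (LINT x|lborel. \<psi> x *\<^sub>R g' x)"
    using weak_derivD[OF w'[folded \<sigma>j], of \<psi>] a unfolding \<sigma>j mi_abs_add mi_abs_axis by simp
  ultimately have "(- 1) ^ mi_abs \<beta> * (LINT x|lborel. partial_deriv j \<psi> x *\<^sub>R g x) = (- 1) ^ mi_abs \<beta> * (- (LINT x|lborel. \<psi> x *\<^sub>R g' x))"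
    by simp
  then have "(LINT x|lborel. partial_deriv j \<psi> x *\<^sub>R g x) = - (LINT x|lborel. \<psi> x *\<^sub>R g' x)"
    by (subst (asm) mult_left_cancel) auto
  then show "(LINT x|lborel. foldr partial_deriv js \<psi> x *\<^sub>R g x) = (- 1) ^ mi_abs (axis j 1) * (LINT x|lborel. \<psi> x *\<^sub>R g' x)"
    unfolding mi_abs_axis by (simp add: js)
qed

lemma weak_deriv_zero: "locally_integrable f \<Longrightarrow> weak_deriv 0 f f"
  unfolding weak_deriv_def
proof (intro conjI allI impI)
  fix \<psi> :: "real^'a \<Rightarrow> real" and js :: "'a list" assume "test_fun \<psi> \<and> (\<forall>j. count_list js j = (0::nat^'a) $ j)"
  then have "js = []" by (cases js) (auto dest!: spec[of _ "hd js"])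
  then show "(LINT x|lborel. foldr partial_deriv js \<psi> x *\<^sub>R f x) = (- 1) ^ mi_abs (0::nat^'a) * (LINT x|lborel. \<psi> x *\<^sub>R f x)"
    by (simp add: mi_abs_def)
qed auto

section \<open>Directional derivatives in terms of coordinate derivatives\<close>

lemma wD_spec: "weak_deriv \<beta> f g \<Longrightarrow> weak_deriv \<beta> f (wD \<beta> f)"
  unfolding wD_def by (rule someI[where P = "weak_deriv \<beta> f"])

lemma sobolev_wD: "f \<in> sobolev k p \<Longrightarrow> mi_abs \<beta> \<le> k \<Longrightarrow> weak_deriv \<beta> f (wD \<beta> f)"
  unfolding sobolev_def by (blast intro: wD_spec)

text \<open>The weight of a word in the expansion of a product of linear forms h . v. The operators
  D_v expand with the same weights, and this is how the gradient takes the place of h.\<close>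

definition dir_coeff :: "(int^'d) list \<Rightarrow> nat list \<Rightarrow> 'd list \<Rightarrow> real" where
  "dir_coeff V is \<sigma> = (\<Prod>(i, j)\<leftarrow>zip is \<sigma>. of_int (V ! i $ j))"

lemma prod_inner_expansion:
  "(\<Prod>i\<leftarrow>is. h \<bullet> real_vec (V ! i)) = (\<Sum>\<sigma>\<in>lists_of (length is). dir_coeff V is \<sigma> * mi_pow h (mi_list \<sigma>))"
proof (induction "is")
  case Nil then show ?case by (simp add: dir_coeff_def mi_pow_def)
next
  case (Cons i "is")
  have "(\<Sum>\<sigma>\<in>lists_of (length (i # is)). dir_coeff V (i # is) \<sigma> * mi_pow h (mi_list \<sigma>))
      = (\<Sum>j\<in>UNIV. \<Sum>\<sigma>\<in>lists_of (length is). (h $ j * of_int (V ! i $ j)) * (dir_coeff V is \<sigma> * mi_pow h (mi_list \<sigma>)))"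
    unfolding length_Cons sum_lists_of_Suc mi_pow_list
    by (intro sum.cong refl) (simp add: dir_coeff_def)
  also have "\<dots> = (h \<bullet> real_vec (V ! i)) * (\<Prod>i\<leftarrow>is. h \<bullet> real_vec (V ! i))"
    unfolding Cons.IH by (simp add: inner_vec_def sum_product)
  finally show ?case by simp
qed

text \<open>Induction over the list; one more D_v is applied to the expansion already known. Since
  that holds only a.e., measurability of the iterate is carried along, as
  \<open>weak_deriv_cong_AE\<close> demands.\<close>

lemma directional_expansion:
  fixes V :: "(int^'d) list"
  assumes f: "f \<in> sobolev k p" and len: "length is \<le> k"
  shows "foldr (\<lambda>i. dir_D (V ! i)) is f \<in> borel_measurable borel \<and>
    (AE t in lborel. foldr (\<lambda>i. dir_D (V ! i)) is f t
      = (\<Sum>\<sigma>\<in>lists_of (length is). of_real (dir_coeff V is \<sigma>) * wD (mi_list \<sigma>) f t))"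
  using len
proof (induction "is")
  case Nil
  have w: "weak_deriv 0 f (wD 0 f)" by (rule sobolev_wD[OF f]) (simp add: mi_abs_def)
  then have l: "locally_integrable f" by (simp add: weak_deriv_def)
  from weak_deriv_unique[OF weak_deriv_zero[OF l] w] l show ?case
    by (auto simp: dir_coeff_def locally_integrable_def)
next
  case (Cons i "is")
  let ?F = "foldr (\<lambda>i. dir_D (V ! i)) is f"
  let ?L = "lists_of (length is) :: 'd list set"
  let ?G = "\<lambda>t. \<Sum>\<sigma>\<in>?L. of_real (dir_coeff V is \<sigma>) * wD (mi_list \<sigma>) f t"
  let ?H = "\<lambda>j t. \<Sum>\<sigma>\<in>?L. of_real (dir_coeff V is \<sigma>) * wD (mi_list (j # \<sigma>)) f t"
  have mF: "?F \<in> borel_measurable borel" and F: "AE t in lborel. ?F t = ?G t" using Cons by auto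
  have "weak_deriv (axis j 1) ?G (?H j)" for j
  proof (rule weak_deriv_sum)
    fix \<sigma> :: "'d list" assume \<sigma>: "\<sigma> \<in> ?L"
    then have a: "mi_abs (mi_list \<sigma>) = length is" by (rule mi_abs_mi_list)
    show "weak_deriv (axis j 1) (wD (mi_list \<sigma>) f) (wD (mi_list (j # \<sigma>)) f)"
      using Cons.prems a by (intro weak_deriv_step[of "mi_list \<sigma>" f])
        (auto intro!: sobolev_wD[OF f] simp: mi_abs_add mi_abs_axis[unfolded One_nat_def])
  qed
  then have wF: "weak_deriv (axis j 1) ?F (?H j)" for j
  proof (rule weak_deriv_cong_AE[OF _ _ mF])
    show "AE t in lborel. ?G t = ?F t" using F by eventually_elim simp
  qed
  have wD1: "weak_deriv (axis j 1) ?F (wD (axis j 1) ?F)" for j by (rule wD_spec[OF wF])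
  have "AE t in lborel. \<forall>j. wD (axis j 1) ?F t = ?H j t"
    by (subst AE_all_countable) (use weak_deriv_unique[OF wD1 wF] in blast)
  then have "AE t in lborel. dir_D (V ! i) ?F t = (\<Sum>\<sigma>\<in>lists_of (length (i # is)). of_real (dir_coeff V (i # is) \<sigma>) * wD (mi_list \<sigma>) f t)"
  proof eventually_elim
    fix t assume t: "\<forall>j. wD (axis j 1) ?F t = ?H j t"
    have "dir_D (V ! i) ?F t = (\<Sum>j\<in>UNIV. of_int (V ! i $ j) * ?H j t)" using t by (simp add: dir_D_def)
    also have "\<dots> = (\<Sum>j\<in>UNIV. \<Sum>\<sigma>\<in>?L. of_real (dir_coeff V (i # is) (j # \<sigma>)) * wD (mi_list (j # \<sigma>)) f t)"
      unfolding sum_distrib_left by (intro sum.cong refl) (simp add: dir_coeff_def mult.assoc)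
    also have "\<dots> = (\<Sum>\<sigma>\<in>lists_of (length (i # is)). of_real (dir_coeff V (i # is) \<sigma>) * wD (mi_list \<sigma>) f t)"
      unfolding length_Cons sum_lists_of_Suc ..
    finally show "dir_D (V ! i) ?F t = (\<Sum>\<sigma>\<in>lists_of (length (i # is)). of_real (dir_coeff V (i # is) \<sigma>) * wD (mi_list \<sigma>) f t)" .
  qed
  moreover have "dir_D (V ! i) ?F \<in> borel_measurable borel"
  proof (subst dir_D_def[abs_def], intro borel_measurable_sum borel_measurable_times borel_measurable_const)
    show "wD (axis j 1) ?F \<in> borel_measurable borel" for j
      using wD1[of j] by (simp add: weak_deriv_def locally_integrable_def)
  qed
  ultimately show ?case by simp
qed

section \<open>The error operator and directional derivatives\<close>

context spline_setting
begin

abbreviation sub_list :: "nat set \<Rightarrow> nat list" where "sub_list \<equiv> sorted_list_of_set"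

text \<open>The identity for a direction is used at the countably many Kronecker points, so one null
  set serves for all of them. For fixed x both sides are homogeneous polynomials in h, and agreement
  at these points forces equal coefficients.\<close>

lemma err_fun_coeff:
  "AE x in lborel. \<forall>\<beta>. mi_abs \<beta> = rho V + 1 \<longrightarrow>
     1 / of_nat (mi_fact \<beta>) * err_fun V \<beta> x
       = (\<Sum>U\<in>Lambda V. (\<Sum>\<sigma> | \<sigma> \<in> lists_of (rho V + 1) \<and> mi_list \<sigma> = \<beta>. of_real (dir_coeff V (sub_list U) \<sigma>)) * bernoulli_spline V U x)"
proof -
  let ?k = "rho V + 1"
  let ?h = "\<lambda>t. kronecker_point ?k t :: real^'d"
  have "AE x in lborel. \<forall>t. (\<Sum>\<beta> | mi_abs \<beta> = ?k. of_real (mi_pow (?h t) \<beta> / real (mi_fact \<beta>)) * err_fun V \<beta> x) = bern_sum (?h t) x"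
    unfolding AE_all_countable by (intro allI err_identity)
  then show ?thesis
  proof eventually_elim
    fix x assume x: "\<forall>t. (\<Sum>\<beta> | mi_abs \<beta> = ?k. of_real (mi_pow (?h t) \<beta> / real (mi_fact \<beta>)) * err_fun V \<beta> x) = bern_sum (?h t) x"
    let ?A = "\<lambda>U \<beta>. \<Sum>\<sigma> | \<sigma> \<in> lists_of ?k \<and> mi_list \<sigma> = \<beta>. complex_of_real (dir_coeff V (sub_list U) \<sigma>)"
    let ?K = "\<lambda>\<beta>. \<Sum>U\<in>Lambda V. ?A U \<beta> * bernoulli_spline V U x"
    have p: "(\<Prod>i\<in>U. complex_of_real (h \<bullet> real_vec (V ! i))) = (\<Sum>\<beta> | mi_abs \<beta> = ?k. of_real (mi_pow h \<beta>) * ?A U \<beta>)"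
      if "U \<in> Lambda V" for U h
    proof -
      have "(\<Prod>i\<in>U. h \<bullet> real_vec (V ! i)) = (\<Prod>i\<leftarrow>sub_list U. h \<bullet> real_vec (V ! i))"
        using LambdaD(1)[OF that] by (simp add: prod.distinct_set_conv_list[symmetric])
      also have "\<dots> = (\<Sum>\<sigma>\<in>lists_of ?k. dir_coeff V (sub_list U) \<sigma> * mi_pow h (mi_list \<sigma>))"
        unfolding prod_inner_expansion using LambdaD[OF that] by simp
      also have "\<dots> = (\<Sum>\<beta> | mi_abs \<beta> = ?k. \<Sum>\<sigma> | \<sigma> \<in> lists_of ?k \<and> mi_list \<sigma> = \<beta>. dir_coeff V (sub_list U) \<sigma> * mi_pow h (mi_list \<sigma>))"
        by (rule sum.group[symmetric]) (auto simp: mi_abs_mi_list)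
      also have "\<dots> = (\<Sum>\<beta> | mi_abs \<beta> = ?k. mi_pow h \<beta> * (\<Sum>\<sigma> | \<sigma> \<in> lists_of ?k \<and> mi_list \<sigma> = \<beta>. dir_coeff V (sub_list U) \<sigma>))"
        unfolding sum_distrib_left by (intro sum.cong refl) (auto simp: mult.commute)
      finally show ?thesis by (simp flip: of_real_prod of_real_sum of_real_mult)
    qed
    have "(\<Sum>\<beta> | mi_abs \<beta> = ?k. of_real (mi_pow (?h t) \<beta>) * (1 / of_nat (mi_fact \<beta>) * err_fun V \<beta> x - ?K \<beta>)) = 0" for t
    proof -
      have "bern_sum (?h t) x = (\<Sum>U\<in>Lambda V. (\<Sum>\<beta> | mi_abs \<beta> = ?k. of_real (mi_pow (?h t) \<beta>) * ?A U \<beta>) * bernoulli_spline V U x)"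
        unfolding bern_sum_def by (intro sum.cong refl) (simp only: p)
      also have "\<dots> = (\<Sum>\<beta> | mi_abs \<beta> = ?k. of_real (mi_pow (?h t) \<beta>) * ?K \<beta>)"
        unfolding sum_distrib_left sum_distrib_right mult.assoc by (rule sum.swap)
      finally have "bern_sum (?h t) x = (\<Sum>\<beta> | mi_abs \<beta> = ?k. of_real (mi_pow (?h t) \<beta>) * ?K \<beta>)" .
      moreover have "(\<Sum>\<beta> | mi_abs \<beta> = ?k. of_real (mi_pow (?h t) \<beta>) * (1 / of_nat (mi_fact \<beta>) * err_fun V \<beta> x)) = bern_sum (?h t) x"
        unfolding x[rule_format, symmetric] by (intro sum.cong refl) simp
      ultimately show ?thesis by (simp only: right_diff_distrib sum_subtractf diff_self)
    qed
    from homogeneous_coeffs_zero[OF this]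
    show "\<forall>\<beta>. mi_abs \<beta> = ?k \<longrightarrow> 1 / of_nat (mi_fact \<beta>) * err_fun V \<beta> x = ?K \<beta>" by auto
  qed
qed

lemma
  assumes f: "f \<in> sobolev (rho V + 1) p" and U: "U \<in> Lambda V"
  shows D_sub_measurable: "D_sub V U f \<in> borel_measurable borel"
    and D_sub_expansion: "AE t in lborel. D_sub V U f t = (\<Sum>\<sigma>\<in>lists_of (rho V + 1). of_real (dir_coeff V (sub_list U) \<sigma>) * wD (mi_list \<sigma>) f t)"
  using directional_expansion[OF f, of "sub_list U" V] LambdaD[OF U] by (simp_all add: D_sub_def[abs_def])

text \<open>The coefficient identity in x and the expansion of D_U f in t meet here: summing over
  \<beta> regroups the words according to their multi-index.\<close>

lemma err_functional_eq:
  assumes f: "f \<in> sobolev (rho V + 1) p"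
  shows "AE t in lborel. AE x in lborel.
    (\<Sum>\<beta> | mi_abs \<beta> = rho V + 1. 1 / of_nat (mi_fact \<beta>) * wD \<beta> f t * err_fun V \<beta> x)
      = (\<Sum>U\<in>Lambda V. D_sub V U f t * bernoulli_spline V U x)"
proof -
  let ?k = "rho V + 1"
  have "AE t in lborel. \<forall>U\<in>Lambda V. D_sub V U f t = (\<Sum>\<sigma>\<in>lists_of ?k. of_real (dir_coeff V (sub_list U) \<sigma>) * wD (mi_list \<sigma>) f t)"
    by (rule AE_finite_allI) (use D_sub_expansion[OF f] in auto)
  then show ?thesis
  proof eventually_elim
    fix t assume t: "\<forall>U\<in>Lambda V. D_sub V U f t = (\<Sum>\<sigma>\<in>lists_of ?k. of_real (dir_coeff V (sub_list U) \<sigma>) * wD (mi_list \<sigma>) f t)"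
    show "AE x in lborel. (\<Sum>\<beta> | mi_abs \<beta> = ?k. 1 / of_nat (mi_fact \<beta>) * wD \<beta> f t * err_fun V \<beta> x)
      = (\<Sum>U\<in>Lambda V. D_sub V U f t * bernoulli_spline V U x)"
      using err_fun_coeff
    proof eventually_elim
      fix x
      let ?A = "\<lambda>U \<beta>. \<Sum>\<sigma> | \<sigma> \<in> lists_of ?k \<and> mi_list \<sigma> = \<beta>. complex_of_real (dir_coeff V (sub_list U) \<sigma>)"
      assume x: "\<forall>\<beta>. mi_abs \<beta> = ?k \<longrightarrow> 1 / of_nat (mi_fact \<beta>) * err_fun V \<beta> x = (\<Sum>U\<in>Lambda V. ?A U \<beta> * bernoulli_spline V U x)"
      have A: "(\<Sum>\<beta> | mi_abs \<beta> = ?k. wD \<beta> f t * ?A U \<beta>) = D_sub V U f t" if "U \<in> Lambda V" for U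
      proof -
        have "(\<Sum>\<beta> | mi_abs \<beta> = ?k. wD \<beta> f t * ?A U \<beta>)
          = (\<Sum>\<beta> | mi_abs \<beta> = ?k. \<Sum>\<sigma> | \<sigma> \<in> lists_of ?k \<and> mi_list \<sigma> = \<beta>. of_real (dir_coeff V (sub_list U) \<sigma>) * wD (mi_list \<sigma>) f t)"
          unfolding sum_distrib_left by (intro sum.cong refl) (auto simp: mult.commute)
        also have "\<dots> = (\<Sum>\<sigma>\<in>lists_of ?k. of_real (dir_coeff V (sub_list U) \<sigma>) * wD (mi_list \<sigma>) f t)"
          by (rule sum.group) (auto simp: mi_abs_mi_list)
        finally show ?thesis using t that by simp
      qed
      have "(\<Sum>\<beta> | mi_abs \<beta> = ?k. 1 / of_nat (mi_fact \<beta>) * wD \<beta> f t * err_fun V \<beta> x)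
        = (\<Sum>\<beta> | mi_abs \<beta> = ?k. wD \<beta> f t * (\<Sum>U\<in>Lambda V. ?A U \<beta> * bernoulli_spline V U x))"
      proof (intro sum.cong refl)
        fix \<beta> :: "nat^'d" assume "\<beta> \<in> {\<beta>. mi_abs \<beta> = ?k}"
        then have "1 / of_nat (mi_fact \<beta>) * err_fun V \<beta> x = (\<Sum>U\<in>Lambda V. ?A U \<beta> * bernoulli_spline V U x)" using x by blast
        from this[symmetric] show "1 / of_nat (mi_fact \<beta>) * wD \<beta> f t * err_fun V \<beta> x = wD \<beta> f t * (\<Sum>U\<in>Lambda V. ?A U \<beta> * bernoulli_spline V U x)"
          by (simp only: mult_ac)
      qed
      also have "\<dots> = (\<Sum>U\<in>Lambda V. (\<Sum>\<beta> | mi_abs \<beta> = ?k. wD \<beta> f t * ?A U \<beta>) * bernoulli_spline V U x)"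
        unfolding sum_distrib_left sum_distrib_right[where A = "{\<beta>. mi_abs \<beta> = ?k}"] mult.assoc[symmetric] by (rule sum.swap)
      also have "\<dots> = (\<Sum>U\<in>Lambda V. D_sub V U f t * bernoulli_spline V U x)"
        by (intro sum.cong refl) (simp only: A)
      finally show "(\<Sum>\<beta> | mi_abs \<beta> = ?k. 1 / of_nat (mi_fact \<beta>) * wD \<beta> f t * err_fun V \<beta> x)
        = (\<Sum>U\<in>Lambda V. D_sub V U f t * bernoulli_spline V U x)" .
    qed
  qed
qed

section \<open>Norms of combinations of Bernoulli splines\<close>

text \<open>The integrand with t frozen and \<open>a U\<close> in place of D_U f(t).\<close>

definition bern_comb :: "(nat set \<Rightarrow> complex) \<Rightarrow> real^'d \<Rightarrow> complex" where
  "bern_comb a x = (\<Sum>U\<in>Lambda V. a U * bernoulli_spline V U x)"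

definition cube_power :: "real \<Rightarrow> (real^'d \<Rightarrow> complex) \<Rightarrow> real" where
  "cube_power p g = (LINT x:cbox 0 1|lborel. norm (g x) powr p)"

definition bern_bound :: real where
  "bern_bound = (SOME C. \<forall>U\<in>Lambda V. \<forall>x. norm (bernoulli_spline V U x) \<le> C)"

lemma bern_bound: "U \<in> Lambda V \<Longrightarrow> norm (bernoulli_spline V U x) \<le> bern_bound"
proof -
  have "\<exists>C. \<forall>x. norm (bernoulli_spline V U x) \<le> C" if "U \<in> Lambda V" for U
    using bern_setting.bernoulli_spline_bounded[OF bern_setting[OF that]] by blast
  then obtain C where C: "\<And>U x. U \<in> Lambda V \<Longrightarrow> norm (bernoulli_spline V U x) \<le> C U" by metis
  have "\<forall>U\<in>Lambda V. \<forall>x. norm (bernoulli_spline V U x) \<le> (\<Sum>U\<in>Lambda V. \<bar>C U\<bar>)"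
  proof (intro ballI allI)
    fix U x assume U: "U \<in> Lambda V"
    have "\<bar>C U\<bar> \<le> (\<Sum>U\<in>Lambda V. \<bar>C U\<bar>)" by (rule member_le_sum[OF U]) auto
    with C[OF U, of x] show "norm (bernoulli_spline V U x) \<le> (\<Sum>U\<in>Lambda V. \<bar>C U\<bar>)" by linarith
  qed
  then have "\<forall>U\<in>Lambda V. \<forall>x. norm (bernoulli_spline V U x) \<le> bern_bound"
    unfolding bern_bound_def by (rule someI)
  then show "U \<in> Lambda V \<Longrightarrow> norm (bernoulli_spline V U x) \<le> bern_bound" by blast
qed

lemma bern_meas: "U \<in> Lambda V \<Longrightarrow> bernoulli_spline V U \<in> borel_measurable borel"
  by (intro bern_setting.bernoulli_spline_measurable bern_setting)

lemma bern_comb_measurable [measurable]: "bern_comb a \<in> borel_measurable borel"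
  unfolding bern_comb_def[abs_def] by (intro borel_measurable_sum borel_measurable_times borel_measurable_const bern_meas)

lemma bern_comb_bounded: "norm (bern_comb a x) \<le> (\<Sum>U\<in>Lambda V. norm (a U) * bern_bound)"
  unfolding bern_comb_def by (rule order_trans[OF norm_sum sum_mono]) (auto simp: norm_mult intro!: mult_left_mono bern_bound)

lemma power_set_integrable:
  assumes [measurable]: "g \<in> borel_measurable borel" and K: "\<And>x. norm (g x) \<le> K" and p: "p \<ge> 0"
  shows "set_integrable lborel (cbox 0 (1::real^'d)) (\<lambda>x. norm (g x :: complex) powr p)"
  using powr_mono2[OF p norm_ge_zero K] by (intro set_integrable_bounded_cube[where M = "K powr p"]) auto

lemma nn_cube_power:
  assumes [measurable]: "g \<in> borel_measurable borel" and K: "\<And>x. norm (g x) \<le> K" and p: "p \<ge> 0"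
  shows "(\<integral>\<^sup>+x\<in>cbox 0 1. ennreal (norm (g x) powr p) \<partial>lborel) = ennreal (cube_power p g)"
proof -
  have "(\<integral>\<^sup>+x\<in>cbox 0 1. ennreal (norm (g x) powr p) \<partial>lborel) = (\<integral>\<^sup>+x. ennreal (indicator (cbox 0 1) x *\<^sub>R norm (g x) powr p) \<partial>lborel)"
    by (intro nn_integral_cong) (auto split: split_indicator)
  also have "\<dots> = ennreal (cube_power p g)"
    unfolding cube_power_def set_lebesgue_integral_def
    by (rule nn_integral_eq_integral[OF power_set_integrable[OF assms, unfolded set_integrable_def]]) auto
  finally show ?thesis .
qed

lemma cube_power_nonneg: "cube_power p g \<ge> 0"
  unfolding cube_power_def set_lebesgue_integral_def by (intro integral_nonneg_AE) auto

lemma cube_power_bern_le: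
  assumes "U \<in> Lambda V" "p \<ge> 0" shows "cube_power p (bernoulli_spline V U) \<le> bern_bound powr p"
proof -
  have "cube_power p (bernoulli_spline V U) \<le> (LINT x:cbox 0 (1::real^'d)|lborel. bern_bound powr p)"
    unfolding cube_power_def
  proof (rule set_integral_mono[OF power_set_integrable])
    show "set_integrable lborel (cbox 0 (1::real^'d)) (\<lambda>x. bern_bound powr p)"
      by (rule set_integrable_bounded_cube[where M = "bern_bound powr p"]) auto
  qed (use assms bern_meas bern_bound in \<open>auto intro: powr_mono2\<close>)
  also have "\<dots> = bern_bound powr p" by (simp add: set_lebesgue_integral_def measure_cbox01)
  finally show ?thesis .
qed

text \<open>The sum is at most the number of terms times the largest one.\<close>

lemma powr_sum_le:
  fixes y :: "'i \<Rightarrow> real"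
  assumes S: "finite S" and y: "\<And>i. i \<in> S \<Longrightarrow> y i \<ge> 0" and p: "p > 0"
  shows "(\<Sum>i\<in>S. y i) powr p \<le> real (card S) powr p * (\<Sum>i\<in>S. y i powr p)"
proof (cases "S = {}")
  case False
  have "Max (y ` S) \<in> y ` S" using S False by (intro Max_in) auto
  then obtain m where m: "m \<in> S" "Max (y ` S) = y m" by blast
  have le: "y i \<le> y m" if "i \<in> S" for i using Max_ge[of "y ` S" "y i"] S that m by auto
  have "(\<Sum>i\<in>S. y i) \<le> real (card S) * y m" using sum_bounded_above[of S y "y m"] le by simp
  then have "(\<Sum>i\<in>S. y i) powr p \<le> (real (card S) * y m) powr p"
    using y p by (intro powr_mono2 sum_nonneg) auto
  also have "\<dots> = real (card S) powr p * y m powr p" using y[OF m(1)] by (simp add: powr_mult)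
  also have "\<dots> \<le> real (card S) powr p * (\<Sum>i\<in>S. y i powr p)"
    using S m by (intro mult_left_mono member_le_sum) auto
  finally show ?thesis .
qed (use p in simp)

lemma cube_power_comb_upper:
  assumes p: "p > 0"
  shows "cube_power p (bern_comb a) \<le> real (card (Lambda V)) powr p * (\<Sum>U\<in>Lambda V. norm (a U) powr p * cube_power p (bernoulli_spline V U))"
proof -
  let ?N = "real (card (Lambda V)) powr p"
  have i: "set_integrable lborel (cbox 0 1) (\<lambda>x. norm (a U) powr p * norm (bernoulli_spline V U x) powr p)" if "U \<in> Lambda V" for U
    using p that by (intro set_integrable_mult_right power_set_integrable[where K = bern_bound] bern_meas bern_bound) auto
  have "cube_power p (bern_comb a) \<le> (LINT x:cbox 0 1|lborel. ?N * (\<Sum>U\<in>Lambda V. norm (a U) powr p * norm (bernoulli_spline V U x) powr p))"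
    unfolding cube_power_def
  proof (rule set_integral_mono[OF power_set_integrable[OF bern_comb_measurable bern_comb_bounded]])
    show "set_integrable lborel (cbox 0 1) (\<lambda>x. ?N * (\<Sum>U\<in>Lambda V. norm (a U) powr p * norm (bernoulli_spline V U x) powr p))"
      by (intro set_integrable_mult_right set_integral_sum(2) i)
    fix x :: "real^'d"
    have "norm (bern_comb a x) powr p \<le> (\<Sum>U\<in>Lambda V. norm (a U * bernoulli_spline V U x)) powr p"
      unfolding bern_comb_def using p by (intro powr_mono2 norm_sum) auto
    also have "\<dots> \<le> ?N * (\<Sum>U\<in>Lambda V. norm (a U * bernoulli_spline V U x) powr p)"
      by (rule powr_sum_le) (use p in auto)
    finally show "norm (bern_comb a x) powr p \<le> ?N * (\<Sum>U\<in>Lambda V. norm (a U) powr p * norm (bernoulli_spline V U x) powr p)"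
      by (simp add: norm_mult powr_mult)
  qed (use p in auto)
  also have "\<dots> = ?N * (\<Sum>U\<in>Lambda V. norm (a U) powr p * cube_power p (bernoulli_spline V U))"
    by (simp only: set_integral_mult_right set_integral_sum(1)[OF i] cube_power_def)
  finally show ?thesis .
qed

text \<open>The index sets of the Fourier series of distinct Bernoulli splines are disjoint, so a Fourier
  coefficient of the combination isolates a single \<open>a U\<close>.\<close>

lemma comb_coeff:
  assumes U: "U \<in> Lambda V"
  obtains \<kappa> where "\<kappa> > 0" "\<And>a. norm (a U) * \<kappa> \<le> (LINT x:cbox 0 1|lborel. norm (bern_comb a x))"
proof
  let ?\<gamma> = "bern_gen V U"
  let ?\<kappa> = "norm (bern_coeff V U ?\<gamma>)"
  have g: "?\<gamma> \<in> bern_index V U"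
    unfolding bern_gen_spec(2)[OF adm uni U] by (auto intro!: exI[of _ 1])
  have act: "active V ?\<gamma> = U" by (rule bern_index_active[OF adm U g])
  have nz: "real_vec ?\<gamma> \<bullet> real_vec (V ! i) \<noteq> 0" if "i \<in> U" for i
  proof -
    have "i \<in> active V ?\<gamma>" unfolding act by (rule that)
    then show ?thesis by (simp add: active_def inner_real_vec)
  qed
  then show "?\<kappa> > 0" using LambdaD(1)[OF U] by (auto simp: bern_coeff_def)
  fix a
  have i: "set_integrable lborel (cbox 0 1) (\<lambda>x. a U' * (bernoulli_spline V U' x * cnj (char_fun ?\<gamma> x)))" if "U' \<in> Lambda V" for U'
  proof (rule set_integrable_mult_right[OF set_integrable_bounded_cube[where M = bern_bound]])
    show "(\<lambda>x. bernoulli_spline V U' x * cnj (char_fun ?\<gamma> x)) \<in> borel_measurable borel"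
      using bern_meas[OF that] by measurable
    show "AE x in lborel. norm (bernoulli_spline V U' x * cnj (char_fun ?\<gamma> x)) \<le> bern_bound"
      using bern_bound[OF that] by (simp add: norm_mult)
  qed
  have "(LINT x:cbox 0 1|lborel. bern_comb a x * cnj (char_fun ?\<gamma> x))
    = (\<Sum>U'\<in>Lambda V. a U' * (if ?\<gamma> \<in> bern_index V U' then bern_coeff V U' ?\<gamma> else 0))"
    unfolding bern_comb_def sum_distrib_right mult.assoc
    by (subst set_integral_sum(1), erule i, intro sum.cong refl)
      (simp add: bern_setting.bernoulli_fourier[OF bern_setting])
  also have "\<dots> = (\<Sum>U'\<in>Lambda V. if U' = U then a U * bern_coeff V U ?\<gamma> else 0)"
    using bern_index_active[OF adm _, of _ ?\<gamma>] act g by (intro sum.cong refl) auto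
  also have "\<dots> = a U * bern_coeff V U ?\<gamma>" using U by simp
  finally have "norm (a U) * ?\<kappa> = norm (LINT x:cbox 0 1|lborel. bern_comb a x * cnj (char_fun ?\<gamma> x))"
    by (simp add: norm_mult)
  also have "\<dots> \<le> (LINT x:cbox 0 1|lborel. norm (bern_comb a x * cnj (char_fun ?\<gamma> x)))"
    by (rule set_integral_norm_bound, rule set_integrable_bounded_cube[where M = "\<Sum>U\<in>Lambda V. norm (a U) * bern_bound"])
      (auto simp: norm_mult bern_comb_bounded)
  also have "\<dots> = (LINT x:cbox 0 1|lborel. norm (bern_comb a x))" by (simp add: norm_mult)
  finally show "norm (a U) * ?\<kappa> \<le> (LINT x:cbox 0 1|lborel. norm (bern_comb a x))" .
qed

text \<open>An elementary substitute for the Hoelder inequality on a set of measure 1: integrating y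
  \<le> s + s^{1-p} y^p with 2 s at most the L^1 norm leaves s on the left. The price is the factor
  2.\<close>

lemma powr_half_le_cube_power:
  assumes m [measurable]: "g \<in> borel_measurable borel" and K: "\<And>x. norm (g x) \<le> K" and p: "p \<ge> 1"
    and s: "s > 0" and le: "2 * s \<le> (LINT x:cbox 0 (1::real^'d)|lborel. norm (g x))"
  shows "s powr p \<le> cube_power p g"
proof -
  \<comment> \<open>For y \<le> s the first summand suffices; for y > s one has y = y^{1-p} y^p with
    nonpositive exponent 1 - p.\<close>
  have pw: "y \<le> s + s powr (1 - p) * y powr p" if "y \<ge> 0" for y
  proof (cases "y \<le> s")
    case True
    have "0 \<le> s powr (1 - p) * y powr p" by simp
    with True show ?thesis by linarith
  next
    case False
    have "y = y powr (1 - p) * y powr p" using False s by (simp flip: powr_add)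
    also have "\<dots> \<le> s powr (1 - p) * y powr p" using False s p by (intro mult_right_mono powr_mono2') auto
    finally show ?thesis using s by linarith
  qed
  have i: "set_integrable lborel (cbox 0 (1::real^'d)) (\<lambda>x. norm (g x) powr p)"
    by (rule power_set_integrable[OF m K]) (use p in simp)
  have c: "set_integrable lborel (cbox 0 (1::real^'d)) (\<lambda>x. s)"
    by (rule set_integrable_bounded_cube[where M = s]) (use s in auto)
  have "2 * s \<le> (LINT x:cbox 0 (1::real^'d)|lborel. norm (g x))" by (rule le)
  also have "\<dots> \<le> (LINT x:cbox 0 (1::real^'d)|lborel. s + s powr (1 - p) * norm (g x) powr p)"
  proof (rule set_integral_mono)
    show "set_integrable lborel (cbox 0 (1::real^'d)) (\<lambda>x. norm (g x))"
      by (rule set_integrable_bounded_cube[where M = K]) (use K in auto)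
    show "set_integrable lborel (cbox 0 (1::real^'d)) (\<lambda>x. s + s powr (1 - p) * norm (g x) powr p)"
      by (intro set_integral_add set_integrable_mult_right i c)
  qed (use pw in auto)
  also have "\<dots> = (LINT x:cbox 0 (1::real^'d)|lborel. s) + s powr (1 - p) * cube_power p g"
    using set_integral_add(2)[OF c set_integrable_mult_right[OF i]] by (simp add: cube_power_def)
  also have "(LINT x:cbox 0 (1::real^'d)|lborel. s) = s" by (simp add: set_lebesgue_integral_def measure_cbox01)
  finally have "s \<le> s powr (1 - p) * cube_power p g" by simp
  then have "s powr (p - 1) * s \<le> s powr (p - 1) * (s powr (1 - p) * cube_power p g)" by (intro mult_left_mono) auto
  also have "\<dots> = cube_power p g" using s by (simp add: mult.assoc[symmetric] flip: powr_add)
  also have "s powr (p - 1) * s = s powr p" using s powr_add[of s "p - 1" 1] by simp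
  finally show ?thesis .
qed

lemma cube_power_comb_lower:
  assumes p: "p \<ge> 1"
  obtains c where "c > 0"
    "\<And>a. c * (\<Sum>U\<in>Lambda V. norm (a U) powr p * cube_power p (bernoulli_spline V U)) \<le> cube_power p (bern_comb a)"
proof -
  have "\<exists>\<kappa>>0. \<forall>a. norm (a U) * \<kappa> \<le> (LINT x:cbox 0 1|lborel. norm (bern_comb a x))" if "U \<in> Lambda V" for U
    using comb_coeff[OF that] by metis
  then obtain \<kappa> where \<kappa>: "\<And>U. U \<in> Lambda V \<Longrightarrow> \<kappa> U > 0"
    "\<And>U a. U \<in> Lambda V \<Longrightarrow> norm (a U) * \<kappa> U \<le> (LINT x:cbox 0 1|lborel. norm (bern_comb a x))" by metis
  \<comment> \<open>Each |a_U| is isolated by \<open>comb_coeff\<close>, where 2 comes from the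
    halving and \<kappa> from the Fourier coefficient; \<open>bern_bound\<close> bounds the p-norm
    of the spline. The summand 1 keeps L positive whatever the sum is.\<close>
  define L where "L = 1 + (\<Sum>U\<in>Lambda V. (2 / \<kappa> U) powr p * bern_bound powr p)"
  have L: "L > 0" unfolding L_def by (intro add_pos_nonneg sum_nonneg) auto
  have one: "norm (a U) powr p * cube_power p (bernoulli_spline V U) \<le> ((2 / \<kappa> U) powr p * bern_bound powr p) * cube_power p (bern_comb a)"
    if U: "U \<in> Lambda V" for U a
  proof -
    have "(norm (a U) * \<kappa> U / 2) powr p \<le> cube_power p (bern_comb a)"
    proof (cases "a U = 0")
      case False
      then show ?thesis
        using \<kappa>[OF U] p by (intro powr_half_le_cube_power[OF bern_comb_measurable bern_comb_bounded]) auto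
    qed (use p in \<open>simp add: cube_power_nonneg\<close>)
    then have "(2 / \<kappa> U) powr p * (norm (a U) * \<kappa> U / 2) powr p \<le> (2 / \<kappa> U) powr p * cube_power p (bern_comb a)"
      by (intro mult_left_mono) auto
    also have "(2 / \<kappa> U) powr p * (norm (a U) * \<kappa> U / 2) powr p = norm (a U) powr p"
      using \<kappa>(1)[OF U] by (simp flip: powr_mult)
    finally have "norm (a U) powr p * cube_power p (bernoulli_spline V U) \<le> ((2 / \<kappa> U) powr p * cube_power p (bern_comb a)) * bern_bound powr p"
      by (intro mult_mono cube_power_bern_le U) (use p in \<open>auto simp: cube_power_nonneg\<close>)
    then show ?thesis by (simp only: mult_ac)
  qed
  show thesis
  proof (rule that[of "1 / L"])
    fix a
    have "(\<Sum>U\<in>Lambda V. norm (a U) powr p * cube_power p (bernoulli_spline V U))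
      \<le> (\<Sum>U\<in>Lambda V. (2 / \<kappa> U) powr p * bern_bound powr p) * cube_power p (bern_comb a)"
      unfolding sum_distrib_right by (intro sum_mono one)
    also have "\<dots> \<le> L * cube_power p (bern_comb a)"
      unfolding L_def by (intro mult_right_mono cube_power_nonneg) simp
    finally show "1 / L * (\<Sum>U\<in>Lambda V. norm (a U) powr p * cube_power p (bernoulli_spline V U)) \<le> cube_power p (bern_comb a)"
      using L by (simp add: field_simps)
  qed (use L in simp)
qed

lemma cube_power_comb_two:
  "cube_power 2 (bern_comb a) = (\<Sum>U\<in>Lambda V. norm (a U) powr 2 * cube_power 2 (bernoulli_spline V U))"
proof -
  have n2: "complex_of_real (norm z powr 2) = z * cnj z" for z :: complex
    by (simp add: complex_norm_square[symmetric])
  have cp: "complex_of_real (cube_power 2 g) = (LINT x:cbox 0 1|lborel. g x * cnj (g x))" for g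
    unfolding cube_power_def set_integral_complex_of_real[symmetric] n2 ..
  let ?B = "bernoulli_spline V"
  have i: "set_integrable lborel (cbox 0 1) (\<lambda>x. (a U * cnj (a U')) * (?B U x * cnj (?B U' x)))"
    if "U \<in> Lambda V" "U' \<in> Lambda V" for U U'
  proof (rule set_integrable_mult_right[OF set_integrable_bounded_cube[where M = "bern_bound * bern_bound"]])
    show "(\<lambda>x. ?B U x * cnj (?B U' x)) \<in> borel_measurable borel"
      using bern_meas[OF that(1)] bern_meas[OF that(2)] by measurable
    have "norm (?B U x * cnj (?B U' x)) \<le> bern_bound * bern_bound" for x
      unfolding norm_mult complex_mod_cnj
      using order_trans[OF norm_ge_zero bern_bound[OF that(1)]] by (intro mult_mono bern_bound that) auto
    then show "AE x in lborel. norm (?B U x * cnj (?B U' x)) \<le> bern_bound * bern_bound" by simp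
  qed
  have "complex_of_real (cube_power 2 (bern_comb a)) = (LINT x:cbox 0 1|lborel. (\<Sum>U\<in>Lambda V. \<Sum>U'\<in>Lambda V. (a U * cnj (a U')) * (?B U x * cnj (?B U' x))))"
    unfolding cp bern_comb_def cnj_sum sum_product by (simp add: mult_ac)
  also have "\<dots> = (\<Sum>U\<in>Lambda V. \<Sum>U'\<in>Lambda V. (a U * cnj (a U')) * (LINT x:cbox 0 1|lborel. ?B U x * cnj (?B U' x)))"
    by (simp add: set_integral_sum i del: mult_cancel_left)
  also have "\<dots> = (\<Sum>U\<in>Lambda V. \<Sum>U'\<in>Lambda V. if U' = U then (a U * cnj (a U)) * of_real (cube_power 2 (?B U)) else 0)"
    by (intro sum.cong refl) (auto simp: cp bernoulli_orthogonal[OF adm uni])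
  also have "\<dots> = complex_of_real (\<Sum>U\<in>Lambda V. norm (a U) powr 2 * cube_power 2 (?B U))"
    unfolding of_real_sum of_real_mult n2 by simp
  finally show ?thesis unfolding of_real_eq_iff .
qed

section \<open>The two functionals\<close>

lemma I_fun_eq:
  assumes "p \<ge> 0"
  shows "I_fun V p f = (\<integral>\<^sup>+t. ennreal (cube_power p (bern_comb (\<lambda>U. D_sub V U f t))) \<partial>lborel)"
proof -
  have "(\<integral>\<^sup>+x\<in>cbox 0 1. ennreal (norm (bern_comb a x) powr p) \<partial>lborel) = ennreal (cube_power p (bern_comb a))" for a
    by (rule nn_cube_power[OF bern_comb_measurable bern_comb_bounded assms])
  then show ?thesis unfolding I_fun_def bern_comb_def by simp
qed

lemma J_fun_eq:
  assumes f: "f \<in> sobolev (rho V + 1) q" and p: "p \<ge> 0"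
  shows "J_fun V p f = (\<integral>\<^sup>+t. ennreal (\<Sum>U\<in>Lambda V. norm (D_sub V U f t) powr p * cube_power p (bernoulli_spline V U)) \<partial>lborel)"
proof -
  have m: "(\<lambda>t. ennreal (norm (D_sub V U f t) powr p)) \<in> borel_measurable lborel" if "U \<in> Lambda V" for U
    using D_sub_measurable[OF f that] by measurable
  have "J_fun V p f = (\<Sum>U\<in>Lambda V. \<integral>\<^sup>+t. ennreal (norm (D_sub V U f t) powr p) * ennreal (cube_power p (bernoulli_spline V U)) \<partial>lborel)"
    unfolding J_fun_def using p m by (intro sum.cong refl) (simp add: nn_cube_power[OF bern_meas bern_bound] nn_integral_multc)
  also have "\<dots> = (\<integral>\<^sup>+t. (\<Sum>U\<in>Lambda V. ennreal (norm (D_sub V U f t) powr p) * ennreal (cube_power p (bernoulli_spline V U))) \<partial>lborel)"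
    by (rule nn_integral_sum[symmetric]) (use m in measurable)
  also have "\<dots> = (\<integral>\<^sup>+t. ennreal (\<Sum>U\<in>Lambda V. norm (D_sub V U f t) powr p * cube_power p (bernoulli_spline V U)) \<partial>lborel)"
    by (intro nn_integral_cong) (simp add: ennreal_mult cube_power_nonneg flip: sum_ennreal)
  finally show ?thesis .
qed

lemma nn_integral_power_sum_mult:
  assumes f: "f \<in> sobolev (rho V + 1) p" and p: "p \<ge> 0" and c: "c \<ge> 0"
  shows "ennreal c * J_fun V p f = (\<integral>\<^sup>+t. ennreal (c * (\<Sum>U\<in>Lambda V. norm (D_sub V U f t) powr p * cube_power p (bernoulli_spline V U))) \<partial>lborel)"
proof -
  have "(\<lambda>t. ennreal (\<Sum>U\<in>Lambda V. norm (D_sub V U f t) powr p * cube_power p (bernoulli_spline V U))) \<in> borel_measurable lborel"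
  proof (intro measurable_compose[OF _ measurable_ennreal] borel_measurable_sum borel_measurable_times borel_measurable_const)
    show "(\<lambda>t. norm (D_sub V U f t) powr p) \<in> borel_measurable lborel" if "U \<in> Lambda V" for U
      using D_sub_measurable[OF f that] by measurable
  qed
  then show ?thesis
    unfolding J_fun_eq[OF f p] by (subst nn_integral_cmult[symmetric]) (auto simp: ennreal_mult'[OF c])
qed

theorem I_fun_J_fun_equivalent:
  assumes p: "p \<ge> 1"
  obtains c C where "0 < c" "c \<le> C"
    "\<And>f :: real^'d \<Rightarrow> complex. f \<in> sobolev (rho V + 1) p \<Longrightarrow> ennreal c * J_fun V p f \<le> I_fun V p f \<and> I_fun V p f \<le> ennreal C * J_fun V p f"
proof -
  obtain c where c: "c > 0"
    "\<And>a. c * (\<Sum>U\<in>Lambda V. norm (a U) powr p * cube_power p (bernoulli_spline V U)) \<le> cube_power p (bern_comb a)"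
    using cube_power_comb_lower[OF p] by blast
  \<comment> \<open>The triangle inequality gives the second entry; the maximum ensures c \<le>
    C.\<close>
  define C where "C = max c (real (card (Lambda V)) powr p)"
  have C: "cube_power p (bern_comb a) \<le> C * (\<Sum>U\<in>Lambda V. norm (a U) powr p * cube_power p (bernoulli_spline V U))" for a
  proof (rule order_trans[OF cube_power_comb_upper mult_right_mono])
    show "real (card (Lambda V)) powr p \<le> C" by (simp add: C_def)
  qed (use p in \<open>auto intro!: sum_nonneg mult_nonneg_nonneg cube_power_nonneg\<close>)
  show thesis
  proof (rule that[of c C])
    fix f :: "real^'d \<Rightarrow> complex" assume f: "f \<in> sobolev (rho V + 1) p"
    show "ennreal c * J_fun V p f \<le> I_fun V p f \<and> I_fun V p f \<le> ennreal C * J_fun V p f"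
      using c p C f by (auto simp: I_fun_eq nn_integral_power_sum_mult C_def intro!: nn_integral_mono ennreal_leI)
  qed (use c in \<open>auto simp: C_def\<close>)
qed

end

theorem mainTheorem3:
  fixes V :: "(int^'d) list"
  assumes "0 \<notin> set V" and "admissible_family V" and "unimodular_family V"
  shows
    "(\<forall>U\<in>Lambda V. square_integrable_on (cbox 0 1) (bernoulli_spline V U)) \<and>
     (\<forall>U\<in>Lambda V. \<forall>U'\<in>Lambda V. U \<noteq> U' \<longrightarrow>
        (LINT x:cbox 0 1|lborel. bernoulli_spline V U x * cnj (bernoulli_spline V U' x)) = 0) \<and>
     (\<forall>p::real. 1 \<le> p \<longrightarrow>
        (\<exists>c C::real. 0 < c \<and> c \<le> C \<and>
          (\<forall>f \<in> sobolev (rho V + 1) p.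
             (\<integral>\<^sup>+t. (\<integral>\<^sup>+x\<in>cbox 0 1.
                ennreal (norm (\<Sum>\<beta> | mi_abs \<beta> = rho V + 1.
                  1 / of_nat (mi_fact \<beta>) * wD \<beta> f t * err_fun V \<beta> x) powr p)
              \<partial>lborel) \<partial>lborel) = I_fun V p f \<and>
             ennreal c * J_fun V p f \<le> I_fun V p f \<and>
             I_fun V p f \<le> ennreal C * J_fun V p f))) \<and>
     (\<forall>f \<in> sobolev (rho V + 1) 2. I_fun V 2 f = J_fun V 2 f)"
proof -
  \<comment> \<open>The representative is needed inside the locale only; the claims concern
    \<open>box_spline\<close> and the functions derived from it.\<close>
  obtain b M R where b: "box_fun V b M R" using box_fun_exists[OF assms(2)] by blast
  interpret spline_setting V b M R by (intro spline_setting.intro b spline_setting_axioms.intro assms)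
  have "square_integrable_on (cbox 0 1) (bernoulli_spline V U)" if "U \<in> Lambda V" for U
    using bern_meas[OF that] power_set_integrable[OF bern_meas[OF that] bern_bound[OF that], of 2]
    by (simp add: square_integrable_on_def)
  moreover have "\<exists>c C::real. 0 < c \<and> c \<le> C \<and>
          (\<forall>f \<in> sobolev (rho V + 1) p.
             (\<integral>\<^sup>+t. (\<integral>\<^sup>+x\<in>cbox 0 1.
                ennreal (norm (\<Sum>\<beta> | mi_abs \<beta> = rho V + 1.
                  1 / of_nat (mi_fact \<beta>) * wD \<beta> f t * err_fun V \<beta> x) powr p)
              \<partial>lborel) \<partial>lborel) = I_fun V p f \<and>
             ennreal c * J_fun V p f \<le> I_fun V p f \<and>
             I_fun V p f \<le> ennreal C * J_fun V p f)" if p: "1 \<le> p" for p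
  proof -
    obtain c C where cC: "0 < c" "c \<le> C"
      "\<And>f. f \<in> sobolev (rho V + 1) p \<Longrightarrow> ennreal c * J_fun V p f \<le> I_fun V p f \<and> I_fun V p f \<le> ennreal C * J_fun V p f"
      using I_fun_J_fun_equivalent[OF p] by blast
    have "(\<integral>\<^sup>+t. (\<integral>\<^sup>+x\<in>cbox 0 1.
                ennreal (norm (\<Sum>\<beta> | mi_abs \<beta> = rho V + 1.
                  1 / of_nat (mi_fact \<beta>) * wD \<beta> f t * err_fun V \<beta> x) powr p)
              \<partial>lborel) \<partial>lborel) = I_fun V p f" if f: "f \<in> sobolev (rho V + 1) p" for f
      unfolding I_fun_def
    proof (rule nn_integral_cong_AE, use err_functional_eq[OF f] in eventually_elim)
      fix t assume "AE x in lborel. (\<Sum>\<beta> | mi_abs \<beta> = rho V + 1. 1 / of_nat (mi_fact \<beta>) * wD \<beta> f t * err_fun V \<beta> x)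
        = (\<Sum>U\<in>Lambda V. D_sub V U f t * bernoulli_spline V U x)"
      then show "(\<integral>\<^sup>+x\<in>cbox 0 1. ennreal (norm (\<Sum>\<beta> | mi_abs \<beta> = rho V + 1. 1 / of_nat (mi_fact \<beta>) * wD \<beta> f t * err_fun V \<beta> x) powr p) \<partial>lborel)
        = (\<integral>\<^sup>+x\<in>cbox 0 1. ennreal (norm (\<Sum>U\<in>Lambda V. D_sub V U f t * bernoulli_spline V U x) powr p) \<partial>lborel)"
        by (intro nn_set_integral_cong) (auto elim: eventually_mono)
    qed
    then show ?thesis using cC by blast
  qed
  moreover have "I_fun V 2 f = J_fun V 2 f" if "f \<in> sobolev (rho V + 1) 2" for f
    unfolding J_fun_eq[OF that zero_le_numeral] I_fun_eq[OF zero_le_numeral] cube_power_comb_two ..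
  ultimately show ?thesis using bernoulli_orthogonal[OF assms(2,3)] by blast
qed

end
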